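(* Let $X\subset\mathbb{R}^n$ ($n\ge2$), $\sigma$, $k$, the isotropic source $S$, the solution $v_0$ of the adjoint equation, the internal functional $H_{v_0}$ and the operators $\mathcal{M}_{v_0},\mathcal{K}_{v_0},\mathcal{S}$ be as defined in the context, and suppose that the assumptions (A1)–(A5) stated there hold. If $0$ is not an eigenvalue of the Fredholm operator $Id+\mathcal{M}_{v_0}\circ\mathcal{K}_{v_0}\circ\mathcal{S}:L^2(X)\to L^2(X)$, then $(Id+\mathcal{M}_{v_0}\circ\mathcal{K}_{v_0}\circ\mathcal{S})^{-1}$ is a bounded linear operator on $L^2(X)$, and the source $S$ can be computed as $$ S=(Id+\mathcal{M}_{v_0}\circ\mathcal{K}_{v_0}\circ\mathcal{S})^{-1}\big(\mathcal{M}_{v_0}[H_{v_0}]\big). $$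
   Context: **Domain.** $X\subset\mathbb{R}^n$, $n\ge2$, is a bounded open set with smooth boundary and unit outer normal $n(x)$; $\Gamma_\pm=\{(x,\theta)\in\partial X\times\mathbb{S}^{n-1}:\ \pm\theta\cdot n(x)>0\}$; $\operatorname{diam}(X)=\sup\{|x-y|:x,y\in X\}$. **Assumptions.** $\sigma=\sigma(x)$ is the attenuation coefficient and $k=k(x,\theta,\theta')$ the scattering kernel; both are uniformly positive. $k$ is rotation invariant: $k(x,\theta,\theta')=k(x,\theta\cdot\theta')$. - (A1) $\sigma$, $k$ and $S$ are continuous on $\overline{X}$. - (A2) With $\rho=\left\|\int_{\mathbb{S}^{n-1}}k(x,\theta,\theta')\,d\theta'\right\|_{L^\infty(X\times\mathbb{S}^{n-1})}$, either $\left(\inf_{\overline X}\sigma\right)-\rho\ge\alpha$ for some constant $\alpha>0$, or $\operatorname{diam}(X)\rho<1$. - (A3) $\sigma(x)\ge\sigma_0>0$ everywhere in $X$ for some constant $\sigma_0$. - (A4) $\left\|\frac{1}{\sigma(x)}\int_{\mathbb{S}^{n-1}}k(x,\theta,\theta')\,d\theta'\right\|_{L^\infty(X\times\mathbb{S}^{n-1})}\le k_0<1$ for some constant $k_0$. - (A5) $\sigma\in W^{1,2}(X)$, and $k(\cdot,\theta,\theta')\in W^{1,2}(X)$ for any $\theta,\theta'\in\mathbb{S}^{n-1}$. **Forward problem.** For an isotropic source $S=S(x)$ (independent of $\theta$), $u=u(x,\theta)$ denotes the unique solution of the radiative transfer equation $$\theta\cdot\nabla u+\sigma(x)u-\int_{\mathbb{S}^{n-1}}k(x,\theta,\theta')u(x,\theta')\,d\theta'=S(x)\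 \text{ in }X\times\mathbb{S}^{n-1},\qquad u|_{\Gamma_-}=0.$$ For $S\in L^2(X)$ the solution is the unique one in $\mathcal{H}^1_2=\{u\in L^2(X\times\mathbb{S}^{n-1}):\theta\cdot\nabla u\in L^2(X\times\mathbb{S}^{n-1})\}$. **Adjoint solution.** $v_0$ is a continuous solution of $$-\theta\cdot\nabla v_0+\sigma v_0-\int_{\mathbb{S}^{n-1}}k(x,\theta,\theta')v_0(x,\theta')\,d\theta'=0,\qquad v_0|_{\Gamma_+}=f_0,$$ where $f_0\in C(\Gamma_+)$ is uniformly positive, such that for some constant $c>0$ one has $v_0(x,\theta)\ge c$ and $\int_{\mathbb{S}^{n-1}}v_0(x,\theta)\,d\theta\ge c$ for all $(x,\theta)\in X\times\mathbb{S}^{n-1}$. **Internal functional.** With $u$ the forward solution for the source $S$, $$H_{v_0}(x)=-\int_{\mathbb{S}^{n-1}}\sigma u v_0\,d\theta+\int_{\mathbb{S}^{n-1}}v_0S\,d\theta+\int_{\mathbb{S}^{n-1}}\int_{\mathbb{S}^{n-1}}k(x,\theta,\theta')v_0(x,\theta)u(x,\theta')\,d\theta'\,d\theta .$$ **Operators.** $\mathcal{A}u(x,\theta)=-\sigma(x)u(x,\theta)+\int_{\mathbb{S}^{n-1}}k(x,\theta,\theta')u(x,\theta')\,d\theta'$. $\mathcal{S}$ maps a source $S$ to the forward solution $u$; $\mathcal{K}_{v_0}u(x)=\int_{\mathbb{S}^{n-1}}\mathcal{A}u(x,\theta)\,v_0(x,\theta)\,d\theta$; $\mathcal{M}_{v_0}f(x)=f(x)\big/\int_{\mathbb{S}^{n-1}}v_0(x,\theta)\,d\theta$.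 These are first defined on continuous sources; $\mathcal{K}_{v_0}\circ\mathcal{S}$ and $\mathcal{M}_{v_0}$ are then extended by continuity (with respect to the $L^2(X)$ norm) to bounded operators $L^2(X)\to L^2(X)$, denoted by the same symbols. *)

theory Defs
  imports "HOL-Analysis.Analysis"
begin

(* Meant for open U only: frechet_derivative is taken in the whole space. *)
primrec Ck_on :: "nat \<Rightarrow> 'a::euclidean_space set \<Rightarrow> ('a \<Rightarrow> real) \<Rightarrow> bool" where
  "Ck_on 0 U f \<longleftrightarrow> continuous_on U f"
| "Ck_on (Suc k) U f \<longleftrightarrow>
     f differentiable_on U \<and> (\<forall>b\<in>Basis. Ck_on k U (\<lambda>x. frechet_derivative f (at x) b))"

definition smooth_on :: "'a::euclidean_space set \<Rightarrow> ('a \<Rightarrow> real) \<Rightarrow> bool" where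
  "smooth_on U f \<longleftrightarrow> (\<forall>k. Ck_on k U f)"

definition C1_compact_support :: "'a::euclidean_space set \<Rightarrow> ('a \<Rightarrow> real) \<Rightarrow> bool" where
  "C1_compact_support U \<phi> \<longleftrightarrow>
     Ck_on 1 UNIV \<phi> \<and> (\<exists>K. compact K \<and> K \<subseteq> U \<and> (\<forall>x. x \<notin> K \<longrightarrow> \<phi> x = 0))"

definition local_defining_function ::
    "'a::euclidean_space set \<Rightarrow> 'a \<Rightarrow> 'a set \<Rightarrow> ('a \<Rightarrow> real) \<Rightarrow> bool" where
  "local_defining_function X x U r \<longleftrightarrow>
     open U \<and> x \<in> U \<and> smooth_on U r \<and>
     (\<forall>y\<in>U. frechet_derivative r (at y) \<noteq> (\<lambda>_. 0)) \<and>
     X \<inter> U = {y \<in> U. r y < 0}"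

definition smooth_boundary :: "'a::euclidean_space set \<Rightarrow> bool" where
  "smooth_boundary X \<longleftrightarrow> (\<forall>x\<in>frontier X. \<exists>U r. local_defining_function X x U r)"

definition outer_normal :: "'a::euclidean_space set \<Rightarrow> 'a \<Rightarrow> 'a" where
  "outer_normal X x =
     (THE \<nu>. norm \<nu> = 1 \<and>
        (\<exists>U r c. local_defining_function X x U r \<and> c > 0 \<and>
                 (r has_derivative (\<lambda>h. c * (\<nu> \<bullet> h))) (at x)))"

definition Gamma_plus :: "'a::euclidean_space set \<Rightarrow> ('a \<times> 'a) set" where
  "Gamma_plus X = {(x, \<theta>). x \<in> frontier X \<and> \<theta> \<in> sphere 0 1 \<and> \<theta> \<bullet> outer_normal X x > 0}"

definition Gamma_minus :: "'a::euclidean_space set \<Rightarrow> ('a \<times> 'a) set" where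
  "Gamma_minus X = {(x, \<theta>). x \<in> frontier X \<and> \<theta> \<in> sphere 0 1 \<and> \<theta> \<bullet> outer_normal X x < 0}"

(* Surface measure of the unit sphere, obtained from the cone formula: the area of A is
   DIM('a) times the volume of {r *\<^sub>R \<theta> | 0 < r < 1, \<theta> \<in> A}. Not normalised. *)
definition sphere_measure :: "'a::euclidean_space measure" where
  "sphere_measure =
     scale_measure (of_nat DIM('a))
       (distr (restrict_space lborel (ball 0 1 - {0})) (restrict_space borel (sphere 0 1)) sgn)"

(* Borel rather than completed measures: every square-integrable class has a Borel
   representative, so the L2 spaces below are the usual ones. *)
abbreviation space_measure :: "'a::euclidean_space set \<Rightarrow> 'a measure" where
  "space_measure X \<equiv> restrict_space lborel X"

abbreviation phase_measure :: "'a::euclidean_space set \<Rightarrow> ('a \<times> 'a) measure" where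
  "phase_measure X \<equiv> space_measure X \<Otimes>\<^sub>M sphere_measure"

(* The elements of L2 are functions, not classes. Equality in L2 is equality almost everywhere. *)
definition L2 :: "'b measure \<Rightarrow> ('b \<Rightarrow> real) set" where
  "L2 M = {f \<in> borel_measurable M. integrable M (\<lambda>x. (f x)\<^sup>2)}"

definition L2_norm :: "'b measure \<Rightarrow> ('b \<Rightarrow> real) \<Rightarrow> real" where
  "L2_norm M f = sqrt (\<integral>x. (f x)\<^sup>2 \<partial>M)"

definition L2_tendsto :: "'b measure \<Rightarrow> (nat \<Rightarrow> 'b \<Rightarrow> real) \<Rightarrow> ('b \<Rightarrow> real) \<Rightarrow> bool" where
  "L2_tendsto M F f \<longleftrightarrow>
     (\<forall>j. F j \<in> L2 M) \<and> f \<in> L2 M \<and> (\<lambda>j. L2_norm M (\<lambda>x. F j x - f x)) \<longlonglongrightarrow> 0"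

definition Linf_norm :: "'b measure \<Rightarrow> ('b \<Rightarrow> real) \<Rightarrow> real" where
  "Linf_norm M f = Inf {c. 0 \<le> c \<and> (AE x in M. \<bar>f x\<bar> \<le> c)}"

definition bounded_linear_L2 :: "'b measure \<Rightarrow> (('b \<Rightarrow> real) \<Rightarrow> 'b \<Rightarrow> real) \<Rightarrow> bool" where
  "bounded_linear_L2 M T \<longleftrightarrow>
     (\<forall>f\<in>L2 M. T f \<in> L2 M) \<and>
     (\<forall>f\<in>L2 M. \<forall>g\<in>L2 M. (AE x in M. f x = g x) \<longrightarrow> (AE x in M. T f x = T g x)) \<and>
     (\<forall>f\<in>L2 M. \<forall>g\<in>L2 M. AE x in M. T (\<lambda>y. f y + g y) x = T f x + T g x) \<and>
     (\<forall>f\<in>L2 M. \<forall>a. AE x in M. T (\<lambda>y. a * f y) x = a * T f x) \<and>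
     (\<exists>C. \<forall>f\<in>L2 M. L2_norm M (T f) \<le> C * L2_norm M f)"

definition inverse_L2 ::
    "'b measure \<Rightarrow> (('b \<Rightarrow> real) \<Rightarrow> 'b \<Rightarrow> real) \<Rightarrow> (('b \<Rightarrow> real) \<Rightarrow> 'b \<Rightarrow> real) \<Rightarrow> bool" where
  "inverse_L2 M T R \<longleftrightarrow>
     (\<forall>f\<in>L2 M. T f \<in> L2 M \<and> R f \<in> L2 M \<and>
        (AE x in M. R (T f) x = f x) \<and> (AE x in M. T (R f) x = f x))"

definition eigenvalue_L2 ::
    "'b measure \<Rightarrow> (('b \<Rightarrow> real) \<Rightarrow> 'b \<Rightarrow> real) \<Rightarrow> real \<Rightarrow> bool" where
  "eigenvalue_L2 M T \<mu> \<longleftrightarrow>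
     (\<exists>f\<in>L2 M. \<not> (AE x in M. f x = 0) \<and> (AE x in M. T f x = \<mu> * f x))"

(* Extension by continuity to L2(X) of an operator B given on continuous functions: the value
   at f is the common L2 limit of B (F j) along all continuous approximations F j of f. *)
definition L2_extension ::
    "'a::euclidean_space set \<Rightarrow> (('a \<Rightarrow> real) \<Rightarrow> 'a \<Rightarrow> real) \<Rightarrow> ('a \<Rightarrow> real) \<Rightarrow> 'a \<Rightarrow> real" where
  "L2_extension X B f =
     (SOME g. g \<in> L2 (space_measure X) \<and>
        (\<forall>F. (\<forall>j. continuous_on (closure X) (F j)) \<and> L2_tendsto (space_measure X) F f \<longrightarrow>
             L2_tendsto (space_measure X) (\<lambda>j. B (F j)) g))"

(* Weak derivatives are tested against C^1 functions of compact support; by mollification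
   this agrees with testing against smooth ones. *)
definition W12 :: "'a::euclidean_space set \<Rightarrow> ('a \<Rightarrow> real) set" where
  "W12 X = {f \<in> L2 (space_measure X). \<forall>b\<in>Basis. \<exists>g\<in>L2 (space_measure X).
     \<forall>\<phi>. C1_compact_support X \<phi> \<longrightarrow>
       (\<integral>x. f x * frechet_derivative \<phi> (at x) b \<partial>space_measure X)
         = - (\<integral>x. g x * \<phi> x \<partial>space_measure X)}"

(* u and its weak derivative g = \<theta> \<bullet> grad_x u are square integrable on X \<times> sphere. The functions
   C^1 with compact support in X \<times> sphere are the restrictions of those in X \<times> UNIV. *)
definition H12_derivative ::
    "'a::euclidean_space set \<Rightarrow> ('a \<times> 'a \<Rightarrow> real) \<Rightarrow> ('a \<times> 'a \<Rightarrow> real) \<Rightarrow> bool" where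
  "H12_derivative X u g \<longleftrightarrow>
     u \<in> L2 (phase_measure X) \<and> g \<in> L2 (phase_measure X) \<and>
     (\<forall>\<phi>. C1_compact_support (X \<times> UNIV) \<phi> \<longrightarrow>
       (\<integral>z. u z * frechet_derivative \<phi> (at z) (snd z, 0) \<partial>phase_measure X)
         = - (\<integral>z. g z * \<phi> z \<partial>phase_measure X))"

(* The trace of u on Gamma_minus is g: some representative w of u tends to g along every
   characteristic entering X. For u in the space above, u is absolutely continuous along
   almost every characteristic, and altering w on a null family of characteristics is
   harmless, so this is the trace defined up to null sets of Gamma_minus. *)
definition inflow_trace ::
    "'a::euclidean_space set \<Rightarrow> ('a \<times> 'a \<Rightarrow> real) \<Rightarrow> ('a \<times> 'a \<Rightarrow> real) \<Rightarrow> bool" where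
  "inflow_trace X u g \<longleftrightarrow>
     (\<exists>w. (AE z in phase_measure X. w z = u z) \<and>
        (\<forall>(y, \<theta>) \<in> Gamma_minus X. ((\<lambda>t. w (y + t *\<^sub>R \<theta>, \<theta>)) \<longlongrightarrow> g (y, \<theta>)) (at_right 0)))"

definition scattering ::
    "('a::euclidean_space \<Rightarrow> 'a \<Rightarrow> 'a \<Rightarrow> real) \<Rightarrow> ('a \<times> 'a \<Rightarrow> real) \<Rightarrow> 'a \<times> 'a \<Rightarrow> real" where
  "scattering k u = (\<lambda>(x, \<theta>). \<integral>\<theta>'. k x \<theta> \<theta>' * u (x, \<theta>') \<partial>sphere_measure)"

definition forward_solution ::
    "'a::euclidean_space set \<Rightarrow> ('a \<Rightarrow> real) \<Rightarrow> ('a \<Rightarrow> 'a \<Rightarrow> 'a \<Rightarrow> real) \<Rightarrow> ('a \<Rightarrow> real) \<Rightarrow>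
       ('a \<times> 'a \<Rightarrow> real) \<Rightarrow> bool" where
  "forward_solution X \<sigma> k S u \<longleftrightarrow>
     (\<exists>g. H12_derivative X u g \<and>
        (AE (x, \<theta>) in phase_measure X.
           g (x, \<theta>) + \<sigma> x * u (x, \<theta>) - scattering k u (x, \<theta>) = S x)) \<and>
     inflow_trace X u (\<lambda>_. 0)"

definition adjoint_solution ::
    "'a::euclidean_space set \<Rightarrow> ('a \<Rightarrow> real) \<Rightarrow> ('a \<Rightarrow> 'a \<Rightarrow> 'a \<Rightarrow> real) \<Rightarrow> ('a \<times> 'a \<Rightarrow> real) \<Rightarrow>
       ('a \<times> 'a \<Rightarrow> real) \<Rightarrow> bool" where
  "adjoint_solution X \<sigma> k f\<^sub>0 v \<longleftrightarrow>
     continuous_on (closure X \<times> sphere 0 1) v \<and>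
     (\<exists>g. H12_derivative X v g \<and>
        (AE (x, \<theta>) in phase_measure X.
           - g (x, \<theta>) + \<sigma> x * v (x, \<theta>) - scattering k v (x, \<theta>) = 0)) \<and>
     (\<forall>z\<in>Gamma_plus X. v z = f\<^sub>0 z)"

definition internal_functional ::
    "('a::euclidean_space \<Rightarrow> real) \<Rightarrow> ('a \<Rightarrow> 'a \<Rightarrow> 'a \<Rightarrow> real) \<Rightarrow> ('a \<times> 'a \<Rightarrow> real) \<Rightarrow>
       ('a \<Rightarrow> real) \<Rightarrow> ('a \<times> 'a \<Rightarrow> real) \<Rightarrow> 'a \<Rightarrow> real" where
  "internal_functional \<sigma> k v S u x =
     - (\<integral>\<theta>. \<sigma> x * u (x, \<theta>) * v (x, \<theta>) \<partial>sphere_measure)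
     + (\<integral>\<theta>. v (x, \<theta>) * S x \<partial>sphere_measure)
     + (\<integral>\<theta>. (\<integral>\<theta>'. k x \<theta> \<theta>' * v (x, \<theta>) * u (x, \<theta>') \<partial>sphere_measure) \<partial>sphere_measure)"

(* The solution is unique in L2 only; a representative is chosen. *)
definition op_S ::
    "'a::euclidean_space set \<Rightarrow> ('a \<Rightarrow> real) \<Rightarrow> ('a \<Rightarrow> 'a \<Rightarrow> 'a \<Rightarrow> real) \<Rightarrow> ('a \<Rightarrow> real) \<Rightarrow>
       'a \<times> 'a \<Rightarrow> real" where
  "op_S X \<sigma> k S = (SOME u. forward_solution X \<sigma> k S u)"

definition op_A ::
    "('a::euclidean_space \<Rightarrow> real) \<Rightarrow> ('a \<Rightarrow> 'a \<Rightarrow> 'a \<Rightarrow> real) \<Rightarrow> ('a \<times> 'a \<Rightarrow> real) \<Rightarrow>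
       'a \<times> 'a \<Rightarrow> real" where
  "op_A \<sigma> k u = (\<lambda>(x, \<theta>). - \<sigma> x * u (x, \<theta>) + scattering k u (x, \<theta>))"

definition op_K ::
    "('a::euclidean_space \<Rightarrow> real) \<Rightarrow> ('a \<Rightarrow> 'a \<Rightarrow> 'a \<Rightarrow> real) \<Rightarrow> ('a \<times> 'a \<Rightarrow> real) \<Rightarrow>
       ('a \<times> 'a \<Rightarrow> real) \<Rightarrow> 'a \<Rightarrow> real" where
  "op_K \<sigma> k v u x = (\<integral>\<theta>. op_A \<sigma> k u (x, \<theta>) * v (x, \<theta>) \<partial>sphere_measure)"

definition op_M :: "('a::euclidean_space \<times> 'a \<Rightarrow> real) \<Rightarrow> ('a \<Rightarrow> real) \<Rightarrow> 'a \<Rightarrow> real" where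
  "op_M v f x = f x / (\<integral>\<theta>. v (x, \<theta>) \<partial>sphere_measure)"

definition op_M_L2 ::
    "'a::euclidean_space set \<Rightarrow> ('a \<times> 'a \<Rightarrow> real) \<Rightarrow> ('a \<Rightarrow> real) \<Rightarrow> 'a \<Rightarrow> real" where
  "op_M_L2 X v = L2_extension X (op_M v)"

definition op_KS_L2 ::
    "'a::euclidean_space set \<Rightarrow> ('a \<Rightarrow> real) \<Rightarrow> ('a \<Rightarrow> 'a \<Rightarrow> 'a \<Rightarrow> real) \<Rightarrow> ('a \<times> 'a \<Rightarrow> real) \<Rightarrow>
       ('a \<Rightarrow> real) \<Rightarrow> 'a \<Rightarrow> real" where
  "op_KS_L2 X \<sigma> k v = L2_extension X (op_K \<sigma> k v \<circ> op_S X \<sigma> k)"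

definition op_Id_MKS ::
    "'a::euclidean_space set \<Rightarrow> ('a \<Rightarrow> real) \<Rightarrow> ('a \<Rightarrow> 'a \<Rightarrow> 'a \<Rightarrow> real) \<Rightarrow> ('a \<times> 'a \<Rightarrow> real) \<Rightarrow>
       ('a \<Rightarrow> real) \<Rightarrow> 'a \<Rightarrow> real" where
  "op_Id_MKS X \<sigma> k v f = (\<lambda>x. f x + op_M_L2 X v (op_KS_L2 X \<sigma> k v f) x)"

end

theory Submission
  imports Defs
begin

text \<open>The forward problem is equivalent to the fixed point equation \<open>u = L (S + K u)\<close>, where \<open>K\<close> is the
 scattering operator and \<open>L\<close> integrates along the characteristics with attenuation: by weak testing,
 a function with zero inflow trace and \<open>u' = - sigma u\<close> along the characteristics vanishes. By the
 symmetry of the kernel, \<open>L K\<close> is a contraction for the norm weighted by \<open>sigma\<close> (Schur test), so the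
 equation is uniquely solvable. After averaging over the angle, \<open>L\<close> applied to a scattered function is, up
 to a small short-range part, an integral operator with a bounded kernel (polar coordinates), hence
 within any distance of a finite rank operator. So \<open>Id + M K S\<close> is a contraction perturbation of the
 identity plus a finite rank operator, for which injectivity gives a bounded inverse. Finally the
 definition of \<open>H\<close> says \<open>M H = (Id + M K S) S\<close>.\<close>

section \<open>Square-integrable functions\<close>

text \<open>Along a ray, \<open>\<sigma>\<close> times the attenuation factor is an exact
  derivative, so its integral is at most 1 from either end of a chord. This makes
  \<open>\<sigma>\<close> the right Schur weight for \<open>L\<close>; symmetry of \<open>k\<close>
  bounds both marginals of the kernel by \<open>\<kappa> * \<sigma>\<close>, with
  \<open>\<kappa> < 1\<close> extracted from \<open>A4\<close>. The same symmetry moves the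
  scattering in \<open>op_K\<close> from \<open>u\<close> onto \<open>v\<^sub>0\<close>, so that
  only an angular average of \<open>u\<close> against a bounded weight remains. Its kernel is
  singular like \<open>|x - y|^(1-n)\<close>; cutting off \<open>|x - y| < a\<close> costs a term of
  norm O(a) and leaves a bounded kernel on a finite measure space. An error of \<open>c / 2\<close>,
  with \<open>c\<close> the lower bound of the angular integral of \<open>v\<^sub>0\<close>, becomes
  the contraction constant 1/2 after division by that integral. The delicate point is uniqueness: a
  zero trace is prescribed on \<open>Gamma_minus\<close> only, so almost every backward
  characteristic has to leave \<open>X\<close> there and not tangentially. Smoothness of the
  boundary makes the tangential exceptions a null set.\<close>

lemma L2_measurable [measurable_dest]: "f \<in> L2 M ==> f \<in> borel_measurable M"
 by (simp add: L2_def)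

lemma L2_integrable_square: "f \<in> L2 M ==> integrable M (%x. (f x)\<^sup>2)"
 by (simp add: L2_def)

lemma L2_iff_nn_integral:
 "f \<in> L2 M \<longleftrightarrow> f \<in> borel_measurable M & (\<integral>\<^sup>+x. ennreal ((f x)\<^sup>2) \<partial>M) < \<infinity>"
proof (cases "f \<in> borel_measurable M")
 case True
 then have "integrable M (%x. (f x)\<^sup>2) \<longleftrightarrow> (\<integral>\<^sup>+x. ennreal ((f x)\<^sup>2) \<partial>M) < \<infinity>"
  by (subst integrable_iff_bounded) simp
 then show ?thesis using True by (simp add: L2_def)
qed (simp add: L2_def)

lemma L2_I_nn_integral:
 assumes "f \<in> borel_measurable M" "(\<integral>\<^sup>+x. ennreal ((f x)\<^sup>2) \<partial>M) <= ennreal C"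
 shows "f \<in> L2 M"
 using assms by (auto simp: L2_iff_nn_integral intro: le_less_trans)

lemma L2_norm_nonneg [simp]: "0 <= L2_norm M f"
 by (simp add: L2_norm_def)

lemma L2_norm_power2: "(L2_norm M f)\<^sup>2 = (\<integral>x. (f x)\<^sup>2 \<partial>M)"
 by (simp add: L2_norm_def)

lemma L2_norm_nn_integral:
 assumes "f \<in> L2 M"
 shows "(\<integral>\<^sup>+x. ennreal ((f x)\<^sup>2) \<partial>M) = ennreal ((L2_norm M f)\<^sup>2)"
 using assms by (simp add: L2_norm_power2 nn_integral_eq_integral L2_def)

text \<open>The Bochner integral of a non-integrable function is 0, so a bound on
  \<open>L2_norm\<close> alone says nothing. A bound on the nonnegative integral yields membership
  in \<open>L2\<close> and the norm estimate together; most operator estimates below are obtained in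
  this form.\<close>

lemma L2_norm_le:
 assumes "f \<in> borel_measurable M" "(\<integral>\<^sup>+x. ennreal ((f x)\<^sup>2) \<partial>M) <= ennreal (C\<^sup>2)" "0 <= C"
 shows "L2_norm M f <= C"
proof -
 have "f \<in> L2 M" using assms L2_I_nn_integral by blast
 then have "(L2_norm M f)\<^sup>2 <= C\<^sup>2"
  using assms(2) by (simp add: L2_norm_nn_integral)
 then show ?thesis using \<open>0 <= C\<close> power2_le_imp_le by blast
qed

lemma L2_cong_AE:
 assumes "f \<in> L2 M" "g \<in> borel_measurable M" "AE x in M. f x = g x"
 shows "g \<in> L2 M"
proof -
 have "(\<integral>\<^sup>+x. ennreal ((g x)\<^sup>2) \<partial>M) = (\<integral>\<^sup>+x. ennreal ((f x)\<^sup>2) \<partial>M)"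
  by (rule nn_integral_cong_AE) (use assms(3) in auto)
 then show ?thesis using assms by (simp add: L2_iff_nn_integral)
qed

lemma L2_norm_cong_AE:
 assumes "f \<in> borel_measurable M" "g \<in> borel_measurable M" "AE x in M. f x = g x"
 shows "L2_norm M f = L2_norm M g"
 unfolding L2_norm_def
 by (rule arg_cong[where f=sqrt], rule integral_cong_AE) (use assms in auto)

lemma L2_mono:
 assumes "f \<in> L2 M" "g \<in> borel_measurable M" "AE x in M. \<bar>g x\<bar> <= \<bar>f x\<bar>"
 shows "g \<in> L2 M" "L2_norm M g <= L2_norm M f"
proof -
 have "(\<integral>\<^sup>+x. ennreal ((g x)\<^sup>2) \<partial>M) <= (\<integral>\<^sup>+x. ennreal ((f x)\<^sup>2) \<partial>M)"
  by (rule nn_integral_mono_AE) (use assms(3) in \<open>auto elim!: eventually_mono intro!: ennreal_leI simp: abs_le_square_iff\<close>)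
 then have *: "(\<integral>\<^sup>+x. ennreal ((g x)\<^sup>2) \<partial>M) <= ennreal ((L2_norm M f)\<^sup>2)"
  using assms(1) by (simp add: L2_norm_nn_integral)
 show "g \<in> L2 M" "L2_norm M g <= L2_norm M f"
  using * assms(2) by (auto intro: L2_norm_le L2_I_nn_integral)
qed

lemma L2_scale: "f \<in> L2 M ==> (%x. a * f x) \<in> L2 M"
 by (auto simp: L2_def power_mult_distrib)

lemma L2_norm_scale: "L2_norm M (%x. a * f x) = \<bar>a\<bar> * L2_norm M f"
 by (simp add: L2_norm_def power_mult_distrib real_sqrt_mult)

lemma L2_uminus: "f \<in> L2 M ==> (%x. - f x) \<in> L2 M"
 using L2_scale[of f M "-1"] by simp

lemma L2_norm_uminus: "L2_norm M (%x. - f x) = L2_norm M f"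
 by (simp add: L2_norm_def)

lemma L2_norm_minus_commute: "L2_norm M (%x. f x - g x) = L2_norm M (%x. g x - f x)"
 by (simp add: L2_norm_def power2_commute)

lemma L2_zero: "(%x. 0) \<in> L2 M"
 by (simp add: L2_def)

lemma L2_norm_zero [simp]: "L2_norm M (%x. 0) = 0"
 by (simp add: L2_norm_def)

lemma L2_mult_integrable:
 assumes "f \<in> L2 M" "g \<in> L2 M"
 shows "integrable M (%x. f x * g x)"
proof (rule Bochner_Integration.integrable_bound)
 show "integrable M (%x. (f x)\<^sup>2 + (g x)\<^sup>2)"
  using assms by (simp add: L2_def)
 show "(%x. f x * g x) \<in> borel_measurable M"
  using assms by (auto simp: L2_def)
 have "\<bar>f x * g x\<bar> <= (f x)\<^sup>2 + (g x)\<^sup>2" for x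
  using sum_squares_bound[of "\<bar>f x\<bar>" "\<bar>g x\<bar>"] mult_nonneg_nonneg[of "\<bar>f x\<bar>" "\<bar>g x\<bar>"]
  unfolding abs_mult power2_abs by linarith
 then show "AE x in M. norm (f x * g x) <= norm ((f x)\<^sup>2 + (g x)\<^sup>2)" by simp
qed

lemma L2_Cauchy_Schwarz:
 assumes "f \<in> L2 M" "g \<in> L2 M"
 shows "(\<integral>x. \<bar>f x * g x\<bar> \<partial>M) <= L2_norm M f * L2_norm M g"
proof -
 note [measurable] = L2_measurable[OF assms(1)] L2_measurable[OF assms(2)]
 have i: "integrable M (%x. \<bar>f x * g x\<bar>)"
  using L2_mult_integrable[OF assms] by (rule integrable_abs)
 have "(\<integral>\<^sup>+x. ennreal \<bar>f x\<bar> * ennreal \<bar>g x\<bar> \<partial>M)\<^sup>2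
   <= (\<integral>\<^sup>+x. ennreal \<bar>f x\<bar> ^ 2 \<partial>M) * (\<integral>\<^sup>+x. ennreal \<bar>g x\<bar> ^ 2 \<partial>M)"
  by (rule Cauchy_Schwarz_nn_integral) auto
 also have "(\<integral>\<^sup>+x. ennreal \<bar>f x\<bar> * ennreal \<bar>g x\<bar> \<partial>M) = ennreal (\<integral>x. \<bar>f x * g x\<bar> \<partial>M)"
  using i by (simp add: nn_integral_eq_integral[symmetric] ennreal_mult abs_mult)
 also have "(\<integral>\<^sup>+x. ennreal \<bar>f x\<bar> ^ 2 \<partial>M) = ennreal ((L2_norm M f)\<^sup>2)"
  using assms by (simp add: L2_norm_nn_integral[symmetric] ennreal_power)
 also have "(\<integral>\<^sup>+x. ennreal \<bar>g x\<bar> ^ 2 \<partial>M) = ennreal ((L2_norm M g)\<^sup>2)"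
  using assms by (simp add: L2_norm_nn_integral[symmetric] ennreal_power)
 finally have "(\<integral>x. \<bar>f x * g x\<bar> \<partial>M)\<^sup>2 <= (L2_norm M f * L2_norm M g)\<^sup>2"
  by (simp add: ennreal_power ennreal_mult[symmetric] power_mult_distrib)
 then show ?thesis by (rule power2_le_imp_le) simp
qed

lemma L2_add:
 assumes "f \<in> L2 M" "g \<in> L2 M"
 shows "(%x. f x + g x) \<in> L2 M"
 using assms L2_mult_integrable[OF assms]
 by (auto simp: L2_def power2_sum mult.assoc)

lemma L2_diff:
 assumes "f \<in> L2 M" "g \<in> L2 M"
 shows "(%x. f x - g x) \<in> L2 M"
 using L2_add[OF assms(1) L2_uminus[OF assms(2)]] by simp

lemma L2_sum:
 assumes "!!i. i \<in> I ==> f i \<in> L2 M"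
 shows "(%x. \<Sum>i\<in>I. f i x) \<in> L2 M"
 using assms by (induction I rule: infinite_finite_induct) (auto intro: L2_add L2_zero)

lemma L2_norm_triangle:
 assumes "f \<in> L2 M" "g \<in> L2 M"
 shows "L2_norm M (%x. f x + g x) <= L2_norm M f + L2_norm M g"
proof (rule power2_le_imp_le)
 have *: "(\<integral>x. f x * g x \<partial>M) <= L2_norm M f * L2_norm M g"
  using L2_Cauchy_Schwarz[OF assms] integral_abs_bound[of M "%x. f x * g x"] by linarith
 have "(L2_norm M (%x. f x + g x))\<^sup>2 = (\<integral>x. (f x)\<^sup>2 + (g x)\<^sup>2 + 2 * (f x * g x) \<partial>M)"
  by (simp add: L2_norm_power2 power2_sum mult.assoc)
 also have "\<dots> = (L2_norm M f)\<^sup>2 + (L2_norm M g)\<^sup>2 + 2 * (\<integral>x. f x * g x \<partial>M)"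
  using assms L2_mult_integrable[OF assms] by (simp add: L2_norm_power2 L2_def)
 also have "\<dots> <= (L2_norm M f + L2_norm M g)\<^sup>2"
  using * by (simp add: power2_sum)
 finally show "(L2_norm M (%x. f x + g x))\<^sup>2 <= (L2_norm M f + L2_norm M g)\<^sup>2" .
qed simp

lemma L2_norm_triangle_diff:
 assumes "f \<in> L2 M" "g \<in> L2 M"
 shows "L2_norm M (%x. f x - g x) <= L2_norm M f + L2_norm M g"
 using L2_norm_triangle[OF assms(1) L2_uminus[OF assms(2)]] by (simp add: L2_norm_uminus)

lemma L2_norm_triangle3:
 assumes "f \<in> L2 M" "g \<in> L2 M" "h \<in> L2 M"
 shows "L2_norm M (%x. f x - h x) <= L2_norm M (%x. f x - g x) + L2_norm M (%x. g x - h x)"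
 using L2_norm_triangle[OF L2_diff[OF assms(1,2)] L2_diff[OF assms(2,3)]] by simp

lemma L2_norm_sum_le:
 assumes "!!i. i \<in> I ==> f i \<in> L2 M"
 shows "L2_norm M (%x. \<Sum>i\<in>I. f i x) <= (\<Sum>i\<in>I. L2_norm M (f i))"
 using assms
proof (induction I rule: infinite_finite_induct)
 case (insert j I)
 then have "L2_norm M (%x. f j x + (\<Sum>i\<in>I. f i x)) <= L2_norm M (f j) + L2_norm M (%x. \<Sum>i\<in>I. f i x)"
  by (intro L2_norm_triangle L2_sum) auto
 then show ?case using insert by force
qed auto

lemma L2_norm_eq_0_iff:
 assumes "f \<in> L2 M"
 shows "L2_norm M f = 0 \<longleftrightarrow> (AE x in M. f x = 0)"
proof -
 have "L2_norm M f = 0 \<longleftrightarrow> (\<integral>x. (f x)\<^sup>2 \<partial>M) = 0"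
  by (simp add: L2_norm_def)
 also have "\<dots> \<longleftrightarrow> (AE x in M. (f x)\<^sup>2 = 0)"
  by (rule integral_nonneg_eq_0_iff_AE) (use assms in \<open>auto simp: L2_def\<close>)
 finally show ?thesis by simp
qed

lemma L2_AE_eqI:
 assumes "f \<in> L2 M" "g \<in> L2 M" "!!e. e > 0 ==> L2_norm M (%x. f x - g x) <= e"
 shows "AE x in M. f x = g x"
proof -
 have "L2_norm M (%x. f x - g x) = 0"
  using assms(3) L2_norm_nonneg[of M "%x. f x - g x"] by (metis dense_le_bounded field_le_epsilon le_less add_0 order_antisym_conv)
 then show ?thesis using L2_norm_eq_0_iff[OF L2_diff[OF assms(1,2)]] by simp
qed

lemma L2_tendsto_unique:
 assumes "L2_tendsto M F f" "L2_tendsto M F g"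
 shows "AE x in M. f x = g x"
proof -
 have L: "f \<in> L2 M" "g \<in> L2 M" "!!j. F j \<in> L2 M" using assms by (auto simp: L2_tendsto_def)
 have "(%j. L2_norm M (%x. F j x - f x) + L2_norm M (%x. F j x - g x)) \<longlonglongrightarrow> 0 + 0"
  using assms unfolding L2_tendsto_def by (intro tendsto_add) auto
 moreover have "L2_norm M (%x. f x - g x) <= L2_norm M (%x. F j x - f x) + L2_norm M (%x. F j x - g x)" for j
  using L2_norm_triangle3[OF L(1) L(3) L(2), of j] by (simp add: L2_norm_minus_commute[of M f "F j"])
 ultimately have "L2_norm M (%x. f x - g x) <= 0"
  by (intro LIMSEQ_le_const) auto
 then show ?thesis using L(1,2) by (intro L2_AE_eqI) auto
qed

lemma (in finite_measure) L2_bounded: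
 assumes "f \<in> borel_measurable M" "AE x in M. \<bar>f x\<bar> <= C"
 shows "f \<in> L2 M"
proof -
 have "(%x. C) \<in> L2 M" by (simp add: L2_def)
 moreover have "AE x in M. \<bar>f x\<bar> <= \<bar>C\<bar>" using assms(2) by (auto elim!: eventually_mono)
 ultimately show ?thesis using L2_mono(1)[of "%x. C" M f] assms(1) by auto
qed

lemma L2_mult_bounded:
 assumes "f \<in> L2 M" "c \<in> borel_measurable M" "AE x in M. \<bar>c x\<bar> <= C"
 shows "(%x. c x * f x) \<in> L2 M" "L2_norm M (%x. c x * f x) <= \<bar>C\<bar> * L2_norm M f"
proof -
 have "AE x in M. \<bar>c x * f x\<bar> <= \<bar>C * f x\<bar>"
  using assms(3) by eventually_elim (auto simp: abs_mult intro!: mult_right_mono)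
 then show "(%x. c x * f x) \<in> L2 M" "L2_norm M (%x. c x * f x) <= \<bar>C\<bar> * L2_norm M f"
  using L2_mono[OF L2_scale[OF assms(1), of C], of "%x. c x * f x"] assms(1,2)
  by (auto simp: L2_norm_scale L2_def)
qed

lemma (in finite_measure) L2_imp_integrable:
 assumes "f \<in> L2 M"
 shows "integrable M f"
proof -
 have "(%x. 1) \<in> L2 M" by (simp add: L2_def)
 from L2_mult_integrable[OF assms this] show ?thesis by simp
qed

lemma (in finite_measure) L1_le_L2:
 assumes "f \<in> L2 M"
 shows "(\<integral>x. \<bar>f x\<bar> \<partial>M) <= sqrt (measure M (space M)) * L2_norm M f"
proof -
 have "(%x. 1) \<in> L2 M" by (simp add: L2_def)
 moreover have "L2_norm M (%x. 1) = sqrt (measure M (space M))" by (simp add: L2_norm_def)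
 ultimately show ?thesis
  using L2_Cauchy_Schwarz[of "%x. 1" M f] assms by simp
qed

text \<open>Riesz-Fischer. A subsequence with geometrically small gaps converges almost everywhere:
  finiteness of the measure turns L2 gaps into L1 gaps, so the sum of the increments is integrable.
  Fatou's lemma then shows that the pointwise limit is the L2 limit of the whole sequence.\<close>

lemma (in finite_measure) L2_complete:
 assumes F: "!!j. F j \<in> L2 M"
  and Cauchy: "!!e. e > 0 ==> \<exists>N. \<forall>m\<ge>N. \<forall>n\<ge>N. L2_norm M (%x. F m x - F n x) < e"
 obtains f where "L2_tendsto M F f"
proof -
 note [measurable] = L2_measurable[OF F]
 \<comment> \<open>\<open>r j\<close> is a threshold for all pairs of indices beyond it, not only
   for consecutive members of the subsequence. This is what later controls the full
   sequence.\<close>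
 have "\<exists>r. strict_mono (r::nat => nat) & (\<forall>j. \<forall>m\<ge>r j. \<forall>n\<ge>r j. L2_norm M (%x. F m x - F n x) < (1/2)^j)"
 proof -
  have "\<exists>r. \<forall>j. (\<forall>m\<ge>r j. \<forall>n\<ge>r j. L2_norm M (%x. F m x - F n x) < (1/2)^j) & r j < r (Suc j)"
  proof (rule dependent_nat_choice)
   show "\<exists>x. \<forall>m\<ge>x. \<forall>n\<ge>x. L2_norm M (%xa. F m xa - F n xa) < (1 / 2) ^ 0"
    using Cauchy[of 1] by simp
   fix x n
   obtain N where "\<forall>m\<ge>N. \<forall>n'\<ge>N. L2_norm M (%x. F m x - F n' x) < (1/2) ^ Suc n"
    using Cauchy[of "(1/2) ^ Suc n"] by auto
   then show "\<exists>y. (\<forall>m\<ge>y. \<forall>na\<ge>y. L2_norm M (%x. F m x - F na x) < (1 / 2) ^ Suc n) & x < y"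
    by (intro exI[of _ "max N (Suc x)"]) auto
  qed
  then show ?thesis by (auto simp: strict_mono_Suc_iff)
 qed
 then obtain r where r: "strict_mono (r::nat => nat)"
  and rC: "!!j m n. m \<ge> r j ==> n \<ge> r j ==> L2_norm M (%x. F m x - F n x) < (1/2)^j" by blast
 define d where "d j x = \<bar>F (r (Suc j)) x - F (r j) x\<bar>" for j x
 have [measurable]: "d j \<in> borel_measurable M" for j unfolding d_def by measurable
 have di: "(\<integral>\<^sup>+x. ennreal (d j x) \<partial>M) <= ennreal (sqrt (measure M (space M)) * (1/2)^j)" for j
 proof -
  have L: "(%x. F (r (Suc j)) x - F (r j) x) \<in> L2 M" by (intro L2_diff F)
  have "(\<integral>x. d j x \<partial>M) <= sqrt (measure M (space M)) * L2_norm M (%x. F (r (Suc j)) x - F (r j) x)"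
   unfolding d_def by (rule L1_le_L2[OF L])
  also have "\<dots> <= sqrt (measure M (space M)) * (1/2)^j"
   using rC[of j "r (Suc j)" "r j"] r by (intro mult_left_mono) (auto simp: strict_mono_Suc_iff less_imp_le)
  finally show ?thesis
   using L2_imp_integrable[OF L] by (subst nn_integral_eq_integral) (auto simp: d_def[abs_def] intro: ennreal_leI)
 qed
 have "(\<integral>\<^sup>+x. (\<Sum>j. ennreal (d j x)) \<partial>M) = (\<Sum>j. \<integral>\<^sup>+x. ennreal (d j x) \<partial>M)"
  by (rule nn_integral_suminf) simp
 also have "\<dots> <= (\<Sum>j. ennreal (sqrt (measure M (space M)) * (1/2)^j))"
  by (rule suminf_le) (use di in auto)
 also have "\<dots> = ennreal (\<Sum>j. sqrt (measure M (space M)) * (1/2)^j)"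
  by (intro suminf_ennreal_eq) (auto intro!: summable_sums summable_mult summable_geometric)
 also have "\<dots> < \<infinity>" by simp
 finally have "AE x in M. (\<Sum>j. ennreal (d j x)) \<noteq> \<infinity>"
  by (intro nn_integral_noteq_infinite) auto
 then have conv: "AE x in M. convergent (%j. F (r j) x)"
 proof eventually_elim
  case (elim x)
  have "summable (%j. d j x)"
   using elim by (intro summable_suminf_not_top) (auto simp: d_def)
  then have "summable (%j. F (r (Suc j)) x - F (r j) x)"
   unfolding d_def by (rule summable_rabs_cancel)
  then have "convergent (%n. \<Sum>j<n. F (r (Suc j)) x - F (r j) x)"
   by (simp add: summable_iff_convergent)
  then have "convergent (%n. F (r n) x - F (r 0) x)"
   by (subst (asm) sum_lessThan_telescope)
  from convergent_add[OF this convergent_const[of "F (r 0) x"]] show ?case by simp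
 qed
 define f where "f x = lim (%j. F (r j) x)" for x
 have [measurable]: "f \<in> borel_measurable M" unfolding f_def by measurable
 have lim: "AE x in M. (%j. F (r j) x) \<longlonglongrightarrow> f x"
  using conv unfolding f_def by (simp add: convergent_LIMSEQ_iff)
 \<comment> \<open>Fatou with \<open>n\<close> fixed and the other index running along the
   subsequence; \<open>n\<close> is any index beyond \<open>r j\<close>.\<close>
 have bound: "(\<integral>\<^sup>+x. ennreal ((F n x - f x)\<^sup>2) \<partial>M) <= ennreal (((1/2)^j)\<^sup>2)" if "n \<ge> r j" for n j
 proof -
  have "(\<integral>\<^sup>+x. ennreal ((F n x - f x)\<^sup>2) \<partial>M) = (\<integral>\<^sup>+x. liminf (%i. ennreal ((F n x - F (r i) x)\<^sup>2)) \<partial>M)"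
  proof (rule nn_integral_cong_AE, use lim in eventually_elim)
   case (elim x)
   then have "(%i. ennreal ((F n x - F (r i) x)\<^sup>2)) \<longlonglongrightarrow> ennreal ((F n x - f x)\<^sup>2)"
    by (intro tendsto_intros)
   then show ?case by (intro lim_imp_Liminf[symmetric] sequentially_bot)
  qed
  also have "\<dots> <= liminf (%i. \<integral>\<^sup>+x. ennreal ((F n x - F (r i) x)\<^sup>2) \<partial>M)"
   by (rule nn_integral_liminf) measurable
  also have "\<dots> <= ennreal (((1/2)^j)\<^sup>2)"
  proof (rule Liminf_le)
   show "\<forall>\<^sub>F i in sequentially. (\<integral>\<^sup>+x. ennreal ((F n x - F (r i) x)\<^sup>2) \<partial>M) <= ennreal (((1/2)^j)\<^sup>2)"
    unfolding eventually_sequentially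
   proof (intro exI[of _ j] allI impI)
    fix i assume "j <= i"
    then have "r j <= r i" using r by (simp add: strict_mono_less_eq)
    then have "(L2_norm M (%x. F n x - F (r i) x))\<^sup>2 <= ((1/2)^j)\<^sup>2"
     using rC[OF that, of "r i"] by (intro power_mono) auto
    then show "(\<integral>\<^sup>+x. ennreal ((F n x - F (r i) x)\<^sup>2) \<partial>M) <= ennreal (((1/2)^j)\<^sup>2)"
     by (subst L2_norm_nn_integral) (auto intro: L2_diff F ennreal_leI)
   qed
  qed simp
  finally show ?thesis .
 qed
 have "(%x. F (r 0) x - f x) \<in> L2 M"
  by (rule L2_I_nn_integral[OF _ bound[of 0]]) auto
 then have f: "f \<in> L2 M"
  using L2_diff[OF F[of "r 0"]] by fastforce
 have "(%n. L2_norm M (%x. F n x - f x)) \<longlonglongrightarrow> 0"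
 proof (rule LIMSEQ_I)
  fix e :: real assume "e > 0"
  then obtain j where j: "(1/2)^j < e" using real_arch_pow_inv[of e "1/2"] by auto
  have "L2_norm M (%x. F n x - f x) <= (1/2)^j" if "n \<ge> r j" for n
   by (rule L2_norm_le[OF _ bound[OF that]]) auto
  then show "\<exists>no. \<forall>n\<ge>no. norm (L2_norm M (%x. F n x - f x) - 0) < e"
   using j by (intro exI[of _ "r j"]) (auto intro: le_less_trans)
 qed
 then show ?thesis using that[of f] F f by (simp add: L2_tendsto_def)
qed

lemma LIMSEQ_squeeze_zero:
 fixes f g :: "nat => real"
 assumes "g \<longlonglongrightarrow> 0" "!!n. 0 <= f n" "!!n. f n <= g n"
 shows "f \<longlonglongrightarrow> 0"
 by (rule tendsto_sandwich[of "%_. 0" f sequentially g 0]) (use assms in auto)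

section \<open>Finite linear systems\<close>

text \<open>Gaussian elimination on the last column. The rows are indexed by an arbitrary finite set
  because the pivot row that is deleted can stand anywhere, whereas the columns remain an initial
  segment.\<close>

lemma square_system_solvable:
 fixes A :: "nat => nat => real"
 assumes "finite I" "card I = n"
  and "!!c. (!!j. j \<in> I ==> (\<Sum>i<n. A j i * c i) = 0) ==> (\<forall>i<n. c i = 0)"
 shows "\<exists>c. \<forall>j\<in>I. (\<Sum>i<n. A j i * c i) = b j"
 using assms
proof (induction n arbitrary: I A b)
 case (Suc n)
 \<comment> \<open>If the last column vanished on \<open>I\<close>, the last unit vector would lie
   in the kernel.\<close>
 have "\<exists>p\<in>I. A p n \<noteq> 0"
 proof (rule ccontr)
  assume "\<not> (\<exists>p\<in>I. A p n \<noteq> 0)"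
  then have "\<forall>i<Suc n. (if i = n then 1 else (0::real)) = 0"
   by (intro Suc.prems(3)) (auto intro!: sum.neutral)
  then show False by auto
 qed
 then obtain p where p: "p \<in> I" "A p n \<noteq> 0" by auto
 define A' where "A' j i = A j i - A j n * A p i / A p n" for j i
 let ?I = "I - {p}"
 \<comment> \<open>The value inserted for the last unknown solves row \<open>p\<close> with
   right-hand side \<open>s\<close>; every row then reduces to the matrix \<open>A'\<close>, whose
   row \<open>p\<close> is zero. It is used with \<open>s = 0\<close> for the kernel and with
   \<open>s = b p\<close> for the solution.\<close>
 have lift: "(\<Sum>i<n. A j i * c i) + A j n * ((s - (\<Sum>i<n. A p i * c i)) / A p n)
   = (\<Sum>i<n. A' j i * c i) + A j n * s / A p n" for j c s
  by (simp add: A'_def algebra_simps sum_subtractf sum_distrib_left sum_divide_distrib diff_divide_distrib)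
 have ker: "\<forall>i<n. c i = 0" if c: "!!j. j \<in> ?I ==> (\<Sum>i<n. A' j i * c i) = 0" for c
 proof -
  define c' where "c' = c(n := (0 - (\<Sum>i<n. A p i * c i)) / A p n)"
  have "(\<Sum>i<Suc n. A j i * c' i) = 0" if "j \<in> I" for j
  proof -
   have "(\<Sum>i<Suc n. A j i * c' i) = (\<Sum>i<n. A j i * c i) + A j n * ((0 - (\<Sum>i<n. A p i * c i)) / A p n)"
    by (simp add: c'_def)
   also have "\<dots> = (\<Sum>i<n. A' j i * c i)" by (simp only: lift mult_zero_right div_0 add_0_right)
   also have "\<dots> = 0" using c[of j] that p by (cases "j = p") (auto simp: A'_def)
   finally show ?thesis .
  qed
  then have "\<forall>i<Suc n. c' i = 0" by (rule Suc.prems(3))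
  then show ?thesis unfolding c'_def by (metis fun_upd_other less_SucI less_irrefl)
 qed
 have "card ?I = n" using Suc.prems p by simp
 from Suc.IH[OF _ this, of A' "%j. b j - A j n * b p / A p n"] ker Suc.prems(1)
 obtain c where c: "!!j. j \<in> ?I ==> (\<Sum>i<n. A' j i * c i) = b j - A j n * b p / A p n" by auto
 define c' where "c' = c(n := (b p - (\<Sum>i<n. A p i * c i)) / A p n)"
 have "(\<Sum>i<Suc n. A j i * c' i) = b j" if "j \<in> I" for j
 proof -
  have "(\<Sum>i<Suc n. A j i * c' i) = (\<Sum>i<n. A j i * c i) + A j n * ((b p - (\<Sum>i<n. A p i * c i)) / A p n)"
   by (simp add: c'_def)
  also have "\<dots> = (\<Sum>i<n. A' j i * c i) + A j n * b p / A p n" by (rule lift)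
  also have "\<dots> = b j" using c[of j] that p by (cases "j = p") (auto simp: A'_def)
  finally show ?thesis .
 qed
 then show ?case by blast
qed simp

section \<open>Operators and functionals modulo null sets\<close>

lemma bounded_linear_L2D:
 assumes "bounded_linear_L2 M T"
 shows "f \<in> L2 M ==> T f \<in> L2 M"
  and "f \<in> L2 M ==> g \<in> L2 M ==> AE x in M. f x = g x ==> AE x in M. T f x = T g x"
  and "f \<in> L2 M ==> g \<in> L2 M ==> AE x in M. T (%y. f y + g y) x = T f x + T g x"
  and "f \<in> L2 M ==> AE x in M. T (%y. a * f y) x = a * T f x"
 using assms by (auto simp: bounded_linear_L2_def)

lemma bounded_linear_L2_diff:
 assumes T: "bounded_linear_L2 M T" and "f \<in> L2 M" "g \<in> L2 M"
 shows "AE x in M. T (%y. f y - g y) x = T f x - T g x"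
 using bounded_linear_L2D(3)[OF T assms(2) L2_scale[OF assms(3), of "-1"]]
  bounded_linear_L2D(4)[OF T assms(3), of "-1"]
 by eventually_elim simp

lemma bounded_linear_L2_bound:
 assumes "bounded_linear_L2 M T"
 obtains C where "C \<ge> 0" "!!f. f \<in> L2 M ==> L2_norm M (T f) <= C * L2_norm M f"
proof -
 obtain C where C: "!!f. f \<in> L2 M ==> L2_norm M (T f) <= C * L2_norm M f"
  using assms unfolding bounded_linear_L2_def by blast
 have "L2_norm M (T f) <= \<bar>C\<bar> * L2_norm M f" if "f \<in> L2 M" for f
  using C[OF that] mult_right_mono[OF abs_ge_self[of C] L2_norm_nonneg[of M f]] by linarith
 then show ?thesis using that[of "\<bar>C\<bar>"] by simp
qed

definition bounded_functional_L2 :: "'b measure => (('b => real) => real) => bool" where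
 "bounded_functional_L2 M l \<longleftrightarrow>
   (\<forall>f\<in>L2 M. \<forall>g\<in>L2 M. (AE x in M. f x = g x) \<longrightarrow> l f = l g) &
   (\<forall>f\<in>L2 M. \<forall>g\<in>L2 M. l (%x. f x + g x) = l f + l g) &
   (\<forall>f\<in>L2 M. \<forall>a. l (%x. a * f x) = a * l f) &
   (\<exists>C. \<forall>f\<in>L2 M. \<bar>l f\<bar> <= C * L2_norm M f)"

lemma bounded_functional_L2I:
 assumes "!!f g. f \<in> L2 M ==> g \<in> L2 M ==> AE x in M. f x = g x ==> l f = l g"
  and "!!f g. f \<in> L2 M ==> g \<in> L2 M ==> l (%x. f x + g x) = l f + l g"
  and "!!f a. f \<in> L2 M ==> l (%x. a * f x) = a * l f"
  and "!!f. f \<in> L2 M ==> \<bar>l f\<bar> <= C * L2_norm M f"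
 shows "bounded_functional_L2 M l"
 unfolding bounded_functional_L2_def by (intro conjI ballI allI impI exI[of _ C] assms)

lemma bounded_functional_L2D:
 assumes "bounded_functional_L2 M l"
 shows "f \<in> L2 M ==> g \<in> L2 M ==> AE x in M. f x = g x ==> l f = l g"
  and "f \<in> L2 M ==> g \<in> L2 M ==> l (%x. f x + g x) = l f + l g"
  and "f \<in> L2 M ==> l (%x. a * f x) = a * l f"
 using assms unfolding bounded_functional_L2_def by blast+

lemma bounded_functional_L2_bound:
 assumes "bounded_functional_L2 M l"
 obtains C where "C \<ge> 0" "!!f. f \<in> L2 M ==> \<bar>l f\<bar> <= C * L2_norm M f"
proof -
 obtain C where C: "!!f. f \<in> L2 M ==> \<bar>l f\<bar> <= C * L2_norm M f"
  using assms unfolding bounded_functional_L2_def by blast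
 have "\<bar>l f\<bar> <= \<bar>C\<bar> * L2_norm M f" if "f \<in> L2 M" for f
  using C[OF that] mult_right_mono[OF abs_ge_self[of C] L2_norm_nonneg[of M f]] by linarith
 then show ?thesis using that[of "\<bar>C\<bar>"] by simp
qed

lemma bounded_functional_L2_sum:
 assumes l: "bounded_functional_L2 M l" and "finite I" "!!i. i \<in> I ==> f i \<in> L2 M"
 shows "l (%x. \<Sum>i\<in>I. c i * f i x) = (\<Sum>i\<in>I. c i * l (f i))"
 using assms(2,3)
proof (induction I)
 case empty
 have "l (%x. 0 * 0) = 0 * l (%x. 0)"
  by (rule bounded_functional_L2D(3)[OF l L2_zero])
 then show ?case by simp
next
 case (insert j I)
 then have "l (%x. c j * f j x + (\<Sum>i\<in>I. c i * f i x)) = c j * l (f j) + l (%x. \<Sum>i\<in>I. c i * f i x)"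
  by (subst bounded_functional_L2D(2)[OF l]) (auto intro!: L2_scale L2_sum bounded_functional_L2D(3)[OF l])
 then show ?case using insert by simp
qed

lemma bounded_functional_L2_compose:
 assumes T: "bounded_linear_L2 M T" and l: "bounded_functional_L2 M l"
 shows "bounded_functional_L2 M (%f. l (T f))"
proof -
 note TD = bounded_linear_L2D[OF T] and lD = bounded_functional_L2D[OF l]
 obtain C where C: "C \<ge> 0" "!!f. f \<in> L2 M ==> L2_norm M (T f) <= C * L2_norm M f"
  using bounded_linear_L2_bound[OF T] by blast
 obtain D where D: "D \<ge> 0" "!!f. f \<in> L2 M ==> \<bar>l f\<bar> <= D * L2_norm M f"
  using bounded_functional_L2_bound[OF l] by blast
 have "\<bar>l (T f)\<bar> <= D * C * L2_norm M f" if "f \<in> L2 M" for f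
  using D(2)[OF TD(1)[OF that]] mult_left_mono[OF C(2)[OF that] D(1)] by (simp add: mult.assoc)
 moreover have "l (T (%x. f x + g x)) = l (T f) + l (T g)" if "f \<in> L2 M" "g \<in> L2 M" for f g
  using lD(1)[OF TD(1)[OF L2_add[OF that]] L2_add[OF TD(1)[OF that(1)] TD(1)[OF that(2)]] TD(3)[OF that]]
   lD(2)[OF TD(1)[OF that(1)] TD(1)[OF that(2)]] by simp
 moreover have "l (T (%x. a * f x)) = a * l (T f)" if "f \<in> L2 M" for f a
  using lD(1)[OF TD(1)[OF L2_scale[OF that]] L2_scale[OF TD(1)[OF that]] TD(4)[OF that]]
   lD(3)[OF TD(1)[OF that]] by simp
 ultimately show ?thesis
  unfolding bounded_functional_L2_def using lD(1)[OF TD(1) TD(1) TD(2)] by blast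
qed

lemma bounded_linear_L2_sum:
 assumes T: "bounded_linear_L2 M T" and "finite I" "!!i. i \<in> I ==> f i \<in> L2 M"
 shows "AE x in M. T (%x. \<Sum>i\<in>I. c i * f i x) x = (\<Sum>i\<in>I. c i * T (f i) x)"
 using assms(2,3)
proof (induction I)
 case empty
 have "AE x in M. T (%x. 0 * 0) x = 0 * T (%x. 0) x"
  by (rule bounded_linear_L2D(4)[OF T L2_zero])
 then show ?case by simp
next
 case (insert j I)
 have 1: "AE x in M. T (%x. c j * f j x + (\<Sum>i\<in>I. c i * f i x)) x
   = T (%x. c j * f j x) x + T (%x. \<Sum>i\<in>I. c i * f i x) x"
  using insert by (intro bounded_linear_L2D(3)[OF T] L2_scale L2_sum) auto
 have 2: "AE x in M. T (%x. c j * f j x) x = c j * T (f j) x"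
  using insert by (intro bounded_linear_L2D(4)[OF T]) auto
 have 3: "AE x in M. T (%x. \<Sum>i\<in>I. c i * f i x) x = (\<Sum>i\<in>I. c i * T (f i) x)"
  using insert by auto
 from 1 2 3 show ?case by eventually_elim (use insert in simp)
qed

lemma bounded_linear_L2_tendsto:
 assumes T: "bounded_linear_L2 M T" and F: "L2_tendsto M F f"
 shows "L2_tendsto M (%j. T (F j)) (T f)"
proof -
 have L: "f \<in> L2 M" "!!j. F j \<in> L2 M" and lim: "(%j. L2_norm M (%x. F j x - f x)) \<longlonglongrightarrow> 0"
  using F by (auto simp: L2_tendsto_def)
 note TD = bounded_linear_L2D[OF T]
 obtain C where C: "C \<ge> 0" "!!f. f \<in> L2 M ==> L2_norm M (T f) <= C * L2_norm M f"
  using bounded_linear_L2_bound[OF T] by blast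
 have "L2_norm M (%x. T (F j) x - T f x) <= C * L2_norm M (%x. F j x - f x)" for j
 proof -
  have "L2_norm M (%x. T (F j) x - T f x) = L2_norm M (T (%x. F j x - f x))"
   by (rule L2_norm_cong_AE)
    (use L bounded_linear_L2_diff[OF T L(2) L(1), of j] in \<open>auto intro!: L2_measurable TD(1) L2_diff\<close>)
  then show ?thesis using C(2)[OF L2_diff[OF L(2) L(1)]] by simp
 qed
 moreover have "(%j. C * L2_norm M (%x. F j x - f x)) \<longlonglongrightarrow> C * 0"
  by (intro tendsto_intros lim)
 ultimately have "(%j. L2_norm M (%x. T (F j) x - T f x)) \<longlonglongrightarrow> 0"
  by - (rule LIMSEQ_squeeze_zero[where g = "%j. C * L2_norm M (%x. F j x - f x)"], simp_all)
 then show ?thesis using L TD(1) by (simp add: L2_tendsto_def)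
qed

lemma L2_tendsto_add:
 assumes "L2_tendsto M F f" "L2_tendsto M G g"
 shows "L2_tendsto M (%j x. F j x + G j x) (%x. f x + g x)"
proof -
 have L: "f \<in> L2 M" "!!j. F j \<in> L2 M" "g \<in> L2 M" "!!j. G j \<in> L2 M"
  using assms by (auto simp: L2_tendsto_def)
 have "(%j. L2_norm M (%x. F j x - f x) + L2_norm M (%x. G j x - g x)) \<longlonglongrightarrow> 0 + 0"
  using assms unfolding L2_tendsto_def by (intro tendsto_add) auto
 moreover have "L2_norm M (%x. F j x + G j x - (f x + g x))
   <= L2_norm M (%x. F j x - f x) + L2_norm M (%x. G j x - g x)" for j
  using L2_norm_triangle[OF L2_diff[OF L(2,1)] L2_diff[OF L(4,3)], of j j] by (simp add: algebra_simps)
 ultimately have "(%j. L2_norm M (%x. F j x + G j x - (f x + g x))) \<longlonglongrightarrow> 0"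
  by - (rule LIMSEQ_squeeze_zero[where g = "%j. L2_norm M (%x. F j x - f x) + L2_norm M (%x. G j x - g x)"], simp_all)
 then show ?thesis using L by (auto simp: L2_tendsto_def intro: L2_add)
qed

section \<open>Neumann iteration and finite rank perturbations\<close>

text \<open>The iteration \<open>g (Suc j) = h - R (g j)\<close> is Cauchy because successive
  differences shrink by the factor \<open>k\<close>. Solutions are unique only up to null sets, so
  \<open>B\<close> has to choose one; its linearity and its compatibility with almost everywhere
  equality are then consequences of uniqueness.\<close>

lemma (in finite_measure) contraction_solvable_L2:
 assumes R: "bounded_linear_L2 M R" and k: "0 <= k" "k < 1"
  and contr: "!!f. f \<in> L2 M ==> L2_norm M (R f) <= k * L2_norm M f"
 obtains B where "bounded_linear_L2 M B" "!!h. h \<in> L2 M ==> AE x in M. B h x + R (B h) x = h x"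
proof -
 note RD = bounded_linear_L2D[OF R]
 have sol: "\<exists>g. g \<in> L2 M & (AE x in M. g x + R g x = h x)" if h: "h \<in> L2 M" for h
 proof -
  define g where "g = rec_nat h (%_ f x. h x - R f x)"
  have g0: "g 0 = h" and gS: "g (Suc j) = (%x. h x - R (g j) x)" for j by (auto simp: g_def)
  have gL: "g j \<in> L2 M" for j
   by (induction j) (auto simp: g0 gS intro!: h L2_diff RD(1))
  have step: "L2_norm M (%x. g (Suc j) x - g j x) <= k ^ j * L2_norm M (R h)" for j
  proof (induction j)
   case 0 then show ?case by (simp add: gS g0 L2_norm_uminus)
  next
   case (Suc j)
   have "L2_norm M (%x. g (Suc (Suc j)) x - g (Suc j) x) = L2_norm M (%x. R (g (Suc j)) x - R (g j) x)"
    by (simp add: gS[of "Suc j"] gS[of j] L2_norm_minus_commute)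
   also have "\<dots> = L2_norm M (R (%x. g (Suc j) x - g j x))"
    using bounded_linear_L2_diff[OF R gL[of "Suc j"] gL[of j]]
    by (intro L2_norm_cong_AE) (auto intro!: L2_measurable RD(1) L2_diff gL)
   also have "\<dots> <= k * L2_norm M (%x. g (Suc j) x - g j x)"
    by (intro contr L2_diff gL)
   also have "\<dots> <= k * (k ^ j * L2_norm M (R h))" by (intro mult_left_mono Suc k)
   finally show ?case by simp
  qed
  have dist: "L2_norm M (%x. g (m + n) x - g m x) <= k ^ m * (L2_norm M (R h) / (1 - k))" for m n
  proof -
   have "L2_norm M (%x. g (m + n) x - g m x) <= (\<Sum>i<n. L2_norm M (%x. g (Suc (m + i)) x - g (m + i) x))"
   proof (induction n)
    case (Suc n)
    have "L2_norm M (%x. g (m + Suc n) x - g m x)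
      <= L2_norm M (%x. g (m + Suc n) x - g (m + n) x) + L2_norm M (%x. g (m + n) x - g m x)"
     by (rule L2_norm_triangle3[OF gL gL gL])
    then show ?case using Suc by simp
   qed simp
   also have "\<dots> <= (\<Sum>i<n. k ^ (m + i) * L2_norm M (R h))" by (intro sum_mono step)
   also have "\<dots> = k ^ m * (L2_norm M (R h) * (\<Sum>i<n. k ^ i))"
    by (simp add: power_add sum_distrib_left sum_distrib_right mult_ac)
   also have "\<dots> <= k ^ m * (L2_norm M (R h) * (1 / (1 - k)))"
   proof (intro mult_left_mono)
    have "(\<Sum>i<n. k ^ i) = (1 - k ^ n) / (1 - k)" using k by (simp add: sum_gp_strict)
    also have "\<dots> <= 1 / (1 - k)" using k by (intro divide_right_mono) auto
    finally show "(\<Sum>i<n. k ^ i) <= 1 / (1 - k)" .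
   qed (use k in auto)
   finally show ?thesis by simp
  qed
  have "\<exists>N. \<forall>m\<ge>N. \<forall>n\<ge>N. L2_norm M (%x. g m x - g n x) < e" if "e > 0" for e
  proof -
   define C where "C = L2_norm M (R h) / (1 - k)"
   have "C \<ge> 0" using k by (simp add: C_def)
   have "(%N. k ^ N * C) \<longlonglongrightarrow> 0"
    using LIMSEQ_power_zero[of k] k by (intro tendsto_mult_left_zero) auto
   then have "\<forall>\<^sub>F N in sequentially. k ^ N * C < e / 2"
    by (rule order_tendstoD) (use that in simp)
   then obtain N where N: "k ^ N * C < e / 2" by (auto simp: eventually_sequentially)
   have near: "L2_norm M (%x. g m x - g N x) < e / 2" if "m \<ge> N" for m
    using dist[of N "m - N"] that N unfolding C_def[symmetric] by simp
   have "L2_norm M (%x. g m x - g n x) < e" if "m \<ge> N" "n \<ge> N" for m n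
    using L2_norm_triangle3[OF gL[of m] gL[of N] gL[of n]] near[OF that(1)] near[OF that(2)]
     L2_norm_minus_commute[of M "g N" "g n"] by linarith
   then show ?thesis by blast
  qed
  then obtain f where f: "L2_tendsto M g f" using L2_complete[of g] gL by blast
  then have fL: "f \<in> L2 M" by (simp add: L2_tendsto_def)
  have "L2_tendsto M (%j x. g (Suc j) x + R (g j) x) (%x. f x + R f x)"
  proof (rule L2_tendsto_add)
   show "L2_tendsto M (%j. g (Suc j)) f"
    using f LIMSEQ_Suc unfolding L2_tendsto_def by blast
  qed (rule bounded_linear_L2_tendsto[OF R f])
  moreover have "L2_tendsto M (%j x. g (Suc j) x + R (g j) x) h"
   using h by (simp add: gS L2_tendsto_def)
  ultimately show ?thesis using fL L2_tendsto_unique by blast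
 qed
 have bound: "L2_norm M g <= 1 / (1 - k) * L2_norm M h"
  if g: "g \<in> L2 M" and h: "h \<in> L2 M" and e: "AE x in M. g x + R g x = h x" for g h
 proof -
  have "L2_norm M g = L2_norm M (%x. h x - R g x)"
   using e by (intro L2_norm_cong_AE) (auto intro!: L2_measurable g L2_diff h RD(1) elim!: eventually_mono)
  also have "\<dots> <= L2_norm M h + k * L2_norm M g"
   using L2_norm_triangle_diff[OF h RD(1)[OF g]] contr[OF g] by linarith
  finally have "(1 - k) * L2_norm M g <= L2_norm M h" by (simp add: algebra_simps)
  then show ?thesis using k by (simp add: field_simps)
 qed
 have unique: "AE x in M. g x = g' x"
  if g: "g \<in> L2 M" "g' \<in> L2 M" and e: "AE x in M. g x + R g x = h x" "AE x in M. g' x + R g' x = h x" for g g' h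
 proof -
  have "AE x in M. (g x - g' x) + R (%x. g x - g' x) x = 0"
   using e bounded_linear_L2_diff[OF R g] by eventually_elim simp
  from bound[OF L2_diff[OF g] L2_zero this]
  have "L2_norm M (%x. g x - g' x) = 0"
   using L2_norm_nonneg[of M "%x. g x - g' x"] by simp
  then show ?thesis using L2_norm_eq_0_iff[OF L2_diff[OF g]] by simp
 qed
 define B where "B h = (SOME g. g \<in> L2 M & (AE x in M. g x + R g x = h x))" for h
 have B: "B h \<in> L2 M" "AE x in M. B h x + R (B h) x = h x" if "h \<in> L2 M" for h
  using someI_ex[OF sol[OF that]] by (auto simp: B_def)
 have "bounded_linear_L2 M B"
  unfolding bounded_linear_L2_def
 proof (intro conjI ballI allI impI)
  fix f g assume f: "f \<in> L2 M" and g: "g \<in> L2 M"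
  show "B f \<in> L2 M" by (rule B[OF f])
  show "AE x in M. B (%y. f y + g y) x = B f x + B g x"
  proof (rule unique)
   show "AE x in M. B f x + B g x + R (%x. B f x + B g x) x = f x + g x"
    using RD(3)[OF B(1)[OF f] B(1)[OF g]] B(2)[OF f] B(2)[OF g] by eventually_elim simp
  qed (auto intro!: B L2_add f g)
  show "AE x in M. B f x = B g x" if e: "AE x in M. f x = g x"
  proof (rule unique)
   show "AE x in M. B g x + R (B g) x = f x"
    using B(2)[OF g] e by eventually_elim simp
  qed (auto intro!: B f g)
 next
  fix f a assume f: "f \<in> L2 M"
  show "AE x in M. B (%y. a * f y) x = a * B f x"
  proof (rule unique)
   show "AE x in M. a * B f x + R (%x. a * B f x) x = a * f x"
    using RD(4)[OF B(1)[OF f], of a] B(2)[OF f] by eventually_elim (simp flip: distrib_left)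
  qed (auto intro!: B L2_scale f)
 next
  show "\<exists>C. \<forall>f\<in>L2 M. L2_norm M (B f) <= C * L2_norm M f"
   using bound[OF B(1) _ B(2)] by blast
 qed
 then show ?thesis using that B(2) by blast
qed

text \<open>Once the contraction is inverted, what remains is a finite linear system for the values of
 the functionals at the solution; its solution formula also bounds the inverse.\<close>

lemma (in finite_measure) Fredholm_finite_rank_contraction:
 fixes N :: nat
 assumes R: "bounded_linear_L2 M R" and k: "0 <= k" "k < 1"
  and contr: "!!f. f \<in> L2 M ==> L2_norm M (R f) <= k * L2_norm M f"
  and a: "!!i. i < N ==> a i \<in> L2 M"
  and l: "!!i. i < N ==> bounded_functional_L2 M (l i)"
  and T: "bounded_linear_L2 M T"
  and T_eq: "!!f. f \<in> L2 M ==> AE x in M. T f x = f x + R f x + (\<Sum>i<N. l i f * a i x)"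
  and inj: "!!f. f \<in> L2 M ==> AE x in M. T f x = 0 ==> AE x in M. f x = 0"
 obtains S where "bounded_linear_L2 M S" "inverse_L2 M T S"
proof -
 note RD = bounded_linear_L2D[OF R] and TD = bounded_linear_L2D[OF T]
 obtain B where B: "bounded_linear_L2 M B" and BR: "!!h. h \<in> L2 M ==> AE x in M. B h x + R (B h) x = h x"
  using contraction_solvable_L2[OF R k contr] by blast
 note BD = bounded_linear_L2D[OF B]
 \<comment> \<open>Inverting \<open>Id + R\<close> turns \<open>T f = h\<close> into
   \<open>f + (\<Sum>i<N. l i f * a' i) = B h\<close>. Applying \<open>l j\<close> gives a square
   system with matrix \<open>A\<close> for the unknown numbers \<open>l i f\<close>.\<close>
 define a' where "a' i = B (a i)" for i
 have a'L: "a' i \<in> L2 M" if "i < N" for i using BD(1) a that by (simp add: a'_def)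
 define A where "A j i = (if j = i then 1 else 0) + l j (a' i)" for j i
 have A_sum: "(\<Sum>i<N. A j i * c i) = c j + (\<Sum>i<N. c i * l j (a' i))" if "j < N" for j c
 proof -
  have "(\<Sum>i<N. A j i * c i) = (\<Sum>i<N. (if j = i then c i else 0) + c i * l j (a' i))"
   by (intro sum.cong) (auto simp: A_def algebra_simps)
  also have "\<dots> = (\<Sum>i<N. if j = i then c i else 0) + (\<Sum>i<N. c i * l j (a' i))" by (rule sum.distrib)
  also have "(\<Sum>i<N. if j = i then c i else 0) = c j" by (subst sum.delta') (use that in auto)
  finally show ?thesis .
 qed
 have comb: "AE x in M. (\<Sum>i<N. c i * a' i x) + R (%x. \<Sum>i<N. c i * a' i x) x = (\<Sum>i<N. c i * a i x)" for c
 proof -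
  have "AE x in M. \<forall>i\<in>{..<N}. a' i x + R (a' i) x = a i x"
   unfolding a'_def by (rule AE_finite_allI) (auto intro!: BR a)
  moreover have "AE x in M. R (%x. \<Sum>i<N. c i * a' i x) x = (\<Sum>i<N. c i * R (a' i) x)"
   by (rule bounded_linear_L2_sum[OF R]) (auto intro: a'L)
  ultimately show ?thesis
  proof eventually_elim
   case (elim x)
   then have "(\<Sum>i<N. c i * a i x) = (\<Sum>i<N. c i * (a' i x + R (a' i) x))" by (intro sum.cong) auto
   then show ?case using elim(2) by (simp add: ring_distribs sum.distrib)
  qed
 qed
 have "\<exists>c. \<forall>j\<in>{..<N}. (\<Sum>i<N. A j i * c i) = b j" for b
 proof (rule square_system_solvable)
  \<comment> \<open>A kernel vector \<open>c\<close> of \<open>A\<close> yields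
    \<open>f = (\<Sum>i<N. c i * a' i)\<close> with \<open>l j f = - c j\<close>. Then
    \<open>f + R f\<close> is the combination of the \<open>a i\<close> with coefficients
    \<open>c i\<close>, which the finite rank part cancels, so \<open>T f = 0\<close>. Injectivity
    of \<open>T\<close> thus makes \<open>A\<close> nonsingular.\<close>
  fix c assume c: "!!j. j \<in> {..<N} ==> (\<Sum>i<N. A j i * c i) = 0"
  define f where "f x = (\<Sum>i<N. c i * a' i x)" for x
  have f: "f \<in> L2 M" unfolding f_def by (intro L2_sum L2_scale a'L) auto
  have lf: "l j f = - c j" if "j < N" for j
   using bounded_functional_L2_sum[OF l[OF that] finite_lessThan, of N a' c] a'L c[of j] A_sum[OF that, of c] that
   by (simp add: f_def[abs_def])
  have "AE x in M. f x = 0"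
  proof (rule inj[OF f])
   show "AE x in M. T f x = 0"
    using T_eq[OF f] comb[of c] by eventually_elim (simp add: f_def[symmetric] lf sum_negf f_def[abs_def, symmetric])
  qed
  then have "l j f = 0" if "j < N" for j
   using bounded_functional_L2D(1)[OF l[OF that] f L2_zero] bounded_functional_L2D(3)[OF l[OF that] L2_zero, of 0]
   by simp
  then show "\<forall>i<N. c i = 0" using lf by auto
 qed auto
 \<comment> \<open>The vectors \<open>D m\<close> are the columns of the inverse matrix, chosen once
   and for all. The coefficients \<open>c h\<close> are therefore explicit combinations of the
   functionals \<open>l m (B h)\<close>, hence linear and bounded in \<open>h\<close>.\<close>
 then have "\<forall>m. \<exists>d. \<forall>j\<in>{..<N}. (\<Sum>i<N. A j i * d i) = (if j = m then 1 else 0)"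
  by (intro allI)
 from choice[OF this]
 obtain D where D: "!!m j. j < N ==> (\<Sum>i<N. A j i * D m i) = (if j = m then 1 else 0)"
  by auto
 define c where "c h i = (\<Sum>m<N. l m (B h) * D m i)" for h i
 have c: "(\<Sum>i<N. A j i * c h i) = l j (B h)" if "j < N" for h j
 proof -
  have "(\<Sum>i<N. A j i * c h i) = (\<Sum>m<N. l m (B h) * (\<Sum>i<N. A j i * D m i))"
   unfolding c_def sum_distrib_left by (subst sum.swap) (simp add: mult_ac)
  also have "\<dots> = l j (B h)" using that by (simp add: D if_distrib cong: if_cong)
  finally show ?thesis .
 qed
 define S where "S h x = B h x - (\<Sum>i<N. c h i * a' i x)" for h x
 have cL: "bounded_functional_L2 M (%h. c h i)" if "i < N" for i
 proof -
  have lB: "bounded_functional_L2 M (%h. l m (B h))" if "m < N" for m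
   by (rule bounded_functional_L2_compose[OF B l[OF that]])
  have "\<forall>m. \<exists>C. m < N \<longrightarrow> (\<forall>f\<in>L2 M. \<bar>l m (B f)\<bar> <= C * L2_norm M f)"
   using lB unfolding bounded_functional_L2_def by blast
  then obtain C where C: "!!m f. m < N ==> f \<in> L2 M ==> \<bar>l m (B f)\<bar> <= C m * L2_norm M f" by metis
  show ?thesis
  proof (rule bounded_functional_L2I)
   show "\<bar>c f i\<bar> <= (\<Sum>m<N. C m * \<bar>D m i\<bar>) * L2_norm M f" if "f \<in> L2 M" for f
   proof -
    have "\<bar>c f i\<bar> <= (\<Sum>m<N. \<bar>l m (B f)\<bar> * \<bar>D m i\<bar>)"
     unfolding c_def using sum_abs[of "%m. l m (B f) * D m i"] by (simp add: abs_mult)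
    also have "\<dots> <= (\<Sum>m<N. C m * L2_norm M f * \<bar>D m i\<bar>)"
     by (intro sum_mono mult_right_mono C that) auto
    finally show ?thesis by (simp add: sum_distrib_right sum_distrib_left mult_ac)
   qed
   show "c f i = c g i" if "f \<in> L2 M" "g \<in> L2 M" "AE x in M. f x = g x" for f g
   proof -
    have "l m (B f) = l m (B g)" if "m < N" for m
     by (rule bounded_functional_L2D(1)[OF lB[OF that]]) fact+
    then show ?thesis unfolding c_def by (intro sum.cong) auto
   qed
   show "c (%x. f x + g x) i = c f i + c g i" if "f \<in> L2 M" "g \<in> L2 M" for f g
   proof -
    have "l m (B (%x. f x + g x)) = l m (B f) + l m (B g)" if "m < N" for m
     by (rule bounded_functional_L2D(2)[OF lB[OF that]]) fact+
    then show ?thesis unfolding c_def sum.distrib[symmetric]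
     by (intro sum.cong) (auto simp: ring_distribs)
   qed
   show "c (%x. r * f x) i = r * c f i" if "f \<in> L2 M" for f r
   proof -
    have "l m (B (%x. r * f x)) = r * l m (B f)" if "m < N" for m
     by (rule bounded_functional_L2D(3)[OF lB[OF that]]) fact+
    then show ?thesis unfolding c_def sum_distrib_left by (intro sum.cong) auto
   qed
  qed
 qed
 note cD = bounded_functional_L2D[OF cL]
 have sumL: "(%x. \<Sum>i<N. c h i * a' i x) \<in> L2 M" for h by (intro L2_sum L2_scale a'L) auto
 have SL: "S h \<in> L2 M" if "h \<in> L2 M" for h
  unfolding S_def[abs_def] by (intro L2_diff sumL BD(1) that)
 have S: "bounded_linear_L2 M S"
  unfolding bounded_linear_L2_def
 proof (intro conjI ballI allI impI)
  fix f g assume f: "f \<in> L2 M" and g: "g \<in> L2 M"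
  show "S f \<in> L2 M" by (rule SL[OF f])
  show "AE x in M. S f x = S g x" if e: "AE x in M. f x = g x"
   using BD(2)[OF f g e]
  proof eventually_elim
   case (elim x)
   then show ?case unfolding S_def using cD(1)[OF _ f g e] by simp
  qed
  show "AE x in M. S (%y. f y + g y) x = S f x + S g x"
   using BD(3)[OF f g]
  proof eventually_elim
   case (elim x)
   then show ?case unfolding S_def using cD(2)[OF _ f g] by (simp add: ring_distribs sum.distrib)
  qed
 next
  fix f r assume f: "f \<in> L2 M"
  show "AE x in M. S (%y. r * f y) x = r * S f x"
   using BD(4)[OF f, of r]
  proof eventually_elim
   case (elim x)
   then show ?case unfolding S_def using cD(3)[OF _ f] by (simp add: right_diff_distrib sum_distrib_left mult.assoc)
  qed
 next
  obtain C where C: "C \<ge> 0" "!!f. f \<in> L2 M ==> L2_norm M (B f) <= C * L2_norm M f"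
   using bounded_linear_L2_bound[OF B] by blast
  have "\<forall>i. \<exists>C. i < N \<longrightarrow> (\<forall>f\<in>L2 M. \<bar>c f i\<bar> <= C * L2_norm M f)"
   using cL unfolding bounded_functional_L2_def by blast
  then obtain E where E: "!!i f. i < N ==> f \<in> L2 M ==> \<bar>c f i\<bar> <= E i * L2_norm M f" by metis
  have "L2_norm M (S f) <= (C + (\<Sum>i<N. E i * L2_norm M (a' i))) * L2_norm M f" if f: "f \<in> L2 M" for f
  proof -
   have "L2_norm M (S f) <= L2_norm M (B f) + L2_norm M (%x. \<Sum>i<N. c f i * a' i x)"
    unfolding S_def[abs_def] by (intro L2_norm_triangle_diff BD(1) f sumL)
   also have "L2_norm M (%x. \<Sum>i<N. c f i * a' i x) <= (\<Sum>i<N. L2_norm M (%x. c f i * a' i x))"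
    by (intro L2_norm_sum_le L2_scale a'L) auto
   also have "\<dots> = (\<Sum>i<N. \<bar>c f i\<bar> * L2_norm M (a' i))" by (simp add: L2_norm_scale)
   also have "\<dots> <= (\<Sum>i<N. E i * L2_norm M f * L2_norm M (a' i))"
    by (intro sum_mono mult_right_mono E f) auto
   finally show ?thesis using C(2)[OF f] by (simp add: ring_distribs sum_distrib_right sum_distrib_left mult_ac)
  qed
  then show "\<exists>C. \<forall>f\<in>L2 M. L2_norm M (S f) <= C * L2_norm M f" by blast
 qed
 have TS: "AE x in M. T (S h) x = h x" if h: "h \<in> L2 M" for h
 proof -
  have lS: "l j (S h) = c h j" if "j < N" for j
  proof -
   note lj = l[OF that]
   have "l j (S h) = l j (%x. B h x + (\<Sum>i<N. (- c h i) * a' i x))"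
    by (simp add: S_def[abs_def] sum_negf)
   also have "\<dots> = l j (B h) + (\<Sum>i<N. (- c h i) * l j (a' i))"
   proof -
    have "(%x. \<Sum>i<N. (- c h i) * a' i x) \<in> L2 M" by (intro L2_sum L2_scale a'L) auto
    moreover have "l j (%x. \<Sum>i<N. (- c h i) * a' i x) = (\<Sum>i<N. (- c h i) * l j (a' i))"
     by (rule bounded_functional_L2_sum[OF lj]) (auto intro: a'L)
    ultimately show ?thesis
     using bounded_functional_L2D(2)[OF lj BD(1)[OF h]] by simp
   qed
   also have "\<dots> = c h j" using c[OF that, of h] A_sum[OF that, of "c h"] by (simp add: sum_negf)
   finally show ?thesis .
  qed
  have "AE x in M. R (S h) x = R (B h) x - R (%x. \<Sum>i<N. c h i * a' i x) x"
   unfolding S_def[abs_def] by (intro bounded_linear_L2_diff[OF R] BD(1) h sumL)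
  then show ?thesis using T_eq[OF SL[OF h]] comb[of "c h"] BR[OF h]
   by eventually_elim (simp add: lS S_def)
 qed
 \<comment> \<open>A right inverse of an injective operator is a left inverse: \<open>T\<close> maps
   \<open>S (T f) - f\<close> to zero.\<close>
 have ST: "AE x in M. S (T f) x = f x" if f: "f \<in> L2 M" for f
 proof -
  note g = SL[OF TD(1)[OF f]]
  have "AE x in M. T (%x. S (T f) x - f x) x = 0"
   using bounded_linear_L2_diff[OF T g f] TS[OF TD(1)[OF f]] by eventually_elim simp
  from inj[OF L2_diff[OF g f] this] show ?thesis by simp
 qed
 have "inverse_L2 M T S"
  unfolding inverse_L2_def using TS ST SL TD(1) by blast
 with S show ?thesis by (rule that)
qed

section \<open>The surface measure of the sphere\<close>

lemma space_sphere_measure [simp]: "space sphere_measure = sphere (0::'a::euclidean_space) 1"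
 by (simp add: sphere_measure_def space_scale_measure space_restrict_space)

lemma sets_sphere_measure:
 "sets sphere_measure = sets (restrict_space borel (sphere (0::'a::euclidean_space) 1))"
 by (simp add: sphere_measure_def)

lemma measurable_sphere_measure_ident [measurable (raw)]:
 "(%th. th) \<in> borel_measurable (sphere_measure :: 'a::euclidean_space measure)"
proof -
 have "(%th::'a. th) \<in> borel_measurable (restrict_space borel (sphere 0 1))"
  by (intro measurable_restrict_space1) simp
 then show ?thesis by (simp cong: measurable_cong_sets add: sets_sphere_measure)
qed

text \<open>Rules on the identity map let the measurability prover pass between product
  sigma-algebras, such as that of \<open>phase_measure X\<close>, and the Borel sets of the whole
  space.\<close>

lemma measurable_ident_pair [measurable (raw)]:
 assumes "(%x. x) \<in> M \<rightarrow>\<^sub>M M'" "(%x. x) \<in> N \<rightarrow>\<^sub>M N'"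
 shows "(%x. x) \<in> M \<Otimes>\<^sub>M N \<rightarrow>\<^sub>M M' \<Otimes>\<^sub>M N'"
 using measurable_Pair[OF measurable_compose[OF measurable_fst assms(1)] measurable_compose[OF measurable_snd assms(2)]]
 by simp

lemma measurable_ident_pair_borel [measurable (raw)]:
 fixes M :: "'b::second_countable_topology measure" and N :: "'c::second_countable_topology measure"
 assumes "(%x. x) \<in> borel_measurable M" "(%x. x) \<in> borel_measurable N"
 shows "(%x. x) \<in> borel_measurable (M \<Otimes>\<^sub>M N)"
 using measurable_ident_pair[OF assms] by (simp add: borel_prod)

lemma measurable_sgn_sphere:
 "sgn \<in> restrict_space lborel (ball 0 1 - {0}) \<rightarrow>\<^sub>M restrict_space borel (sphere (0::'a::euclidean_space) 1)"
 by (intro measurable_restrict_space2 measurable_restrict_space1)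
  (auto simp: space_restrict_space norm_sgn)

lemma nn_integral_sphere_measure:
 fixes f :: "'a::euclidean_space => ennreal"
 assumes "f \<in> borel_measurable (sphere_measure)"
 shows "(\<integral>\<^sup>+th. f th \<partial>sphere_measure)
  = of_nat DIM('a) * (\<integral>\<^sup>+x. f (sgn x) * indicator (ball 0 1 - {0}) x \<partial>lborel)"
proof -
 have f: "f \<in> borel_measurable (restrict_space borel (sphere (0::'a) 1))"
  using assms by (simp cong: measurable_cong_sets add: sets_sphere_measure)
 then have f': "f \<in> borel_measurable (distr (restrict_space lborel (ball 0 1 - {0})) (restrict_space borel (sphere (0::'a) 1)) sgn)"
  by simp
 show ?thesis
  unfolding sphere_measure_def
  using f f' measurable_sgn_sphere
  by (subst nn_integral_scale_measure, simp, subst nn_integral_distr)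
   (simp_all add: nn_integral_restrict_space)
qed

lemma emeasure_sphere_measure:
 "emeasure sphere_measure (sphere (0::'a::euclidean_space) 1) = of_nat DIM('a) * emeasure lborel (ball (0::'a) 1)"
proof -
 have "emeasure sphere_measure (sphere (0::'a) 1) = (\<integral>\<^sup>+th. 1 \<partial>(sphere_measure :: 'a measure))"
  by simp
 also have "\<dots> = of_nat DIM('a) * (\<integral>\<^sup>+x. indicator (ball 0 1 - {0::'a}) x \<partial>lborel)"
  by (subst nn_integral_sphere_measure) auto
 also have "(\<integral>\<^sup>+x. indicator (ball 0 1 - {0::'a}) x \<partial>lborel) = emeasure lborel (ball (0::'a) 1)"
  by (simp add: emeasure_Diff)
 finally show ?thesis .
qed

interpretation sphere_measure: finite_measure "sphere_measure :: 'a::euclidean_space measure"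
proof
 show "emeasure sphere_measure (space (sphere_measure :: 'a measure)) \<noteq> \<infinity>"
  using emeasure_lborel_ball_finite[of "0::'a" 1]
  by (simp add: emeasure_sphere_measure ennreal_mult_eq_top_iff)
qed

lemma nn_integral_lborel_scaleR:
 fixes f :: "'a::euclidean_space => ennreal"
 assumes [measurable]: "f \<in> borel_measurable borel" and "c > 0"
 shows "(\<integral>\<^sup>+x. f x \<partial>lborel) = ennreal (c ^ DIM('a)) * (\<integral>\<^sup>+x. f (c *\<^sub>R x) \<partial>lborel)"
 using assms(2)
 by (subst lborel_affine[of c 0])
  (auto simp: nn_integral_density nn_integral_distr nn_integral_cmult)

lemma nn_integral_lborel_translate:
 fixes f :: "'a::euclidean_space => ennreal"
 assumes [measurable]: "f \<in> borel_measurable borel"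
 shows "(\<integral>\<^sup>+x. f (x + c) \<partial>lborel) = (\<integral>\<^sup>+x. f x \<partial>lborel)"
 by (subst lborel_distr_plus[of c, symmetric]) (simp add: nn_integral_distr add.commute)

text \<open>Polar coordinates. The cone formula turns the left-hand side into an integral over the unit
 ball; rescaling twice and exchanging the order leaves the elementary integral of \<open>n t\<^sup>-\<^sup>n\<^sup>-\<^sup>1\<close>
 over \<open>t > |y|\<close>.\<close>

lemma nn_integral_polar:
 fixes F :: "'a::euclidean_space => ennreal"
 assumes [measurable]: "F \<in> borel_measurable borel"
 shows "(\<integral>\<^sup>+th. (\<integral>\<^sup>+s. F (s *\<^sub>R th) * ennreal (s ^ (DIM('a) - 1)) * indicator {0<..} s \<partial>lborel) \<partial>sphere_measure)
   = (\<integral>\<^sup>+y. F y \<partial>lborel)"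
proof -
 define n where "n = DIM('a)"
 have n: "n > 0" by (simp add: n_def)
 have [measurable]: "ball (0::'a) 1 \<in> sets borel" by simp
 let ?J = "%th. \<integral>\<^sup>+s. F (s *\<^sub>R th) * ennreal (s ^ (n - 1)) * indicator {0<..} s \<partial>lborel"
 \<comment> \<open>Substitution \<open>s = norm x * t\<close>, after which the direction
   \<open>sgn x\<close> is replaced by \<open>x\<close> itself.\<close>
 have scale1: "?J (sgn x) = (\<integral>\<^sup>+t. F (t *\<^sub>R x) * ennreal (t ^ (n - 1) * norm x ^ n) * indicator {0<..} t \<partial>lborel)"
  if "x \<noteq> 0" for x
 proof -
  have nx: "norm x > 0" using that by simp
  have "?J (sgn x) = ennreal \<bar>norm x\<bar> * (\<integral>\<^sup>+t. F ((0 + norm x * t) *\<^sub>R sgn x) * ennreal ((0 + norm x * t) ^ (n - 1)) * indicator {0<..} (0 + norm x * t) \<partial>lborel)"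
   by (rule nn_integral_real_affine) (use that in auto)
  also have "\<dots> = (\<integral>\<^sup>+t. ennreal (norm x) * (F (t *\<^sub>R x) * ennreal ((norm x * t) ^ (n - 1)) * indicator {0<..} t) \<partial>lborel)"
   using that by (subst nn_integral_cmult[symmetric])
    (auto intro!: nn_integral_cong simp: sgn_div_norm indicator_def zero_less_mult_iff mult_ac)
  also have "\<dots> = (\<integral>\<^sup>+t. F (t *\<^sub>R x) * ennreal (t ^ (n - 1) * norm x ^ n) * indicator {0<..} t \<partial>lborel)"
  proof (intro nn_integral_cong)
   fix t :: real
   have "norm x ^ n = norm x * norm x ^ (n - 1)" using n by (cases n) auto
   then have "t > 0 ==> ennreal (t ^ (n - 1) * norm x ^ n) = ennreal (norm x) * ennreal ((norm x * t) ^ (n - 1))"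
    by (simp add: ennreal_mult[symmetric] power_mult_distrib mult_ac)
   then show "ennreal (norm x) * (F (t *\<^sub>R x) * ennreal ((norm x * t) ^ (n - 1)) * indicator {0<..} t)
     = F (t *\<^sub>R x) * ennreal (t ^ (n - 1) * norm x ^ n) * indicator {0<..} t"
    by (auto simp: indicator_def mult_ac)
  qed
  finally show ?thesis .
 qed
 \<comment> \<open>Substitution \<open>y = t *\<^sub>R x\<close>: the unit ball becomes the ball of
   radius \<open>t\<close>.\<close>
 have scale2: "(\<integral>\<^sup>+x. F (t *\<^sub>R x) * ennreal (t ^ (n - 1) * norm x ^ n) * indicator (ball 0 1) x \<partial>lborel)
   = (\<integral>\<^sup>+y. F y * ennreal (norm y ^ n / t ^ Suc n) * indicator {0<..} (t - norm y) \<partial>lborel)" if t: "t > 0" for t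
 proof -
  have "(\<integral>\<^sup>+y. F y * ennreal (norm y ^ n / t ^ Suc n) * indicator {0<..} (t - norm y) \<partial>lborel)
   = ennreal (t ^ n) * (\<integral>\<^sup>+x. F (t *\<^sub>R x) * ennreal (norm (t *\<^sub>R x) ^ n / t ^ Suc n) * indicator {0<..} (t - norm (t *\<^sub>R x)) \<partial>lborel)"
   unfolding n_def by (rule nn_integral_lborel_scaleR) (use t in measurable)
  also have "\<dots> = (\<integral>\<^sup>+x. ennreal (t ^ n) * (F (t *\<^sub>R x) * ennreal (norm (t *\<^sub>R x) ^ n / t ^ Suc n) * indicator {0<..} (t - norm (t *\<^sub>R x))) \<partial>lborel)"
   by (rule nn_integral_cmult[symmetric]) measurable
  also have "\<dots> = (\<integral>\<^sup>+x. F (t *\<^sub>R x) * ennreal (t ^ (n - 1) * norm x ^ n) * indicator (ball 0 1) x \<partial>lborel)"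
  proof (intro nn_integral_cong)
   fix x :: 'a
   have "t ^ n = t * t ^ (n - 1)" using n by (cases n) auto
   then have "t ^ (n - 1) * norm x ^ n = t ^ n * (norm (t *\<^sub>R x) ^ n / t ^ Suc n)"
    using t by (simp add: power_mult_distrib field_simps)
   then have 1: "ennreal (t ^ (n - 1) * norm x ^ n) = ennreal (t ^ n) * ennreal (norm (t *\<^sub>R x) ^ n / t ^ Suc n)"
    using t by (simp add: ennreal_mult[symmetric])
   have 2: "indicator {0<..} (t - norm (t *\<^sub>R x)) = (indicator (ball 0 1) x :: ennreal)"
    using t by (auto simp: indicator_def)
   show "ennreal (t ^ n) * (F (t *\<^sub>R x) * ennreal (norm (t *\<^sub>R x) ^ n / t ^ Suc n) * indicator {0<..} (t - norm (t *\<^sub>R x)))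
     = F (t *\<^sub>R x) * ennreal (t ^ (n - 1) * norm x ^ n) * indicator (ball 0 1) x"
    unfolding 1 2 by (simp add: mult_ac)
  qed
  finally show ?thesis by simp
 qed
 \<comment> \<open>The value does not depend on \<open>y\<close> and cancels the factor
   \<open>DIM('a)\<close> of the cone formula.\<close>
 have tail: "(\<integral>\<^sup>+t. ennreal (norm y ^ n / t ^ Suc n) * indicator {0<..} (t - norm y) \<partial>lborel) = ennreal (1 / real n)"
  if "y \<noteq> 0" for y :: 'a
 proof -
  have y: "norm y > 0" using that by simp
  have "(\<integral>\<^sup>+t. ennreal (norm y ^ n / t ^ Suc n) * indicator {0<..} (t - norm y) \<partial>lborel)
    = (\<integral>\<^sup>+t. ennreal (norm y ^ n / t ^ Suc n) * indicator {norm y..} t \<partial>lborel)"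
   by (intro nn_integral_cong_AE eventually_mono[OF AE_lborel_singleton[of "norm y"]])
    (auto simp: indicator_def)
  also have "\<dots> = ennreal (0 - (- (norm y ^ n / (real n * norm y ^ n))))"
  proof (rule nn_integral_FTC_atLeast[where F = "%t. - (norm y ^ n / (real n * t ^ n))"])
   show "((%t. - (norm y ^ n / (real n * t ^ n))) has_real_derivative norm y ^ n / t ^ Suc n) (at t)"
    if "norm y <= t" for t
   proof -
    have "t > 0" using y that by linarith
    moreover have "t ^ n = t * t ^ (n - 1)" using n by (cases n) auto
    ultimately show ?thesis using n
     by (auto intro!: derivative_eq_intros simp: field_simps power2_eq_square)
   qed
   show "((%t. - (norm y ^ n / (real n * t ^ n))) \<longlongrightarrow> 0) at_top"
   proof -
    have "((%t. - (norm y ^ n / real n * inverse (t ^ n))) \<longlongrightarrow> - (norm y ^ n / real n * 0)) at_top"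
     by (intro tendsto_intros tendsto_inverse_0_at_top filterlim_pow_at_top n filterlim_ident)
    then show ?thesis by (simp add: field_simps)
   qed
   show "0 <= norm y ^ n / t ^ Suc n" if "norm y <= t" for t
    using that y order_trans[OF norm_ge_zero that] by (intro divide_nonneg_nonneg zero_le_power) auto
  qed auto
  also have "0 - (- (norm y ^ n / (real n * norm y ^ n))) = 1 / real n"
   using y n by simp
  finally show ?thesis .
 qed
 have "(\<integral>\<^sup>+th. ?J th \<partial>sphere_measure)
   = of_nat n * (\<integral>\<^sup>+x. ?J (sgn x) * indicator (ball 0 1 - {0}) x \<partial>lborel)"
  unfolding n_def by (rule nn_integral_sphere_measure) measurable
 also have "(\<integral>\<^sup>+x. ?J (sgn x) * indicator (ball 0 1 - {0}) x \<partial>lborel)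
   = (\<integral>\<^sup>+x. (\<integral>\<^sup>+t. F (t *\<^sub>R x) * ennreal (t ^ (n - 1) * norm x ^ n) * indicator {0<..} t * indicator (ball 0 1) x \<partial>lborel) \<partial>lborel)"
 proof (rule nn_integral_cong_AE, rule eventually_mono[OF AE_lborel_singleton[of 0]])
  fix x :: 'a assume "x \<noteq> 0"
  then show "?J (sgn x) * indicator (ball 0 1 - {0}) x
   = (\<integral>\<^sup>+t. F (t *\<^sub>R x) * ennreal (t ^ (n - 1) * norm x ^ n) * indicator {0<..} t * indicator (ball 0 1) x \<partial>lborel)"
   using scale1[of x] by (cases "x \<in> ball 0 1") auto
 qed
 also have "\<dots> = (\<integral>\<^sup>+t. (\<integral>\<^sup>+x. F (t *\<^sub>R x) * ennreal (t ^ (n - 1) * norm x ^ n) * indicator {0<..} t * indicator (ball 0 1) x \<partial>lborel) \<partial>lborel)"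
  by (rule lborel_pair.Fubini') measurable
 also have "\<dots> = (\<integral>\<^sup>+t. (\<integral>\<^sup>+y. F y * (ennreal (norm y ^ n / t ^ Suc n) * indicator {0<..} (t - norm y)) \<partial>lborel) \<partial>lborel)"
 proof (rule nn_integral_cong)
  fix t :: real
  show "(\<integral>\<^sup>+x. F (t *\<^sub>R x) * ennreal (t ^ (n - 1) * norm x ^ n) * indicator {0<..} t * indicator (ball 0 1) x \<partial>lborel)
    = (\<integral>\<^sup>+y. F y * (ennreal (norm y ^ n / t ^ Suc n) * indicator {0<..} (t - norm y)) \<partial>lborel)"
  proof (cases "t > 0")
   case True
   then show ?thesis using scale2[of t] by (simp add: mult_ac)
  next
   case False
   have "norm y < t \<longleftrightarrow> False" for y :: 'a
    using False order_le_less_trans[OF norm_ge_zero] by blast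
   then show ?thesis using False by simp
  qed
 qed
 also have "\<dots> = (\<integral>\<^sup>+y. (\<integral>\<^sup>+t. F y * (ennreal (norm y ^ n / t ^ Suc n) * indicator {0<..} (t - norm y)) \<partial>lborel) \<partial>lborel)"
  by (rule lborel_pair.Fubini'[symmetric]) measurable
 also have "\<dots> = (\<integral>\<^sup>+y. F y * ennreal (1 / real n) \<partial>lborel)"
 proof (rule nn_integral_cong_AE, rule eventually_mono[OF AE_lborel_singleton[of 0]])
  fix y :: 'a assume "y \<noteq> 0"
  then show "(\<integral>\<^sup>+t. F y * (ennreal (norm y ^ n / t ^ Suc n) * indicator {0<..} (t - norm y)) \<partial>lborel) = F y * ennreal (1 / real n)"
   by (subst nn_integral_cmult) (simp_all add: tail del: power_Suc)
 qed
 also have "\<dots> = (\<integral>\<^sup>+y. F y \<partial>lborel) * ennreal (1 / real n)"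
  by (rule nn_integral_multc) simp
 also have "of_nat n * \<dots> = (\<integral>\<^sup>+y. F y \<partial>lborel) * (ennreal (real n) * ennreal (1 / real n))"
  by (simp add: ennreal_of_nat_eq_real_of_nat mult_ac)
 also have "ennreal (real n) * ennreal (1 / real n) = 1"
  using n by (simp add: ennreal_mult[symmetric])
 finally show ?thesis by (simp add: n_def)
qed

section \<open>Transport along characteristics\<close>

text \<open>A step of length \<open>s\<close> backwards along the characteristic through
  \<open>z = (x, \<theta>)\<close>; negative \<open>s\<close> moves forwards.\<close>

definition shift :: "'a::euclidean_space \<times> 'a => real => 'a \<times> 'a" where
 "shift z s = (fst z - s *\<^sub>R snd z, snd z)"

text \<open>The whole segment must lie in \<open>X\<close>, not only its end point: \<open>X\<close>
  need not be convex, and beyond its first exit from \<open>X\<close> the characteristic must not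
  collect any further source.\<close>

definition chord :: "'a::euclidean_space set => (('a \<times> 'a) \<times> real) set" where
 "chord X = {(z, s). 0 <= s & (\<forall>r\<in>{0..s}. fst z - r *\<^sub>R snd z \<in> X)}"

text \<open>Extension by zero gives Borel functions on the whole space. These can be composed with
  \<open>shift\<close>, which does not preserve the phase space, and integrated by translation
  invariance.\<close>

definition zext :: "'a::euclidean_space set => ('a \<times> 'a => real) => 'a \<times> 'a => real" where
 "zext X f z = (if z \<in> X \<times> sphere 0 1 then f z else 0)"

text \<open>Integration backwards from \<open>z\<close> up to the first exit from \<open>X\<close>.
  With the attenuation factor as \<open>a\<close> this is the solution operator without scattering;
  a further cut-off in \<open>s\<close> gives its near and remote parts.\<close>

definition transport ::
  "'a::euclidean_space set => (('a \<times> 'a) \<times> real => real) => ('a \<times> 'a => real) => 'a \<times> 'a => real" where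
 "transport X a q z = (\<integral>s. indicator (chord X) (z, s) * a (z, s) * q (shift z s) \<partial>lborel)"

lemma shift_simps [simp]:
 "fst (shift z s) = fst z - s *\<^sub>R snd z" "snd (shift z s) = snd z" "shift z 0 = z"
 by (simp_all add: shift_def)

lemma shift_shift: "shift (shift z s) t = shift z (s + t)"
 by (simp add: shift_def algebra_simps)

lemma shift_minus [simp]: "shift (shift z s) (- s) = z" "shift (shift z (- s)) s = z"
 by (simp_all add: shift_shift)

lemma continuous_on_shift [continuous_intros]:
 assumes "continuous_on S f" "continuous_on S g"
 shows "continuous_on S (%x. shift (f x) (g x))"
 unfolding shift_def by (intro continuous_intros assms)

lemma measurable_ident_borel_pair [measurable (raw)]:
 "(%x. x) \<in> (borel :: ('a::second_countable_topology \<times> 'b::second_countable_topology) measure) \<rightarrow>\<^sub>M borel \<Otimes>\<^sub>M borel"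
 by (simp add: borel_prod)

lemma measurable_ident_borel_triple [measurable (raw)]:
 "(%x. x) \<in> (borel :: (('a::second_countable_topology \<times> 'b::second_countable_topology) \<times> 'c::second_countable_topology) measure)
  \<rightarrow>\<^sub>M (borel \<Otimes>\<^sub>M borel) \<Otimes>\<^sub>M borel"
 by (simp add: borel_prod)

lemma measurable_shift [measurable]:
 "(%w. shift (fst w) (snd w)) \<in> borel_measurable (borel :: (('a::euclidean_space \<times> 'a) \<times> real) measure)"
 by (intro borel_measurable_continuous_onI continuous_intros)

lemma shift_in_X: "(z, s) \<in> chord X ==> fst (shift z s) \<in> X"
 by (auto simp: chord_def)

lemma chord_in_X: "(z, s) \<in> chord X ==> fst z \<in> X"
 by (auto simp: chord_def dest!: bspec[of _ _ 0])

lemma chord_shift_minus: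
 "(shift z (- s), s) \<in> chord X \<longleftrightarrow> 0 <= s & (\<forall>r\<in>{0..s}. fst z + r *\<^sub>R snd z \<in> X)"
proof -
 have "(\<forall>r\<in>{0..s}. fst z + s *\<^sub>R snd z - r *\<^sub>R snd z \<in> X) \<longleftrightarrow> (\<forall>r\<in>{0..s}. fst z + r *\<^sub>R snd z \<in> X)"
 proof -
  have "fst z + s *\<^sub>R snd z - r *\<^sub>R snd z = fst z + (s - r) *\<^sub>R snd z" for r by (simp add: algebra_simps)
  moreover have "(\<forall>r\<in>{0..s}. P (s - r)) \<longleftrightarrow> (\<forall>r\<in>{0..s}. P r)" for P
   by (metis atLeastAtMost_iff diff_diff_eq2 diff_ge_0_iff_ge diff_add_cancel add_diff_cancel_left' le_diff_eq add_le_same_cancel1 diff_left_mono diff_zero cancel_comm_monoid_add_class.diff_cancel)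
  ultimately show ?thesis by (simp only:)
 qed
 then show ?thesis by (simp add: chord_def)
qed

lemma chord_mono: "(z, s) \<in> chord X ==> 0 <= t ==> t <= s ==> (z, t) \<in> chord X"
 by (auto simp: chord_def)

text \<open>Tube lemma over the compact parameter interval. The segment is rescaled to parameters in
  [0,1] so that the interval does not vary with the length; \<open>chord X\<close> is then an open
  set intersected with a closed one, hence Borel.\<close>

lemma open_segment_condition:
 fixes X :: "'a::euclidean_space set"
 assumes "open X"
 shows "open {w :: ('a \<times> 'a) \<times> real. \<forall>r\<in>{0..1}. fst (fst w) - (r * snd w) *\<^sub>R snd (fst w) \<in> X}" (is "open ?O")
proof (subst open_subopen, intro ballI)
 fix w0 assume w0: "w0 \<in> ?O"
 define W where "W = (%(w, r). fst (fst w) - (r * snd w) *\<^sub>R snd (fst w)) -` X \<inter> (UNIV :: ((('a \<times> 'a) \<times> real) \<times> real) set)"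
 have "open W" unfolding W_def split_beta'
  by (simp, intro open_vimage assms continuous_intros)
 moreover have "{w0} \<times> {0..1} \<subseteq> W" using w0 by (auto simp: W_def)
 ultimately obtain V where "w0 \<in> V" "open V" "V \<times> {0..1} \<subseteq> W"
  using Elementary_Topology.tube_lemma[of "{0..1::real}" W w0] by auto
 then show "\<exists>T. open T & w0 \<in> T & T \<subseteq> ?O"
  by (intro exI[of _ V]) (auto simp: W_def)
qed

lemma chord_alt:
 "chord X = {w. \<forall>r\<in>{0..1}. fst (fst w) - (r * snd w) *\<^sub>R snd (fst w) \<in> X} \<inter> {w. 0 <= snd w}"
proof -
 have *: "(\<forall>r\<in>{0..s}. P r) \<longleftrightarrow> (\<forall>r\<in>{0..1}. P (r * s))" if s: "0 <= s" for P :: "real => bool" and s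
 proof (intro iffI ballI)
  fix r assume *: "\<forall>r\<in>{0..1}. P (r * s)" and r: "r \<in> {0..s}"
  show "P r"
  proof (cases "s = 0")
   case True then show ?thesis using * r by auto
  next
   case False
   then show ?thesis using *[rule_format, of "r / s"] r s by auto
  qed
 next
  fix r assume "\<forall>r\<in>{0..s}. P r" "r \<in> {0..1::real}"
  then show "P (r * s)" using s by (auto intro!: mult_left_le_one_le)
 qed
 show ?thesis
 proof (rule set_eqI)
  fix w :: "('a \<times> 'a) \<times> real"
  show "w \<in> chord X \<longleftrightarrow> w \<in> {w. \<forall>r\<in>{0..1}. fst (fst w) - (r * snd w) *\<^sub>R snd (fst w) \<in> X} \<inter> {w. 0 <= snd w}"
  proof (cases "0 <= snd w")
   case True
   from *[OF this, of "%r. fst (fst w) - r *\<^sub>R snd (fst w) \<in> X"] True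
   show ?thesis by (simp only: chord_def mem_Collect_eq split_beta' Int_iff simp_thms)
  qed (simp add: chord_def split_beta')
 qed
qed

lemma chord_measurable [measurable]:
 assumes "open X"
 shows "chord X \<in> sets borel"
 unfolding chord_alt
 by (intro sets.Int borel_open open_segment_condition assms borel_closed closed_Collect_le continuous_intros)

lemma ennreal_abs_integral_le:
 fixes f :: "'b => real"
 shows "ennreal \<bar>\<integral>x. f x \<partial>M\<bar> <= (\<integral>\<^sup>+x. ennreal \<bar>f x\<bar> \<partial>M)"
proof (cases "integrable M f")
 case True
 then show ?thesis using integral_norm_bound_ennreal[of M f] by simp
qed (simp add: not_integrable_integral_eq)

locale bounded_domain =
 fixes X :: "'a::euclidean_space set"
 assumes open_X: "open X" and bounded_X: "bounded X"
begin

lemma X_borel [measurable]: "X \<in> sets borel"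
 using open_X by simp

lemmas chord_borel [measurable] = chord_measurable[OF open_X]

lemma space_space_measure [simp]: "space (space_measure X) = X"
 by (simp add: space_restrict_space)

lemma space_phase_measure [simp]: "space (phase_measure X) = X \<times> sphere 0 1"
 by (simp add: space_pair_measure)

lemma nn_integral_space_measure:
 "(\<integral>\<^sup>+x. f x \<partial>space_measure X) = (\<integral>\<^sup>+x. f x * indicator X x \<partial>lborel)"
 by (rule nn_integral_restrict_space) simp

sublocale space: finite_measure "space_measure X"
proof
 have "emeasure (space_measure X) (space (space_measure X)) = emeasure lborel X"
  by (simp add: emeasure_restrict_space)
 then show "emeasure (space_measure X) (space (space_measure X)) \<noteq> \<infinity>"
  using emeasure_bounded_finite[OF bounded_X] by simp
qed

sublocale phase: finite_measure "phase_measure X"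
 by (rule finite_measure_pair_measure) (rule sphere_measure.finite_measure_axioms space.finite_measure_axioms)+

sublocale phase_pair: pair_sigma_finite "space_measure X" "sphere_measure :: 'a measure" ..
sublocale phase_line: pair_sigma_finite "phase_measure X" "lborel :: real measure" ..
sublocale phase_sphere: pair_sigma_finite "phase_measure X" "sphere_measure :: 'a measure" ..
sublocale sphere_sphere: pair_sigma_finite "sphere_measure :: 'a measure" "sphere_measure :: 'a measure" ..
sublocale space_phase: pair_sigma_finite "space_measure X" "phase_measure X" ..
sublocale sphere_line: pair_sigma_finite "sphere_measure :: 'a measure" "lborel :: real measure" ..

lemma measurable_space_ident [measurable (raw)]: "(%x. x) \<in> borel_measurable (space_measure X)"
 by (intro measurable_restrict_space1) simp

lemma measurable_phase_fst [measurable (raw)]: "fst \<in> borel_measurable (phase_measure X)"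
 using measurable_compose[OF measurable_fst measurable_space_ident] by simp

lemma measurable_phase_snd [measurable (raw)]: "snd \<in> borel_measurable (phase_measure X)"
 using measurable_compose[OF measurable_snd measurable_sphere_measure_ident] by simp

lemma measurable_phase_ident [measurable (raw)]: "(%z. z) \<in> borel_measurable (phase_measure X)"
 using borel_measurable_Pair[OF measurable_phase_fst measurable_phase_snd] by simp

lemma measurable_phase_line_ident [measurable (raw)]:
 "(%w. w) \<in> borel_measurable (phase_measure X \<Otimes>\<^sub>M (lborel :: real measure))"
proof -
 have "(%w. (fst w, snd w)) \<in> borel_measurable (phase_measure X \<Otimes>\<^sub>M (lborel :: real measure))"
  by (intro borel_measurable_Pair measurable_compose[OF measurable_fst measurable_phase_ident]) auto
 then show ?thesis by simp
qed

lemma borel_measurable_phase_line: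
 "f \<in> borel_measurable borel ==> f \<in> borel_measurable (phase_measure X \<Otimes>\<^sub>M (lborel :: real measure))"
 using measurable_compose[OF measurable_phase_line_ident] by blast

lemma borel_measurable_phase: "f \<in> borel_measurable borel ==> f \<in> borel_measurable (phase_measure X)"
 using measurable_compose[OF measurable_phase_ident] by blast

lemma borel_measurable_zext [measurable]:
 assumes f: "f \<in> borel_measurable (phase_measure X)"
 shows "zext X f \<in> borel_measurable borel"
proof -
 have XS: "X \<times> sphere 0 1 \<in> sets (borel :: ('a \<times> 'a) measure)"
  unfolding borel_prod[symmetric] by (intro pair_measureI) auto
 have "(%z. (fst z, snd z)) \<in> restrict_space borel (X \<times> sphere 0 1) \<rightarrow>\<^sub>M phase_measure X"
 proof (rule measurable_Pair)
  have "fst \<in> (borel :: ('a \<times> 'a) measure) \<rightarrow>\<^sub>M (lborel :: 'a measure)"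
   "snd \<in> (borel :: ('a \<times> 'a) measure) \<rightarrow>\<^sub>M (borel :: 'a measure)"
   unfolding borel_prod[symmetric] by simp_all
  from this[THEN measurable_restrict_space1]
  have "fst \<in> restrict_space borel (X \<times> sphere (0::'a) 1) \<rightarrow>\<^sub>M (lborel :: 'a measure)"
   "snd \<in> restrict_space borel (X \<times> sphere (0::'a) 1) \<rightarrow>\<^sub>M (borel :: 'a measure)" .
  then show "fst \<in> restrict_space borel (X \<times> sphere (0::'a) 1) \<rightarrow>\<^sub>M space_measure X"
   "snd \<in> restrict_space borel (X \<times> sphere 0 1) \<rightarrow>\<^sub>M (sphere_measure :: 'a measure)"
   by (auto intro!: measurable_restrict_space2 simp: space_restrict_space
     cong: measurable_cong_sets simp: sets_sphere_measure)
 qed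
 then have "f \<in> borel_measurable (restrict_space borel (X \<times> sphere 0 1))"
  using measurable_compose[OF _ f] by simp
 then show ?thesis
  unfolding zext_def[abs_def] using XS by (subst (asm) measurable_restrict_space_iff[where c = 0]) auto
qed

lemma zext_eq: "z \<in> space (phase_measure X) ==> zext X f z = f z"
 by (auto simp: zext_def)

lemma shift_in_phase:
 assumes "(z, s) \<in> chord X" "z \<in> space (phase_measure X)"
 shows "shift z s \<in> space (phase_measure X)"
 using assms shift_in_X[OF assms(1)] by (auto simp: shift_def)

lemma zext_shift:
 "z \<in> space (phase_measure X) ==>
  indicator (chord X) (z, s) * zext X f (shift z s) = indicator (chord X) (z, s) * f (shift z s)"
 using shift_in_phase[of z s] by (auto simp: zext_eq indicator_def)

text \<open>The support condition allows the space variable to range over the whole space, where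
  translations act; the direction and the length are moved to the outer integrals so that they are
  fixed during a translation.\<close>

lemma nn_integral_phase_line:
 fixes H :: "('a \<times> 'a) \<times> real => ennreal"
 assumes H [measurable]: "H \<in> borel_measurable borel"
  and supp: "!!z s. H (z, s) \<noteq> 0 ==> fst z \<in> X"
 shows "(\<integral>\<^sup>+z. (\<integral>\<^sup>+s. H (z, s) \<partial>lborel) \<partial>phase_measure X)
  = (\<integral>\<^sup>+th. (\<integral>\<^sup>+s. (\<integral>\<^sup>+x. H ((x, th), s) \<partial>lborel) \<partial>lborel) \<partial>sphere_measure)"
proof -
 note [measurable] = borel_measurable_phase_line[OF H]
 have "(\<integral>\<^sup>+z. (\<integral>\<^sup>+s. H (z, s) \<partial>lborel) \<partial>phase_measure X)
   = (\<integral>\<^sup>+th. (\<integral>\<^sup>+x. (\<integral>\<^sup>+s. H ((x, th), s) \<partial>lborel) \<partial>space_measure X) \<partial>sphere_measure)"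
  by (rule phase_pair.nn_integral_snd[symmetric]) measurable
 also have "\<dots> = (\<integral>\<^sup>+th. (\<integral>\<^sup>+x. (\<integral>\<^sup>+s. H ((x, th), s) \<partial>lborel) \<partial>lborel) \<partial>sphere_measure)"
 proof (rule nn_integral_cong)
  fix th :: 'a
  have "(\<integral>\<^sup>+x. (\<integral>\<^sup>+s. H ((x, th), s) \<partial>lborel) \<partial>space_measure X)
   = (\<integral>\<^sup>+x. (\<integral>\<^sup>+s. H ((x, th), s) \<partial>lborel) * indicator X x \<partial>lborel)"
   by (rule nn_integral_space_measure)
  also have "\<dots> = (\<integral>\<^sup>+x. (\<integral>\<^sup>+s. H ((x, th), s) \<partial>lborel) \<partial>lborel)"
  proof (rule nn_integral_cong)
   fix x
   have "H ((x, th), s) = 0" if "x \<notin> X" for s using supp[of "(x, th)" s] that by auto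
   then show "(\<integral>\<^sup>+s. H ((x, th), s) \<partial>lborel) * indicator X x = (\<integral>\<^sup>+s. H ((x, th), s) \<partial>lborel)"
    by (cases "x \<in> X") auto
  qed
  finally show "(\<integral>\<^sup>+x. (\<integral>\<^sup>+s. H ((x, th), s) \<partial>lborel) \<partial>space_measure X)
   = (\<integral>\<^sup>+x. (\<integral>\<^sup>+s. H ((x, th), s) \<partial>lborel) \<partial>lborel)" .
 qed
 also have "\<dots> = (\<integral>\<^sup>+th. (\<integral>\<^sup>+s. (\<integral>\<^sup>+x. H ((x, th), s) \<partial>lborel) \<partial>lborel) \<partial>sphere_measure)"
  by (intro nn_integral_cong lborel_pair.Fubini') measurable
 finally show ?thesis .
qed

text \<open>For a fixed direction and length the two ends of a chord differ by a translation, which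
  preserves Lebesgue measure. An integral over chords may therefore be read from the other end. The
  Schur test, the adjoint of \<open>L\<close> and the treatment of null sets all rest on
  this.\<close>

lemma nn_integral_chord_shift:
 fixes G :: "('a \<times> 'a) \<times> real => ennreal"
 assumes [measurable]: "G \<in> borel_measurable borel"
 shows "(\<integral>\<^sup>+z. (\<integral>\<^sup>+s. indicator (chord X) (z, s) * G (z, s) \<partial>lborel) \<partial>phase_measure X)
  = (\<integral>\<^sup>+z. (\<integral>\<^sup>+s. indicator (chord X) (shift z (- s), s) * G (shift z (- s), s) \<partial>lborel) \<partial>phase_measure X)"
proof -
 define H where "H w = indicator (chord X) w * G w" for w
 have [measurable]: "H \<in> borel_measurable borel" unfolding H_def by measurable
 have H': "(%w. H (shift (fst w) (- snd w), snd w)) \<in> borel_measurable borel"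
  unfolding shift_def by measurable
 have "(\<integral>\<^sup>+z. (\<integral>\<^sup>+s. H (z, s) \<partial>lborel) \<partial>phase_measure X)
  = (\<integral>\<^sup>+th. (\<integral>\<^sup>+s. (\<integral>\<^sup>+x. H ((x, th), s) \<partial>lborel) \<partial>lborel) \<partial>sphere_measure)"
  by (rule nn_integral_phase_line) (auto simp: H_def indicator_def dest: chord_in_X split: if_splits)
 also have "\<dots> = (\<integral>\<^sup>+th. (\<integral>\<^sup>+s. (\<integral>\<^sup>+x. H (shift (x, th) (- s), s) \<partial>lborel) \<partial>lborel) \<partial>sphere_measure)"
 proof (rule nn_integral_cong, rule nn_integral_cong)
  fix th :: 'a and s :: real
  have "(\<integral>\<^sup>+x. H ((x + s *\<^sub>R th, th), s) \<partial>lborel) = (\<integral>\<^sup>+x. H ((x, th), s) \<partial>lborel)"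
   by (rule nn_integral_lborel_translate) measurable
  then show "(\<integral>\<^sup>+x. H ((x, th), s) \<partial>lborel) = (\<integral>\<^sup>+x. H (shift (x, th) (- s), s) \<partial>lborel)"
   by (simp add: shift_def)
 qed
 also have "\<dots> = (\<integral>\<^sup>+z. (\<integral>\<^sup>+s. H (shift z (- s), s) \<partial>lborel) \<partial>phase_measure X)"
 proof (subst nn_integral_phase_line[OF H', simplified fst_conv snd_conv])
  show "fst z \<in> X" if "H (shift z (- s), s) \<noteq> 0" for z s
  proof -
   have "(shift z (- s), s) \<in> chord X" using that by (auto simp: H_def indicator_def split: if_splits)
   then show ?thesis unfolding chord_shift_minus by (auto dest!: bspec[of _ _ 0])
  qed
 qed simp
 finally show ?thesis by (simp add: H_def)
qed

text \<open>Almost every characteristic meets a null set of the phase space in a linear null set.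
  Since elements of \<open>L2\<close> are functions, this is what makes integrals along
  characteristics insensitive to the representative.\<close>

lemma AE_phase_shift:
 assumes P: "AE z in phase_measure X. P z"
 shows "AE z in phase_measure X. AE s in lborel. (z, s) \<in> chord X \<longrightarrow> P (shift z s)"
proof -
 obtain N where N: "{z \<in> space (phase_measure X). \<not> P z} \<subseteq> N" "emeasure (phase_measure X) N = 0" "N \<in> sets (phase_measure X)"
  by (rule AE_E[OF P])
 have "(indicator N :: _ => real) \<in> borel_measurable (phase_measure X)" using N(3) by simp
 note [measurable] = borel_measurable_zext[OF this]
 define G where "G w = ennreal (zext X (indicator N) (shift (fst w) (snd w)))" for w
 have G[measurable]: "G \<in> borel_measurable borel" unfolding G_def by measurable
 have cG: "(%w. indicator (chord X) w * G w) \<in> borel_measurable borel" by measurable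
 note [measurable] = borel_measurable_phase_line[OF cG]
 have "(\<integral>\<^sup>+z. (\<integral>\<^sup>+s. indicator (chord X) (z, s) * G (z, s) \<partial>lborel) \<partial>phase_measure X)
   = (\<integral>\<^sup>+z. (\<integral>\<^sup>+s. indicator (chord X) (shift z (- s), s) * G (shift z (- s), s) \<partial>lborel) \<partial>phase_measure X)"
  by (rule nn_integral_chord_shift) measurable
 also have "\<dots> = (\<integral>\<^sup>+z. 0 \<partial>phase_measure X)"
 proof (rule nn_integral_cong_AE)
  have "AE z in phase_measure X. z \<notin> N" using N by (simp add: AE_not_in null_sets_def)
  then show "AE z in phase_measure X. (\<integral>\<^sup>+s. indicator (chord X) (shift z (- s), s) * G (shift z (- s), s) \<partial>lborel) = 0"
   by eventually_elim (simp add: G_def zext_def)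
 qed
 finally have "(\<integral>\<^sup>+z. (\<integral>\<^sup>+s. indicator (chord X) (z, s) * G (z, s) \<partial>lborel) \<partial>phase_measure X) = 0"
  by simp
 then have "AE z in phase_measure X. (\<integral>\<^sup>+s. indicator (chord X) (z, s) * G (z, s) \<partial>lborel) = 0"
  by (subst (asm) nn_integral_0_iff_AE) measurable
 then show ?thesis
 proof (rule AE_mp[OF _ AE_I2[OF impI]])
  fix z assume z: "z \<in> space (phase_measure X)" and "(\<integral>\<^sup>+s. indicator (chord X) (z, s) * G (z, s) \<partial>lborel) = 0"
  then have "AE s in lborel. indicator (chord X) (z, s) * G (z, s) = 0"
   by (subst (asm) nn_integral_0_iff_AE) (use measurable_compose[OF _ cG, of "%s. (z, s)" lborel] in auto)
  then show "AE s in lborel. (z, s) \<in> chord X \<longrightarrow> P (shift z s)"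
  proof eventually_elim
   case (elim s)
   show ?case
   proof
    assume c: "(z, s) \<in> chord X"
    then have sp: "shift z s \<in> space (phase_measure X)" using z by (rule shift_in_phase)
    have "shift z s \<notin> N" using elim c sp by (auto simp: G_def zext_eq)
    then show "P (shift z s)" using N(1) sp by auto
   qed
  qed
 qed
qed

lemma transport_measurable [measurable]:
 assumes [measurable]: "a \<in> borel_measurable borel" "q \<in> borel_measurable (phase_measure X)"
 shows "transport X a q \<in> borel_measurable (phase_measure X)"
proof -
 define h where "h w = indicator (chord X) w * a w * zext X q (shift (fst w) (snd w))" for w
 have "h \<in> borel_measurable borel" unfolding h_def by measurable
 note [measurable] = borel_measurable_phase_line[OF this]
 have "(%z. \<integral>s. h (z, s) \<partial>lborel) \<in> borel_measurable (phase_measure X)" by measurable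
 moreover have *: "transport X a q z = (\<integral>s. h (z, s) \<partial>lborel)" if "z \<in> space (phase_measure X)" for z
  unfolding transport_def h_def
 proof (intro Bochner_Integration.integral_cong refl)
  fix s
  show "indicator (chord X) (z, s) * a (z, s) * q (shift z s)
    = indicator (chord X) (z, s) * a (z, s) * zext X q (shift (fst (z, s)) (snd (z, s)))"
   using zext_shift[OF that, of s q] by (cases "(z, s) \<in> chord X") auto
 qed
 ultimately show ?thesis by (subst measurable_cong[OF *])
qed

text \<open>Schur test. Split \<open>a * |q|\<close> as \<open>sqrt (a * p)\<close> times
  \<open>sqrt (a / p) * |q|\<close>; by Cauchy-Schwarz the first factor contributes
  \<open>C1\<close>. Reading the chords from the other end leaves the integral of
  \<open>a * c\<close>, bounded by \<open>C2\<close>. Unit weights give plain boundedness, the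
  weights \<open>\<sigma>\<close> give the contraction.\<close>

lemma transport_Schur:
 assumes [measurable]: "a \<in> borel_measurable borel" "p \<in> borel_measurable borel" "c \<in> borel_measurable borel"
  and q: "q \<in> borel_measurable (phase_measure X)"
  and nonneg: "!!w. a w \<ge> 0" "!!z. p z > 0" "!!z. c z \<ge> 0"
  and C1: "!!z. z \<in> space (phase_measure X) ==>
   (\<integral>\<^sup>+s. indicator (chord X) (z, s) * ennreal (a (z, s) * p (shift z s)) \<partial>lborel) <= C1"
  and C2: "!!z. z \<in> space (phase_measure X) ==>
   (\<integral>\<^sup>+s. indicator (chord X) (shift z (- s), s) * ennreal (a (shift z (- s), s) * c (shift z (- s))) \<partial>lborel) <= C2"
 shows "(\<integral>\<^sup>+z. ennreal (c z) * (\<integral>\<^sup>+s. indicator (chord X) (z, s) * ennreal (a (z, s) * \<bar>q (shift z s)\<bar>) \<partial>lborel)\<^sup>2 \<partial>phase_measure X)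
  <= C1 * C2 * (\<integral>\<^sup>+z. ennreal ((q z)\<^sup>2 / p z) \<partial>phase_measure X)"
proof -
 define q' where "q' = zext X q"
 have q'[measurable]: "q' \<in> borel_measurable borel" unfolding q'_def using q by (rule borel_measurable_zext)
 define G where "G w = ennreal (c (fst w) * a w * (q' (shift (fst w) (snd w)))\<^sup>2 / p (shift (fst w) (snd w)))" for w
 have G [measurable]: "G \<in> borel_measurable borel" unfolding G_def by measurable
 have *: "ennreal (c z) * (\<integral>\<^sup>+s. indicator (chord X) (z, s) * ennreal (a (z, s) * \<bar>q (shift z s)\<bar>) \<partial>lborel)\<^sup>2
   <= C1 * (\<integral>\<^sup>+s. indicator (chord X) (z, s) * G (z, s) \<partial>lborel)" if z: "z \<in> space (phase_measure X)" for z
 proof -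
  let ?f = "%s. ennreal (indicator (chord X) (z, s) * sqrt (a (z, s) * p (shift z s)))"
  let ?g = "%s. ennreal (indicator (chord X) (z, s) * (sqrt (a (z, s) / p (shift z s)) * \<bar>q' (shift z s)\<bar>))"
  have m: "(%s. shift z s) \<in> borel_measurable borel" unfolding shift_def by measurable
  note [measurable] = m
  have "(\<integral>\<^sup>+s. ?f s * ?g s \<partial>lborel)\<^sup>2 <= (\<integral>\<^sup>+s. (?f s)\<^sup>2 \<partial>lborel) * (\<integral>\<^sup>+s. (?g s)\<^sup>2 \<partial>lborel)"
   by (rule Cauchy_Schwarz_nn_integral) measurable
  moreover have "(\<integral>\<^sup>+s. ?f s * ?g s \<partial>lborel) = (\<integral>\<^sup>+s. indicator (chord X) (z, s) * ennreal (a (z, s) * \<bar>q (shift z s)\<bar>) \<partial>lborel)"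
  proof (rule nn_integral_cong)
   fix s
   have "sqrt (a (z, s) * p (shift z s)) * (sqrt (a (z, s) / p (shift z s)) * \<bar>q' (shift z s)\<bar>) = a (z, s) * \<bar>q' (shift z s)\<bar>"
    using nonneg(1)[of "(z, s)"] nonneg(2)[of "shift z s"] by (simp add: real_sqrt_mult real_sqrt_divide)
   then show "?f s * ?g s = indicator (chord X) (z, s) * ennreal (a (z, s) * \<bar>q (shift z s)\<bar>)"
    using shift_in_phase[OF _ z, of s] nonneg(1)[of "(z, s)"] less_imp_le[OF nonneg(2)[of "shift z s"]]
    by (auto simp: indicator_def ennreal_mult[symmetric] zext_eq q'_def)
  qed
  moreover have "(\<integral>\<^sup>+s. (?f s)\<^sup>2 \<partial>lborel) <= C1"
  proof -
   have "(\<integral>\<^sup>+s. (?f s)\<^sup>2 \<partial>lborel) = (\<integral>\<^sup>+s. indicator (chord X) (z, s) * ennreal (a (z, s) * p (shift z s)) \<partial>lborel)"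
    using nonneg(1) less_imp_le[OF nonneg(2)]
    by (intro nn_integral_cong) (auto simp: indicator_def ennreal_power)
   then show ?thesis using C1[OF z] by simp
  qed
  moreover have "(\<integral>\<^sup>+s. (?g s)\<^sup>2 \<partial>lborel) = (\<integral>\<^sup>+s. indicator (chord X) (z, s) * ennreal (a (z, s) * (q' (shift z s))\<^sup>2 / p (shift z s)) \<partial>lborel)"
   using nonneg(1) less_imp_le[OF nonneg(2)]
   by (intro nn_integral_cong) (auto simp: indicator_def ennreal_power power_mult_distrib)
  ultimately have "(\<integral>\<^sup>+s. indicator (chord X) (z, s) * ennreal (a (z, s) * \<bar>q (shift z s)\<bar>) \<partial>lborel)\<^sup>2
    <= C1 * (\<integral>\<^sup>+s. indicator (chord X) (z, s) * ennreal (a (z, s) * (q' (shift z s))\<^sup>2 / p (shift z s)) \<partial>lborel)"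
   by (simp only:) (erule order_trans, rule mult_right_mono, assumption, simp)
  then have "ennreal (c z) * (\<integral>\<^sup>+s. indicator (chord X) (z, s) * ennreal (a (z, s) * \<bar>q (shift z s)\<bar>) \<partial>lborel)\<^sup>2
    <= ennreal (c z) * (C1 * (\<integral>\<^sup>+s. indicator (chord X) (z, s) * ennreal (a (z, s) * (q' (shift z s))\<^sup>2 / p (shift z s)) \<partial>lborel))"
   by (intro mult_left_mono) auto
  also have "\<dots> = C1 * (\<integral>\<^sup>+s. ennreal (c z) * (indicator (chord X) (z, s) * ennreal (a (z, s) * (q' (shift z s))\<^sup>2 / p (shift z s))) \<partial>lborel)"
   by (subst nn_integral_cmult) (simp_all add: mult_ac)
  also have "\<dots> = C1 * (\<integral>\<^sup>+s. indicator (chord X) (z, s) * G (z, s) \<partial>lborel)"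
  proof (rule arg_cong2[where f = "(*)", OF refl], rule nn_integral_cong)
   fix s
   have "0 <= a (z, s)" "0 <= p (shift z s)" "0 <= c z"
    using nonneg(1)[of "(z, s)"] nonneg(2)[of "shift z s"] nonneg(3)[of z] by auto
   then show "ennreal (c z) * (indicator (chord X) (z, s) * ennreal (a (z, s) * (q' (shift z s))\<^sup>2 / p (shift z s)))
     = indicator (chord X) (z, s) * G (z, s)"
    using ennreal_mult'[of "c z" "a (z, s) * (q' (shift z s))\<^sup>2 / p (shift z s)"]
    by (cases "(z, s) \<in> chord X") (simp_all add: G_def mult.assoc)
  qed
  finally show ?thesis .
 qed
 have cG: "(%w. indicator (chord X) w * G w) \<in> borel_measurable borel" by measurable
 have "(\<integral>\<^sup>+z. ennreal (c z) * (\<integral>\<^sup>+s. indicator (chord X) (z, s) * ennreal (a (z, s) * \<bar>q (shift z s)\<bar>) \<partial>lborel)\<^sup>2 \<partial>phase_measure X)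
   <= (\<integral>\<^sup>+z. C1 * (\<integral>\<^sup>+s. indicator (chord X) (z, s) * G (z, s) \<partial>lborel) \<partial>phase_measure X)"
  by (intro nn_integral_mono *)
 also have "\<dots> = C1 * (\<integral>\<^sup>+z. (\<integral>\<^sup>+s. indicator (chord X) (z, s) * G (z, s) \<partial>lborel) \<partial>phase_measure X)"
  using borel_measurable_phase_line[OF cG] by (intro nn_integral_cmult) measurable
 also have "(\<integral>\<^sup>+z. (\<integral>\<^sup>+s. indicator (chord X) (z, s) * G (z, s) \<partial>lborel) \<partial>phase_measure X)
   = (\<integral>\<^sup>+z. (\<integral>\<^sup>+s. indicator (chord X) (shift z (- s), s) * G (shift z (- s), s) \<partial>lborel) \<partial>phase_measure X)"
  by (rule nn_integral_chord_shift) measurable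
 also have "\<dots> <= (\<integral>\<^sup>+z. C2 * ennreal ((q z)\<^sup>2 / p z) \<partial>phase_measure X)"
 proof (rule nn_integral_mono)
  fix z assume z: "z \<in> space (phase_measure X)"
  have m: "(%s. shift z (- s)) \<in> borel_measurable borel" unfolding shift_def by measurable
  note [measurable] = m
  have "(\<integral>\<^sup>+s. indicator (chord X) (shift z (- s), s) * G (shift z (- s), s) \<partial>lborel)
    = (\<integral>\<^sup>+s. indicator (chord X) (shift z (- s), s) * ennreal (a (shift z (- s), s) * c (shift z (- s))) * ennreal ((q z)\<^sup>2 / p z) \<partial>lborel)"
   using nonneg less_imp_le[OF nonneg(2)] z
   by (intro nn_integral_cong) (auto simp: G_def indicator_def ennreal_mult[symmetric] mult_ac q'_def zext_eq)
  also have "\<dots> = (\<integral>\<^sup>+s. indicator (chord X) (shift z (- s), s) * ennreal (a (shift z (- s), s) * c (shift z (- s))) \<partial>lborel) * ennreal ((q z)\<^sup>2 / p z)"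
   by (rule nn_integral_multc) measurable
  also have "\<dots> <= C2 * ennreal ((q z)\<^sup>2 / p z)"
   by (intro mult_right_mono C2 z) auto
  finally show "(\<integral>\<^sup>+s. indicator (chord X) (shift z (- s), s) * G (shift z (- s), s) \<partial>lborel) <= C2 * ennreal ((q z)\<^sup>2 / p z)" .
 qed
 also have "\<dots> = C2 * (\<integral>\<^sup>+z. ennreal ((q z)\<^sup>2 / p z) \<partial>phase_measure X)"
 proof -
  have [measurable]: "p \<in> borel_measurable (phase_measure X)" by (rule borel_measurable_phase) fact
  note [measurable] = q
  show ?thesis by (rule nn_integral_cmult) measurable
 qed
 finally show ?thesis by (simp add: mult.assoc mult_left_mono)
qed

end

section \<open>Bounded operators with explicit constants\<close>

text \<open>The bound is a parameter, in contrast to \<open>bounded_linear_L2\<close>, because some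
  operators must be small and not merely bounded: the near part of the transport and the remainder
  after finite rank approximation.\<close>

definition bounded_operator_L2 ::
  "'b measure => 'c measure => real => (('b => real) => 'c => real) => bool" where
 "bounded_operator_L2 M N K T \<longleftrightarrow> 0 <= K &
   (\<forall>f\<in>L2 M. T f \<in> L2 N) &
   (\<forall>f\<in>L2 M. \<forall>g\<in>L2 M. (AE x in M. f x = g x) \<longrightarrow> (AE y in N. T f y = T g y)) &
   (\<forall>f\<in>L2 M. \<forall>g\<in>L2 M. AE y in N. T (%x. f x + g x) y = T f y + T g y) &
   (\<forall>f\<in>L2 M. \<forall>a. AE y in N. T (%x. a * f x) y = a * T f y) &
   (\<forall>f\<in>L2 M. L2_norm N (T f) <= K * L2_norm M f)"

lemma bounded_operator_L2I:
 assumes "0 <= K" "!!f. f \<in> L2 M ==> T f \<in> L2 N"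
  and "!!f g. f \<in> L2 M ==> g \<in> L2 M ==> AE x in M. f x = g x ==> AE y in N. T f y = T g y"
  and "!!f g. f \<in> L2 M ==> g \<in> L2 M ==> AE y in N. T (%x. f x + g x) y = T f y + T g y"
  and "!!f a. f \<in> L2 M ==> AE y in N. T (%x. a * f x) y = a * T f y"
  and "!!f. f \<in> L2 M ==> L2_norm N (T f) <= K * L2_norm M f"
 shows "bounded_operator_L2 M N K T"
 unfolding bounded_operator_L2_def by (intro conjI ballI allI impI assms)

lemma bounded_operator_L2D:
 assumes "bounded_operator_L2 M N K T"
 shows "0 <= K"
  and "f \<in> L2 M ==> T f \<in> L2 N"
  and "f \<in> L2 M ==> g \<in> L2 M ==> AE x in M. f x = g x ==> AE y in N. T f y = T g y"
  and "f \<in> L2 M ==> g \<in> L2 M ==> AE y in N. T (%x. f x + g x) y = T f y + T g y"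
  and "f \<in> L2 M ==> AE y in N. T (%x. a * f x) y = a * T f y"
  and "f \<in> L2 M ==> L2_norm N (T f) <= K * L2_norm M f"
 using assms unfolding bounded_operator_L2_def by blast+

lemma bounded_operator_L2_diff:
 assumes T: "bounded_operator_L2 M N K T" and "f \<in> L2 M" "g \<in> L2 M"
 shows "AE y in N. T (%x. f x - g x) y = T f y - T g y"
 using bounded_operator_L2D(4)[OF T assms(2) L2_scale[OF assms(3), of "-1"]]
  bounded_operator_L2D(5)[OF T assms(3), of "-1"]
 by eventually_elim simp

lemma bounded_operator_imp_bounded_linear_L2:
 assumes "bounded_operator_L2 M M K T"
 shows "bounded_linear_L2 M T"
 using bounded_operator_L2D[OF assms] unfolding bounded_linear_L2_def by blast

lemma bounded_linear_imp_bounded_operator_L2: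
 assumes "bounded_linear_L2 M T"
 obtains K where "bounded_operator_L2 M M K T"
proof -
 obtain C where "C \<ge> 0" "!!f. f \<in> L2 M ==> L2_norm M (T f) <= C * L2_norm M f"
  using bounded_linear_L2_bound[OF assms] by blast
 then have "bounded_operator_L2 M M C T"
  by (intro bounded_operator_L2I bounded_linear_L2D[OF assms])
 then show ?thesis by (rule that)
qed

lemma bounded_operator_L2_compose:
 assumes T: "bounded_operator_L2 M N K T" and S: "bounded_operator_L2 N P K' S"
 shows "bounded_operator_L2 M P (K' * K) (%f. S (T f))"
proof -
 note TD = bounded_operator_L2D[OF T] and SD = bounded_operator_L2D[OF S]
 show ?thesis
 proof (rule bounded_operator_L2I)
  show "0 <= K' * K" using TD(1) SD(1) by simp
  fix f assume f: "f \<in> L2 M"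
  show "S (T f) \<in> L2 P" by (intro SD(2) TD(2) f)
  show "L2_norm P (S (T f)) <= K' * K * L2_norm M f"
   using SD(6)[OF TD(2)[OF f]] mult_left_mono[OF TD(6)[OF f] SD(1)] by (simp add: mult.assoc)
  show "AE y in P. S (T (%x. a * f x)) y = a * S (T f) y" for a
   using SD(3)[OF TD(2)[OF L2_scale[OF f]] L2_scale[OF TD(2)[OF f]] TD(5)[OF f], of a] SD(5)[OF TD(2)[OF f], of a]
   by eventually_elim simp
  fix g assume g: "g \<in> L2 M"
  show "AE y in P. S (T f) y = S (T g) y" if "AE x in M. f x = g x"
   by (intro SD(3) TD(2,3) f g that)
  show "AE y in P. S (T (%x. f x + g x)) y = S (T f) y + S (T g) y"
   using SD(3)[OF TD(2)[OF L2_add[OF f g]] L2_add[OF TD(2)[OF f] TD(2)[OF g]] TD(4)[OF f g]]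
    SD(4)[OF TD(2)[OF f] TD(2)[OF g]]
   by eventually_elim simp
 qed
qed

lemma bounded_operator_L2_add:
 assumes T: "bounded_operator_L2 M N K T" and S: "bounded_operator_L2 M N K' S"
 shows "bounded_operator_L2 M N (K + K') (%f y. T f y + S f y)"
proof -
 note TD = bounded_operator_L2D[OF T] and SD = bounded_operator_L2D[OF S]
 show ?thesis
 proof (rule bounded_operator_L2I)
  show "0 <= K + K'" using TD(1) SD(1) by simp
  fix f assume f: "f \<in> L2 M"
  show "(%y. T f y + S f y) \<in> L2 N" by (intro L2_add SD(2) TD(2) f)
  show "L2_norm N (%y. T f y + S f y) <= (K + K') * L2_norm M f"
   using L2_norm_triangle[OF TD(2)[OF f] SD(2)[OF f]] TD(6)[OF f] SD(6)[OF f] by (simp add: ring_distribs)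
  show "AE y in N. T (%x. a * f x) y + S (%x. a * f x) y = a * (T f y + S f y)" for a
   using TD(5)[OF f, of a] SD(5)[OF f, of a] by eventually_elim (simp add: ring_distribs)
  fix g assume g: "g \<in> L2 M"
  show "AE y in N. T f y + S f y = T g y + S g y" if "AE x in M. f x = g x"
   using TD(3)[OF f g that] SD(3)[OF f g that] by eventually_elim simp
  show "AE y in N. T (%x. f x + g x) y + S (%x. f x + g x) y = T f y + S f y + (T g y + S g y)"
   using TD(4)[OF f g] SD(4)[OF f g] by eventually_elim simp
 qed
qed

lemma bounded_operator_L2_mult:
 assumes "c \<in> borel_measurable M" "AE x in M. \<bar>c x\<bar> <= C"
 shows "bounded_operator_L2 M M \<bar>C\<bar> (%f x. c x * f x)"
 by (rule bounded_operator_L2I) (use L2_mult_bounded[OF _ assms] in \<open>auto simp: ring_distribs\<close>)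

lemma bounded_operator_L2_uminus:
 assumes "bounded_operator_L2 M N K T"
 shows "bounded_operator_L2 M N K (%f x. - T f x)"
 using bounded_operator_L2_compose[OF assms bounded_operator_L2_mult[of "%_. -1" N 1]] by simp

lemma L2_slice:
 assumes "sigma_finite_measure M2" and u: "u \<in> L2 (M1 \<Otimes>\<^sub>M M2)"
 shows "AE x in M1. (%y. u (x, y)) \<in> L2 M2"
proof -
 interpret sigma_finite_measure M2 by fact
 note [measurable] = L2_measurable[OF u]
 have "(\<integral>\<^sup>+x. (\<integral>\<^sup>+y. ennreal ((u (x, y))\<^sup>2) \<partial>M2) \<partial>M1) < \<infinity>"
  using u by (subst nn_integral_fst) (auto simp: L2_iff_nn_integral)
 then have "AE x in M1. (\<integral>\<^sup>+y. ennreal ((u (x, y))\<^sup>2) \<partial>M2) \<noteq> \<infinity>"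
  by (intro nn_integral_noteq_infinite) auto
 then show ?thesis
  by (rule AE_mp[OF _ AE_I2]) (auto simp: L2_iff_nn_integral less_top)
qed

text \<open>Covers both the angular average (\<open>g\<close> the identity on \<open>X\<close>) and the scattering operator
 (\<open>g\<close> the projection of the phase space onto \<open>X\<close>).\<close>

lemma bounded_operator_L2_partial_integral:
 fixes m :: "'n => 'c => real" and B C :: real
 assumes "sigma_finite_measure M1" and "finite_measure M2"
  and g [measurable]: "g \<in> N \<rightarrow>\<^sub>M M1" and "0 <= B"
  and B: "!!h. h \<in> borel_measurable M1 ==> (\<integral>\<^sup>+y. h (g y) \<partial>N) <= ennreal B * (\<integral>\<^sup>+x. h x \<partial>M1)"
  and m [measurable]: "case_prod m \<in> borel_measurable (N \<Otimes>\<^sub>M M2)"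
  and C: "!!y t. y \<in> space N ==> t \<in> space M2 ==> \<bar>m y t\<bar> <= C" "0 <= C"
 shows "bounded_operator_L2 (M1 \<Otimes>\<^sub>M M2) N (C * sqrt (measure M2 (space M2) * B)) (%u y. \<integral>t. m y t * u (g y, t) \<partial>M2)"
  and "u \<in> L2 (M1 \<Otimes>\<^sub>M M2) ==> AE y in N. (%t. u (g y, t)) \<in> L2 M2"
proof -
 interpret M1: sigma_finite_measure M1 by fact
 interpret M2: finite_measure M2 by fact
 interpret pair_sigma_finite M1 M2 ..
 \<comment> \<open>The hypothesis \<open>B\<close> bounds the image of \<open>N\<close> under
   \<open>g\<close> by a multiple of \<open>M1\<close>, so null sets pull back to null sets.\<close>
 have AE_g: "AE y in N. P (g y)" if P: "AE x in M1. P x" for P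
 proof -
  obtain Z where Z: "{x \<in> space M1. \<not> P x} \<subseteq> Z" "emeasure M1 Z = 0" "Z \<in> sets M1" by (rule AE_E[OF P])
  note [measurable] = Z(3)
  have "(\<integral>\<^sup>+y. indicator Z (g y) \<partial>N) <= ennreal B * (\<integral>\<^sup>+x. indicator Z x \<partial>M1)"
   by (rule B) measurable
  then have "(\<integral>\<^sup>+y. indicator Z (g y) \<partial>N) = 0" using Z by simp
  then have "AE y in N. (indicator Z (g y) :: ennreal) = 0"
   by (subst (asm) nn_integral_0_iff_AE) measurable
  then show ?thesis
   by (rule AE_mp[OF _ AE_I2]) (use Z(1) measurable_space[OF g] in \<open>auto simp: indicator_def split: if_splits\<close>)
 qed
 show slice: "AE y in N. (%t. u (g y, t)) \<in> L2 M2" if "u \<in> L2 (M1 \<Otimes>\<^sub>M M2)" for u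
  by (rule AE_g[OF L2_slice[OF M2.sigma_finite_measure_axioms that]])
 have int: "integrable M2 (%t. m y t * f t)" if "y \<in> space N" "f \<in> L2 M2" for y f
 proof (rule L2_mult_integrable[OF M2.L2_bounded that(2)])
  show "(%t. m y t) \<in> borel_measurable M2" using that(1) by measurable
  show "AE t in M2. \<bar>m y t\<bar> <= C" using C that(1) by (intro AE_I2) auto
 qed
 show "bounded_operator_L2 (M1 \<Otimes>\<^sub>M M2) N (C * sqrt (measure M2 (space M2) * B)) (%u y. \<integral>t. m y t * u (g y, t) \<partial>M2)"
 proof (rule bounded_operator_L2I)
  show "0 <= C * sqrt (measure M2 (space M2) * B)" using C \<open>0 <= B\<close> by simp
  fix u assume u: "u \<in> L2 (M1 \<Otimes>\<^sub>M M2)"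
  note [measurable] = L2_measurable[OF u]
  have meas: "(%y. \<integral>t. m y t * u (g y, t) \<partial>M2) \<in> borel_measurable N" by measurable
  have "(\<integral>\<^sup>+y. ennreal ((\<integral>t. m y t * u (g y, t) \<partial>M2)\<^sup>2) \<partial>N)
    <= (\<integral>\<^sup>+y. ennreal (C\<^sup>2 * measure M2 (space M2)) * (\<integral>\<^sup>+t. ennreal ((u (g y, t))\<^sup>2) \<partial>M2) \<partial>N)"
  proof (rule nn_integral_mono_AE, use slice[OF u] AE_space in eventually_elim)
   case (elim y)
   let ?f = "%t. u (g y, t)"
   have "\<bar>\<integral>t. m y t * ?f t \<partial>M2\<bar> <= (\<integral>t. \<bar>m y t * ?f t\<bar> \<partial>M2)" by (rule integral_abs_bound)
   also have "\<dots> <= (\<integral>t. C * \<bar>?f t\<bar> \<partial>M2)"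
   proof (rule integral_mono)
    show "integrable M2 (%t. \<bar>m y t * ?f t\<bar>)" using int[OF elim(2,1)] by (rule integrable_abs)
    show "integrable M2 (%t. C * \<bar>?f t\<bar>)" using M2.L2_imp_integrable[OF elim(1)] by simp
    show "\<bar>m y t * ?f t\<bar> <= C * \<bar>?f t\<bar>" if "t \<in> space M2" for t
     using C(1)[OF elim(2) that] by (simp add: abs_mult mult_right_mono)
   qed
   also have "\<dots> <= C * (sqrt (measure M2 (space M2)) * L2_norm M2 ?f)"
    using M2.L1_le_L2[OF elim(1)] C(2) by (simp add: mult_left_mono)
   finally have "(\<integral>t. m y t * ?f t \<partial>M2)\<^sup>2 <= (C * (sqrt (measure M2 (space M2)) * L2_norm M2 ?f))\<^sup>2"
    by (metis abs_ge_zero power2_abs power_mono)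
   also have "\<dots> = C\<^sup>2 * measure M2 (space M2) * (L2_norm M2 ?f)\<^sup>2"
    by (simp add: power_mult_distrib)
   finally show ?case
    by (simp add: L2_norm_nn_integral[OF elim(1)] ennreal_mult[symmetric])
  qed
  also have "\<dots> = ennreal (C\<^sup>2 * measure M2 (space M2)) * (\<integral>\<^sup>+y. (\<integral>\<^sup>+t. ennreal ((u (g y, t))\<^sup>2) \<partial>M2) \<partial>N)"
   by (rule nn_integral_cmult) measurable
  also have "(\<integral>\<^sup>+y. (\<integral>\<^sup>+t. ennreal ((u (g y, t))\<^sup>2) \<partial>M2) \<partial>N) <= ennreal B * (\<integral>\<^sup>+x. (\<integral>\<^sup>+t. ennreal ((u (x, t))\<^sup>2) \<partial>M2) \<partial>M1)"
   by (rule B) measurable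
  also have "(\<integral>\<^sup>+x. (\<integral>\<^sup>+t. ennreal ((u (x, t))\<^sup>2) \<partial>M2) \<partial>M1) = ennreal ((L2_norm (M1 \<Otimes>\<^sub>M M2) u)\<^sup>2)"
   by (subst M2.nn_integral_fst) (auto simp: L2_norm_nn_integral[OF u])
  also have "ennreal (C\<^sup>2 * measure M2 (space M2)) * (ennreal B * ennreal ((L2_norm (M1 \<Otimes>\<^sub>M M2) u)\<^sup>2))
    = ennreal ((C * sqrt (measure M2 (space M2) * B) * L2_norm (M1 \<Otimes>\<^sub>M M2) u)\<^sup>2)"
   using \<open>0 <= B\<close> by (simp add: power_mult_distrib ennreal_mult[symmetric] mult_ac)
  finally have bound: "(\<integral>\<^sup>+y. ennreal ((\<integral>t. m y t * u (g y, t) \<partial>M2)\<^sup>2) \<partial>N)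
    <= ennreal ((C * sqrt (measure M2 (space M2) * B) * L2_norm (M1 \<Otimes>\<^sub>M M2) u)\<^sup>2)"
   by (simp add: mult_left_mono)
  show "(%y. \<integral>t. m y t * u (g y, t) \<partial>M2) \<in> L2 N"
   by (rule L2_I_nn_integral[OF meas bound])
  show "L2_norm N (%y. \<integral>t. m y t * u (g y, t) \<partial>M2) <= C * sqrt (measure M2 (space M2) * B) * L2_norm (M1 \<Otimes>\<^sub>M M2) u"
   by (rule L2_norm_le[OF meas bound]) (use C \<open>0 <= B\<close> in auto)
  show "AE y in N. (\<integral>t. m y t * (a * u (g y, t)) \<partial>M2) = a * (\<integral>t. m y t * u (g y, t) \<partial>M2)" for a
  proof (rule AE_I2)
   fix y
   have "(\<integral>t. m y t * (a * u (g y, t)) \<partial>M2) = (\<integral>t. a * (m y t * u (g y, t)) \<partial>M2)"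
    by (rule Bochner_Integration.integral_cong) auto
   then show "(\<integral>t. m y t * (a * u (g y, t)) \<partial>M2) = a * (\<integral>t. m y t * u (g y, t) \<partial>M2)" by simp
  qed
  fix v assume v: "v \<in> L2 (M1 \<Otimes>\<^sub>M M2)"
  note [measurable] = L2_measurable[OF v]
  show "AE y in N. (\<integral>t. m y t * (u (g y, t) + v (g y, t)) \<partial>M2) = (\<integral>t. m y t * u (g y, t) \<partial>M2) + (\<integral>t. m y t * v (g y, t) \<partial>M2)"
   using slice[OF u] slice[OF v] AE_space
  proof eventually_elim
   case (elim y)
   show ?case
    using Bochner_Integration.integral_add[OF int[OF elim(3,1)] int[OF elim(3,2)]]
    by (simp add: ring_distribs)
  qed
  show "AE y in N. (\<integral>t. m y t * u (g y, t) \<partial>M2) = (\<integral>t. m y t * v (g y, t) \<partial>M2)"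
   if "AE x in M1 \<Otimes>\<^sub>M M2. u x = v x"
   using AE_g[OF AE_pair[OF that]] AE_space
  proof eventually_elim
   case (elim y)
   have [measurable]: "y \<in> space N" by (rule elim(2))
   have "g y \<in> space M1" using elim(2) measurable_space[OF g] by auto
   then show ?case
    using elim(1) by (intro integral_cong_AE) (measurable, auto)
  qed
 qed
qed

context bounded_domain
begin

text \<open>The summand 1 makes \<open>D\<close> positive and strictly larger than every chord, so a
  ray from a point of \<open>X\<close> has certainly left \<open>X\<close> somewhere within length
  \<open>D\<close>.\<close>

definition D :: real where "D = diameter X + 1"

lemma D_pos: "D > 0" unfolding D_def using diameter_ge_0[OF bounded_X] by simp

lemma chord_length:
 assumes c: "(z, s) \<in> chord X" and z: "norm (snd z) = 1"
 shows "0 <= s" "s < D"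
proof -
 show s: "0 <= s" using c by (auto simp: chord_def)
 have "dist (fst z) (fst (shift z s)) <= diameter X"
  by (intro diameter_bounded_bound bounded_X chord_in_X[OF c] shift_in_X[OF c])
 then show "s < D" using s z by (simp add: dist_norm D_def)
qed

lemma chord_shift_length:
 assumes "(shift z (- s), s) \<in> chord X" "norm (snd z) = 1"
 shows "0 <= s" "s < D"
 using chord_length[OF assms(1)] assms(2) by auto

lemma nn_integral_chord_bound:
 assumes a: "!!s. 0 <= s ==> s < D ==> a s <= A"
  and P: "!!s. P s ==> 0 <= s & s < D"
 shows "(\<integral>\<^sup>+s. indicator {s. P s} s * ennreal (a s) \<partial>lborel) <= ennreal D * ennreal A"
proof -
 have "(\<integral>\<^sup>+s. indicator {s. P s} s * ennreal (a s) \<partial>lborel) <= (\<integral>\<^sup>+s. ennreal A * indicator {0..D} s \<partial>lborel)"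
  by (intro nn_integral_mono) (auto simp: indicator_def intro!: ennreal_leI a dest: P)
 also have "\<dots> = ennreal A * ennreal D"
  using D_pos by (simp add: nn_integral_cmult)
 finally show ?thesis by (simp add: mult.commute)
qed

text \<open>The Schur test with unit weights. Integrability along almost every ray is recorded as
  well, because the Bochner integral is additive only on integrable functions.\<close>

lemma bounded_operator_L2_transport:
 assumes a [measurable]: "a \<in> borel_measurable borel" and "0 <= C" and nonneg: "!!w. a w \<ge> 0"
  and C1: "!!z. z \<in> space (phase_measure X) ==> (\<integral>\<^sup>+s. indicator (chord X) (z, s) * ennreal (a (z, s)) \<partial>lborel) <= ennreal C"
  and C2: "!!z. z \<in> space (phase_measure X) ==>
   (\<integral>\<^sup>+s. indicator (chord X) (shift z (- s), s) * ennreal (a (shift z (- s), s)) \<partial>lborel) <= ennreal C"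
 shows "bounded_operator_L2 (phase_measure X) (phase_measure X) C (transport X a)"
  and "q \<in> L2 (phase_measure X) ==>
   AE z in phase_measure X. integrable lborel (%s. indicator (chord X) (z, s) * a (z, s) * q (shift z s))"
proof -
 let ?M = "phase_measure X"
 let ?N = "%q z. \<integral>\<^sup>+s. indicator (chord X) (z, s) * ennreal (a (z, s) * \<bar>q (shift z s)\<bar>) \<partial>lborel"
 have le: "ennreal ((transport X a q z)\<^sup>2) <= (?N q z)\<^sup>2" for q z
 proof -
  have "ennreal \<bar>transport X a q z\<bar> <= (\<integral>\<^sup>+s. ennreal \<bar>indicator (chord X) (z, s) * a (z, s) * q (shift z s)\<bar> \<partial>lborel)"
   unfolding transport_def by (rule ennreal_abs_integral_le)
  also have "\<dots> = ?N q z"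
   using nonneg by (intro nn_integral_cong) (auto simp: indicator_def abs_mult)
  finally have "(ennreal \<bar>transport X a q z\<bar>)\<^sup>2 <= (?N q z)\<^sup>2" by (rule power_mono) simp
  then show ?thesis by (simp add: ennreal_power)
 qed
 have Schur: "(\<integral>\<^sup>+z. (?N q z)\<^sup>2 \<partial>?M) <= ennreal ((C * L2_norm ?M q)\<^sup>2)" if q: "q \<in> L2 ?M" for q
 proof -
  have "(\<integral>\<^sup>+z. ennreal 1 * (?N q z)\<^sup>2 \<partial>?M) <= ennreal C * ennreal C * (\<integral>\<^sup>+z. ennreal ((q z)\<^sup>2 / 1) \<partial>?M)"
   by (rule transport_Schur) (use q nonneg C1 C2 in \<open>auto simp: L2_def\<close>)
  then show ?thesis
   using \<open>0 <= C\<close>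
   by (simp add: L2_norm_nn_integral[OF q] ennreal_mult[symmetric] power_mult_distrib)
    (simp add: power2_eq_square mult_ac)
 qed
 have N_meas: "?N q \<in> borel_measurable ?M" if q: "q \<in> L2 ?M" for q
 proof -
  have [measurable]: "zext X q \<in> borel_measurable borel" by (intro borel_measurable_zext L2_measurable q)
  define h where "h w = indicator (chord X) w * ennreal (a w * \<bar>zext X q (shift (fst w) (snd w))\<bar>)" for w
  have "h \<in> borel_measurable borel" unfolding h_def by measurable
  note [measurable] = borel_measurable_phase_line[OF this]
  have *: "?N q z = (\<integral>\<^sup>+s. h (z, s) \<partial>lborel)" if "z \<in> space ?M" for z
   using shift_in_phase[OF _ that] by (intro nn_integral_cong) (auto simp: h_def indicator_def zext_eq)
  have "(%z. \<integral>\<^sup>+s. h (z, s) \<partial>lborel) \<in> borel_measurable ?M" by measurable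
  then show ?thesis by (subst measurable_cong[OF *])
 qed
 show int: "AE z in ?M. integrable lborel (%s. indicator (chord X) (z, s) * a (z, s) * q (shift z s))"
  if q: "q \<in> L2 ?M" for q
 proof -
  have [measurable]: "zext X q \<in> borel_measurable borel" by (intro borel_measurable_zext L2_measurable q)
  have "(\<integral>\<^sup>+z. (?N q z)\<^sup>2 \<partial>?M) \<noteq> \<infinity>"
   using Schur[OF q] by (auto simp: top_unique)
  then have "AE z in ?M. (?N q z)\<^sup>2 \<noteq> \<infinity>"
   using N_meas[OF q] by (intro nn_integral_noteq_infinite) auto
  then show ?thesis
  proof (rule AE_mp[OF _ AE_I2[OF impI]])
   fix z assume z: "z \<in> space ?M" and "(?N q z)\<^sup>2 \<noteq> \<infinity>"
   then have fin: "?N q z < \<infinity>" by (auto simp: less_top power2_eq_square ennreal_mult_eq_top_iff)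
   have [measurable]: "(%s. shift z s) \<in> borel_measurable borel" unfolding shift_def by measurable
   have "integrable lborel (%s. indicator (chord X) (z, s) * a (z, s) * zext X q (shift z s))"
   proof (rule integrableI_bounded)
    have "(\<integral>\<^sup>+s. ennreal (norm (indicator (chord X) (z, s) * a (z, s) * zext X q (shift z s))) \<partial>lborel) = ?N q z"
     using nonneg shift_in_phase[OF _ z] by (intro nn_integral_cong) (auto simp: indicator_def abs_mult zext_eq)
    then show "(\<integral>\<^sup>+s. ennreal (norm (indicator (chord X) (z, s) * a (z, s) * zext X q (shift z s))) \<partial>lborel) < \<infinity>"
     using fin by simp
   qed measurable
   moreover have "indicator (chord X) (z, s) * a (z, s) * zext X q (shift z s) = indicator (chord X) (z, s) * a (z, s) * q (shift z s)" for s
    using zext_shift[OF z, of s q] by (cases "(z, s) \<in> chord X") auto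
   ultimately show "integrable lborel (%s. indicator (chord X) (z, s) * a (z, s) * q (shift z s))" by simp
  qed
 qed
 show "bounded_operator_L2 ?M ?M C (transport X a)"
 proof (rule bounded_operator_L2I)
  fix q assume q: "q \<in> L2 ?M"
  have meas: "transport X a q \<in> borel_measurable ?M"
   by (intro transport_measurable a L2_measurable q)
  have bound: "(\<integral>\<^sup>+z. ennreal ((transport X a q z)\<^sup>2) \<partial>?M) <= ennreal ((C * L2_norm ?M q)\<^sup>2)"
   using nn_integral_mono[of ?M, OF le] Schur[OF q] by (rule order_trans)
  show "transport X a q \<in> L2 ?M" by (rule L2_I_nn_integral[OF meas bound])
  show "L2_norm ?M (transport X a q) <= C * L2_norm ?M q"
   by (rule L2_norm_le[OF meas bound]) (use \<open>0 <= C\<close> in auto)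
  show "AE z in ?M. transport X a (%x. b * q x) z = b * transport X a q z" for b
  proof (rule AE_I2)
   fix z
   have "transport X a (%x. b * q x) z = (\<integral>s. b * (indicator (chord X) (z, s) * a (z, s) * q (shift z s)) \<partial>lborel)"
    unfolding transport_def by (rule Bochner_Integration.integral_cong) auto
   then show "transport X a (%x. b * q x) z = b * transport X a q z" by (simp add: transport_def)
  qed
  fix r assume r: "r \<in> L2 ?M"
  show "AE z in ?M. transport X a (%x. q x + r x) z = transport X a q z + transport X a r z"
   using int[OF q] int[OF r]
  proof eventually_elim
   case (elim z)
   show ?case
    using Bochner_Integration.integral_add[OF elim] by (simp add: transport_def ring_distribs)
  qed
  show "AE z in ?M. transport X a q z = transport X a r z" if "AE z in ?M. q z = r z"
   using AE_phase_shift[OF that] AE_space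
  proof eventually_elim
   case (elim z)
   have [measurable]: "(%s. shift z s) \<in> borel_measurable borel" unfolding shift_def by measurable
   have [measurable]: "zext X q \<in> borel_measurable borel" "zext X r \<in> borel_measurable borel"
    by (intro borel_measurable_zext L2_measurable q r)+
   have e: "transport X a p z = (\<integral>s. indicator (chord X) (z, s) * a (z, s) * zext X p (shift z s) \<partial>lborel)" for p
    unfolding transport_def
   proof (rule Bochner_Integration.integral_cong[OF refl])
    show "indicator (chord X) (z, s) * a (z, s) * p (shift z s) = indicator (chord X) (z, s) * a (z, s) * zext X p (shift z s)" for s
     using zext_shift[OF elim(2), of s p] by (cases "(z, s) \<in> chord X") auto
   qed
   show ?case unfolding e
   proof (rule integral_cong_AE)
    show "AE s in lborel. indicator (chord X) (z, s) * a (z, s) * zext X q (shift z s) = indicator (chord X) (z, s) * a (z, s) * zext X r (shift z s)"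
     using elim(1) by eventually_elim (use shift_in_phase[OF _ elim(2)] in \<open>auto simp: indicator_def zext_eq\<close>)
   qed measurable
  qed
 qed (use \<open>0 <= C\<close> in auto)
qed

lemma nn_integral_phase_fst:
 assumes [measurable]: "h \<in> borel_measurable (space_measure X)"
 shows "(\<integral>\<^sup>+z. h (fst z) \<partial>phase_measure X)
  = ennreal (measure (sphere_measure :: 'a measure) (sphere 0 1)) * (\<integral>\<^sup>+x. h x \<partial>space_measure X)"
proof -
 have "(\<integral>\<^sup>+z. h (fst z) \<partial>phase_measure X) = (\<integral>\<^sup>+x. (\<integral>\<^sup>+th. h (fst (x, th)) \<partial>(sphere_measure :: 'a measure)) \<partial>space_measure X)"
  by (rule sphere_measure.nn_integral_fst[symmetric]) measurable
 also have "\<dots> = (\<integral>\<^sup>+x. emeasure (sphere_measure :: 'a measure) (sphere 0 1) * h x \<partial>space_measure X)"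
  by (intro nn_integral_cong) (simp add: mult.commute)
 also have "\<dots> = emeasure (sphere_measure :: 'a measure) (sphere 0 1) * (\<integral>\<^sup>+x. h x \<partial>space_measure X)"
  by (rule nn_integral_cmult) measurable
 finally show ?thesis by (simp add: sphere_measure.emeasure_eq_measure)
qed

definition sphere_area :: real where
 "sphere_area = measure (sphere_measure :: 'a measure) (sphere 0 1)"

lemma sphere_area_nonneg: "sphere_area \<ge> 0" by (simp add: sphere_area_def)

lemma bounded_operator_L2_scattering:
 assumes [measurable]: "(%(z, th'). m (fst z) (snd z) th') \<in> borel_measurable (phase_measure X \<Otimes>\<^sub>M (sphere_measure :: 'a measure))"
  and C: "!!x th th'. x \<in> X ==> th \<in> sphere 0 1 ==> th' \<in> sphere 0 1 ==> \<bar>m x th th'\<bar> <= C" "0 <= C"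
 shows "bounded_operator_L2 (phase_measure X) (phase_measure X) (C * sphere_area) (scattering m)"
proof -
 have "bounded_operator_L2 (phase_measure X) (phase_measure X) (C * sqrt (measure (sphere_measure :: 'a measure) (space sphere_measure) * sphere_area))
   (%u z. \<integral>th'. m (fst z) (snd z) th' * u (fst z, th') \<partial>sphere_measure)"
  by (rule bounded_operator_L2_partial_integral(1))
   (use C in \<open>auto simp: sphere_area_def nn_integral_phase_fst
    intro: sphere_measure.finite_measure_axioms space.sigma_finite_measure_axioms\<close>)
 then show ?thesis
  using sphere_area_nonneg by (simp add: sphere_area_def scattering_def[abs_def] split_beta')
qed

lemma bounded_operator_L2_angular:
 assumes [measurable]: "w \<in> borel_measurable (phase_measure X)"
  and C: "!!z. z \<in> space (phase_measure X) ==> \<bar>w z\<bar> <= C" "0 <= C"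
 shows "bounded_operator_L2 (phase_measure X) (space_measure X) (C * sqrt sphere_area)
  (%u x. \<integral>th. w (x, th) * u (x, th) \<partial>sphere_measure)"
proof -
 have "bounded_operator_L2 (phase_measure X) (space_measure X) (C * sqrt (measure (sphere_measure :: 'a measure) (space sphere_measure) * 1))
  (%u x. \<integral>th. w (x, th) * u ((%x. x) x, th) \<partial>sphere_measure)"
  by (rule bounded_operator_L2_partial_integral(1))
   (use C in \<open>auto intro: sphere_measure.finite_measure_axioms space.sigma_finite_measure_axioms\<close>)
 then show ?thesis by (simp add: sphere_area_def)
qed

lemma bounded_operator_L2_lift:
 "bounded_operator_L2 (space_measure X) (phase_measure X) (sqrt sphere_area) (%f z. f (fst z))"
proof (rule bounded_operator_L2I)
 fix f assume f: "f \<in> L2 (space_measure X)"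
 note [measurable] = L2_measurable[OF f]
 have "(\<integral>\<^sup>+z. ennreal ((f (fst z))\<^sup>2) \<partial>phase_measure X) = ennreal sphere_area * ennreal ((L2_norm (space_measure X) f)\<^sup>2)"
  unfolding L2_norm_nn_integral[OF f, symmetric] sphere_area_def by (rule nn_integral_phase_fst) measurable
 then have b: "(\<integral>\<^sup>+z. ennreal ((f (fst z))\<^sup>2) \<partial>phase_measure X) <= ennreal ((sqrt sphere_area * L2_norm (space_measure X) f)\<^sup>2)"
  using sphere_area_nonneg by (simp add: ennreal_mult[symmetric] power_mult_distrib)
 show "(%z. f (fst z)) \<in> L2 (phase_measure X)" by (rule L2_I_nn_integral[OF _ b]) measurable
 show "L2_norm (phase_measure X) (%z. f (fst z)) <= sqrt sphere_area * L2_norm (space_measure X) f"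
  by (rule L2_norm_le[OF _ b]) (use sphere_area_nonneg in auto)
 fix g assume "g \<in> L2 (space_measure X)" and e: "AE x in space_measure X. f x = g x"
 have "AE x in space_measure X. AE th in (sphere_measure :: 'a measure). f (fst (x, th)) = g (fst (x, th))"
  using e by eventually_elim simp
 then show "AE z in phase_measure X. f (fst z) = g (fst z)"
 proof (rule phase_pair.AE_pair_measure[rotated])
  show "{z \<in> space (phase_measure X). f (fst z) = g (fst z)} \<in> sets (phase_measure X)"
   by (intro borel_measurable_eq measurable_compose[OF measurable_fst] L2_measurable f \<open>g \<in> _\<close>)
 qed
qed (use sphere_area_nonneg in auto)

end

section \<open>Attenuation along a line\<close>

text \<open>The range of integration is encoded by two indicators on the whole line, which makes
  joint measurability in the end point and in parameters of \<open>g\<close> automatic. The value is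
  0 for negative \<open>s\<close>.\<close>

definition primitive :: "(real => real) => real => real" where
 "primitive g s = (\<integral>r. indicator {0..} r * indicator {0..} (s - r) * g r \<partial>lborel)"

lemma primitive_eq_integral:
 assumes "continuous_on UNIV g"
 shows "primitive g s = integral {0..s} g"
proof -
 have c: "continuous_on {0..s} g" using assms continuous_on_subset by blast
 have "primitive g s = (LINT r:{0..s}|lborel. g r)"
  unfolding primitive_def set_lebesgue_integral_def
  by (rule Bochner_Integration.integral_cong) (auto simp: indicator_def)
 also have "\<dots> = integral {0..s} g"
  by (rule set_borel_integral_eq_integral(2)[OF borel_integrable_atLeastAtMost'[OF c]])
 finally show ?thesis .
qed

lemma primitive_has_derivative:
 assumes "continuous_on UNIV g" "s \<in> {0..b}"
 shows "(primitive g has_real_derivative g s) (at s within {0..b})"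
proof -
 have "continuous_on {0..b} g" using assms continuous_on_subset by blast
 from integral_has_real_derivative[OF this assms(2)] show ?thesis
  by (simp add: primitive_eq_integral[OF assms(1), abs_def])
qed

lemma primitive_nonneg: "(!!r. 0 <= g r) ==> 0 <= primitive g s"
 unfolding primitive_def by (intro integral_nonneg_AE AE_I2) auto

lemma primitive_0 [simp]: "primitive g 0 = 0"
proof -
 have "AE r in lborel. indicator {0..} r * indicator {0..} (0 - r) * g r = 0"
  using AE_lborel_singleton[of "0::real"] by eventually_elim (auto simp: indicator_def)
 then show ?thesis unfolding primitive_def by (rule integral_eq_zero_AE)
qed

lemma primitive_reflect: "primitive (%r. g (s - r)) s = primitive g s"
proof -
 have "primitive g s = \<bar>-1\<bar> *\<^sub>R (\<integral>r. indicator {0..} (s + -1 * r) * indicator {0..} (s - (s + -1 * r)) * g (s + -1 * r) \<partial>lborel)"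
  unfolding primitive_def by (rule lborel_integral_real_affine) simp
 then show ?thesis by (simp add: primitive_def mult_ac)
qed

text \<open>The integrand is the derivative of \<open>- exp (- primitive g s)\<close>: the fraction
  absorbed along a line is at most 1, whatever its length.\<close>

lemma nn_integral_absorption:
 assumes g: "continuous_on UNIV g" "!!r. 0 <= g r"
 shows "(\<integral>\<^sup>+s. ennreal (g s * exp (- primitive g s)) * indicator {0..b} s \<partial>lborel) <= 1"
proof (cases "0 <= b")
 case True
 have d: "((%s. - exp (- primitive g s)) has_real_derivative g s * exp (- primitive g s)) (at s within {0..b})"
  if "s \<in> {0..b}" for s
  by (rule derivative_eq_intros primitive_has_derivative[OF g(1) that] refl)+ simp
 have c: "continuous_on {0..b} (%s. g s * exp (- primitive g s))"
  using continuous_on_subset[OF g(1)] DERIV_continuous_on[of "{0..b}" "primitive g" g] primitive_has_derivative[OF g(1)]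
  by (intro continuous_intros) auto
 have "(\<integral>\<^sup>+s. ennreal (g s * exp (- primitive g s)) * indicator {0..b} s \<partial>lborel)
   = ennreal (- exp (- primitive g b) - - exp (- primitive g 0))"
 proof -
  have i: "((%s. g s * exp (- primitive g s)) has_integral (- exp (- primitive g b) - - exp (- primitive g 0))) {0..b}"
   by (rule fundamental_theorem_of_calculus[OF True])
    (use d in \<open>auto simp: has_real_derivative_iff_has_vector_derivative\<close>)
  have s: "set_integrable lborel {0..b} (%s. g s * exp (- primitive g s))"
   by (rule borel_integrable_atLeastAtMost'[OF c])
  have "(\<integral>\<^sup>+s. ennreal (g s * exp (- primitive g s)) * indicator {0..b} s \<partial>lborel)
    = (\<integral>\<^sup>+s. ennreal (indicator {0..b} s *\<^sub>R (g s * exp (- primitive g s))) \<partial>lborel)"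
   by (intro nn_integral_cong) (auto simp: indicator_def)
  also have "\<dots> = ennreal (LINT s:{0..b}|lborel. g s * exp (- primitive g s))"
   unfolding set_lebesgue_integral_def
   by (rule nn_integral_eq_integral) (use s g(2) in \<open>auto simp: set_integrable_def intro!: AE_I2\<close>)
  also have "(LINT s:{0..b}|lborel. g s * exp (- primitive g s)) = - exp (- primitive g b) - - exp (- primitive g 0)"
   using set_borel_integral_eq_integral(2)[OF s] i by (simp add: integral_unique)
  finally show ?thesis .
 qed
 also have "\<dots> <= ennreal 1" by (intro ennreal_leI) simp
 finally show ?thesis by simp
qed simp

section \<open>The transport operator with attenuation and scattering\<close>

text \<open>Regularity and bounds are demanded on the whole space, where the rays are parametrised;
  the given coefficients are controlled on the closure of \<open>X\<close> and are replaced by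
  extensions in the final proof. \<open>\<kappa>\<close> bounds the ratio of scattering to
  attenuation.\<close>

locale transport_problem = bounded_domain X for X :: "'a::euclidean_space set" +
 fixes \<sigma> :: "'a => real" and k :: "'a => 'a => 'a => real" and \<sigma>\<^sub>0 \<sigma>\<^sub>1 \<kappa> C :: real
 assumes \<sigma>_cont: "continuous_on UNIV \<sigma>" and \<sigma>\<^sub>0_pos: "\<sigma>\<^sub>0 > 0"
  and \<sigma>_bounds: "!!x. \<sigma>\<^sub>0 <= \<sigma> x" "!!x. \<sigma> x <= \<sigma>\<^sub>1"
  and k_borel: "(%w. k (fst w) (fst (snd w)) (snd (snd w))) \<in> borel_measurable borel"
  and k_bounds: "!!x th th'. 0 <= k x th th'" "!!x th th'. k x th th' <= C"
  and k_sym: "!!x th th'. x \<in> X ==> th \<in> sphere 0 1 ==> th' \<in> sphere 0 1 ==> k x th th' = k x th' th"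
  and \<kappa>_bounds: "0 <= \<kappa>" "\<kappa> < 1"
  and subcritical: "AE z in phase_measure X. (\<integral>\<^sup>+th'. ennreal (k (fst z) (snd z) th') \<partial>sphere_measure) <= ennreal (\<kappa> * \<sigma> (fst z))"
begin

lemma \<sigma>_pos: "0 < \<sigma> x" using \<sigma>_bounds(1)[of x] \<sigma>\<^sub>0_pos by linarith

lemma \<sigma>_measurable [measurable]: "\<sigma> \<in> borel_measurable borel"
 using \<sigma>_cont by (rule borel_measurable_continuous_onI)

lemma C_nonneg: "0 <= C" using k_bounds order_trans by blast

lemma k_measurable [measurable (raw)]:
 assumes "f \<in> borel_measurable M" "g \<in> borel_measurable M" "h \<in> borel_measurable M"
 shows "(%x. k (f x) (g x) (h x)) \<in> borel_measurable M"
proof -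
 have "(%x. (f x, g x, h x)) \<in> borel_measurable M" by (intro borel_measurable_Pair assms)
 from measurable_compose[OF this k_borel] show ?thesis by simp
qed

definition att :: "('a \<times> 'a) \<times> real => real" where
 "att w = exp (- primitive (%r. \<sigma> (fst (fst w) - r *\<^sub>R snd (fst w))) (snd w))"

lemma \<sigma>_line_continuous: "continuous_on UNIV (%r. \<sigma> (x - r *\<^sub>R th))"
 by (intro continuous_on_compose2[OF \<sigma>_cont] continuous_intros) auto

lemma \<sigma>_line_continuous': "continuous_on UNIV (%r. \<sigma> (x + r *\<^sub>R th))"
 by (intro continuous_on_compose2[OF \<sigma>_cont] continuous_intros) auto

lemma att_measurable [measurable]: "att \<in> borel_measurable borel"
proof -
 have "att \<in> borel_measurable ((borel \<Otimes>\<^sub>M borel) \<Otimes>\<^sub>M borel)"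
  unfolding att_def[abs_def] primitive_def by measurable
 then show ?thesis by (simp add: borel_prod)
qed

lemma att_bounds: "0 < att w" "att w <= 1"
 using primitive_nonneg[of "%r. \<sigma> (fst (fst w) - r *\<^sub>R snd (fst w))" "snd w"] less_imp_le[OF \<sigma>_pos]
 by (auto simp: att_def)

text \<open>The attenuation of a segment, read from its starting point instead of its end.\<close>

lemma att_shift_minus:
 "att (shift z (- s), s) = exp (- primitive (%r. \<sigma> (fst z + r *\<^sub>R snd z)) s)"
proof -
 have "primitive (%r. \<sigma> (fst (shift z (- s)) - r *\<^sub>R snd z)) s = primitive (%r. \<sigma> (fst z + (s - r) *\<^sub>R snd z)) s"
  by (rule arg_cong2[where f = primitive]) (auto simp: algebra_simps)
 also have "\<dots> = primitive (%r. \<sigma> (fst z + r *\<^sub>R snd z)) s"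
  by (rule primitive_reflect[of "%r. \<sigma> (fst z + r *\<^sub>R snd z)"])
 finally show ?thesis by (simp add: att_def)
qed

definition L :: "('a \<times> 'a => real) => 'a \<times> 'a => real" where
 "L = transport X att"

text \<open>With weight \<open>\<sigma>\<close> the Schur constants are the fractions absorbed along
  the two halves of a characteristic. This lemma treats the half behind \<open>z\<close>, the next
  one the half ahead of it.\<close>

lemma nn_integral_att_forward:
 assumes "z \<in> space (phase_measure X)"
 shows "(\<integral>\<^sup>+s. indicator (chord X) (z, s) * ennreal (att (z, s) * \<sigma> (fst (shift z s))) \<partial>lborel) <= 1"
proof -
 have "norm (snd z) = 1" using assms by auto
 note le = chord_length[OF _ this]
 have "(\<integral>\<^sup>+s. indicator (chord X) (z, s) * ennreal (att (z, s) * \<sigma> (fst (shift z s))) \<partial>lborel)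
   <= (\<integral>\<^sup>+s. ennreal (\<sigma> (fst z - s *\<^sub>R snd z) * exp (- primitive (%r. \<sigma> (fst z - r *\<^sub>R snd z)) s)) * indicator {0..D} s \<partial>lborel)"
  by (intro nn_integral_mono) (auto simp: indicator_def att_def mult.commute dest: le)
 also have "\<dots> <= 1"
  by (rule nn_integral_absorption[OF \<sigma>_line_continuous]) (rule less_imp_le[OF \<sigma>_pos])
 finally show ?thesis .
qed

lemma nn_integral_att_backward:
 assumes "z \<in> space (phase_measure X)"
 shows "(\<integral>\<^sup>+s. indicator (chord X) (shift z (- s), s) * ennreal (att (shift z (- s), s) * \<sigma> (fst (shift z (- s)))) \<partial>lborel) <= 1"
proof -
 have "norm (snd z) = 1" using assms by auto
 note le = chord_shift_length[OF _ this]
 have "(\<integral>\<^sup>+s. indicator (chord X) (shift z (- s), s) * ennreal (att (shift z (- s), s) * \<sigma> (fst (shift z (- s)))) \<partial>lborel)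
   <= (\<integral>\<^sup>+s. ennreal (\<sigma> (fst z + s *\<^sub>R snd z) * exp (- primitive (%r. \<sigma> (fst z + r *\<^sub>R snd z)) s)) * indicator {0..D} s \<partial>lborel)"
  by (intro nn_integral_mono) (auto simp: indicator_def att_shift_minus mult.commute dest: le)
 also have "\<dots> <= 1"
  by (rule nn_integral_absorption[OF \<sigma>_line_continuous']) (rule less_imp_le[OF \<sigma>_pos])
 finally show ?thesis .
qed

text \<open>Only lengths below \<open>a\<close> contribute and the attenuation is at most 1, so the
  norm is at most \<open>a\<close>. This disposes of the short-range singularity of the averaged
  kernel.\<close>

lemma transport_truncated:
 assumes "0 <= a"
 shows "bounded_operator_L2 (phase_measure X) (phase_measure X) a (transport X (%w. indicator {..<a} (snd w) * att w))"
proof (rule bounded_operator_L2_transport(1))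
 have *: "(\<integral>\<^sup>+s. indicator (chord X) (g s, s) * ennreal (indicator {..<a} s * att (g s, s)) \<partial>lborel) <= ennreal a" for g
 proof -
  have "(\<integral>\<^sup>+s. indicator (chord X) (g s, s) * ennreal (indicator {..<a} s * att (g s, s)) \<partial>lborel)
    <= (\<integral>\<^sup>+s. indicator {0..a} s \<partial>lborel)"
   using att_bounds by (intro nn_integral_mono) (auto simp: indicator_def chord_def)
  then show ?thesis using assms by simp
 qed
 show "(\<integral>\<^sup>+s. indicator (chord X) (z, s) * ennreal (indicator {..<a} (snd (z, s)) * att (z, s)) \<partial>lborel) <= ennreal a" for z
  using *[of "%_. z"] by simp
 show "(\<integral>\<^sup>+s. indicator (chord X) (shift z (- s), s) * ennreal (indicator {..<a} (snd (shift z (- s), s)) * att (shift z (- s), s)) \<partial>lborel) <= ennreal a" for z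
  using *[of "%s. shift z (- s)"] by simp
 show "(%w. indicator {..<a} (snd w) * att w) \<in> borel_measurable borel" by measurable
 show "0 <= indicator {..<a} (snd w) * att w" for w :: "('a \<times> 'a) \<times> real"
  by (intro mult_nonneg_nonneg less_imp_le[OF att_bounds(1)]) simp
qed (use assms in simp)

lemma L_operator: "bounded_operator_L2 (phase_measure X) (phase_measure X) D L"
 and L_integrable: "q \<in> L2 (phase_measure X) ==>
   AE z in phase_measure X. integrable lborel (%s. indicator (chord X) (z, s) * att (z, s) * q (shift z s))"
proof -
 have 1: "(\<integral>\<^sup>+s. indicator (chord X) (z, s) * ennreal (att (z, s)) \<partial>lborel) <= ennreal D"
  if "z \<in> space (phase_measure X)" for z
  using nn_integral_chord_bound[of "%s. att (z, s)" 1 "%s. (z, s) \<in> chord X"] att_bounds(2) chord_length[of z _] that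
  by (auto simp: indicator_def)
 have 2: "(\<integral>\<^sup>+s. indicator (chord X) (shift z (- s), s) * ennreal (att (shift z (- s), s)) \<partial>lborel) <= ennreal D"
  if "z \<in> space (phase_measure X)" for z
  using nn_integral_chord_bound[of "%s. att (shift z (- s), s)" 1 "%s. (shift z (- s), s) \<in> chord X"] att_bounds(2)
   chord_shift_length[of z _] that
  by (auto simp: indicator_def)
 show "bounded_operator_L2 (phase_measure X) (phase_measure X) D L"
  unfolding L_def by (rule bounded_operator_L2_transport(1)) (use 1 2 D_pos att_bounds(1) in \<open>auto intro: less_imp_le\<close>)
 show "q \<in> L2 (phase_measure X) ==>
   AE z in phase_measure X. integrable lborel (%s. indicator (chord X) (z, s) * att (z, s) * q (shift z s))"
  by (rule bounded_operator_L2_transport(2)[where C = D]) (use 1 2 D_pos att_bounds(1) in \<open>auto intro: less_imp_le\<close>)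
qed

lemma scattering_operator:
 "bounded_operator_L2 (phase_measure X) (phase_measure X) (C * sphere_area) (scattering k)"
proof (rule bounded_operator_L2_scattering)
 show "(%(z, th'). k (fst z) (snd z) th') \<in> borel_measurable (phase_measure X \<Otimes>\<^sub>M sphere_measure)"
  unfolding split_beta' by measurable
qed (use k_bounds C_nonneg in auto)

lemma L_weighted:
 assumes q: "q \<in> L2 (phase_measure X)"
 shows "(\<integral>\<^sup>+z. ennreal (\<sigma> (fst z) * (L q z)\<^sup>2) \<partial>phase_measure X) <= (\<integral>\<^sup>+z. ennreal ((q z)\<^sup>2 / \<sigma> (fst z)) \<partial>phase_measure X)"
proof -
 let ?N = "%z. \<integral>\<^sup>+s. indicator (chord X) (z, s) * ennreal (att (z, s) * \<bar>q (shift z s)\<bar>) \<partial>lborel"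
 have "ennreal (\<sigma> (fst z) * (L q z)\<^sup>2) <= ennreal (\<sigma> (fst z)) * (?N z)\<^sup>2" for z
 proof -
  have "ennreal \<bar>L q z\<bar> <= (\<integral>\<^sup>+s. ennreal \<bar>indicator (chord X) (z, s) * att (z, s) * q (shift z s)\<bar> \<partial>lborel)"
   unfolding L_def transport_def by (rule ennreal_abs_integral_le)
  also have "\<dots> = ?N z"
   using less_imp_le[OF att_bounds(1)] by (intro nn_integral_cong) (auto simp: indicator_def abs_mult)
  finally have "(ennreal \<bar>L q z\<bar>)\<^sup>2 <= (?N z)\<^sup>2" by (rule power_mono) simp
  then show ?thesis
   using less_imp_le[OF \<sigma>_pos] by (simp add: ennreal_power ennreal_mult mult_left_mono)
 qed
 then have "(\<integral>\<^sup>+z. ennreal (\<sigma> (fst z) * (L q z)\<^sup>2) \<partial>phase_measure X) <= (\<integral>\<^sup>+z. ennreal (\<sigma> (fst z)) * (?N z)\<^sup>2 \<partial>phase_measure X)"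
  by (rule nn_integral_mono)
 also have "\<dots> <= 1 * 1 * (\<integral>\<^sup>+z. ennreal ((q z)\<^sup>2 / \<sigma> (fst z)) \<partial>phase_measure X)"
 proof (rule transport_Schur[where p = "%z. \<sigma> (fst z)" and c = "%z. \<sigma> (fst z)"])
  show "(%z. \<sigma> (fst z)) \<in> borel_measurable (borel :: ('a \<times> 'a) measure)" by measurable
 qed (use q att_bounds(1) \<sigma>_pos nn_integral_att_forward nn_integral_att_backward in \<open>auto simp: L2_def intro: less_imp_le\<close>)
 finally show ?thesis by simp
qed

text \<open>Cauchy-Schwarz with weight \<open>k\<close> splits off the integral of \<open>k\<close>
  over its last variable, at most \<open>\<kappa> * \<sigma>\<close>, which absorbs the weight
  \<open>1 / \<sigma>\<close>. After Fubini the integral of \<open>k\<close> over the other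
  direction appears; by symmetry it obeys the same bound and supplies the second factor
  \<open>\<kappa>\<close>.\<close>

lemma scattering_weighted:
 assumes u: "u \<in> L2 (phase_measure X)"
 shows "(\<integral>\<^sup>+z. ennreal ((scattering k u z)\<^sup>2 / \<sigma> (fst z)) \<partial>phase_measure X)
  <= ennreal (\<kappa>\<^sup>2) * (\<integral>\<^sup>+z. ennreal (\<sigma> (fst z) * (u z)\<^sup>2) \<partial>phase_measure X)"
proof -
 note [measurable] = L2_measurable[OF u]
 let ?h = "%x th th'. ennreal (k x th th' * (u (x, th'))\<^sup>2)"
 have "(\<integral>\<^sup>+z. ennreal ((scattering k u z)\<^sup>2 / \<sigma> (fst z)) \<partial>phase_measure X)
   <= (\<integral>\<^sup>+z. ennreal \<kappa> * (\<integral>\<^sup>+th'. ?h (fst z) (snd z) th' \<partial>sphere_measure) \<partial>phase_measure X)"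
 proof (rule nn_integral_mono_AE, use subcritical AE_space in eventually_elim)
  case (elim z)
  obtain x th where z: "z = (x, th)" by (cases z)
  have [measurable]: "x \<in> space (space_measure X)" using elim(2) z by auto
  have "ennreal \<bar>scattering k u z\<bar> <= (\<integral>\<^sup>+th'. ennreal \<bar>k x th th' * u (x, th')\<bar> \<partial>sphere_measure)"
   unfolding scattering_def z split by (rule ennreal_abs_integral_le)
  also have "\<dots> = (\<integral>\<^sup>+th'. ennreal (sqrt (k x th th')) * ennreal (sqrt (k x th th') * \<bar>u (x, th')\<bar>) \<partial>sphere_measure)"
   using k_bounds(1) by (intro nn_integral_cong) (simp add: ennreal_mult[symmetric] abs_mult flip: mult.assoc)
  finally have "(ennreal \<bar>scattering k u z\<bar>)\<^sup>2 <= (\<integral>\<^sup>+th'. ennreal (sqrt (k x th th')) * ennreal (sqrt (k x th th') * \<bar>u (x, th')\<bar>) \<partial>sphere_measure)\<^sup>2"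
   by (rule power_mono) simp
  also have "\<dots> <= (\<integral>\<^sup>+th'. (ennreal (sqrt (k x th th')))\<^sup>2 \<partial>sphere_measure) * (\<integral>\<^sup>+th'. (ennreal (sqrt (k x th th') * \<bar>u (x, th')\<bar>))\<^sup>2 \<partial>sphere_measure)"
   by (rule Cauchy_Schwarz_nn_integral) measurable
  also have "\<dots> = (\<integral>\<^sup>+th'. ennreal (k x th th') \<partial>sphere_measure) * (\<integral>\<^sup>+th'. ?h x th th' \<partial>sphere_measure)"
   using k_bounds(1) by (simp add: ennreal_power power_mult_distrib)
  also have "\<dots> <= ennreal (\<kappa> * \<sigma> x) * (\<integral>\<^sup>+th'. ?h x th th' \<partial>sphere_measure)"
   using elim(1) by (intro mult_right_mono) (auto simp: z)
  finally have "ennreal (1 / \<sigma> x) * (ennreal \<bar>scattering k u z\<bar>)\<^sup>2 <= ennreal (1 / \<sigma> x) * (ennreal (\<kappa> * \<sigma> x) * (\<integral>\<^sup>+th'. ?h x th th' \<partial>sphere_measure))"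
   by (rule mult_left_mono) simp
  moreover have "ennreal (1 / \<sigma> x) * ennreal (\<kappa> * \<sigma> x) = ennreal \<kappa>"
   using \<sigma>_pos[of x] \<kappa>_bounds by (simp add: ennreal_mult[symmetric])
  moreover have "ennreal (1 / \<sigma> x) * (ennreal \<bar>scattering k u z\<bar>)\<^sup>2 = ennreal ((scattering k u z)\<^sup>2 / \<sigma> x)"
   using less_imp_le[OF \<sigma>_pos[of x]] by (simp add: ennreal_power ennreal_mult[symmetric])
  ultimately show ?case by (simp add: z mult.assoc[symmetric])
 qed
 also have "\<dots> = ennreal \<kappa> * (\<integral>\<^sup>+z. (\<integral>\<^sup>+th'. ?h (fst z) (snd z) th' \<partial>sphere_measure) \<partial>phase_measure X)"
  by (rule nn_integral_cmult) measurable
 also have "(\<integral>\<^sup>+z. (\<integral>\<^sup>+th'. ?h (fst z) (snd z) th' \<partial>sphere_measure) \<partial>phase_measure X)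
   = (\<integral>\<^sup>+x. (\<integral>\<^sup>+th. (\<integral>\<^sup>+th'. ?h x th th' \<partial>sphere_measure) \<partial>sphere_measure) \<partial>space_measure X)"
 proof -
  have "(%z. \<integral>\<^sup>+th'. ?h (fst z) (snd z) th' \<partial>sphere_measure) \<in> borel_measurable (phase_measure X)" by measurable
  from sphere_measure.nn_integral_fst[OF this, symmetric] show ?thesis by simp
 qed
 also have "\<dots> = (\<integral>\<^sup>+x. (\<integral>\<^sup>+th'. (\<integral>\<^sup>+th. ?h x th th' \<partial>sphere_measure) \<partial>sphere_measure) \<partial>space_measure X)"
 proof (rule nn_integral_cong)
  fix x assume [measurable]: "x \<in> space (space_measure X)"
  show "(\<integral>\<^sup>+th. (\<integral>\<^sup>+th'. ?h x th th' \<partial>sphere_measure) \<partial>sphere_measure) = (\<integral>\<^sup>+th'. (\<integral>\<^sup>+th. ?h x th th' \<partial>sphere_measure) \<partial>sphere_measure)"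
   by (rule sphere_sphere.Fubini'[symmetric]) measurable
 qed
 also have "\<dots> = (\<integral>\<^sup>+x. (\<integral>\<^sup>+th'. ennreal ((u (x, th'))\<^sup>2) * (\<integral>\<^sup>+th. ennreal (k x th' th) \<partial>sphere_measure) \<partial>sphere_measure) \<partial>space_measure X)"
 proof (rule nn_integral_cong, rule nn_integral_cong)
  fix x th' assume x: "x \<in> space (space_measure X)" and th': "th' \<in> space (sphere_measure :: 'a measure)"
  have "(\<integral>\<^sup>+th. ?h x th th' \<partial>sphere_measure) = (\<integral>\<^sup>+th. ennreal ((u (x, th'))\<^sup>2) * ennreal (k x th' th) \<partial>sphere_measure)"
   using k_sym[of x] x th' k_bounds(1) by (intro nn_integral_cong) (auto simp: ennreal_mult[symmetric] mult.commute)
  also have "\<dots> = ennreal ((u (x, th'))\<^sup>2) * (\<integral>\<^sup>+th. ennreal (k x th' th) \<partial>sphere_measure)"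
   by (rule nn_integral_cmult) measurable
  finally show "(\<integral>\<^sup>+th. ?h x th th' \<partial>sphere_measure) = \<dots>" .
 qed
 also have "\<dots> = (\<integral>\<^sup>+z. ennreal ((u z)\<^sup>2) * (\<integral>\<^sup>+th. ennreal (k (fst z) (snd z) th) \<partial>sphere_measure) \<partial>phase_measure X)"
 proof -
  have "(%z. ennreal ((u z)\<^sup>2) * (\<integral>\<^sup>+th. ennreal (k (fst z) (snd z) th) \<partial>sphere_measure)) \<in> borel_measurable (phase_measure X)" by measurable
  from sphere_measure.nn_integral_fst[OF this] show ?thesis by simp
 qed
 also have "\<dots> <= (\<integral>\<^sup>+z. ennreal \<kappa> * ennreal (\<sigma> (fst z) * (u z)\<^sup>2) \<partial>phase_measure X)"
 proof (rule nn_integral_mono_AE, use subcritical in eventually_elim)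
  case (elim z)
  have "ennreal ((u z)\<^sup>2) * (\<integral>\<^sup>+th. ennreal (k (fst z) (snd z) th) \<partial>sphere_measure) <= ennreal ((u z)\<^sup>2) * ennreal (\<kappa> * \<sigma> (fst z))"
   by (rule mult_left_mono[OF elim]) simp
  also have "\<dots> = ennreal \<kappa> * ennreal (\<sigma> (fst z) * (u z)\<^sup>2)"
   using \<kappa>_bounds(1) less_imp_le[OF \<sigma>_pos[of "fst z"]] by (simp add: ennreal_mult[symmetric] mult_ac)
  finally show ?case .
 qed
 also have "\<dots> = ennreal \<kappa> * (\<integral>\<^sup>+z. ennreal (\<sigma> (fst z) * (u z)\<^sup>2) \<partial>phase_measure X)"
  by (rule nn_integral_cmult) measurable
 finally show ?thesis
  using \<kappa>_bounds(1) by (simp add: power2_eq_square ennreal_mult mult_left_mono mult.assoc)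
qed

section \<open>Solvability of the fixed point equation\<close>

definition LK :: "('a \<times> 'a => real) => 'a \<times> 'a => real" where
 "LK u = L (scattering k u)"

lemma LK_operator: "bounded_operator_L2 (phase_measure X) (phase_measure X) (D * (C * sphere_area)) LK"
 unfolding LK_def[abs_def] by (rule bounded_operator_L2_compose[OF scattering_operator L_operator])

lemma LK_weighted:
 assumes u: "u \<in> L2 (phase_measure X)"
 shows "(\<integral>\<^sup>+z. ennreal (\<sigma> (fst z) * (LK u z)\<^sup>2) \<partial>phase_measure X)
  <= ennreal (\<kappa>\<^sup>2) * (\<integral>\<^sup>+z. ennreal (\<sigma> (fst z) * (u z)\<^sup>2) \<partial>phase_measure X)"
 unfolding LK_def
 by (rule order_trans[OF L_weighted scattering_weighted[OF u]])
  (rule bounded_operator_L2D(2)[OF scattering_operator u])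

lemma LK_fixed_point:
 assumes u: "u \<in> L2 (phase_measure X)" and e: "AE z in phase_measure X. u z = LK u z"
 shows "AE z in phase_measure X. u z = 0"
proof -
 note [measurable] = L2_measurable[OF u]
 let ?I = "\<integral>\<^sup>+z. ennreal (\<sigma> (fst z) * (u z)\<^sup>2) \<partial>phase_measure X"
 \<comment> \<open>Only for a finite \<open>?I\<close> does the inequality between \<open>?I\<close>
   and its multiple by \<open>\<kappa>^2\<close> force it to vanish; the upper bound of
   \<open>\<sigma>\<close> provides this.\<close>
 have "?I <= (\<integral>\<^sup>+z. ennreal \<sigma>\<^sub>1 * ennreal ((u z)\<^sup>2) \<partial>phase_measure X)"
  using \<sigma>_bounds(2) less_imp_le[OF \<sigma>_pos] order_trans[OF less_imp_le[OF \<sigma>_pos] \<sigma>_bounds(2)]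
  by (intro nn_integral_mono) (auto simp: ennreal_mult[symmetric] intro!: ennreal_leI mult_right_mono)
 also have "\<dots> < \<infinity>"
  using L2_norm_nn_integral[OF u] by (subst nn_integral_cmult) (auto simp: ennreal_mult_less_top)
 finally have fin: "?I < \<infinity>" .
 have "?I = (\<integral>\<^sup>+z. ennreal (\<sigma> (fst z) * (LK u z)\<^sup>2) \<partial>phase_measure X)"
  using e by (intro nn_integral_cong_AE) (auto elim!: eventually_mono)
 also have "\<dots> <= ennreal (\<kappa>\<^sup>2) * ?I" by (rule LK_weighted[OF u])
 finally have "?I <= ennreal (\<kappa>\<^sup>2) * ?I" .
 moreover obtain i where i: "?I = ennreal i" "0 <= i" using fin by (cases ?I) auto
 ultimately have "i <= \<kappa>\<^sup>2 * i" by (simp add: ennreal_mult[symmetric])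
 moreover have "\<kappa>\<^sup>2 < 1" using \<kappa>_bounds by (simp add: power_less_one_iff abs_square_less_1)
 ultimately have "i = 0" using i(2) by (metis mult_le_cancel_right1 not_less order_antisym_conv mult.commute)
 then have "?I = 0" using i(1) by simp
 then have "AE z in phase_measure X. ennreal (\<sigma> (fst z) * (u z)\<^sup>2) = 0"
  by (subst (asm) nn_integral_0_iff_AE) measurable
 then show ?thesis
 proof eventually_elim
  case (elim z)
  then have "\<sigma> (fst z) * (u z)\<^sup>2 <= 0" by (simp add: ennreal_eq_0_iff)
  then show ?case using \<sigma>_pos[of "fst z"] by (simp add: mult_le_0_iff)
 qed
qed

text \<open>\<open>LK\<close> contracts only the norm weighted by \<open>\<sigma>\<close>.
  Conjugation with \<open>sqrt \<sigma>\<close> turns that norm into the plain one, to which the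
  Neumann iteration applies; the bounds on \<open>\<sigma>\<close> from both sides keep the
  conjugation bounded on \<open>L2\<close>.\<close>

lemma LK_invertible:
 obtains B where "bounded_linear_L2 (phase_measure X) B"
  "!!h. h \<in> L2 (phase_measure X) ==> AE z in phase_measure X. B h z - LK (B h) z = h z"
proof -
 let ?M = "phase_measure X"
 define p where "p z = sqrt (\<sigma> (fst z))" for z :: "'a \<times> 'a"
 have p_pos: "p z > 0" for z using \<sigma>_pos by (simp add: p_def)
 have [measurable]: "p \<in> borel_measurable ?M" unfolding p_def[abs_def] by measurable
 have p_le: "\<bar>p z\<bar> <= sqrt \<sigma>\<^sub>1" "\<bar>1 / p z\<bar> <= 1 / sqrt \<sigma>\<^sub>0" for z
  using \<sigma>_bounds[of "fst z"] p_pos[of z] \<sigma>\<^sub>0_pos by (auto simp: p_def intro!: frac_le)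
 have P: "bounded_operator_L2 ?M ?M \<bar>sqrt \<sigma>\<^sub>1\<bar> (%f z. p z * f z)"
  by (rule bounded_operator_L2_mult) (use p_le in auto)
 have Q: "bounded_operator_L2 ?M ?M \<bar>1 / sqrt \<sigma>\<^sub>0\<bar> (%f z. 1 / p z * f z)"
  by (rule bounded_operator_L2_mult) (use p_le in auto)
 define R where "R f z = - (p z * LK (%z. 1 / p z * f z) z)" for f z
 have R: "bounded_linear_L2 ?M R"
  unfolding R_def[abs_def]
  by (rule bounded_operator_imp_bounded_linear_L2,
    rule bounded_operator_L2_uminus[OF bounded_operator_L2_compose[OF bounded_operator_L2_compose[OF Q LK_operator] P]])
 have contr: "L2_norm ?M (R f) <= \<kappa> * L2_norm ?M f" if f: "f \<in> L2 ?M" for f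
 proof (rule L2_norm_le)
  show "R f \<in> borel_measurable ?M" using bounded_linear_L2D(1)[OF R f] by (rule L2_measurable)
  let ?g = "%z. 1 / p z * f z"
  have "(\<integral>\<^sup>+z. ennreal ((R f z)\<^sup>2) \<partial>?M) = (\<integral>\<^sup>+z. ennreal (\<sigma> (fst z) * (LK ?g z)\<^sup>2) \<partial>?M)"
   using less_imp_le[OF \<sigma>_pos] by (simp add: R_def p_def power_mult_distrib)
  also have "\<dots> <= ennreal (\<kappa>\<^sup>2) * (\<integral>\<^sup>+z. ennreal (\<sigma> (fst z) * (?g z)\<^sup>2) \<partial>?M)"
   by (rule LK_weighted[OF bounded_operator_L2D(2)[OF Q f]])
  also have "(\<integral>\<^sup>+z. ennreal (\<sigma> (fst z) * (?g z)\<^sup>2) \<partial>?M) = (\<integral>\<^sup>+z. ennreal ((f z)\<^sup>2) \<partial>?M)"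
  proof (rule nn_integral_cong)
   fix z
   show "ennreal (\<sigma> (fst z) * (?g z)\<^sup>2) = ennreal ((f z)\<^sup>2)"
    using \<sigma>_pos[of "fst z"] less_imp_le[OF \<sigma>_pos[of "fst z"]]
    by (simp add: p_def power_mult_distrib power_divide)
  qed
  also have "ennreal (\<kappa>\<^sup>2) * \<dots> = ennreal ((\<kappa> * L2_norm ?M f)\<^sup>2)"
   by (simp add: L2_norm_nn_integral[OF f] ennreal_mult[symmetric] power_mult_distrib)
  finally show "(\<integral>\<^sup>+z. ennreal ((R f z)\<^sup>2) \<partial>?M) <= ennreal ((\<kappa> * L2_norm ?M f)\<^sup>2)" .
 qed (use \<kappa>_bounds in simp)
 obtain B where B: "bounded_linear_L2 ?M B" "!!h. h \<in> L2 ?M ==> AE z in ?M. B h z + R (B h) z = h z"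
  using phase.contraction_solvable_L2[OF R \<kappa>_bounds contr] by blast
 obtain K where BK: "bounded_operator_L2 ?M ?M K B"
  using bounded_linear_imp_bounded_operator_L2[OF B(1)] by blast
 define B' where "B' h z = 1 / p z * B (%z. p z * h z) z" for h z
 have "bounded_linear_L2 ?M B'"
  unfolding B'_def[abs_def]
  by (rule bounded_operator_imp_bounded_linear_L2,
    rule bounded_operator_L2_compose[OF bounded_operator_L2_compose[OF P BK] Q])
 moreover have "AE z in ?M. B' h z - LK (B' h) z = h z" if h: "h \<in> L2 ?M" for h
  using B(2)[OF bounded_operator_L2D(2)[OF P h]]
 proof eventually_elim
  case (elim z)
  have "p z * (B' h z - LK (B' h) z) = p z * h z"
   using elim p_pos[of z] by (simp add: R_def B'_def[abs_def] right_diff_distrib)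
  then show ?case using p_pos[of z] by simp
 qed
 ultimately show ?thesis by (rule that)
qed

text \<open>The forward problem integrated along characteristics, with the zero inflow condition
  built in. No derivative and no trace occur; the equivalence with \<open>forward_solution\<close>
  is \<open>forward_solution_iff_mild\<close>.\<close>

definition mild :: "('a => real) => ('a \<times> 'a => real) => bool" where
 "mild f u \<longleftrightarrow> u \<in> L2 (phase_measure X) &
   (AE z in phase_measure X. u z = L (%z. f (fst z) + scattering k u z) z)"

lemma mild_operator:
 obtains G K where "bounded_operator_L2 (space_measure X) (phase_measure X) K G"
  "!!f. f \<in> L2 (space_measure X) ==> mild f (G f)"
proof -
 let ?M = "phase_measure X"
 obtain B where B: "bounded_linear_L2 ?M B" "!!h. h \<in> L2 ?M ==> AE z in ?M. B h z - LK (B h) z = h z"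
  using LK_invertible by blast
 obtain K where BK: "bounded_operator_L2 ?M ?M K B"
  using bounded_linear_imp_bounded_operator_L2[OF B(1)] by blast
 note J = bounded_operator_L2_lift and LD = bounded_operator_L2D[OF L_operator]
 define G where "G f = B (L (%z. f (fst z)))" for f
 have G: "bounded_operator_L2 (space_measure X) ?M (K * (D * sqrt sphere_area)) G"
  unfolding G_def[abs_def] by (rule bounded_operator_L2_compose[OF bounded_operator_L2_compose[OF J L_operator] BK])
 have "mild f (G f)" if f: "f \<in> L2 (space_measure X)" for f
  unfolding mild_def
 proof
  show GL: "G f \<in> L2 ?M" by (rule bounded_operator_L2D(2)[OF G f])
  have Jf: "(%z. f (fst z)) \<in> L2 ?M" by (rule bounded_operator_L2D(2)[OF J f])
  have Kf: "scattering k (G f) \<in> L2 ?M" by (rule bounded_operator_L2D(2)[OF scattering_operator GL])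
  show "AE z in ?M. G f z = L (%z. f (fst z) + scattering k (G f) z) z"
   using LD(4)[OF Jf Kf] B(2)[OF LD(2)[OF Jf]]
   by eventually_elim (simp add: G_def LK_def)
 qed
 with G show ?thesis by (rule that)
qed

lemma mild_unique:
 assumes f: "f \<in> L2 (space_measure X)" and u: "mild f u" and v: "mild f v"
 shows "AE z in phase_measure X. u z = v z"
proof -
 let ?M = "phase_measure X"
 note LD = bounded_operator_L2D[OF L_operator]
 have uL: "u \<in> L2 ?M" and vL: "v \<in> L2 ?M" using u v by (auto simp: mild_def)
 have Jf: "(%z. f (fst z)) \<in> L2 ?M" by (rule bounded_operator_L2D(2)[OF bounded_operator_L2_lift f])
 have KL: "scattering k w \<in> L2 ?M" if "w \<in> L2 ?M" for w by (rule bounded_operator_L2D(2)[OF scattering_operator that])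
 have "AE z in ?M. u z - v z = LK (%z. u z - v z) z"
  using bounded_operator_L2_diff[OF LK_operator uL vL] LD(4)[OF Jf KL[OF uL]] LD(4)[OF Jf KL[OF vL]]
   u[unfolded mild_def, THEN conjunct2] v[unfolded mild_def, THEN conjunct2]
  by eventually_elim (simp add: LK_def)
 from LK_fixed_point[OF L2_diff[OF uL vL] this] show ?thesis by simp
qed

end

section \<open>Test functions and the weak equation for \<open>L\<close>\<close>

lemma primitive_continuous:
 assumes "continuous_on UNIV g"
 shows "continuous_on {0..b} (primitive g)"
 by (rule DERIV_continuous_on[where D = g]) (rule primitive_has_derivative[OF assms])

definition streaming :: "('a::euclidean_space \<times> 'a => real) => 'a \<times> 'a => real" where
 "streaming \<phi> z = frechet_derivative \<phi> (at z) (snd z, 0)"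

lemma C1_compact_supportD:
 fixes \<phi> :: "'a::euclidean_space \<times> 'a => real"
 assumes "C1_compact_support U \<phi>"
 shows "(\<phi> has_derivative frechet_derivative \<phi> (at z)) (at z)"
  and "continuous_on UNIV \<phi>" and "continuous_on UNIV (streaming \<phi>)"
  and "\<exists>K. compact K & K \<subseteq> U & (\<forall>z. z \<notin> K \<longrightarrow> \<phi> z = 0 & streaming \<phi> z = 0)"
proof -
 have d: "\<phi> differentiable_on UNIV" and p: "!!b. b \<in> Basis ==> continuous_on UNIV (%z. frechet_derivative \<phi> (at z) b)"
  using assms by (auto simp: C1_compact_support_def)
 show D: "(\<phi> has_derivative frechet_derivative \<phi> (at z)) (at z)" for z
 proof -
  have "\<phi> differentiable at z" using d unfolding differentiable_on_def by blast
  then show ?thesis by (simp only: frechet_derivative_works)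
 qed
 show "continuous_on UNIV \<phi>" using d by (rule differentiable_imp_continuous_on)
 have "streaming \<phi> z = (\<Sum>b\<in>Basis. ((snd z, 0) \<bullet> b) * frechet_derivative \<phi> (at z) b)" for z
 proof -
  interpret bounded_linear "frechet_derivative \<phi> (at z)" by (rule has_derivative_bounded_linear[OF D])
  have "streaming \<phi> z = frechet_derivative \<phi> (at z) (\<Sum>b\<in>Basis. ((snd z, 0) \<bullet> b) *\<^sub>R b)"
   by (simp add: streaming_def euclidean_representation)
  then show ?thesis by (simp add: sum scaleR)
 qed
 then show "continuous_on UNIV (streaming \<phi>)"
  by (simp add: continuous_intros p cong: continuous_on_cong)
 obtain K where K: "compact K" "K \<subseteq> U" "!!z. z \<notin> K ==> \<phi> z = 0"
  using assms by (auto simp: C1_compact_support_def)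
 have "streaming \<phi> z = 0" if "z \<notin> K" for z
 proof -
  have "(\<phi> has_derivative (%_. 0)) (at z)"
   by (rule has_derivative_transform_within_open[of "%_. 0" _ _ _ "- K"])
    (use that K compact_imp_closed[OF K(1)] in \<open>auto simp: open_Compl\<close>)
  from has_derivative_unique[OF D this] show ?thesis by (simp add: streaming_def)
 qed
 then show "\<exists>K. compact K & K \<subseteq> U & (\<forall>z. z \<notin> K \<longrightarrow> \<phi> z = 0 & streaming \<phi> z = 0)"
  using K by blast
qed

lemma C1_compact_support_bounded:
 fixes \<phi> :: "'a::euclidean_space \<times> 'a => real"
 assumes "C1_compact_support U \<phi>"
 obtains B where "0 <= B" "!!z. \<bar>\<phi> z\<bar> <= B" "!!z. \<bar>streaming \<phi> z\<bar> <= B"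
proof -
 note C = C1_compact_supportD[OF assms]
 obtain K where K: "compact K" "!!z. z \<notin> K ==> \<phi> z = 0 & streaming \<phi> z = 0" using C(4) by blast
 have "compact ((%z. (\<phi> z, streaming \<phi> z)) ` K)"
  by (intro compact_continuous_image K continuous_intros continuous_on_subset[OF C(2)] continuous_on_subset[OF C(3)]) auto
 then obtain B where B: "!!z. z \<in> K ==> norm (\<phi> z, streaming \<phi> z) <= B"
  using compact_imp_bounded bounded_iff by (metis (mono_tags, lifting) imageI)
 have "\<bar>\<phi> z\<bar> <= max 0 B & \<bar>streaming \<phi> z\<bar> <= max 0 B" for z
 proof (cases "z \<in> K")
  case True
  then show ?thesis
   using B[OF True] norm_fst_le[of "\<phi> z" "streaming \<phi> z"] norm_snd_le[of "streaming \<phi> z" "\<phi> z"] by auto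
 qed (use K(2) in auto)
 then show ?thesis using that[of "max 0 B"] by auto
qed

lemma C1_line_derivative:
 fixes \<phi> :: "'a::euclidean_space \<times> 'a => real"
 assumes "C1_compact_support U \<phi>"
 shows "((%s. \<phi> (shift z (- s))) has_real_derivative streaming \<phi> (shift z (- s))) (at s within S)"
proof -
 let ?F = "frechet_derivative \<phi> (at (shift z (- s)))"
 interpret bounded_linear ?F by (rule has_derivative_bounded_linear[OF C1_compact_supportD(1)[OF assms]])
 have "((%s. shift z (- s)) has_derivative (%h. (h *\<^sub>R snd z, 0))) (at s within S)"
  unfolding shift_def by (auto intro!: derivative_eq_intros)
 from has_derivative_compose[OF this C1_compact_supportD(1)[OF assms]]
 have "((%s. \<phi> (shift z (- s))) has_derivative (%h. ?F (h *\<^sub>R snd z, 0))) (at s within S)" .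
 moreover have "?F (h *\<^sub>R snd z, 0) = streaming \<phi> (shift z (- s)) * h" for h
  using scaleR[of h "(snd z, 0)"] by (simp add: streaming_def mult.commute)
 ultimately show ?thesis by (simp add: has_field_derivative_def)
qed

context bounded_domain
begin

text \<open>The exit time is the least parameter at which the ray is outside \<open>X\<close>; there
  is one because chords are shorter than \<open>D\<close>. As \<open>X\<close> is open, the exit
  point lies outside and the admissible lengths form a half-open interval.\<close>

lemma forward_exit_time:
 assumes z: "z \<in> space (phase_measure X)"
 obtains \<tau> where "0 < \<tau>" "fst z + \<tau> *\<^sub>R snd z \<notin> X" "!!s. (shift z (- s), s) \<in> chord X \<longleftrightarrow> 0 <= s & s < \<tau>"
proof -
 define N where "N = {s \<in> {0..D}. fst z + s *\<^sub>R snd z \<notin> X}"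
 have c: "closed {s. fst z + s *\<^sub>R snd z \<notin> X}"
 proof -
  have "open ((%s. fst z + s *\<^sub>R snd z) -` X)" by (intro open_vimage open_X continuous_intros)
  then show ?thesis by (simp add: closed_def Collect_neg_eq[symmetric] vimage_def)
 qed
 have "N = {0..D} \<inter> {s. fst z + s *\<^sub>R snd z \<notin> X}" by (auto simp: N_def)
 then have "compact N" using c by (simp add: compact_Int_closed)
 have nz: "norm (snd z) = 1" using z by auto
 have "N \<noteq> {}"
 proof
  assume "N = {}"
  then have "(shift z (- D), D) \<in> chord X" unfolding chord_shift_minus using D_pos by (auto simp: N_def)
  from chord_shift_length(2)[OF this nz] show False by simp
 qed
 then obtain \<tau> where \<tau>: "\<tau> \<in> N" "!!s. s \<in> N ==> \<tau> <= s"
  using compact_attains_inf[OF \<open>compact N\<close>] by blast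
 have "\<tau> \<noteq> 0" using \<tau>(1) z by (auto simp: N_def)
 show ?thesis
 proof
  show "0 < \<tau>" using \<tau>(1) \<open>\<tau> \<noteq> 0\<close> by (auto simp: N_def)
  show "fst z + \<tau> *\<^sub>R snd z \<notin> X" using \<tau>(1) by (auto simp: N_def)
  show "(shift z (- s), s) \<in> chord X \<longleftrightarrow> 0 <= s & s < \<tau>" for s
  proof
   assume c: "(shift z (- s), s) \<in> chord X"
   then have "s < \<tau>" using \<tau>(1) unfolding chord_shift_minus N_def by (auto simp: not_less[symmetric])
   then show "0 <= s & s < \<tau>" using chord_shift_length(1)[OF c nz] by simp
  next
   assume s: "0 <= s & s < \<tau>"
   have "fst z + r *\<^sub>R snd z \<in> X" if "r \<in> {0..s}" for r
    using \<tau>(2)[of r] \<tau>(1) that s by (force simp: N_def)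
   then show "(shift z (- s), s) \<in> chord X" unfolding chord_shift_minus using s by auto
  qed
 qed
qed

lemma integral_chord_shift:
 fixes G :: "('a \<times> 'a) \<times> real => real"
 assumes [measurable]: "G \<in> borel_measurable borel"
  and fin: "(\<integral>\<^sup>+z. (\<integral>\<^sup>+s. indicator (chord X) (z, s) * ennreal \<bar>G (z, s)\<bar> \<partial>lborel) \<partial>phase_measure X) < \<infinity>"
 shows "(\<integral>z. (\<integral>s. indicator (chord X) (z, s) * G (z, s) \<partial>lborel) \<partial>phase_measure X)
  = (\<integral>z. (\<integral>s. indicator (chord X) (shift z (- s), s) * G (shift z (- s), s) \<partial>lborel) \<partial>phase_measure X)"
proof -
 let ?P = "phase_measure X \<Otimes>\<^sub>M (lborel :: real measure)"
 let ?\<tau> = "%w. (shift (fst w) (- snd w), snd w)"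
 have \<tau>[measurable]: "?\<tau> \<in> borel_measurable (borel :: (('a \<times> 'a) \<times> real) measure)"
  unfolding shift_def by measurable
 define H where "H w = indicator (chord X) w * G w" for w
 have [measurable]: "H \<in> borel_measurable borel" unfolding H_def by measurable
 have H\<tau>: "(%w. H (?\<tau> w)) \<in> borel_measurable borel" using measurable_compose[OF \<tau>] by measurable
 note [measurable] = borel_measurable_phase_line[OF \<open>H \<in> _\<close>] borel_measurable_phase_line[OF H\<tau>]
 \<comment> \<open>Since \<open>ennreal\<close> cuts off negative values, one identity serves three
   times: \<open>abs\<close> gives integrability, the identity and negation give the two halves of
   the Bochner integral.\<close>
 have nn: "(\<integral>\<^sup>+w. ennreal (f (H w)) \<partial>?P) = (\<integral>\<^sup>+w. ennreal (f (H (?\<tau> w))) \<partial>?P)"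
  if [measurable]: "f \<in> borel_measurable borel" and f0: "f 0 = 0" for f :: "real => real"
 proof -
  have "(\<integral>\<^sup>+w. ennreal (f (H w)) \<partial>?P) = (\<integral>\<^sup>+z. (\<integral>\<^sup>+s. ennreal (f (H (z, s))) \<partial>lborel) \<partial>phase_measure X)"
   by (rule lborel.nn_integral_fst[symmetric]) measurable
  also have "\<dots> = (\<integral>\<^sup>+z. (\<integral>\<^sup>+s. indicator (chord X) (z, s) * ennreal (f (G (z, s))) \<partial>lborel) \<partial>phase_measure X)"
   using f0 by (intro nn_integral_cong) (auto simp: H_def indicator_def)
  also have "\<dots> = (\<integral>\<^sup>+z. (\<integral>\<^sup>+s. indicator (chord X) (shift z (- s), s) * ennreal (f (G (shift z (- s), s))) \<partial>lborel) \<partial>phase_measure X)"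
   by (rule nn_integral_chord_shift) measurable
  also have "\<dots> = (\<integral>\<^sup>+z. (\<integral>\<^sup>+s. ennreal (f (H (?\<tau> (z, s)))) \<partial>lborel) \<partial>phase_measure X)"
   using f0 by (intro nn_integral_cong) (auto simp: H_def indicator_def)
  also have "\<dots> = (\<integral>\<^sup>+w. ennreal (f (H (?\<tau> w))) \<partial>?P)"
   by (rule lborel.nn_integral_fst) measurable
  finally show ?thesis .
 qed
 have "(\<integral>\<^sup>+w. ennreal \<bar>H w\<bar> \<partial>?P) < \<infinity>"
 proof -
  have "(\<integral>\<^sup>+w. ennreal \<bar>H w\<bar> \<partial>?P) = (\<integral>\<^sup>+z. (\<integral>\<^sup>+s. ennreal \<bar>H (z, s)\<bar> \<partial>lborel) \<partial>phase_measure X)"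
   by (rule lborel.nn_integral_fst[symmetric]) measurable
  also have "\<dots> = (\<integral>\<^sup>+z. (\<integral>\<^sup>+s. indicator (chord X) (z, s) * ennreal \<bar>G (z, s)\<bar> \<partial>lborel) \<partial>phase_measure X)"
   by (intro nn_integral_cong) (auto simp: H_def indicator_def)
  finally show ?thesis using fin by simp
 qed
 then have i1: "integrable ?P H" and i2: "integrable ?P (%w. H (?\<tau> w))"
  using nn[of abs] by (auto intro!: integrableI_bounded)
 have "(\<integral>w. H w \<partial>?P) = (\<integral>w. H (?\<tau> w) \<partial>?P)"
  using nn[of "%x. x"] nn[of "%x. - x"] by (simp add: real_lebesgue_integral_def i1 i2)
 then show ?thesis
  using phase_line.integral_fst'[OF i1] phase_line.integral_fst'[OF i2] by (simp add: H_def[abs_def])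
qed

end

context transport_problem
begin

text \<open>The adjoint of \<open>L\<close>: instead of collecting backwards from \<open>z\<close>,
  it collects forwards, with the attenuation from \<open>z\<close> to the point reached.\<close>

definition Ladj :: "('a \<times> 'a => real) => 'a \<times> 'a => real" where
 "Ladj \<psi> z = (\<integral>s. indicator (chord X) (shift z (- s), s) * (att (shift z (- s), s) * \<psi> (shift z (- s))) \<partial>lborel)"

lemma Ladj_integrable:
 assumes z: "z \<in> space (phase_measure X)" and \<psi>: "continuous_on UNIV \<psi>"
 shows "integrable lborel (%s. indicator (chord X) (shift z (- s), s) * (att (shift z (- s), s) * \<psi> (shift z (- s))))"
proof -
 obtain \<tau> where \<tau>: "0 < \<tau>" "!!s. (shift z (- s), s) \<in> chord X \<longleftrightarrow> 0 <= s & s < \<tau>"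
  using forward_exit_time[OF z] by blast
 have c: "continuous_on {0..\<tau>} (%s. exp (- primitive (%r. \<sigma> (fst z + r *\<^sub>R snd z)) s) * \<psi> (shift z (- s)))"
  using primitive_continuous[OF \<sigma>_line_continuous']
  by (intro continuous_intros continuous_on_compose2[OF \<psi>]) auto
 from borel_integrable_atLeastAtMost'[OF c]
 have i: "integrable lborel (%s. indicator {0..\<tau>} s * (att (shift z (- s), s) * \<psi> (shift z (- s))))"
  by (simp add: set_integrable_def att_shift_minus)
 show ?thesis
 proof (rule integrable_cong_AE_imp[OF i])
  have [measurable]: "\<psi> \<in> borel_measurable borel" using \<psi> by (rule borel_measurable_continuous_onI)
  have [measurable]: "(%s. shift z (- s)) \<in> borel_measurable borel" unfolding shift_def by measurable
  show "(%s. indicator (chord X) (shift z (- s), s) * (att (shift z (- s), s) * \<psi> (shift z (- s)))) \<in> borel_measurable lborel"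
   by measurable
  show "AE s in lborel. indicator {0..\<tau>} s * (att (shift z (- s), s) * \<psi> (shift z (- s)))
    = indicator (chord X) (shift z (- s), s) * (att (shift z (- s), s) * \<psi> (shift z (- s)))"
   using AE_lborel_singleton[of \<tau>] by eventually_elim (auto simp: indicator_def \<tau>(2))
 qed
qed

text \<open>Along the forward ray, attenuation times \<open>\<phi>\<close> has as derivative
  attenuation times \<open>streaming \<phi> - \<sigma> * \<phi>\<close>. The test function vanishes
  at the exit point, so only the value at the start remains.\<close>

lemma Ladj_streaming:
 assumes z: "z \<in> space (phase_measure X)" and \<phi>: "C1_compact_support (X \<times> UNIV) \<phi>"
 shows "Ladj (streaming \<phi>) z - Ladj (%z. \<sigma> (fst z) * \<phi> z) z = - \<phi> z"
proof -
 note C = C1_compact_supportD[OF \<phi>]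
 obtain K where K: "K \<subseteq> X \<times> UNIV" "!!z. z \<notin> K ==> \<phi> z = 0" using C(4) by blast
 obtain \<tau> where \<tau>: "0 < \<tau>" "fst z + \<tau> *\<^sub>R snd z \<notin> X" "!!s. (shift z (- s), s) \<in> chord X \<longleftrightarrow> 0 <= s & s < \<tau>"
  using forward_exit_time[OF z] by blast
 let ?E = "%s. exp (- primitive (%r. \<sigma> (fst z + r *\<^sub>R snd z)) s)"
 let ?f = "%s. ?E s * (streaming \<phi> (shift z (- s)) - \<sigma> (fst (shift z (- s))) * \<phi> (shift z (- s)))"
 have d: "((%s. ?E s * \<phi> (shift z (- s))) has_real_derivative ?f s) (at s within {0..\<tau>})" if "s \<in> {0..\<tau>}" for s
  by (rule derivative_eq_intros primitive_has_derivative[OF \<sigma>_line_continuous' that] C1_line_derivative[OF \<phi>] refl)+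
   (simp add: algebra_simps)
 have "\<phi> (shift z (- \<tau>)) = 0" using K \<tau>(2) by (metis (no_types, lifting) mem_Sigma_iff prod.collapse shift_simps(1) subsetD scaleR_minus_left diff_minus_eq_add)
 then have i: "(?f has_integral 0 - \<phi> z) {0..\<tau>}"
  using fundamental_theorem_of_calculus[of 0 \<tau> "%s. ?E s * \<phi> (shift z (- s))" ?f] d \<tau>(1)
  by (simp add: has_real_derivative_iff_has_vector_derivative)
 have c: "continuous_on {0..\<tau>} ?f"
  using primitive_continuous[OF \<sigma>_line_continuous']
  by (intro continuous_intros continuous_on_compose2[OF C(2)] continuous_on_compose2[OF C(3)] continuous_on_compose2[OF \<sigma>_cont]) auto
 have *: "(LINT s:{0..\<tau>}|lborel. ?f s) = - \<phi> z"
  using set_borel_integral_eq_integral(2)[OF borel_integrable_atLeastAtMost'[OF c]] integral_unique[OF i] by simp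
 have \<sigma>\<phi>: "continuous_on UNIV (%z. \<sigma> (fst z) * \<phi> z)"
  by (intro continuous_intros continuous_on_compose2[OF \<sigma>_cont] C(2)) auto
 have "Ladj (streaming \<phi>) z - Ladj (%z. \<sigma> (fst z) * \<phi> z) z = (\<integral>s. indicator (chord X) (shift z (- s), s) * ?f s \<partial>lborel)"
  unfolding Ladj_def Bochner_Integration.integral_diff[OF Ladj_integrable[OF z C(3)] Ladj_integrable[OF z \<sigma>\<phi>], symmetric]
  by (rule Bochner_Integration.integral_cong) (auto simp: att_shift_minus algebra_simps)
 also have "\<dots> = (LINT s:{0..\<tau>}|lborel. ?f s)"
  unfolding set_lebesgue_integral_def
 proof (rule integral_cong_AE)
  have [measurable]: "streaming \<phi> \<in> borel_measurable borel" "\<phi> \<in> borel_measurable borel"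
   using C(2,3) by (auto intro: borel_measurable_continuous_onI)
  have [measurable]: "(%s. shift z (- s)) \<in> borel_measurable borel" unfolding shift_def by measurable
  have m: "?f \<in> borel_measurable lborel" unfolding primitive_def shift_simps by measurable
  note [measurable] = m
  show "(%s. indicator (chord X) (shift z (- s), s) * ?f s) \<in> borel_measurable lborel" by measurable
  show "(%s. indicator {0..\<tau>} s *\<^sub>R ?f s) \<in> borel_measurable lborel" by measurable
  show "AE s in lborel. indicator (chord X) (shift z (- s), s) * ?f s = indicator {0..\<tau>} s *\<^sub>R ?f s"
   using AE_lborel_singleton[of \<tau>] by eventually_elim (auto simp: indicator_def \<tau>(3))
 qed
 finally show ?thesis using * by simp
qed

lemma Ladj_bounded:
 assumes z: "z \<in> space (phase_measure X)" and "!!z. \<bar>\<psi> z\<bar> <= B"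
 shows "\<bar>Ladj \<psi> z\<bar> <= D * B"
proof -
 have B: "0 <= B" using order_trans[OF abs_ge_zero assms(2)] .
 have "ennreal \<bar>Ladj \<psi> z\<bar> <= (\<integral>\<^sup>+s. ennreal \<bar>indicator (chord X) (shift z (- s), s) * (att (shift z (- s), s) * \<psi> (shift z (- s)))\<bar> \<partial>lborel)"
  unfolding Ladj_def by (rule ennreal_abs_integral_le)
 also have "\<dots> <= (\<integral>\<^sup>+s. ennreal B * indicator {0..D} s \<partial>lborel)"
 proof (rule nn_integral_mono)
  fix s
  have "\<bar>att (shift z (- s), s) * \<psi> (shift z (- s))\<bar> <= 1 * B"
   unfolding abs_mult using att_bounds[of "(shift z (- s), s)"] assms(2) by (intro mult_mono) auto
  moreover have "s \<in> {0..D}" if "(shift z (- s), s) \<in> chord X"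
   using chord_shift_length[OF that] z by auto
  ultimately show "ennreal \<bar>indicator (chord X) (shift z (- s), s) * (att (shift z (- s), s) * \<psi> (shift z (- s)))\<bar> <= ennreal B * indicator {0..D} s"
   by (auto simp: indicator_def intro!: ennreal_leI)
 qed
 also have "\<dots> = ennreal (D * B)" using D_pos B by (simp add: nn_integral_cmult ennreal_mult[symmetric] mult.commute)
 finally show ?thesis using D_pos B by simp
qed

lemma Ladj_measurable [measurable]:
 assumes [measurable]: "\<psi> \<in> borel_measurable borel"
 shows "Ladj \<psi> \<in> borel_measurable (phase_measure X)"
proof -
 define h where "h w = indicator (chord X) (shift (fst w) (- snd w), snd w) * (att (shift (fst w) (- snd w), snd w) * \<psi> (shift (fst w) (- snd w)))" for w
 have [measurable]: "(%w. shift (fst w) (- snd w)) \<in> borel_measurable (borel :: (('a \<times> 'a) \<times> real) measure)"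
  unfolding shift_def by measurable
 have "h \<in> borel_measurable borel" unfolding h_def by measurable
 note [measurable] = borel_measurable_phase_line[OF this]
 have "(%z. \<integral>s. h (z, s) \<partial>lborel) \<in> borel_measurable (phase_measure X)" by measurable
 then show ?thesis by (simp add: h_def Ladj_def[abs_def])
qed

lemma L_adjoint:
 assumes q: "q \<in> L2 (phase_measure X)" and \<psi>[measurable]: "\<psi> \<in> borel_measurable borel" and B: "!!z. \<bar>\<psi> z\<bar> <= B"
 shows "(\<integral>z. L q z * \<psi> z \<partial>phase_measure X) = (\<integral>z. q z * Ladj \<psi> z \<partial>phase_measure X)"
proof -
 have [measurable]: "zext X q \<in> borel_measurable borel" by (intro borel_measurable_zext L2_measurable q)
 have B0: "0 <= B" using order_trans[OF abs_ge_zero B] .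
 define G where "G w = att w * zext X q (shift (fst w) (snd w)) * \<psi> (fst w)" for w
 have G [measurable]: "G \<in> borel_measurable borel" unfolding G_def by measurable
 have "(\<integral>\<^sup>+z. (\<integral>\<^sup>+s. indicator (chord X) (z, s) * ennreal \<bar>G (z, s)\<bar> \<partial>lborel) \<partial>phase_measure X)
   = (\<integral>\<^sup>+z. (\<integral>\<^sup>+s. indicator (chord X) (shift z (- s), s) * ennreal \<bar>G (shift z (- s), s)\<bar> \<partial>lborel) \<partial>phase_measure X)"
  by (rule nn_integral_chord_shift) measurable
 also have "\<dots> <= (\<integral>\<^sup>+z. (\<integral>\<^sup>+s. ennreal (\<bar>q z\<bar> * B) * indicator {0..D} s \<partial>lborel) \<partial>phase_measure X)"
 proof (rule nn_integral_mono, rule nn_integral_mono)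
  fix z s assume z: "z \<in> space (phase_measure X)"
  have "\<bar>G (shift z (- s), s)\<bar> <= 1 * \<bar>q z\<bar> * B"
   unfolding G_def abs_mult using att_bounds[of "(shift z (- s), s)"] B z
   by (intro mult_mono) (auto simp: zext_eq)
  moreover have "s \<in> {0..D}" if "(shift z (- s), s) \<in> chord X"
   using chord_shift_length[OF that] z by auto
  ultimately show "indicator (chord X) (shift z (- s), s) * ennreal \<bar>G (shift z (- s), s)\<bar> <= ennreal (\<bar>q z\<bar> * B) * indicator {0..D} s"
   by (auto simp: indicator_def intro!: ennreal_leI)
 qed
 also have "\<dots> = (\<integral>\<^sup>+z. ennreal (\<bar>q z\<bar> * B * D) \<partial>phase_measure X)"
  using D_pos B0 by (simp add: nn_integral_cmult ennreal_mult[symmetric])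
 also have "\<dots> < \<infinity>"
  using phase.L2_imp_integrable[OF q] D_pos B0
  by (subst nn_integral_eq_integral) auto
 finally have fin: "(\<integral>\<^sup>+z. (\<integral>\<^sup>+s. indicator (chord X) (z, s) * ennreal \<bar>G (z, s)\<bar> \<partial>lborel) \<partial>phase_measure X) < \<infinity>" .
 have "(\<integral>z. L q z * \<psi> z \<partial>phase_measure X) = (\<integral>z. (\<integral>s. indicator (chord X) (z, s) * G (z, s) \<partial>lborel) \<partial>phase_measure X)"
 proof (rule Bochner_Integration.integral_cong[OF refl])
  fix z assume z: "z \<in> space (phase_measure X)"
  have *: "indicator (chord X) (z, s) * G (z, s) = indicator (chord X) (z, s) * att (z, s) * q (shift z s) * \<psi> z" for s
   using zext_shift[OF z, of s q] by (cases "(z, s) \<in> chord X") (auto simp: G_def)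
  then show "L q z * \<psi> z = (\<integral>s. indicator (chord X) (z, s) * G (z, s) \<partial>lborel)"
   unfolding * L_def transport_def by simp
 qed
 also have "\<dots> = (\<integral>z. (\<integral>s. indicator (chord X) (shift z (- s), s) * G (shift z (- s), s) \<partial>lborel) \<partial>phase_measure X)"
  by (rule integral_chord_shift[OF G fin])
 also have "\<dots> = (\<integral>z. q z * Ladj \<psi> z \<partial>phase_measure X)"
 proof (rule Bochner_Integration.integral_cong[OF refl])
  fix z assume z: "z \<in> space (phase_measure X)"
  have *: "indicator (chord X) (shift z (- s), s) * G (shift z (- s), s)
    = q z * (indicator (chord X) (shift z (- s), s) * (att (shift z (- s), s) * \<psi> (shift z (- s))))" for s
   using z by (simp add: G_def zext_eq)
  then show "(\<integral>s. indicator (chord X) (shift z (- s), s) * G (shift z (- s), s) \<partial>lborel) = q z * Ladj \<psi> z"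
   unfolding * Ladj_def by simp
 qed
 finally show ?thesis .
qed

lemma \<sigma>_mult_L2:
 assumes "u \<in> L2 (phase_measure X)"
 shows "(%z. \<sigma> (fst z) * u z) \<in> L2 (phase_measure X)"
 by (rule L2_mult_bounded(1)[OF assms, where C = "\<sigma>\<^sub>1"])
  (use \<sigma>_bounds(2) less_imp_le[OF \<sigma>_pos] in \<open>auto\<close>)

text \<open>Dual form of \<open>Ladj_streaming\<close>: \<open>L\<close> is moved onto the test
  function, where the derivative is classical, and the term with \<open>\<sigma>\<close> is moved
  back.\<close>

lemma L_weak_derivative:
 assumes q: "q \<in> L2 (phase_measure X)"
 shows "H12_derivative X (L q) (%z. q z - \<sigma> (fst z) * L q z)"
 unfolding H12_derivative_def
proof (intro conjI allI impI)
 let ?M = "phase_measure X"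
 show LqL: "L q \<in> L2 ?M" by (rule bounded_operator_L2D(2)[OF L_operator q])
 show "(%z. q z - \<sigma> (fst z) * L q z) \<in> L2 ?M" by (intro L2_diff q \<sigma>_mult_L2 LqL)
 fix \<phi> :: "'a \<times> 'a => real" assume \<phi>: "C1_compact_support (X \<times> UNIV) \<phi>"
 note C = C1_compact_supportD[OF \<phi>]
 obtain B where B: "0 <= B" "!!z. \<bar>\<phi> z\<bar> <= B" "!!z. \<bar>streaming \<phi> z\<bar> <= B"
  using C1_compact_support_bounded[OF \<phi>] by blast
 have [measurable]: "streaming \<phi> \<in> borel_measurable borel" "\<phi> \<in> borel_measurable borel"
  using C(2,3) by (auto intro: borel_measurable_continuous_onI)
 have \<phi>L: "\<phi> \<in> L2 ?M" by (rule phase.L2_bounded[where C = B]) (use B in \<open>auto intro: borel_measurable_phase\<close>)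
 have B': "\<bar>\<sigma> (fst z) * \<phi> z\<bar> <= \<sigma>\<^sub>1 * B" for z
  unfolding abs_mult using \<sigma>_bounds(2) less_imp_le[OF \<sigma>_pos] B order_trans[OF less_imp_le[OF \<sigma>_pos] \<sigma>_bounds(2)]
  by (intro mult_mono) auto
 have 1: "(%z. \<sigma> (fst z) * \<phi> z) \<in> borel_measurable (borel :: ('a \<times> 'a) measure)" by measurable
 have L1: "Ladj (streaming \<phi>) \<in> L2 ?M" "Ladj (%z. \<sigma> (fst z) * \<phi> z) \<in> L2 ?M"
 proof -
  show "Ladj (streaming \<phi>) \<in> L2 ?M"
   by (rule phase.L2_bounded[where C = "D * B"]) (measurable, intro AE_I2 Ladj_bounded B(3))
  show "Ladj (%z. \<sigma> (fst z) * \<phi> z) \<in> L2 ?M"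
   by (rule phase.L2_bounded[where C = "D * (\<sigma>\<^sub>1 * B)"]) (rule Ladj_measurable[OF 1], intro AE_I2 Ladj_bounded B')
 qed
 have "(\<integral>z. L q z * frechet_derivative \<phi> (at z) (snd z, 0) \<partial>?M) = (\<integral>z. q z * Ladj (streaming \<phi>) z \<partial>?M)"
  using L_adjoint[OF q, of "streaming \<phi>" B] B by (simp add: streaming_def)
 also have "\<dots> = (\<integral>z. q z * Ladj (%z. \<sigma> (fst z) * \<phi> z) z - q z * \<phi> z \<partial>?M)"
 proof (rule Bochner_Integration.integral_cong[OF refl])
  fix z assume "z \<in> space ?M"
  from Ladj_streaming[OF this \<phi>] have "Ladj (streaming \<phi>) z = Ladj (%z. \<sigma> (fst z) * \<phi> z) z - \<phi> z" by simp
  then show "q z * Ladj (streaming \<phi>) z = q z * Ladj (%z. \<sigma> (fst z) * \<phi> z) z - q z * \<phi> z"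
   by (simp add: right_diff_distrib)
 qed
 also have "\<dots> = (\<integral>z. L q z * (\<sigma> (fst z) * \<phi> z) \<partial>?M) - (\<integral>z. q z * \<phi> z \<partial>?M)"
  using L2_mult_integrable[OF q L1(2)] L2_mult_integrable[OF q \<phi>L] L_adjoint[OF q 1 B'] by simp
 also have "\<dots> = (\<integral>z. L q z * (\<sigma> (fst z) * \<phi> z) - q z * \<phi> z \<partial>?M)"
  using L2_mult_integrable[OF LqL \<sigma>_mult_L2[OF \<phi>L]] L2_mult_integrable[OF q \<phi>L] by simp
 also have "\<dots> = - (\<integral>z. (q z - \<sigma> (fst z) * L q z) * \<phi> z \<partial>?M)"
  unfolding integral_minus[symmetric] by (rule Bochner_Integration.integral_cong) (auto simp: algebra_simps)
 finally show "(\<integral>z. L q z * frechet_derivative \<phi> (at z) (snd z, 0) \<partial>?M) = - (\<integral>z. (q z - \<sigma> (fst z) * L q z) * \<phi> z \<partial>?M)" .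
qed

text \<open>\<open>inflow_trace\<close> asks for a limit along every entering characteristic, so
  nothing may be assumed about \<open>q\<close> on this particular ray. If the ray integral diverges
  for every small \<open>t\<close>, the Bochner integral is 0 by convention. If it converges for one
  \<open>t\<^sub>1\<close>, then \<open>q\<close> is integrable near the entry point, and the
  integral over a shrinking interval tends to 0.\<close>

lemma L_entering_trace:
 assumes y: "y \<notin> X" "0 < t\<^sub>0" "!!t. 0 < t ==> t < t\<^sub>0 ==> y + t *\<^sub>R th \<in> X"
 shows "((%t. L q (y + t *\<^sub>R th, th)) \<longlongrightarrow> 0) (at_right 0)"
proof -
 define h where "h r = q (y + r *\<^sub>R th, th)" for r
 define f where "f t s = indicator {0..} s * indicator {0<..} (t - s) * att ((y + t *\<^sub>R th, th), s) * h (t - s)" for t s :: real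
 have chord_iff: "((y + t *\<^sub>R th, th), s) \<in> chord X \<longleftrightarrow> 0 <= s & s < t" if t: "0 < t" "t < t\<^sub>0" for t s
 proof
  assume c: "((y + t *\<^sub>R th, th), s) \<in> chord X"
  show "0 <= s & s < t"
  proof (rule ccontr)
   assume "\<not> (0 <= s & s < t)"
   then have "t \<in> {0..s}" using c t by (auto simp: chord_def)
   moreover have "\<forall>r\<in>{0..s}. y + t *\<^sub>R th - r *\<^sub>R th \<in> X" using c by (auto simp: chord_def)
   ultimately have "y + t *\<^sub>R th - t *\<^sub>R th \<in> X" by blast
   then show False using y(1) by simp
  qed
 next
  assume s: "0 <= s & s < t"
  have "y + t *\<^sub>R th - r *\<^sub>R th \<in> X" if "r \<in> {0..s}" for r
   using y(3)[of "t - r"] that s t by (simp add: algebra_simps)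
  then show "((y + t *\<^sub>R th, th), s) \<in> chord X" using s by (auto simp: chord_def)
 qed
 have L_eq: "L q (y + t *\<^sub>R th, th) = (\<integral>s. f t s \<partial>lborel)" if t: "0 < t" "t < t\<^sub>0" for t
  unfolding L_def transport_def
  by (rule Bochner_Integration.integral_cong)
   (auto simp: f_def h_def shift_def indicator_def chord_iff[OF t] algebra_simps)
 show ?thesis
 proof (cases "\<exists>t. 0 < t & t < t\<^sub>0 & integrable lborel (f t)")
  case False
  then have "L q (y + t *\<^sub>R th, th) = 0" if "0 < t" "t < t\<^sub>0" for t
   using L_eq[OF that] that by (auto simp: not_integrable_integral_eq)
  then have "eventually (%t. L q (y + t *\<^sub>R th, th) = 0) (at_right 0)"
   unfolding eventually_at_right_field using y(2) by blast
  then show ?thesis by (rule tendsto_eventually)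
 next
  case True
  then obtain t\<^sub>1 where t1: "0 < t\<^sub>1" "t\<^sub>1 < t\<^sub>0" and i: "integrable lborel (f t\<^sub>1)" by blast
  have meas_att: "(%r. att ((y + t\<^sub>1 *\<^sub>R th, th), t\<^sub>1 - r)) \<in> borel_measurable borel" by measurable
  have i2: "integrable lborel (%r. f t\<^sub>1 (t\<^sub>1 + (-1) * r))"
   using lborel_integrable_real_affine[OF i, of "-1" t\<^sub>1] by simp
  have att_low: "exp (- \<sigma>\<^sub>1 * t\<^sub>1) <= att ((y + t\<^sub>1 *\<^sub>R th, th), s)" if s: "0 <= s" "s <= t\<^sub>1" for s
  proof -
   have "primitive (%r. \<sigma> (y + t\<^sub>1 *\<^sub>R th - r *\<^sub>R th)) s = integral {0..s} (%r. \<sigma> (y + t\<^sub>1 *\<^sub>R th - r *\<^sub>R th))"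
    by (rule primitive_eq_integral[OF \<sigma>_line_continuous])
   also have "\<dots> <= integral {0..s} (%r. \<sigma>\<^sub>1)"
    by (rule integral_le) (use \<sigma>_bounds(2) continuous_on_subset[OF \<sigma>_line_continuous] in \<open>auto intro!: integrable_continuous_real\<close>)
   also have "\<dots> = \<sigma>\<^sub>1 * s" using s by simp
   also have "\<dots> <= \<sigma>\<^sub>1 * t\<^sub>1" using s order_trans[OF less_imp_le[OF \<sigma>_pos] \<sigma>_bounds(2)] by (intro mult_left_mono) auto
   finally show ?thesis by (simp add: att_def)
  qed
  \<comment> \<open>The absolute value of \<open>q\<close> on the first stretch of the ray. It is
    integrable because the attenuation over a length of at most \<open>t\<^sub>1\<close> is at least
    \<open>exp (- \<sigma>\<^sub>1 * t\<^sub>1)\<close>.\<close>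
  define H where "H r = indicator {0<..t\<^sub>1} r * \<bar>h r\<bar>" for r
  have H_eq: "H r = \<bar>f t\<^sub>1 (t\<^sub>1 + (-1) * r)\<bar> / att ((y + t\<^sub>1 *\<^sub>R th, th), t\<^sub>1 - r)" for r
   using att_bounds(1)[of "((y + t\<^sub>1 *\<^sub>R th, th), t\<^sub>1 - r)"]
   by (auto simp: H_def f_def indicator_def abs_mult)
  have Hi: "integrable lborel H"
  proof (rule Bochner_Integration.integrable_bound)
   show "integrable lborel (%r. exp (\<sigma>\<^sub>1 * t\<^sub>1) * f t\<^sub>1 (t\<^sub>1 + (-1) * r))" using i2 by simp
   show "H \<in> borel_measurable lborel"
    unfolding H_eq[abs_def] using meas_att borel_measurable_integrable[OF i2] by (intro borel_measurable_divide borel_measurable_abs) simp_all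
   show "AE r in lborel. norm (H r) <= norm (exp (\<sigma>\<^sub>1 * t\<^sub>1) * f t\<^sub>1 (t\<^sub>1 + (-1) * r))"
   proof (rule AE_I2)
    fix r
    show "norm (H r) <= norm (exp (\<sigma>\<^sub>1 * t\<^sub>1) * f t\<^sub>1 (t\<^sub>1 + (-1) * r))"
    proof (cases "0 < r & r <= t\<^sub>1")
     case True
     have "exp (- \<sigma>\<^sub>1 * t\<^sub>1) * exp (\<sigma>\<^sub>1 * t\<^sub>1) = 1" by (simp add: exp_add[symmetric])
     then have "1 <= exp (\<sigma>\<^sub>1 * t\<^sub>1) * att ((y + t\<^sub>1 *\<^sub>R th, th), t\<^sub>1 - r)"
      using mult_right_mono[OF att_low[of "t\<^sub>1 - r"], of "exp (\<sigma>\<^sub>1 * t\<^sub>1)"] True by (simp add: mult.commute)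
     from mult_right_mono[OF this abs_ge_zero[of "h r"]] True show ?thesis
      using att_bounds(1)[of "((y + t\<^sub>1 *\<^sub>R th, th), t\<^sub>1 - r)"]
      by (simp add: H_def f_def abs_mult mult.assoc)
    qed (auto simp: H_def)
   qed
  qed
  define a where "a t = (\<integral>r. indicator {..t} r * H r \<partial>lborel)" for t
  have bound: "\<bar>L q (y + t *\<^sub>R th, th)\<bar> <= a t" if t: "0 < t" "t < t\<^sub>1" for t
  proof -
   have t': "0 < t" "t < t\<^sub>0" using t t1 by auto
   have Hm [measurable]: "H \<in> borel_measurable borel" using borel_measurable_integrable[OF Hi] by simp
   have "ennreal \<bar>L q (y + t *\<^sub>R th, th)\<bar> <= (\<integral>\<^sup>+s. ennreal \<bar>f t s\<bar> \<partial>lborel)"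
    unfolding L_eq[OF t'] by (rule ennreal_abs_integral_le)
   also have "\<dots> <= (\<integral>\<^sup>+s. ennreal (indicator {..t} (t - s) * H (t - s)) \<partial>lborel)"
   proof (intro nn_integral_mono ennreal_leI)
    fix s
    show "\<bar>f t s\<bar> <= indicator {..t} (t - s) * H (t - s)"
     using att_bounds[of "((y + t *\<^sub>R th, th), s)"] t mult_right_mono[OF att_bounds(2)[of "((y + t *\<^sub>R th, th), s)"] abs_ge_zero[of "h (t - s)"]]
     by (auto simp: f_def H_def indicator_def abs_mult)
   qed
   also have "\<dots> = (\<integral>\<^sup>+r. ennreal (indicator {..t} r * H r) \<partial>lborel)"
    using nn_integral_real_affine[of "%r. ennreal (indicator {..t} r * H r)" "-1" t] by simp
   also have "\<dots> = ennreal (a t)"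
    unfolding a_def
    by (rule nn_integral_eq_integral)
     (use integrable_mult_indicator[OF _ Hi, of "{..t}"] in \<open>auto simp: H_def\<close>)
   finally show ?thesis
    by (subst (asm) ennreal_le_iff) (auto simp: a_def H_def intro!: integral_nonneg_AE)
  qed
  have "(a \<longlongrightarrow> 0) (at_right 0)"
  proof (rule tendsto_at_right_sequentially[OF t1(1)])
   fix S :: "nat => real" assume S: "!!n. 0 < S n" "S \<longlonglongrightarrow> 0"
   have "(%n. a (S n)) \<longlonglongrightarrow> (\<integral>r. 0 \<partial>(lborel :: real measure))"
    unfolding a_def
   proof (rule integral_dominated_convergence)
    show "integrable lborel H" by (rule Hi)
    show "AE r in lborel. (%n. indicator {..S n} r * H r) \<longlonglongrightarrow> 0"
    proof (rule AE_I2)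
     fix r
     show "(%n. indicator {..S n} r * H r) \<longlonglongrightarrow> 0"
     proof (cases "0 < r")
      case True
      then have "eventually (%n. S n < r) sequentially" using S(2) by (rule order_tendstoD(2)[rotated])
      then have "eventually (%n. indicator {..S n} r * H r = 0) sequentially"
       by eventually_elim (auto simp: indicator_def)
      then show ?thesis by (rule tendsto_eventually)
     qed (simp add: H_def)
    qed
    show "(%r. indicator {..S n} r * H r) \<in> borel_measurable lborel" for n
     using borel_measurable_integrable[OF Hi] by measurable
    show "AE r in lborel. norm (indicator {..S n} r * H r) <= H r" for n
     by (rule AE_I2) (auto simp: H_def indicator_def)
   qed simp
   then show "(%n. a (S n)) \<longlonglongrightarrow> 0" by simp
  qed
  moreover have "eventually (%t. norm (L q (y + t *\<^sub>R th, th)) <= a t) (at_right 0)"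
   unfolding eventually_at_right_field using t1(1) bound by auto
  ultimately show ?thesis by (rule Lim_null_comparison[rotated])
 qed
qed

end

section \<open>Traces of weakly differentiable functions\<close>

lemma Ck_on_1I:
 fixes f :: "'b::euclidean_space => real"
 assumes D: "!!z. (f has_derivative f' z) (at z)"
  and c: "!!b. b \<in> Basis ==> continuous_on UNIV (%z. f' z b)"
 shows "Ck_on 1 UNIV f"
proof -
 have "frechet_derivative f (at z) = f' z" for z using frechet_derivative_at[OF D] by simp
 moreover have "f differentiable_on UNIV"
  unfolding differentiable_on_def using D has_derivative_at_withinI unfolding differentiable_def by blast
 ultimately show ?thesis using c by simp
qed

lemma Ck_on_1E:
 fixes f :: "'b::euclidean_space => real"
 assumes "Ck_on 1 UNIV f"
 obtains f' where "!!z. (f has_derivative f' z) (at z)" "!!b. b \<in> Basis ==> continuous_on UNIV (%z. f' z b)"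
  "continuous_on UNIV f"
proof -
 have d: "f differentiable_on UNIV" using assms by simp
 have D: "(f has_derivative frechet_derivative f (at z)) (at z)" for z
 proof -
  have "f differentiable at z" using d unfolding differentiable_on_def by blast
  then show ?thesis by (simp only: frechet_derivative_works)
 qed
 show ?thesis
  by (rule that[OF D]) (use assms differentiable_imp_continuous_on[OF d] in auto)
qed

lemma Ck_on_1_mult:
 fixes f g :: "'b::euclidean_space => real"
 assumes "Ck_on 1 UNIV f" "Ck_on 1 UNIV g"
 shows "Ck_on 1 UNIV (%z. f z * g z)"
proof -
 obtain f' where f: "!!z. (f has_derivative f' z) (at z)" "!!b. b \<in> Basis ==> continuous_on UNIV (%z. f' z b)"
  "continuous_on UNIV f" using Ck_on_1E[OF assms(1)] by blast
 obtain g' where g: "!!z. (g has_derivative g' z) (at z)" "!!b. b \<in> Basis ==> continuous_on UNIV (%z. g' z b)"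
  "continuous_on UNIV g" using Ck_on_1E[OF assms(2)] by blast
 show ?thesis
  by (rule Ck_on_1I[OF has_derivative_mult[OF f(1) g(1)]]) (intro continuous_intros f g)
qed

lemma Ck_on_1_const: "Ck_on 1 UNIV (%z :: 'b::euclidean_space. c :: real)"
 by (rule Ck_on_1I[of _ "%_ _. 0"]) auto

lemma Ck_on_1_prod:
 fixes f :: "'i => 'b::euclidean_space => real"
 assumes "!!i. i \<in> I ==> Ck_on 1 UNIV (f i)"
 shows "Ck_on 1 UNIV (%z. \<Prod>i\<in>I. f i z)"
 using assms
proof (induction I rule: infinite_finite_induct)
 case (insert i I)
 then have "Ck_on 1 UNIV (%z. f i z * (\<Prod>i\<in>I. f i z))" by (intro Ck_on_1_mult) auto
 moreover have "(%z. \<Prod>i\<in>insert i I. f i z) = (%z. f i z * (\<Prod>i\<in>I. f i z))"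
  using insert(1,2) by simp
 ultimately show ?case by (simp only:)
next
 case (infinite I)
 then have e: "(%z. \<Prod>i\<in>I. f i z) = (%z. 1)" by simp
 show ?case unfolding e by (rule Ck_on_1_const)
next
 case empty
 show ?case unfolding prod.empty by (rule Ck_on_1_const)
qed

lemma Ck_on_1_compose_real:
 fixes f :: "'b::euclidean_space => real"
 assumes "Ck_on 1 UNIV f" "!!z. (h has_real_derivative h' (f z)) (at (f z))" "continuous_on (range f) h'"
 shows "Ck_on 1 UNIV (%z. h (f z))"
proof -
 obtain f' where f: "!!z. (f has_derivative f' z) (at z)" "!!b. b \<in> Basis ==> continuous_on UNIV (%z. f' z b)"
  "continuous_on UNIV f" using Ck_on_1E[OF assms(1)] by blast
 have "((%z. h (f z)) has_derivative (%d. h' (f z) * f' z d)) (at z)" for z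
  using has_derivative_compose[OF f(1)] assms(2)[of z, unfolded has_field_derivative_def] by blast
 then show ?thesis
  by (rule Ck_on_1I) (intro continuous_intros f continuous_on_compose2[OF assms(3) f(3)], auto)
qed

lemma DERIV_max_square:
 fixes t :: real
 shows "((%t. (max 0 t)\<^sup>2) has_real_derivative 2 * max 0 t) (at t)"
proof (cases "t = 0")
 case True
 have "((%h. (max 0 h)\<^sup>2 / h) \<longlongrightarrow> 0) (at (0::real))"
 proof (rule Lim_null_comparison[where g = "%h. \<bar>h\<bar>"])
  show "\<forall>\<^sub>F h in at 0. norm ((max 0 h)\<^sup>2 / h) <= \<bar>h :: real\<bar>"
   by (rule always_eventually) (auto simp: max_def power2_eq_square)
  show "((%h. \<bar>h\<bar>) \<longlongrightarrow> 0) (at (0::real))" by (rule tendsto_rabs_zero) simp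
 qed
 then show ?thesis by (simp add: True DERIV_def)
next
 case False
 then consider "t > 0" | "t < 0" by linarith
 then show ?thesis
 proof cases
  case 1
  have "((%t. t\<^sup>2) has_real_derivative 2 * max 0 t) (at t)"
   using 1 by (auto intro!: derivative_eq_intros)
  then show ?thesis
   by (rule has_field_derivative_transform_within_open[where S = "{0<..}"]) (use 1 in auto)
 next
  case 2
  have "((%t. 0) has_real_derivative 2 * max 0 t) (at t)"
   using 2 by (auto intro!: derivative_eq_intros)
  then show ?thesis
   by (rule has_field_derivative_transform_within_open[where S = "{..<0}"]) (use 2 in auto)
 qed
qed

lemma Ck_on_1_affine:
 fixes v :: "'b::euclidean_space"
 shows "Ck_on 1 UNIV (%z. \<alpha> * (z \<bullet> v) + \<beta>)"
 by (rule Ck_on_1I[of _ "%_ d. \<alpha> * (d \<bullet> v)"]) (auto intro!: derivative_eq_intros)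

text \<open>The C1 functions \<open>n P / (1 + n P)\<close>, where \<open>P\<close> vanishes exactly outside the box, increase to
 its indicator.\<close>

lemma box_indicator_limit_C1:
 fixes a b :: "'b::euclidean_space"
 assumes "cbox a b \<subseteq> U"
 obtains \<phi> where "!!n. C1_compact_support U (\<phi> n)" "!!n z. \<bar>\<phi> n z\<bar> <= 1"
  "!!z. (%n. \<phi> n z) \<longlonglongrightarrow> indicator (box a b) z"
proof -
 define P where "P z = (\<Prod>i\<in>Basis. (max 0 (1 * (z \<bullet> i) + - (a \<bullet> i)))\<^sup>2 * (max 0 (- 1 * (z \<bullet> i) + b \<bullet> i))\<^sup>2)" for z
 have sq: "Ck_on 1 UNIV (%z. (max 0 (f z))\<^sup>2)" if "Ck_on 1 UNIV f" for f :: "'b => real"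
  by (rule Ck_on_1_compose_real[OF that, where h' = "%t. 2 * max 0 t"]) (auto intro!: DERIV_max_square continuous_intros)
 have P: "Ck_on 1 UNIV P"
  unfolding P_def[abs_def] by (intro Ck_on_1_prod Ck_on_1_mult sq Ck_on_1_affine)
 have P_nonneg: "0 <= P z" for z unfolding P_def by (intro prod_nonneg) auto
 have P_pos: "P z > 0" if "z \<in> box a b" for z
  unfolding P_def using that by (intro prod_pos) (auto simp: mem_box)
 have P_zero: "P z = 0" if "z \<notin> box a b" for z
 proof -
  obtain i where i: "i \<in> Basis" "z \<bullet> i <= a \<bullet> i \<or> b \<bullet> i <= z \<bullet> i"
   using \<open>z \<notin> box a b\<close> by (auto simp: mem_box not_less)
  have "(max 0 (1 * (z \<bullet> i) + - (a \<bullet> i)))\<^sup>2 * (max 0 (- 1 * (z \<bullet> i) + b \<bullet> i))\<^sup>2 = 0"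
   using i(2) by (auto simp: max_def)
  then show ?thesis unfolding P_def using i(1) by (intro prod_zero) auto
 qed
 define \<phi> where "\<phi> n z = 1 - inverse (1 + real n * P z)" for n z
 have pos: "1 + real n * P z > 0" for n z using P_nonneg[of z] by (simp add: add_pos_nonneg)
 show ?thesis
 proof
  fix n
  have "Ck_on 1 UNIV (\<phi> n)"
   unfolding \<phi>_def[abs_def]
  proof (rule Ck_on_1_compose_real[OF P, where h = "%t. 1 - inverse (1 + real n * t)" and h' = "%t. real n * (inverse (1 + real n * t))\<^sup>2"])
   show "((%t. 1 - inverse (1 + real n * t)) has_real_derivative real n * (inverse (1 + real n * P z))\<^sup>2) (at (P z))" for z
    using pos[of n z] by (auto intro!: derivative_eq_intros simp: power2_eq_square)
   show "continuous_on (range P) (%t. real n * (inverse (1 + real n * t))\<^sup>2)"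
    using pos[of n] by (intro continuous_intros) (auto simp: less_imp_neq[symmetric])
  qed
  then show "C1_compact_support U (\<phi> n)"
   unfolding C1_compact_support_def
   using assms P_zero box_subset_cbox[of a b] by (intro conjI exI[of _ "cbox a b"]) (auto simp: \<phi>_def)
 next
  show "\<bar>\<phi> n z\<bar> <= 1" for n z
  proof -
   have "1 <= 1 + real n * P z" using P_nonneg[of z] by simp
   then have "0 < inverse (1 + real n * P z)" "inverse (1 + real n * P z) <= 1"
    using pos[of n z] by (auto simp: inverse_le_1_iff)
   then show ?thesis by (simp add: \<phi>_def)
  qed
 next
  show "(%n. \<phi> n z) \<longlonglongrightarrow> indicator (box a b) z" for z
  proof (cases "z \<in> box a b")
   case True
   have "filterlim (%n. 1 + real n * P z) at_top sequentially"
    using P_pos[OF True]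
    by (intro filterlim_tendsto_add_at_top[OF tendsto_const] filterlim_at_top_mult_tendsto_pos[OF tendsto_const])
     (auto intro: filterlim_real_sequentially)
   then have "(%n. 1 - inverse (1 + real n * P z)) \<longlonglongrightarrow> 1 - 0"
    by (intro tendsto_intros tendsto_inverse_0_at_top)
   then show ?thesis using True by (simp add: \<phi>_def)
  next
   case False
   then show ?thesis using P_zero[OF False] by (simp add: \<phi>_def)
  qed
 qed
qed

text \<open>Integration of a test function along the characteristics: its derivative in the direction
 of the characteristics is a difference of two translates.\<close>

lemma C1_line_integral:
 fixes \<phi> :: "'a::euclidean_space \<times> 'a => real"
 assumes \<phi>: "C1_compact_support {z. (z, h) \<in> chord X} \<phi>" and h: "0 < h"
 defines "\<Phi> \<equiv> %z. integral {0..h} (%s. \<phi> (shift z (- s)))"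
 shows "C1_compact_support (X \<times> UNIV) \<Phi>" and "streaming \<Phi> z = \<phi> (shift z (- h)) - \<phi> z"
proof -
 note C = C1_compact_supportD[OF \<phi>]
 define F where "F z s = (%d. frechet_derivative \<phi> (at (shift z (- s))) (shift d (- s)))" for z s
 have lin: "bounded_linear (%d :: 'a \<times> 'a. shift d (- s))" for s :: real
  unfolding shift_def by (intro bounded_linear_intros bounded_linear_fst bounded_linear_snd)
 have Fbl: "bounded_linear (F z s)" for z s
  unfolding F_def
  by (rule bounded_linear_compose[OF has_derivative_bounded_linear[OF C(1)] lin])
 have Fd: "((%z. \<phi> (shift z (- s))) has_derivative F z s) (at z)" for z s
  unfolding F_def
  by (rule has_derivative_compose[OF bounded_linear_imp_has_derivative[OF lin] C(1)])
 \<comment> \<open>The Leibniz rule wants the derivative as an element of the space of bounded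
   linear functions; continuity there is checked on basis vectors.\<close>
 define fx where "fx z s = Blinfun (F z s)" for z s
 have fx: "blinfun_apply (fx z s) = F z s" for z s
  unfolding fx_def by (rule bounded_linear_Blinfun_apply[OF Fbl])
 have part: "continuous_on UNIV (%z. frechet_derivative \<phi> (at z) b)" if "b \<in> Basis" for b
  using \<phi> that by (auto simp: C1_compact_support_def)
 have sc: "continuous_on UNIV (%w :: ('a \<times> 'a) \<times> real. shift (fst w) (- snd w))"
  by (intro continuous_intros)
 have fx_cont: "continuous_on (UNIV \<times> cbox 0 h) (%(z, s). fx z s)"
 proof (rule continuous_on_subset[OF _ subset_UNIV], rule continuous_on_blinfun_componentwise)
  fix i :: "'a \<times> 'a" assume "i \<in> Basis"
  have "blinfun_apply (case w of (z, s) => fx z s) i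
    = (\<Sum>b\<in>Basis. (shift i (- snd w) \<bullet> b) * frechet_derivative \<phi> (at (shift (fst w) (- snd w))) b)" for w
  proof -
   interpret bounded_linear "frechet_derivative \<phi> (at (shift (fst w) (- snd w)))"
    by (rule has_derivative_bounded_linear[OF C(1)])
   have "frechet_derivative \<phi> (at (shift (fst w) (- snd w))) (shift i (- snd w))
     = frechet_derivative \<phi> (at (shift (fst w) (- snd w))) (\<Sum>b\<in>Basis. (shift i (- snd w) \<bullet> b) *\<^sub>R b)"
    by (simp add: euclidean_representation)
   then show ?thesis by (simp add: split_beta' fx F_def sum scaleR)
  qed
  moreover have "continuous_on UNIV (%w :: ('a \<times> 'a) \<times> real.
    (\<Sum>b\<in>Basis. (shift i (- snd w) \<bullet> b) * frechet_derivative \<phi> (at (shift (fst w) (- snd w))) b))"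
   by (intro continuous_intros continuous_on_compose2[OF part sc]) auto
  ultimately show "continuous_on UNIV (%w. blinfun_apply (case w of (z, s) => fx z s) i)" by simp
 qed
 have \<phi>_int: "(%s. \<phi> (shift z (- s))) integrable_on cbox 0 h" for z
  by (intro integrable_continuous continuous_on_compose2[OF C(2)] continuous_intros) auto
 have \<Phi>_deriv: "(\<Phi> has_derivative blinfun_apply (integral (cbox 0 h) (fx z))) (at z)" for z
 proof -
  have "((%z. integral (cbox 0 h) (%s. \<phi> (shift z (- s)))) has_derivative integral (cbox 0 h) (fx z)) (at z within UNIV)"
   by (rule leibniz_rule) (use Fd fx fx_cont \<phi>_int in auto)
  then show ?thesis by (simp add: \<Phi>_def)
 qed
 have fx_line: "continuous_on (cbox 0 h) (fx z)" for z
 proof -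
  have "continuous_on (cbox 0 h) (%s. (%(z, s). fx z s) (z, s))"
   by (rule continuous_on_compose2[OF fx_cont]) (auto intro!: continuous_intros)
  then show ?thesis by simp
 qed
 have fx_apply: "blinfun_apply (integral (cbox 0 h) (fx z)) d = integral (cbox 0 h) (%s. F z s d)" for z d
  using integral_linear[OF integrable_continuous[OF fx_line] blinfun.bounded_linear_left, of d z] by (simp add: o_def fx)
 have "continuous_on UNIV (%z. integral (cbox 0 h) (fx z))"
  by (rule integral_continuous_on_param) (rule fx_cont)
 then have c: "continuous_on UNIV (%z. blinfun_apply (integral (cbox 0 h) (fx z)) b)" for b
  by (intro continuous_intros)
 have C1: "Ck_on 1 UNIV \<Phi>" by (rule Ck_on_1I[OF \<Phi>_deriv c])
 obtain K where K: "compact K" "K \<subseteq> {z. (z, h) \<in> chord X}" "!!z. z \<notin> K ==> \<phi> z = 0"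
  using C(4) by blast
 \<comment> \<open>\<open>\<Phi>\<close> lives on the support of \<open>\<phi>\<close> moved
   backwards by at most \<open>h\<close>. By hypothesis the whole segment of length \<open>h\<close>
   behind each point of that support lies in \<open>X\<close>.\<close>
 define K' where "K' = (%w. shift (fst w) (snd w)) ` (K \<times> {0..h})"
 have "compact K'" unfolding K'_def
  by (intro compact_continuous_image compact_Times K compact_Icc continuous_intros)
 moreover have "K' \<subseteq> X \<times> UNIV"
 proof -
  have *: "fst (shift z s) \<in> X" if "z \<in> K" "s \<in> {0..h}" for z s
  proof (rule shift_in_X)
   show "(z, s) \<in> chord X" by (rule chord_mono[of z h]) (use K(2) that in auto)
  qed
  show ?thesis unfolding K'_def
  proof (rule image_subsetI)
   fix w assume "w \<in> K \<times> {0..h}"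
   then have "fst (shift (fst w) (snd w)) \<in> X" by (intro *) auto
   then show "shift (fst w) (snd w) \<in> X \<times> UNIV" by (simp add: mem_Times_iff)
  qed
 qed
 moreover have "\<Phi> z = 0" if "z \<notin> K'" for z
 proof -
  have "\<phi> (shift z (- s)) = 0" if s: "s \<in> {0..h}" for s
  proof (rule K(3), rule notI)
   assume "shift z (- s) \<in> K"
   then have "shift (shift z (- s)) s \<in> K'" unfolding K'_def using s by force
   then show False using \<open>z \<notin> K'\<close> by simp
  qed
  then have "\<Phi> z = integral {0..h} (%s. 0)" unfolding \<Phi>_def by (intro integral_cong) auto
  then show ?thesis by simp
 qed
 ultimately show "C1_compact_support (X \<times> UNIV) \<Phi>"
  unfolding C1_compact_support_def using C1 by blast
 have "streaming \<Phi> z = integral {0..h} (%s. F z s (snd z, 0))"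
  unfolding streaming_def using frechet_derivative_at[OF \<Phi>_deriv, of z] fx_apply[of z "(snd z, 0)"] by (simp add: cbox_interval)
 also have "\<dots> = integral {0..h} (%s. streaming \<phi> (shift z (- s)))"
  by (simp add: F_def streaming_def shift_def)
 also have "\<dots> = \<phi> (shift z (- h)) - \<phi> (shift z (- 0))"
  using C1_line_derivative[OF \<phi>, of z] h
  by (intro integral_unique fundamental_theorem_of_calculus)
   (auto simp: has_real_derivative_iff_has_vector_derivative[symmetric])
 finally show "streaming \<Phi> z = \<phi> (shift z (- h)) - \<phi> z" by simp
qed

context bounded_domain
begin

text \<open>The fundamental lemma of the calculus of variations with C1 test functions. Dominated
  convergence gives vanishing integrals over boxes, a Dynkin argument extends this to all Borel
  subsets of a fixed box, and the sets where \<open>\<Theta>\<close> has a fixed sign then show that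
  it vanishes. Countably many boxes exhaust \<open>U\<close>.\<close>

lemma fundamental_lemma:
 assumes \<Theta>: "integrable (phase_measure X) \<Theta>" and "open U"
  and zero: "!!\<phi>. C1_compact_support U \<phi> ==> (\<integral>z. \<phi> z * \<Theta> z \<partial>phase_measure X) = 0"
 shows "AE z in phase_measure X. z \<in> U \<longrightarrow> \<Theta> z = 0"
proof -
 let ?M = "phase_measure X"
 note [measurable] = borel_measurable_integrable[OF \<Theta>]
 have box_meas: "indicator A \<in> borel_measurable ?M" if "A \<in> sets borel" for A :: "('a \<times> 'a) set"
  using that by (intro borel_measurable_phase) auto
 have int_ind: "integrable ?M (%z. indicator A z * \<Theta> z)" if "A \<in> sets borel" for A :: "('a \<times> 'a) set"
 proof (rule Bochner_Integration.integrable_bound[OF \<Theta>])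
  note [measurable] = box_meas[OF that]
  show "(%z. indicator A z * \<Theta> z) \<in> borel_measurable ?M" by measurable
 qed (auto simp: indicator_def)
 have box0: "(\<integral>z. indicator (box a b) z * \<Theta> z \<partial>?M) = 0" if ab: "cbox a b \<subseteq> U" for a b
 proof -
  obtain \<phi> where \<phi>: "!!n. C1_compact_support U (\<phi> n)" "!!n z. \<bar>\<phi> n z\<bar> <= 1"
   "!!z. (%n::nat. \<phi> n z) \<longlonglongrightarrow> indicator (box a b) z" using box_indicator_limit_C1[OF ab] by blast
  have "(%n. \<integral>z. \<phi> n z * \<Theta> z \<partial>?M) \<longlonglongrightarrow> (\<integral>z. indicator (box a b) z * \<Theta> z \<partial>?M)"
  proof (rule integral_dominated_convergence[where w = "%z. \<bar>\<Theta> z\<bar>"])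
   show "(%z. indicator (box a b) z * \<Theta> z) \<in> borel_measurable ?M"
    using box_meas[of "box a b"] by measurable
   show "(%z. \<phi> n z * \<Theta> z) \<in> borel_measurable ?M" for n
    using borel_measurable_phase[OF borel_measurable_continuous_onI[OF C1_compact_supportD(2)[OF \<phi>(1)[of n]]]] by measurable
   show "AE z in ?M. (%n. \<phi> n z * \<Theta> z) \<longlonglongrightarrow> indicator (box a b) z * \<Theta> z"
    by (intro AE_I2 tendsto_intros \<phi>)
   show "AE z in ?M. norm (\<phi> n z * \<Theta> z) <= \<bar>\<Theta> z\<bar>" for n
    using \<phi>(2)[of n] by (intro AE_I2) (auto simp: abs_mult intro!: mult_left_le_one_le)
  qed (use \<Theta> in auto)
  then show ?thesis using zero[OF \<phi>(1)] LIMSEQ_unique[OF tendsto_const] by (metis (no_types, lifting) ext)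
 qed
 have sub: "AE z in ?M. z \<in> box c d \<longrightarrow> \<Theta> z = 0" if cd: "cbox c d \<subseteq> U" for c d
 proof -
  \<comment> \<open>The intersection with a fixed box keeps all sets inside \<open>U\<close>; in
    particular the complement in the Dynkin argument is taken relative to this box.\<close>
  define I where "I A = (\<integral>z. indicator (A \<inter> box c d) z * \<Theta> z \<partial>?M)" for A
  let ?G = "range (%(a, b :: 'a \<times> 'a). box a b)"
  have gen: "sets (borel :: ('a \<times> 'a) measure) = sigma_sets UNIV ?G"
   by (subst borel_eq_box) simp
  have stable: "Int_stable ?G" by (auto simp: Int_stable_def box_Int_box)
  have sub_Pow: "?G \<subseteq> Pow UNIV" by auto
  have I0: "I A = 0" if "A \<in> sigma_sets UNIV ?G" for A
   using stable sub_Pow that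
  proof (induction rule: sigma_sets_induct_disjoint)
   case (basic A)
   then obtain a b where A: "A = box a b" by auto
   define e where "e = (\<Sum>i\<in>Basis. max (a \<bullet> i) (c \<bullet> i) *\<^sub>R i)"
   define f where "f = (\<Sum>i\<in>Basis. min (b \<bullet> i) (d \<bullet> i) *\<^sub>R i)"
   have ef: "A \<inter> box c d = box e f" unfolding A e_def f_def by (rule box_Int_box)
   show ?case
   proof (cases "box e f = {}")
    case False
    have "cbox e f \<subseteq> cbox c d"
     by (auto simp: mem_box e_def f_def)
    then show ?thesis unfolding I_def ef using cd by (intro box0) auto
   qed (simp add: I_def ef)
  next
   case (compl A)
   have A: "A \<in> sets borel" using compl gen by simp
   have "I (UNIV - A) = (\<integral>z. indicator (box c d) z * \<Theta> z - indicator (A \<inter> box c d) z * \<Theta> z \<partial>?M)"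
    unfolding I_def by (rule Bochner_Integration.integral_cong) (auto simp: indicator_def)
   also have "\<dots> = (\<integral>z. indicator (box c d) z * \<Theta> z \<partial>?M) - I A"
    unfolding I_def using A by (intro Bochner_Integration.integral_diff int_ind) auto
   finally show ?case using compl box0[OF cd] by simp
  next
   case (union A)
   have A: "A i \<in> sets borel" for i using union(2) gen by auto
   have "(%n. \<Sum>i<n. I (A i)) \<longlonglongrightarrow> I (\<Union>i. A i)"
   proof -
    have e: "(\<Sum>i<n. I (A i)) = (\<integral>z. indicator ((\<Union>i<n. A i) \<inter> box c d) z * \<Theta> z \<partial>?M)" for n
    proof -
     have "(\<Sum>i<n. I (A i)) = (\<integral>z. (\<Sum>i<n. indicator (A i \<inter> box c d) z * \<Theta> z) \<partial>?M)"
      unfolding I_def using A by (intro Bochner_Integration.integral_sum[symmetric] int_ind) auto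
     also have "\<dots> = (\<integral>z. indicator ((\<Union>i<n. A i) \<inter> box c d) z * \<Theta> z \<partial>?M)"
     proof (rule Bochner_Integration.integral_cong[OF refl])
      fix z
      have "(\<Sum>i<n. indicator (A i) z) = (indicator (\<Union>i<n. A i) z :: real)"
       using union(1) by (intro indicator_UN_disjoint[symmetric]) (auto simp: disjoint_family_on_def)
      then have "(\<Sum>i<n. indicator (A i) z * (indicator (box c d) z * \<Theta> z)) = indicator (\<Union>i<n. A i) z * (indicator (box c d) z * \<Theta> z)"
       by (simp only: sum_distrib_right[symmetric])
      then show "(\<Sum>i<n. indicator (A i \<inter> box c d) z * \<Theta> z) = indicator ((\<Union>i<n. A i) \<inter> box c d) z * \<Theta> z"
       by (simp only: indicator_inter_arith mult.assoc)
     qed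
     finally show ?thesis .
    qed
    show ?thesis unfolding e unfolding I_def
    proof (rule integral_dominated_convergence[where w = "%z. \<bar>\<Theta> z\<bar>"])
     have [measurable]: "A i \<in> sets borel" "box c d \<in> sets borel" for i using A by auto
     show "(%z. indicator ((\<Union>i. A i) \<inter> box c d) z * \<Theta> z) \<in> borel_measurable ?M"
      by (rule borel_measurable_integrable[OF int_ind]) measurable
     show "(%z. indicator ((\<Union>i<n. A i) \<inter> box c d) z * \<Theta> z) \<in> borel_measurable ?M" for n
      by (rule borel_measurable_integrable[OF int_ind]) measurable
     show "AE z in ?M. (%n. indicator ((\<Union>i<n. A i) \<inter> box c d) z * \<Theta> z) \<longlonglongrightarrow> indicator ((\<Union>i. A i) \<inter> box c d) z * \<Theta> z"
     proof (rule AE_I2)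
      fix z
      have "(%n. indicator (\<Union>i<n. A i) z :: real) \<longlonglongrightarrow> indicator (\<Union>i. A i) z"
       by (rule LIMSEQ_indicator_UN)
      then show "(%n. indicator ((\<Union>i<n. A i) \<inter> box c d) z * \<Theta> z) \<longlonglongrightarrow> indicator ((\<Union>i. A i) \<inter> box c d) z * \<Theta> z"
       unfolding indicator_inter_arith by (intro tendsto_intros)
     qed
     show "AE z in ?M. norm (indicator ((\<Union>i<n. A i) \<inter> box c d) z * \<Theta> z) <= \<bar>\<Theta> z\<bar>" for n
      by (intro AE_I2) (auto simp: indicator_def)
    qed (use \<Theta> in auto)
   qed
   then have "(%n::nat. 0) \<longlonglongrightarrow> I (\<Union>i. A i)" using union(3) by simp
   from LIMSEQ_unique[OF this tendsto_const] show ?case .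
  qed (simp add: I_def)
  have Z: "zext X \<Theta> \<in> borel_measurable borel" by measurable
  \<comment> \<open>The two values of \<open>c'\<close> treat the positive and the negative part of
    \<open>\<Theta>\<close>; the sign set is formed with \<open>zext X \<Theta>\<close>, which is
    Borel on the whole space.\<close>
  have sgn0: "AE z in ?M. z \<in> box c d \<longrightarrow> c' * \<Theta> z <= 0" if c': "c' = 1 \<or> c' = - 1" for c' :: real
  proof -
   define A where "A = {z. 0 < c' * zext X \<Theta> z}"
   have A: "A \<in> sets borel" unfolding A_def using Z by measurable
   then have "I A = 0" using I0 gen by simp
   then have "(\<integral>z. c' * (indicator (A \<inter> box c d) z * \<Theta> z) \<partial>?M) = 0" by (simp add: I_def)
   moreover have "0 <= c' * (indicator (A \<inter> box c d) z * \<Theta> z)" if "z \<in> space ?M" for z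
    using zext_eq[OF that, of \<Theta>] by (auto simp: A_def indicator_def less_imp_le)
   ultimately have "AE z in ?M. c' * (indicator (A \<inter> box c d) z * \<Theta> z) = 0"
    using A by (subst integral_nonneg_eq_0_iff_AE[symmetric]) (auto intro!: int_ind integrable_mult_right AE_I2)
   then show ?thesis
   proof (rule AE_mp[OF _ AE_I2[OF impI]])
    fix z assume z: "z \<in> space ?M" "c' * (indicator (A \<inter> box c d) z * \<Theta> z) = 0"
    show "z \<in> box c d \<longrightarrow> c' * \<Theta> z <= 0"
    proof (cases "z \<in> A")
     case False
     then show ?thesis using zext_eq[OF z(1), of \<Theta>] by (simp add: A_def)
    qed (use z(2) in auto)
   qed
  qed
  show ?thesis using sgn0[of 1] sgn0[of "-1"] by (auto elim: eventually_elim2)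
 qed
 define \<F> where "\<F> = {W. \<exists>c d. W = box c d & cbox c d \<subseteq> U}"
 have "\<Union>\<F> = U"
 proof (rule subset_antisym)
  show "\<Union>\<F> \<subseteq> U" unfolding \<F>_def using box_subset_cbox by blast
  show "U \<subseteq> \<Union>\<F>"
  proof
   fix z assume "z \<in> U"
   then obtain a b where "cbox a b \<subseteq> U" "z \<in> box a b" using open_contains_cbox[OF \<open>open U\<close>] by metis
   then show "z \<in> \<Union>\<F>" unfolding \<F>_def by blast
  qed
 qed
 moreover obtain \<D> where \<D>: "\<D> \<subseteq> \<F>" "countable \<D>" "\<Union>\<D> = \<Union>\<F>"
  using Lindelof[of \<F>] by (auto simp: \<F>_def)
 moreover have "AE z in ?M. \<forall>W\<in>\<D>. z \<in> W \<longrightarrow> \<Theta> z = 0"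
  unfolding AE_ball_countable[OF \<D>(2)] using \<D>(1) sub by (auto simp: \<F>_def)
 ultimately show ?thesis by (auto elim!: eventually_mono)
qed

end

section \<open>Weak derivatives along characteristics and the inflow trace\<close>

context bounded_domain
begin

text \<open>Backwards in time, almost every characteristic first leaves \<open>X\<close> at a point
  where the trace is prescribed. Stating this separately keeps the geometry of the boundary out of
  the trace argument; it is proved in \<open>transversal_exit_smooth\<close>.\<close>

definition transversal_exit :: bool where
 "transversal_exit \<longleftrightarrow> (AE z in phase_measure X.
   \<exists>\<tau>>0. (\<forall>s. (z, s) \<in> chord X \<longleftrightarrow> 0 <= s & s < \<tau>) & shift z \<tau> \<in> Gamma_minus X)"

lemma nn_integral_phase:
 fixes H :: "'a \<times> 'a => ennreal"
 assumes H [measurable]: "H \<in> borel_measurable borel" and supp: "!!z. H z \<noteq> 0 ==> fst z \<in> X"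
 shows "(\<integral>\<^sup>+z. H z \<partial>phase_measure X) = (\<integral>\<^sup>+th. (\<integral>\<^sup>+x. H (x, th) \<partial>lborel) \<partial>sphere_measure)"
proof -
 have "(\<integral>\<^sup>+z. H z \<partial>phase_measure X) = (\<integral>\<^sup>+th. (\<integral>\<^sup>+x. H (x, th) \<partial>space_measure X) \<partial>sphere_measure)"
  by (rule phase_pair.nn_integral_snd[symmetric]) (rule borel_measurable_phase[OF H])
 also have "\<dots> = (\<integral>\<^sup>+th. (\<integral>\<^sup>+x. H (x, th) \<partial>lborel) \<partial>sphere_measure)"
 proof (rule nn_integral_cong)
  fix th :: 'a
  have "H (x, th) * indicator X x = H (x, th)" for x
   using supp[of "(x, th)"] by (cases "H (x, th) = 0") auto
  then show "(\<integral>\<^sup>+x. H (x, th) \<partial>space_measure X) = (\<integral>\<^sup>+x. H (x, th) \<partial>lborel)"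
   unfolding nn_integral_space_measure by simp
 qed
 finally show ?thesis .
qed

lemma phase_shift_fixed:
 fixes F :: "'a \<times> 'a => real"
 assumes F [measurable]: "F \<in> borel_measurable borel"
  and supp: "!!z. F z \<noteq> 0 ==> fst z \<in> X" "!!z. F (shift z (- h)) \<noteq> 0 ==> fst z \<in> X"
  and i: "integrable (phase_measure X) (%z. F (shift z (- h)))"
 shows "integrable (phase_measure X) F"
  and "(\<integral>z. F z \<partial>phase_measure X) = (\<integral>z. F (shift z (- h)) \<partial>phase_measure X)"
proof -
 let ?M = "phase_measure X"
 have [measurable]: "(%z. shift z (- h)) \<in> borel_measurable (borel :: ('a \<times> 'a) measure)"
  unfolding shift_def by measurable
 have Fm: "F \<in> borel_measurable ?M" by (rule borel_measurable_phase) measurable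
 have nn: "(\<integral>\<^sup>+z. ennreal (f (F z)) \<partial>?M) = (\<integral>\<^sup>+z. ennreal (f (F (shift z (- h)))) \<partial>?M)"
  if [measurable]: "f \<in> borel_measurable borel" and f0: "f 0 = 0" for f :: "real => real"
 proof -
  have "(\<integral>\<^sup>+z. ennreal (f (F z)) \<partial>?M) = (\<integral>\<^sup>+th. (\<integral>\<^sup>+x. ennreal (f (F (x, th))) \<partial>lborel) \<partial>sphere_measure)"
  proof (rule nn_integral_phase)
   show "ennreal (f (F z)) \<noteq> 0 ==> fst z \<in> X" for z using supp(1)[of z] f0 by (cases "F z = 0") auto
  qed measurable
  also have "\<dots> = (\<integral>\<^sup>+th. (\<integral>\<^sup>+x. ennreal (f (F (shift (x, th) (- h)))) \<partial>lborel) \<partial>sphere_measure)"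
  proof (rule nn_integral_cong)
   fix th :: 'a
   have "(\<integral>\<^sup>+x. ennreal (f (F (x + h *\<^sub>R th, th))) \<partial>lborel) = (\<integral>\<^sup>+x. ennreal (f (F (x, th))) \<partial>lborel)"
    by (rule nn_integral_lborel_translate) measurable
   then show "(\<integral>\<^sup>+x. ennreal (f (F (x, th))) \<partial>lborel) = (\<integral>\<^sup>+x. ennreal (f (F (shift (x, th) (- h)))) \<partial>lborel)"
    by (simp add: shift_def)
  qed
  also have "\<dots> = (\<integral>\<^sup>+z. ennreal (f (F (shift z (- h)))) \<partial>?M)"
  proof (rule nn_integral_phase[symmetric])
   show "ennreal (f (F (shift z (- h)))) \<noteq> 0 ==> fst z \<in> X" for z
    using supp(2)[of z] f0 by (cases "F (shift z (- h)) = 0") auto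
  qed measurable
  finally show ?thesis .
 qed
 show iF: "integrable ?M F"
  using nn[of abs] i Fm by (simp add: integrable_iff_bounded)
 show "(\<integral>z. F z \<partial>?M) = (\<integral>z. F (shift z (- h)) \<partial>?M)"
  using nn[of "%x. x"] nn[of "%x. - x"] by (simp add: real_lebesgue_integral_def iF i)
qed

text \<open>Fundamental theorem of calculus along characteristics for one fixed length
  \<open>h\<close>. For a test function \<open>\<phi>\<close> supported where a chord of length
  \<open>h\<close> exists, its line integral \<open>\<Phi>\<close> is admissible in the weak
  formulation and \<open>streaming \<Phi>\<close> is a difference of two translates. Moving the
  translations onto \<open>u\<close> and \<open>g\<close> gives the identity tested against an
  arbitrary \<open>\<phi>\<close>.\<close>

lemma weak_line:
 assumes H: "H12_derivative X u g" and h: "0 < h"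
 shows "AE z in phase_measure X. (z, h) \<in> chord X \<longrightarrow>
  zext X u z = zext X u (shift z h) + (\<integral>s. indicator {0..h} s * zext X g (shift z s) \<partial>lborel)"
proof -
 let ?M = "phase_measure X"
 let ?O = "{z. (z, h) \<in> chord X}"
 have u: "u \<in> L2 ?M" and g: "g \<in> L2 ?M" using H by (auto simp: H12_derivative_def)
 define u' where "u' = zext X u"
 define g' where "g' = zext X g"
 have [measurable]: "u' \<in> borel_measurable borel" "g' \<in> borel_measurable borel"
  unfolding u'_def g'_def using u g by (auto intro: borel_measurable_zext L2_measurable)
 have u'M: "u' \<in> borel_measurable ?M" and g'M: "g' \<in> borel_measurable ?M"
  by (rule borel_measurable_phase, measurable)+
 have "integrable ?M (zext X f) \<longleftrightarrow> integrable ?M f" for f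
  by (rule Bochner_Integration.integrable_cong[OF refl zext_eq])
 then have u'i: "integrable ?M u'" and g'i: "integrable ?M g'"
  using phase.L2_imp_integrable[OF u] phase.L2_imp_integrable[OF g] by (simp_all only: u'_def g'_def)
 have openO: "open ?O"
 proof -
  have "?O = (%z. (z, h)) -` {w. \<forall>r\<in>{0..1}. fst (fst w) - (r * snd w) *\<^sub>R snd (fst w) \<in> X}"
   using h by (auto simp: chord_alt)
  then show ?thesis
   by (simp only:) (intro open_vimage open_segment_condition open_X continuous_intros)
 qed
 have O_meas [measurable]: "?O \<in> sets borel" using openO by simp
 have sh [measurable]: "(%z. shift z c) \<in> borel_measurable (borel :: ('a \<times> 'a) measure)" for c
  unfolding shift_def by measurable
 define A where "A z = indicator ?O z * u' (shift z h)" for z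
 have A_meas [measurable]: "A \<in> borel_measurable borel" unfolding A_def by measurable
 have A_supp: "fst z \<in> X" if "A z \<noteq> 0" for z
  using that by (auto simp: A_def indicator_def split: if_splits dest: chord_in_X)
 have A_shift: "A (shift z (- h)) = indicator ?O (shift z (- h)) * u' z" for z by (simp add: A_def)
 have u'_supp: "fst z \<in> X" if "u' z \<noteq> 0" for z using that by (auto simp: u'_def zext_def split: if_splits)
 have A_i: "integrable ?M A"
 proof (rule phase_shift_fixed(1))
  show "integrable ?M (%z. A (shift z (- h)))"
  proof (rule Bochner_Integration.integrable_bound[OF u'i])
   show "(%z. A (shift z (- h))) \<in> borel_measurable ?M" by (rule borel_measurable_phase) measurable
   show "AE z in ?M. norm (A (shift z (- h))) <= norm (u' z)" unfolding A_shift by (simp add: indicator_def)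
  qed
  show "fst z \<in> X" if "A (shift z (- h)) \<noteq> 0" for z
   using that u'_supp[of z] unfolding A_shift by (cases "u' z = 0") simp_all
 qed (use A_supp in simp_all)
 define I where "I z = (\<integral>s. indicator {0..h} s * g' (shift z s) \<partial>lborel)" for z
 have jm [measurable]: "(%w. indicator {0..h} (snd w) * g' (shift (fst w) (snd w))) \<in> borel_measurable (borel :: (('a \<times> 'a) \<times> real) measure)"
  by measurable
 have I_meas: "I \<in> borel_measurable ?M"
  unfolding I_def using borel_measurable_phase_line[OF jm] by measurable
 have nn_g: "(\<integral>\<^sup>+z. (\<integral>\<^sup>+s. indicator (chord X) (z, s) * ennreal \<bar>g' (shift z s)\<bar> \<partial>lborel) \<partial>?M) < \<infinity>"
 proof -
  have "(\<integral>\<^sup>+z. (\<integral>\<^sup>+s. indicator (chord X) (z, s) * ennreal \<bar>g' (shift z s)\<bar> \<partial>lborel) \<partial>?M)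
    = (\<integral>\<^sup>+z. (\<integral>\<^sup>+s. indicator (chord X) (shift z (- s), s) * ennreal \<bar>g' z\<bar> \<partial>lborel) \<partial>?M)"
   using nn_integral_chord_shift[of "%w. ennreal \<bar>g' (shift (fst w) (snd w))\<bar>"] by simp
  also have "\<dots> <= (\<integral>\<^sup>+z. (\<integral>\<^sup>+s. ennreal \<bar>g' z\<bar> * indicator {0..D} s \<partial>lborel) \<partial>?M)"
  proof (rule nn_integral_mono, rule nn_integral_mono)
   fix z s assume "z \<in> space ?M"
   then show "indicator (chord X) (shift z (- s), s) * ennreal \<bar>g' z\<bar> <= ennreal \<bar>g' z\<bar> * indicator {0..D} s"
    using chord_shift_length[of z s] by (auto simp: indicator_def)
  qed
  also have "\<dots> = (\<integral>\<^sup>+z. ennreal (\<bar>g' z\<bar> * D) \<partial>?M)"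
   using D_pos by (simp add: nn_integral_cmult ennreal_mult)
  also have "\<dots> < \<infinity>" using g'i D_pos by (subst nn_integral_eq_integral) auto
  finally show ?thesis .
 qed
 have O_chord: "(z, s) \<in> chord X" if "z \<in> ?O" "s \<in> {0..h}" for z s
  using that by (auto intro: chord_mono)
 define B where "B z = indicator ?O z * I z" for z
 have B_i: "integrable ?M B"
 proof (rule integrableI_bounded)
  show "B \<in> borel_measurable ?M"
   unfolding B_def[abs_def] by (intro borel_measurable_times I_meas borel_measurable_phase borel_measurable_indicator O_meas)
  have "(\<integral>\<^sup>+z. ennreal (norm (B z)) \<partial>?M) <= (\<integral>\<^sup>+z. (\<integral>\<^sup>+s. indicator (chord X) (z, s) * ennreal \<bar>g' (shift z s)\<bar> \<partial>lborel) \<partial>?M)"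
  proof (rule nn_integral_mono)
   fix z
   have "ennreal (norm (B z)) <= (\<integral>\<^sup>+s. ennreal \<bar>indicator ?O z * (indicator {0..h} s * g' (shift z s))\<bar> \<partial>lborel)"
    using ennreal_abs_integral_le[of lborel "%s. indicator ?O z * (indicator {0..h} s * g' (shift z s))"]
    by (simp add: B_def I_def)
   also have "\<dots> <= (\<integral>\<^sup>+s. indicator (chord X) (z, s) * ennreal \<bar>g' (shift z s)\<bar> \<partial>lborel)"
    using O_chord by (intro nn_integral_mono) (auto simp: indicator_def)
   finally show "ennreal (norm (B z)) <= (\<integral>\<^sup>+s. indicator (chord X) (z, s) * ennreal \<bar>g' (shift z s)\<bar> \<partial>lborel)" .
  qed
  then show "(\<integral>\<^sup>+z. ennreal (norm (B z)) \<partial>?M) < \<infinity>" using nn_g by (rule le_less_trans)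
 qed
 define \<Theta> where "\<Theta> z = A z - u' z + B z" for z
 have "AE z in ?M. z \<in> ?O \<longrightarrow> \<Theta> z = 0"
 proof (rule fundamental_lemma[OF _ openO])
  show "integrable ?M \<Theta>" unfolding \<Theta>_def using A_i u'i B_i by auto
  fix \<phi> :: "'a \<times> 'a => real" assume \<phi>: "C1_compact_support ?O \<phi>"
  note C = C1_compact_supportD[OF \<phi>]
  define \<Phi> where "\<Phi> z = integral {0..h} (%s. \<phi> (shift z (- s)))" for z
  have \<Phi>: "C1_compact_support (X \<times> UNIV) \<Phi>" "!!z. streaming \<Phi> z = \<phi> (shift z (- h)) - \<phi> z"
   using C1_line_integral[OF \<phi> h] unfolding \<Phi>_def by auto
  have K: "\<phi> z = 0" if "z \<notin> ?O" for z using C(4) that by blast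
  obtain b where b: "0 <= b" "!!z. \<bar>\<phi> z\<bar> <= b" "!!z. \<bar>streaming \<phi> z\<bar> <= b"
   using C1_compact_support_bounded[OF \<phi>] by blast
  have \<phi>m [measurable]: "\<phi> \<in> borel_measurable borel" using C(2) by (rule borel_measurable_continuous_onI)
  have mi: "integrable ?M (%z. p z * f z)" if f: "integrable ?M f" and p: "p \<in> borel_measurable borel" "!!z. \<bar>p z\<bar> <= b" for f p
  proof (rule Bochner_Integration.integrable_bound)
   show "integrable ?M (%z. b * f z)" using f by simp
   show "(%z. p z * f z) \<in> borel_measurable ?M"
    using borel_measurable_integrable[OF f] borel_measurable_phase[OF p(1)] by measurable
   show "AE z in ?M. norm (p z * f z) <= norm (b * f z)"
    using p(2) b(1) by (intro AE_I2) (auto simp: abs_mult intro!: mult_right_mono)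
  qed
  have T1: "(\<integral>z. \<phi> z * A z \<partial>?M) = (\<integral>z. \<phi> (shift z (- h)) * u' z \<partial>?M)"
  proof -
   have e: "\<phi> z * A z = \<phi> z * u' (shift z h)" for z using K[of z] by (cases "z \<in> ?O") (auto simp: A_def)
   have "(\<integral>z. \<phi> z * u' (shift z h) \<partial>?M) = (\<integral>z. \<phi> (shift z (- h)) * u' (shift (shift z (- h)) h) \<partial>?M)"
   proof (rule phase_shift_fixed(2))
    show "fst z \<in> X" if "\<phi> z * u' (shift z h) \<noteq> 0" for z
     using that K[of z] by (auto dest: chord_in_X)
    show "fst z \<in> X" if "\<phi> (shift z (- h)) * u' (shift (shift z (- h)) h) \<noteq> 0" for z
     using that u'_supp[of z] by auto
    show "integrable ?M (%z. \<phi> (shift z (- h)) * u' (shift (shift z (- h)) h))"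
     using b by (simp, intro mi u'i) auto
   qed measurable
   then show ?thesis by (simp add: e)
  qed
  have T3: "(\<integral>z. \<phi> z * B z \<partial>?M) = (\<integral>z. g z * \<Phi> z \<partial>?M)"
  proof -
   define G where "G w = indicator {0..h} (snd w) * \<phi> (fst w) * g' (shift (fst w) (snd w))" for w
   have G [measurable]: "G \<in> borel_measurable borel" unfolding G_def by measurable
   have G_chord: "indicator (chord X) (z, s) * G (z, s) = G (z, s)" for z s
    using K[of z] O_chord[of z s] by (cases "z \<in> ?O") (auto simp: G_def indicator_def)
   have "(\<integral>\<^sup>+z. (\<integral>\<^sup>+s. indicator (chord X) (z, s) * ennreal \<bar>G (z, s)\<bar> \<partial>lborel) \<partial>?M)
     <= (\<integral>\<^sup>+z. (\<integral>\<^sup>+s. ennreal b * (indicator (chord X) (z, s) * ennreal \<bar>g' (shift z s)\<bar>) \<partial>lborel) \<partial>?M)"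
   proof (rule nn_integral_mono, rule nn_integral_mono)
    fix z s
    have "\<bar>G (z, s)\<bar> <= 1 * b * \<bar>g' (shift z s)\<bar>"
     unfolding G_def abs_mult using b by (intro mult_mono) (auto simp: indicator_def)
    then have "ennreal \<bar>G (z, s)\<bar> <= ennreal b * ennreal \<bar>g' (shift z s)\<bar>"
     using b(1) by (simp add: ennreal_mult[symmetric] ennreal_leI)
    then show "indicator (chord X) (z, s) * ennreal \<bar>G (z, s)\<bar> <= ennreal b * (indicator (chord X) (z, s) * ennreal \<bar>g' (shift z s)\<bar>)"
     by (auto simp: indicator_def)
   qed
   also have "\<dots> = ennreal b * (\<integral>\<^sup>+z. (\<integral>\<^sup>+s. indicator (chord X) (z, s) * ennreal \<bar>g' (shift z s)\<bar> \<partial>lborel) \<partial>?M)"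
   proof -
    have m: "(%w. indicator (chord X) w * ennreal \<bar>g' (shift (fst w) (snd w))\<bar>) \<in> borel_measurable borel" by measurable
    note [measurable] = borel_measurable_phase_line[OF m] measurable_compose[OF _ m]
    have "(\<integral>\<^sup>+s. ennreal b * (indicator (chord X) (z, s) * ennreal \<bar>g' (shift z s)\<bar>) \<partial>lborel)
      = ennreal b * (\<integral>\<^sup>+s. indicator (chord X) (z, s) * ennreal \<bar>g' (shift z s)\<bar> \<partial>lborel)" for z
     using measurable_compose[OF _ m, of "%s. (z, s)" lborel] by (intro nn_integral_cmult) simp
    moreover have "(%z. \<integral>\<^sup>+s. indicator (chord X) (z, s) * ennreal \<bar>g' (shift z s)\<bar> \<partial>lborel) \<in> borel_measurable ?M"
     using lborel.borel_measurable_nn_integral_fst[OF borel_measurable_phase_line[OF m]] by simp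
    ultimately show ?thesis by (simp add: nn_integral_cmult)
   qed
   also have "\<dots> < \<infinity>" using nn_g by (simp add: ennreal_mult_less_top)
   finally have fin: "(\<integral>\<^sup>+z. (\<integral>\<^sup>+s. indicator (chord X) (z, s) * ennreal \<bar>G (z, s)\<bar> \<partial>lborel) \<partial>?M) < \<infinity>" .
   have "(\<integral>z. \<phi> z * B z \<partial>?M) = (\<integral>z. (\<integral>s. indicator (chord X) (z, s) * G (z, s) \<partial>lborel) \<partial>?M)"
   proof (rule Bochner_Integration.integral_cong[OF refl])
    fix z
    have "\<phi> z * B z = \<phi> z * I z" using K[of z] by (cases "z \<in> ?O") (auto simp: B_def)
    also have "\<dots> = (\<integral>s. \<phi> z * (indicator {0..h} s * g' (shift z s)) \<partial>lborel)" by (simp add: I_def)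
    also have "\<dots> = (\<integral>s. indicator (chord X) (z, s) * G (z, s) \<partial>lborel)"
     unfolding G_chord by (rule Bochner_Integration.integral_cong) (auto simp: G_def)
    finally show "\<phi> z * B z = (\<integral>s. indicator (chord X) (z, s) * G (z, s) \<partial>lborel)" .
   qed
   also have "\<dots> = (\<integral>z. (\<integral>s. indicator (chord X) (shift z (- s), s) * G (shift z (- s), s) \<partial>lborel) \<partial>?M)"
    by (rule integral_chord_shift[OF G fin])
   also have "\<dots> = (\<integral>z. g z * \<Phi> z \<partial>?M)"
   proof (rule Bochner_Integration.integral_cong[OF refl])
    fix z assume z: "z \<in> space ?M"
    have c: "continuous_on {0..h} (%s. \<phi> (shift z (- s)))"
     by (intro continuous_on_compose2[OF C(2)] continuous_intros) auto
    have "(\<integral>s. indicator (chord X) (shift z (- s), s) * G (shift z (- s), s) \<partial>lborel)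
      = (\<integral>s. g z * (indicator {0..h} s *\<^sub>R \<phi> (shift z (- s))) \<partial>lborel)"
     unfolding G_chord using z by (intro Bochner_Integration.integral_cong) (auto simp: G_def g'_def zext_eq)
    also have "\<dots> = g z * (LINT s:{0..h}|lborel. \<phi> (shift z (- s)))"
     by (simp add: set_lebesgue_integral_def)
    also have "\<dots> = g z * \<Phi> z"
     unfolding \<Phi>_def using set_borel_integral_eq_integral(2)[OF borel_integrable_atLeastAtMost'[OF c]] by simp
    finally show "(\<integral>s. indicator (chord X) (shift z (- s), s) * G (shift z (- s), s) \<partial>lborel) = g z * \<Phi> z" .
   qed
   finally show ?thesis .
  qed
  have ui: "integrable ?M (%z. \<phi> (shift z (- h)) * u' z)" by (rule mi[OF u'i]) (use b in auto)
  have "(\<integral>z. \<phi> (shift z (- h)) * u' z \<partial>?M) - (\<integral>z. \<phi> z * u' z \<partial>?M) = (\<integral>z. u z * streaming \<Phi> z \<partial>?M)"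
   unfolding Bochner_Integration.integral_diff[OF ui mi[OF u'i \<phi>m b(2)], symmetric]
   by (rule Bochner_Integration.integral_cong) (auto simp: \<Phi>(2) u'_def zext_eq algebra_simps)
  also have "\<dots> = - (\<integral>z. g z * \<Phi> z \<partial>?M)"
   using H \<Phi>(1) unfolding H12_derivative_def streaming_def by blast
  finally have "(\<integral>z. \<phi> z * A z \<partial>?M) - (\<integral>z. \<phi> z * u' z \<partial>?M) + (\<integral>z. \<phi> z * B z \<partial>?M) = 0"
   using T1 T3 by simp
  moreover have "(\<integral>z. \<phi> z * \<Theta> z \<partial>?M) = (\<integral>z. \<phi> z * A z - \<phi> z * u' z + \<phi> z * B z \<partial>?M)"
   by (rule Bochner_Integration.integral_cong) (auto simp: \<Theta>_def algebra_simps)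
  moreover have "\<dots> = (\<integral>z. \<phi> z * A z \<partial>?M) - (\<integral>z. \<phi> z * u' z \<partial>?M) + (\<integral>z. \<phi> z * B z \<partial>?M)"
   using mi[OF A_i \<phi>m b(2)] mi[OF u'i \<phi>m b(2)] mi[OF B_i \<phi>m b(2)] by simp
  ultimately show "(\<integral>z. \<phi> z * \<Theta> z \<partial>?M) = 0" by simp
 qed
 then show ?thesis
  by eventually_elim (auto simp: \<Theta>_def A_def B_def I_def u'_def g'_def)
qed

text \<open>\<open>weak_line\<close> has an exceptional null set for each length. Fubini exchanges
  the quantifiers: for almost every characteristic the formula holds for almost every
  length.\<close>

lemma line_formula:
 assumes H: "H12_derivative X u g"
 shows "AE z in phase_measure X. AE s in lborel. 0 < s & (z, s) \<in> chord X \<longrightarrow>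
  u z = u (shift z s) + (\<integral>r. indicator {0..s} r * zext X g (shift z r) \<partial>lborel)"
proof -
 let ?M = "phase_measure X"
 have u: "u \<in> L2 ?M" and g: "g \<in> L2 ?M" using H by (auto simp: H12_derivative_def)
 define u' where "u' = zext X u"
 define g' where "g' = zext X g"
 have [measurable]: "u' \<in> borel_measurable borel" "g' \<in> borel_measurable borel"
  unfolding u'_def g'_def using u g by (auto intro: borel_measurable_zext L2_measurable)
 \<comment> \<open>The exchange of quantifiers requires a jointly measurable exceptional set; hence
   the range of integration is again written with indicators.\<close>
 define J where "J w = (\<integral>r. indicator {0..} r * indicator {0..} (snd w - r) * g' (shift (fst w) r) \<partial>lborel)" for w
 have J_eq: "J (z, s) = (\<integral>r. indicator {0..s} r * g' (shift z r) \<partial>lborel)" for z s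
  unfolding J_def by (rule Bochner_Integration.integral_cong) (auto simp: indicator_def)
 have J [measurable]: "J \<in> borel_measurable borel"
 proof -
  have "fst \<in> borel_measurable ((borel :: ('a \<times> 'a) measure) \<Otimes>\<^sub>M (borel :: real measure))"
   by simp
  then have "fst \<in> borel_measurable (borel :: (('a \<times> 'a) \<times> real) measure)"
   by (simp only: borel_prod)
  then have "(%w. (fst (fst w), snd w)) \<in> (borel :: (('a \<times> 'a) \<times> real) measure) \<Otimes>\<^sub>M lborel \<rightarrow>\<^sub>M (borel :: (('a \<times> 'a) \<times> real) measure)"
   by (intro borel_measurable_Pair measurable_compose[OF measurable_fst]) auto
  from measurable_compose[OF this measurable_shift]
  have [measurable]: "(%w. shift (fst (fst w)) (snd w)) \<in> borel_measurable ((borel :: (('a \<times> 'a) \<times> real) measure) \<Otimes>\<^sub>M lborel)" by simp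
  show ?thesis unfolding J_def[abs_def] by measurable
 qed
 define \<Delta> where "\<Delta> w = indicator (chord X) w * indicator {0<..} (snd w) * (u' (fst w) - (u' (shift (fst w) (snd w)) + J w))" for w
 define P where "P z s \<longleftrightarrow> \<Delta> (z, s) = 0" for z s
 have P_iff: "P z s \<longleftrightarrow> (0 < s & (z, s) \<in> chord X \<longrightarrow> u' z = u' (shift z s) + J (z, s))" for z s
  unfolding P_def \<Delta>_def by (simp add: indicator_def) blast
 have "\<Delta> \<in> borel_measurable borel" unfolding \<Delta>_def[abs_def] by measurable
 note \<Delta> = borel_measurable_phase_line[OF this]
 have "(AE z in ?M. AE s in lborel. P z s) \<longleftrightarrow> (AE s in lborel. AE z in ?M. P z s)"
 proof (rule phase_line.AE_commute)
  show "{w \<in> space (?M \<Otimes>\<^sub>M lborel). P (fst w) (snd w)} \<in> sets (?M \<Otimes>\<^sub>M lborel)"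
   unfolding P_def prod.collapse by (rule borel_measurable_eq[OF \<Delta> borel_measurable_const])
 qed
 moreover have "AE z in ?M. P z s" for s
 proof (cases "0 < s")
  case True
  from weak_line[OF H this] show ?thesis by eventually_elim (simp add: P_iff J_eq u'_def g'_def)
 qed (simp add: P_iff)
 ultimately have "AE z in ?M. AE s in lborel. P z s" by simp
 then show ?thesis
 proof (rule AE_mp[OF _ AE_I2[OF impI]])
  fix z assume z: "z \<in> space ?M" and "AE s in lborel. P z s"
  then show "AE s in lborel. 0 < s & (z, s) \<in> chord X \<longrightarrow>
   u z = u (shift z s) + (\<integral>r. indicator {0..s} r * zext X g (shift z r) \<partial>lborel)"
  proof eventually_elim
   case (elim s)
   then show ?case
    using z shift_in_phase[OF _ z, of s] by (auto simp: P_iff J_eq u'_def g'_def zext_eq)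
  qed
 qed
qed

text \<open>Let the length in \<open>line_formula\<close> tend to the exit time. The trace is known
  only for a representative \<open>w\<close>, but on almost every characteristic \<open>w\<close>
  and \<open>u\<close> agree at almost every point, and the exit point lies in
  \<open>Gamma_minus\<close>, where \<open>w\<close> tends to 0.\<close>

lemma trace_formula:
 assumes H: "H12_derivative X u g" and tr: "inflow_trace X u (%_. 0)" and exit: transversal_exit
 shows "AE z in phase_measure X. u z = (\<integral>r. indicator (chord X) (z, r) * zext X g (shift z r) \<partial>lborel)"
proof -
 let ?M = "phase_measure X"
 have g: "g \<in> L2 ?M" using H by (auto simp: H12_derivative_def)
 obtain w where w: "AE z in ?M. w z = u z"
  and lim: "!!y th. (y, th) \<in> Gamma_minus X ==> ((%t. w (y + t *\<^sub>R th, th)) \<longlongrightarrow> 0) (at_right 0)"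
  using tr by (auto simp: inflow_trace_def)
 have gi: "AE z in ?M. integrable lborel (%s. indicator (chord X) (z, s) * 1 * g (shift z s))"
 proof (rule bounded_operator_L2_transport(2)[where a = "%_. 1" and C = D, OF _ _ _ _ _ g])
  fix z assume z: "z \<in> space ?M"
  show "(\<integral>\<^sup>+s. indicator (chord X) (z, s) * ennreal 1 \<partial>lborel) <= ennreal D"
   using nn_integral_chord_bound[of "%_. 1" 1 "%s. (z, s) \<in> chord X"] chord_length[of z _] z by (auto simp: indicator_def)
  show "(\<integral>\<^sup>+s. indicator (chord X) (shift z (- s), s) * ennreal 1 \<partial>lborel) <= ennreal D"
   using nn_integral_chord_bound[of "%_. 1" 1 "%s. (shift z (- s), s) \<in> chord X"] chord_shift_length[of z _] z by (auto simp: indicator_def)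
 qed (use D_pos in auto)
 show ?thesis
  using line_formula[OF H] AE_phase_shift[OF w] exit[unfolded transversal_exit_def] gi AE_space
 proof eventually_elim
  case (elim z)
  obtain \<tau> where \<tau>: "0 < \<tau>" "!!s. (z, s) \<in> chord X \<longleftrightarrow> 0 <= s & s < \<tau>" "shift z \<tau> \<in> Gamma_minus X"
   using elim(3) by blast
  define f where "f r = indicator (chord X) (z, r) * zext X g (shift z r)" for r
  have f_i: "integrable lborel f"
  proof -
   have "f = (%s. indicator (chord X) (z, s) * 1 * g (shift z s))"
    unfolding f_def using zext_shift[OF elim(5)] by auto
   then show ?thesis using elim(4) by simp
  qed
  define R where "R s = u z - w (shift z s) - (\<integral>r. indicator {0..s} r * f r \<partial>lborel)" for s
  have R0: "AE s in lborel. 0 < s & s < \<tau> \<longrightarrow> R s = 0"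
   using elim(1,2)
  proof eventually_elim
   case (elim s)
   show ?case
   proof
    assume s: "0 < s & s < \<tau>"
    then have "(\<integral>r. indicator {0..s} r * f r \<partial>lborel) = (\<integral>r. indicator {0..s} r * zext X g (shift z r) \<partial>lborel)"
     by (intro Bochner_Integration.integral_cong) (auto simp: f_def indicator_def \<tau>(2))
    then show "R s = 0" using elim s by (auto simp: R_def \<tau>(2))
   qed
  qed
  have "(R \<longlongrightarrow> u z - 0 - (\<integral>r. f r \<partial>lborel)) (at_left \<tau>)"
   unfolding R_def
  proof (intro tendsto_diff tendsto_const)
   have "((%t. w (shift (shift z \<tau>) (- t))) \<longlongrightarrow> 0) (at_right 0)"
    using lim[of "fst (shift z \<tau>)" "snd z"] \<tau>(3) by (simp add: shift_def[of "(_ :: 'a, _ :: 'a)"] shift_def)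
   then have "((%t. w (shift (shift z \<tau>) (- (\<tau> - t)))) \<longlongrightarrow> 0) (at_left \<tau>)"
    by (rule filterlim_compose)
     (auto simp: filterlim_at eventually_at_left_field intro!: tendsto_eq_intros exI[of _ "\<tau> - 1"])
   then show "((%s. w (shift z s)) \<longlongrightarrow> 0) (at_left \<tau>)" by (simp add: shift_shift)
   show "((%s. \<integral>r. indicator {0..s} r * f r \<partial>lborel) \<longlongrightarrow> (\<integral>r. f r \<partial>lborel)) (at_left \<tau>)"
   proof (rule tendsto_at_left_sequentially[OF \<tau>(1)])
    fix S :: "nat => real" assume S: "!!n. S n < \<tau>" "S \<longlonglongrightarrow> \<tau>"
    show "(%n. \<integral>r. indicator {0..S n} r * f r \<partial>lborel) \<longlonglongrightarrow> (\<integral>r. f r \<partial>lborel)"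
    proof (rule integral_dominated_convergence[where w = "%r. \<bar>f r\<bar>"])
     show "AE r in lborel. (%n. indicator {0..S n} r * f r) \<longlonglongrightarrow> f r"
     proof (rule AE_I2)
      fix r
      show "(%n. indicator {0..S n} r * f r) \<longlonglongrightarrow> f r"
      proof (cases "0 <= r & r < \<tau>")
       case True
       then have "eventually (%n. r < S n) sequentially" using S(2) by (auto intro: order_tendstoD(1))
       then have "eventually (%n. indicator {0..S n} r * f r = f r) sequentially"
        by eventually_elim (use True in \<open>auto simp: indicator_def\<close>)
       then show ?thesis by (rule tendsto_eventually)
      qed (auto simp: f_def \<tau>(2))
     qed
    qed (use f_i in \<open>auto simp: indicator_def\<close>)
   qed
  qed
  \<comment> \<open>A nonzero limit would keep \<open>R\<close> away from 0 on a whole interval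
    below \<open>\<tau>\<close>, which has positive measure, whereas \<open>R\<close> vanishes
    almost everywhere there.\<close>
  moreover have "\<not> eventually (%s. R s \<noteq> 0) (at_left \<tau>)"
  proof
   assume "eventually (%s. R s \<noteq> 0) (at_left \<tau>)"
   then obtain b where b: "b < \<tau>" "!!s. b < s ==> s < \<tau> ==> R s \<noteq> 0"
    by (auto simp: eventually_at_left_field)
   have "AE s in lborel. s \<notin> {max 0 b<..<\<tau>}" using R0 by eventually_elim (use b in auto)
   then have "emeasure lborel {max 0 b<..<\<tau>} = 0"
    by (subst (asm) AE_iff_measurable[of "{max 0 b<..<\<tau>}"]) auto
   then show False using b(1) \<tau>(1) by auto
  qed
  ultimately have "u z - 0 - (\<integral>r. f r \<partial>lborel) = 0"
   using tendsto_imp_eventually_ne[of R _ "at_left \<tau>" 0] by blast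
  then show ?case by (simp add: f_def[abs_def])
 qed
qed

lemma nn_integral_exp_half_line:
 assumes "0 < \<nu>"
 shows "(\<integral>\<^sup>+s. ennreal (exp (- \<nu> * s)) * indicator {0..} s \<partial>lborel) = ennreal (1 / \<nu>)"
proof -
 have "(\<integral>\<^sup>+s. ennreal (exp (- \<nu> * s)) * indicator {0..} s \<partial>lborel) = ennreal (0 - (- exp (- \<nu> * 0) / \<nu>))"
 proof (rule nn_integral_FTC_atLeast[where F = "%s. - exp (- \<nu> * s) / \<nu>"])
  show "((%s. - exp (- \<nu> * s) / \<nu>) \<longlongrightarrow> 0) at_top"
  proof -
   have "filterlim (%s. - \<nu> * s) at_bot at_top"
    by (rule filterlim_tendsto_neg_mult_at_bot[OF tendsto_const _ filterlim_ident]) (use assms in simp)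
   then have "((%s. exp (- \<nu> * s)) \<longlongrightarrow> 0) at_top" by (rule filterlim_compose[OF exp_at_bot])
   from tendsto_divide[OF tendsto_minus[OF this] tendsto_const[of \<nu>]] show ?thesis using assms by simp
  qed
 qed (use assms in \<open>auto intro!: derivative_eq_intros\<close>)
 then show ?thesis by simp
qed

text \<open>With the weight \<open>exp (- \<nu> th \<bullet> x)\<close>, integration along characteristics contracts the
 L1 norm by \<open>1 / \<nu>\<close>.\<close>

lemma damped_equation_zero:
 assumes H: "H12_derivative X u g" and tr: "inflow_trace X u (%_. 0)" and exit: transversal_exit
  and c: "0 < c" "AE z in phase_measure X. \<bar>g z\<bar> <= c * \<bar>u z\<bar>"
 shows "AE z in phase_measure X. u z = 0"
proof -
 let ?M = "phase_measure X"
 have u: "u \<in> L2 ?M" and g: "g \<in> L2 ?M" using H by (auto simp: H12_derivative_def)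
 note [measurable] = L2_measurable[OF u]
 define u' where "u' = zext X u"
 have [measurable]: "u' \<in> borel_measurable borel"
  unfolding u'_def using u by (auto intro: borel_measurable_zext L2_measurable)
 \<comment> \<open>The exponent \<open>2 * c\<close> is twice the constant of the differential
   inequality, so that one integration gains the factor \<open>c / (2 * c) = 1 / 2\<close>.\<close>
 define e where "e z = exp (- (2 * c) * (snd z \<bullet> fst z))" for z :: "'a \<times> 'a"
 have [measurable]: "e \<in> borel_measurable borel" unfolding e_def by measurable
 have e_pos: "0 < e z" for z by (simp add: e_def)
 have e_shift: "e (shift z (- s)) = e z * exp (- (2 * c) * s)" if "z \<in> space ?M" for z s
 proof -
  have "snd z \<bullet> snd z = 1" using that by (auto simp: power2_norm_eq_inner[symmetric])
  then show ?thesis by (simp add: e_def inner_add_right algebra_simps exp_add[symmetric])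
 qed
 let ?I = "\<integral>\<^sup>+z. ennreal (e z * \<bar>u z\<bar>) \<partial>?M"
 have fin: "?I < \<infinity>"
 proof -
  obtain b where b: "!!x. x \<in> X ==> norm x <= b" "0 < b" using bounded_X bounded_pos by blast
  have e_le: "e z <= exp (2 * c * b)" if "z \<in> space ?M" for z
  proof -
   have "\<bar>snd z \<bullet> fst z\<bar> <= 1 * b" using Cauchy_Schwarz_ineq2[of "snd z" "fst z"] b(1)[of "fst z"] that by auto
   then have "- (snd z \<bullet> fst z) <= b" by linarith
   then have "2 * c * (- (snd z \<bullet> fst z)) <= 2 * c * b" using c(1) by (intro mult_left_mono) auto
   then show ?thesis by (simp only: e_def exp_le_cancel_iff mult_minus_left mult_minus_right)
  qed
  have "?I <= (\<integral>\<^sup>+z. ennreal (exp (2 * c * b) * \<bar>u z\<bar>) \<partial>?M)"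
  proof (rule nn_integral_mono)
   fix z assume "z \<in> space ?M"
   from mult_right_mono[OF e_le[OF this] abs_ge_zero]
   show "ennreal (e z * \<bar>u z\<bar>) <= ennreal (exp (2 * c * b) * \<bar>u z\<bar>)" by (rule ennreal_leI)
  qed
  also have "\<dots> < \<infinity>" using phase.L2_imp_integrable[OF u] by (subst nn_integral_eq_integral) auto
  finally show ?thesis .
 qed
 have pointwise: "AE z in ?M. ennreal (e z * \<bar>u z\<bar>) <= (\<integral>\<^sup>+s. indicator (chord X) (z, s) * ennreal (c * e z * \<bar>u' (shift z s)\<bar>) \<partial>lborel)"
  using trace_formula[OF H tr exit] AE_phase_shift[OF c(2)] AE_space
 proof eventually_elim
  case (elim z)
  have [measurable]: "(%s. shift z s) \<in> borel_measurable borel" unfolding shift_def by measurable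
  have "ennreal \<bar>u z\<bar> <= (\<integral>\<^sup>+s. ennreal \<bar>indicator (chord X) (z, s) * zext X g (shift z s)\<bar> \<partial>lborel)"
   unfolding elim(1) by (rule ennreal_abs_integral_le)
  also have "\<dots> <= (\<integral>\<^sup>+s. indicator (chord X) (z, s) * ennreal (c * \<bar>u' (shift z s)\<bar>) \<partial>lborel)"
   by (rule nn_integral_mono_AE, use elim(2) in eventually_elim)
    (use shift_in_phase[OF _ elim(3)] in \<open>auto simp: indicator_def zext_eq u'_def intro!: ennreal_leI\<close>)
  finally have "ennreal (e z) * ennreal \<bar>u z\<bar> <= ennreal (e z) * (\<integral>\<^sup>+s. indicator (chord X) (z, s) * ennreal (c * \<bar>u' (shift z s)\<bar>) \<partial>lborel)"
   by (rule mult_left_mono) simp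
  also have "\<dots> = (\<integral>\<^sup>+s. ennreal (e z) * (indicator (chord X) (z, s) * ennreal (c * \<bar>u' (shift z s)\<bar>)) \<partial>lborel)"
   by (rule nn_integral_cmult[symmetric]) measurable
  also have "\<dots> = (\<integral>\<^sup>+s. indicator (chord X) (z, s) * ennreal (c * e z * \<bar>u' (shift z s)\<bar>) \<partial>lborel)"
   using c(1) less_imp_le[OF e_pos[of z]] by (intro nn_integral_cong) (auto simp: indicator_def ennreal_mult[symmetric] mult_ac)
  finally show ?case using less_imp_le[OF e_pos[of z]] by (simp add: ennreal_mult)
 qed
 have "?I <= (\<integral>\<^sup>+z. (\<integral>\<^sup>+s. indicator (chord X) (z, s) * ennreal (c * e z * \<bar>u' (shift z s)\<bar>) \<partial>lborel) \<partial>?M)"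
  by (rule nn_integral_mono_AE[OF pointwise])
 also have "\<dots> = (\<integral>\<^sup>+z. (\<integral>\<^sup>+s. indicator (chord X) (shift z (- s), s) * ennreal (c * e (shift z (- s)) * \<bar>u' z\<bar>) \<partial>lborel) \<partial>?M)"
  using nn_integral_chord_shift[of "%w. ennreal (c * e (fst w) * \<bar>u' (shift (fst w) (snd w))\<bar>)"] by simp
 also have "\<dots> <= (\<integral>\<^sup>+z. (\<integral>\<^sup>+s. ennreal (c * e z * \<bar>u z\<bar>) * (ennreal (exp (- (2 * c) * s)) * indicator {0..} s) \<partial>lborel) \<partial>?M)"
 proof (rule nn_integral_mono, rule nn_integral_mono)
  fix z s assume z: "z \<in> space ?M"
  have "(shift z (- s), s) \<in> chord X ==> 0 <= s" using chord_shift_length(1)[of z s] z by auto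
  then show "indicator (chord X) (shift z (- s), s) * ennreal (c * e (shift z (- s)) * \<bar>u' z\<bar>)
    <= ennreal (c * e z * \<bar>u z\<bar>) * (ennreal (exp (- (2 * c) * s)) * indicator {0..} s)"
   using z c(1) less_imp_le[OF e_pos[of z]]
   by (auto simp: indicator_def e_shift u'_def zext_eq ennreal_mult[symmetric] mult_ac)
 qed
 also have "\<dots> = (\<integral>\<^sup>+z. ennreal (c * e z * \<bar>u z\<bar>) * ennreal (1 / (2 * c)) \<partial>?M)"
  using nn_integral_exp_half_line[of "2 * c"] c(1) by (intro nn_integral_cong) (subst nn_integral_cmult, auto)
 also have "\<dots> = (\<integral>\<^sup>+z. ennreal (1 / 2) * ennreal (e z * \<bar>u z\<bar>) \<partial>?M)"
 proof (rule nn_integral_cong)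
  fix z
  have "ennreal (c * e z * \<bar>u z\<bar>) * ennreal (1 / (2 * c)) = ennreal (c * e z * \<bar>u z\<bar> * (1 / (2 * c)))"
   using c(1) less_imp_le[OF e_pos[of z]] by (intro ennreal_mult[symmetric]) auto
  also have "c * e z * \<bar>u z\<bar> * (1 / (2 * c)) = 1 / 2 * (e z * \<bar>u z\<bar>)" using c(1) by simp
  also have "ennreal (1 / 2 * (e z * \<bar>u z\<bar>)) = ennreal (1 / 2) * ennreal (e z * \<bar>u z\<bar>)"
   using less_imp_le[OF e_pos[of z]] by (intro ennreal_mult) auto
  finally show "ennreal (c * e z * \<bar>u z\<bar>) * ennreal (1 / (2 * c)) = ennreal (1 / 2) * ennreal (e z * \<bar>u z\<bar>)" .
 qed
 also have "\<dots> = ennreal (1 / 2) * ?I"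
  using borel_measurable_phase[of e] by (intro nn_integral_cmult) measurable
 finally have le: "?I <= ennreal (1 / 2) * ?I" .
 obtain i where i: "?I = ennreal i" "0 <= i" using fin by (cases ?I) auto
 moreover have "ennreal (1 / 2) * ennreal i = ennreal (1 / 2 * i)" by (rule ennreal_mult[symmetric]) (use i in auto)
 ultimately have "i <= 1 / 2 * i" using le i by (metis ennreal_le_iff mult_nonneg_nonneg zero_le_divide_1_iff zero_le_numeral)
 then have "?I = 0" using i by simp
 then have "AE z in ?M. ennreal (e z * \<bar>u z\<bar>) = 0"
  using borel_measurable_phase[of e] by (subst (asm) nn_integral_0_iff_AE) measurable
 then show ?thesis
 proof eventually_elim
  case (elim z)
  then have "e z * \<bar>u z\<bar> <= 0" by (simp add: ennreal_eq_0_iff)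
  then show ?case using e_pos[of z] by (simp add: mult_le_0_iff)
 qed
qed

end

section \<open>Smooth boundaries\<close>

definition gradient :: "('a::euclidean_space => real) => 'a => 'a" where
 "gradient r y = (\<Sum>b\<in>Basis. frechet_derivative r (at y) b *\<^sub>R b)"

lemma differentiable_on_open_has_derivative:
 assumes "f differentiable_on U" "open U" "y \<in> U"
 shows "(f has_derivative frechet_derivative f (at y)) (at y)"
proof -
 have "f differentiable (at y within U)" using assms(1,3) unfolding differentiable_on_def by blast
 then have "f differentiable (at y)" unfolding at_within_open[OF assms(3,2)] .
 then show ?thesis by (simp only: frechet_derivative_works)
qed

lemma smooth_onD:
 assumes "smooth_on U r" "open U"
 shows "y \<in> U ==> (r has_derivative frechet_derivative r (at y)) (at y)"
  and "b \<in> Basis ==> continuous_on U (%y. frechet_derivative r (at y) b)"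
  and "b \<in> Basis ==> y \<in> U ==> ((%y. frechet_derivative r (at y) b) has_derivative
   frechet_derivative (%y. frechet_derivative r (at y) b) (at y)) (at y)"
  and "b \<in> Basis ==> c \<in> Basis ==>
   continuous_on U (%y. frechet_derivative (%y. frechet_derivative r (at y) b) (at y) c)"
  and "continuous_on U r"
proof -
 have 2: "Ck_on (Suc (Suc 0)) U r" using assms(1) by (simp add: smooth_on_def)
 then have d: "r differentiable_on U" "!!b. b \<in> Basis ==> (%y. frechet_derivative r (at y) b) differentiable_on U"
  by simp_all
 show "y \<in> U ==> (r has_derivative frechet_derivative r (at y)) (at y)"
  by (rule differentiable_on_open_has_derivative[OF d(1) assms(2)])
 show "b \<in> Basis ==> continuous_on U (%y. frechet_derivative r (at y) b)"
  using d(2) differentiable_imp_continuous_on by blast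
 show "b \<in> Basis ==> y \<in> U ==> ((%y. frechet_derivative r (at y) b) has_derivative
   frechet_derivative (%y. frechet_derivative r (at y) b) (at y)) (at y)"
  by (rule differentiable_on_open_has_derivative[OF d(2) assms(2)])
 show "b \<in> Basis ==> c \<in> Basis ==>
   continuous_on U (%y. frechet_derivative (%y. frechet_derivative r (at y) b) (at y) c)"
  using 2 by simp
 show "continuous_on U r" using d(1) by (rule differentiable_imp_continuous_on)
qed

lemma bounded_linear_Basis_expansion:
 fixes f :: "'a::euclidean_space => real"
 assumes "bounded_linear f"
 shows "f h = (\<Sum>b\<in>Basis. (h \<bullet> b) * f b)"
proof -
 interpret bounded_linear f by fact
 have "f h = f (\<Sum>b\<in>Basis. (h \<bullet> b) *\<^sub>R b)" by (simp add: euclidean_representation)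
 then show ?thesis by (simp add: sum scaleR)
qed

lemma gradient_inner:
 assumes "(r has_derivative frechet_derivative r (at y)) (at y)"
 shows "frechet_derivative r (at y) h = gradient r y \<bullet> h"
 unfolding gradient_def bounded_linear_Basis_expansion[OF has_derivative_bounded_linear[OF assms], of h]
 by (simp add: inner_sum_left inner_commute[of h] mult.commute)

lemma DERIV_along_line:
 assumes "(f has_derivative f') (at (y + s *\<^sub>R v))"
 shows "((%s. f (y + s *\<^sub>R v)) has_real_derivative f' v) (at s within S)"
proof -
 interpret bounded_linear f' by (rule has_derivative_bounded_linear[OF assms])
 have "((%s. y + s *\<^sub>R v) has_derivative (%h. h *\<^sub>R v)) (at s within S)"
  by (auto intro!: derivative_eq_intros)
 from has_derivative_compose[OF this assms] show ?thesis
  by (simp add: has_field_derivative_def scaleR mult_commute_abs)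
qed

lemma emeasure_lborel_translate:
 fixes A :: "'a::euclidean_space set"
 assumes [measurable]: "A \<in> sets borel"
 shows "(\<integral>\<^sup>+x. indicator A (x + c) \<partial>lborel) = emeasure lborel A"
 using nn_integral_lborel_translate[of "indicator A" c] by simp

lemma emeasure_lborel_lines:
 fixes A :: "'a::euclidean_space set"
 assumes [measurable]: "A \<in> sets borel" and "p <= q"
 shows "(\<integral>\<^sup>+x. (\<integral>\<^sup>+s. indicator A (x + s *\<^sub>R v) * indicator {p..q} s \<partial>lborel) \<partial>lborel) = ennreal (q - p) * emeasure lborel A"
proof -
 have "(\<integral>\<^sup>+x. (\<integral>\<^sup>+s. indicator A (x + s *\<^sub>R v) * indicator {p..q} s \<partial>lborel) \<partial>lborel)
   = (\<integral>\<^sup>+s. (\<integral>\<^sup>+x. indicator A (x + s *\<^sub>R v) * indicator {p..q} s \<partial>lborel) \<partial>lborel)"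
  by (rule lborel_pair.Fubini') measurable
 also have "\<dots> = (\<integral>\<^sup>+s. emeasure lborel A * indicator {p..q} s \<partial>lborel)"
  by (intro nn_integral_cong) (subst nn_integral_multc, auto simp: emeasure_lborel_translate)
 also have "\<dots> = ennreal (q - p) * emeasure lborel A"
  using assms(2) by (subst nn_integral_cmult) (auto simp: mult.commute)
 finally show ?thesis .
qed

text \<open>If \<open>r\<close> is strictly monotone in a coordinate direction, every line in that direction meets
 \<open>|r| <= \<delta>\<close> in a set of length \<open>O(\<delta>)\<close>.\<close>

lemma thin_level_set:
 fixes V :: "'a::euclidean_space set"
 assumes V: "compact V" "convex V" and b: "norm b = 1" and c: "0 < c"
  and r: "continuous_on V r" "!!y. y \<in> V ==> (r has_derivative r' y) (at y)" "!!y. y \<in> V ==> c <= r' y b"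
 obtains K where "0 <= K" "!!\<delta>. 0 <= \<delta> ==> emeasure lborel {y \<in> V. \<bar>r y\<bar> <= \<delta>} <= ennreal (K * \<delta>)"
proof -
 obtain R where R: "!!y. y \<in> V ==> norm y <= R" "0 < R" using compact_imp_bounded[OF V(1)] bounded_pos by blast
 define W where "W = cball (0::'a) (R + 1)"
 have Wfin: "emeasure lborel W < \<infinity>" unfolding W_def by (rule emeasure_bounded_finite) simp
 define m where "m = measure lborel W"
 have m: "emeasure lborel W = ennreal m" "0 <= m"
  unfolding m_def using Wfin by (auto intro: emeasure_eq_ennreal_measure)
 show ?thesis
 proof
  show "0 <= 4 / c * m" using c m by simp
  fix \<delta> :: real assume \<delta>: "0 <= \<delta>"
  let ?A = "{y \<in> V. \<bar>r y\<bar> <= \<delta>}"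
  have "?A = V \<inter> (%y. \<bar>r y\<bar>) -` {..\<delta>}" by auto
  then have "closed ?A"
   using continuous_closed_preimage[of V "%y. \<bar>r y\<bar>" "{..\<delta>}"] r(1) compact_imp_closed[OF V(1)]
   by (auto intro: continuous_on_rabs)
  then have A [measurable]: "?A \<in> sets borel" by simp
  \<comment> \<open>By the mean value theorem two points of the strip on the same line are at most
    \<open>2 * \<delta> / c\<close> apart; convexity keeps the segment between them in
    \<open>V\<close>.\<close>
  have close: "\<bar>t - s\<bar> <= 2 * \<delta> / c" if st: "y + s *\<^sub>R b \<in> ?A" "y + t *\<^sub>R b \<in> ?A" for y s t
  proof -
   have main: "t - s <= 2 * \<delta> / c" if st: "s < t" "y + s *\<^sub>R b \<in> ?A" "y + t *\<^sub>R b \<in> ?A" for s t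
   proof -
    have inV: "y + u *\<^sub>R b \<in> V" if u: "s <= u" "u <= t" for u
    proof -
     define l where "l = (u - s) / (t - s)"
     have l: "0 <= l" "l <= 1" using u st(1) by (auto simp: l_def)
     have "l * (t - s) = u - s" using st(1) by (simp add: l_def)
     then have "s + l * (t - s) = u" by simp
     then have "(1 - l) *\<^sub>R (y + s *\<^sub>R b) + l *\<^sub>R (y + t *\<^sub>R b) = y + u *\<^sub>R b"
      by (simp add: algebra_simps flip: scaleR_add_left)
     then show ?thesis using convexD[OF V(2), of "y + s *\<^sub>R b" "y + t *\<^sub>R b" "1 - l" l] st l by auto
    qed
    obtain u where u: "s < u" "u < t" "r (y + t *\<^sub>R b) - r (y + s *\<^sub>R b) = (t - s) * r' (y + u *\<^sub>R b) b"
     using MVT2[OF st(1), of "%u. r (y + u *\<^sub>R b)" "%u. r' (y + u *\<^sub>R b) b"] DERIV_along_line[OF r(2)[OF inV]] by auto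
    have "(t - s) * c <= (t - s) * r' (y + u *\<^sub>R b) b"
     using r(3)[OF inV[of u]] u st(1) by (intro mult_left_mono) auto
    also have "\<dots> <= 2 * \<delta>" using u(3) st by auto
    finally show ?thesis using c by (simp add: field_simps)
   qed
   show ?thesis using main[of s t] main[of t s] st \<delta> c by (cases s t rule: linorder_cases) auto
  qed
  have "ennreal (1 - 0) * emeasure lborel ?A = (\<integral>\<^sup>+y. (\<integral>\<^sup>+s. indicator ?A (y + s *\<^sub>R b) * indicator {0..1} s \<partial>lborel) \<partial>lborel)"
   by (rule emeasure_lborel_lines[symmetric]) auto
  \<comment> \<open>The measure is averaged over unit segments in direction \<open>b\<close>. A
    segment that meets the strip starts in the enlarged ball \<open>W\<close> and stays in the strip
    for a length of at most \<open>4 * \<delta> / c\<close>.\<close>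
  also have "\<dots> <= (\<integral>\<^sup>+y. ennreal (4 * \<delta> / c) * indicator W y \<partial>lborel)"
  proof (rule nn_integral_mono)
   fix y
   show "(\<integral>\<^sup>+s. indicator ?A (y + s *\<^sub>R b) * indicator {0..1} s \<partial>lborel) <= ennreal (4 * \<delta> / c) * indicator W y"
   proof (cases "\<exists>s\<in>{0..1}. y + s *\<^sub>R b \<in> ?A")
    case True
    then obtain s where s: "s \<in> {0..1}" "y + s *\<^sub>R b \<in> ?A" by blast
    have "norm y <= norm (y + s *\<^sub>R b) + norm (s *\<^sub>R b)" using norm_triangle_ineq4[of "y + s *\<^sub>R b" "s *\<^sub>R b"] by simp
    also have "\<dots> <= R + 1" using R(1)[of "y + s *\<^sub>R b"] s b by auto
    finally have "y \<in> W" by (simp add: W_def)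
    have "(\<integral>\<^sup>+t. indicator ?A (y + t *\<^sub>R b) * indicator {0..1} t \<partial>lborel) <= (\<integral>\<^sup>+t. indicator {s - 2 * \<delta> / c..s + 2 * \<delta> / c} t \<partial>lborel)"
    proof (rule nn_integral_mono)
     fix t
     show "indicator ?A (y + t *\<^sub>R b) * indicator {0..1} t <= (indicator {s - 2 * \<delta> / c..s + 2 * \<delta> / c} t :: ennreal)"
     proof (cases "y + t *\<^sub>R b \<in> ?A")
      case True
      from close[OF s(2) this] have "t \<in> {s - 2 * \<delta> / c..s + 2 * \<delta> / c}" by (auto simp: abs_le_iff)
      then show ?thesis by (simp add: indicator_def)
     qed (simp add: indicator_def)
    qed
    also have "\<dots> = ennreal (s + 2 * \<delta> / c - (s - 2 * \<delta> / c))" using \<delta> c by (subst nn_integral_indicator) auto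
    finally show ?thesis using \<open>y \<in> W\<close> by (simp add: field_simps)
   next
    case False
    then have "(\<integral>\<^sup>+s. indicator ?A (y + s *\<^sub>R b) * indicator {0..1} s \<partial>lborel) = (\<integral>\<^sup>+s. 0 \<partial>(lborel :: real measure))"
     by (intro nn_integral_cong) (auto simp: indicator_def)
    then show ?thesis by simp
   qed
  qed
  also have "\<dots> = ennreal (4 * \<delta> / c) * ennreal m"
  proof -
   have "W \<in> sets lborel" by (simp add: W_def)
   then show ?thesis by (simp add: nn_integral_cmult m(1))
  qed
  also have "\<dots> = ennreal (4 / c * m * \<delta>)" using \<delta> c m(2) by (simp add: ennreal_mult[symmetric])
  finally show "emeasure lborel ?A <= ennreal (4 / c * m * \<delta>)" by simp
 qed
qed

text \<open>The tangential lines through a piece of the hypersurface \<open>r = 0\<close> in a fixed direction \<open>th\<close>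
 fill a null set: near the point of tangency \<open>r\<close> vanishes to second order, so such a line spends
 length \<open>2 \<epsilon>\<close> in \<open>|r| <= C \<epsilon>\<^sup>2\<close>, a set of measure \<open>O(\<epsilon>\<^sup>2)\<close>.\<close>

lemma tangential_lines_null:
 fixes U :: "'a::euclidean_space set"
 assumes U: "open U" "y\<^sub>0 \<in> U" and r: "smooth_on U r" and nz: "gradient r y\<^sub>0 \<noteq> 0" and "0 <= d"
 obtains \<rho> where "0 < \<rho>" "cball y\<^sub>0 \<rho> \<subseteq> U"
  "!!th N. norm th = 1 ==> N \<in> sets borel ==>
   (!!x. x \<in> N ==> \<exists>y t. x = y + t *\<^sub>R th & y \<in> cball y\<^sub>0 \<rho> & r y = 0 & gradient r y \<bullet> th = 0 & 0 <= t & t <= d) ==>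
   emeasure lborel N = 0"
proof -
 note S = smooth_onD[OF r U(1)]
 have "\<exists>b\<in>Basis. frechet_derivative r (at y\<^sub>0) b \<noteq> 0"
  using nz by (auto simp: gradient_def intro: sum.neutral)
 then obtain b where b: "b \<in> Basis" "frechet_derivative r (at y\<^sub>0) b \<noteq> 0" by blast
 \<comment> \<open>The sign makes the derivative in direction \<open>e *\<^sub>R b\<close> positive
   at \<open>y\<^sub>0\<close>, hence bounded below by half its value on a small ball.\<close>
 define e where "e = sgn (frechet_derivative r (at y\<^sub>0) b)"
 define p where "p y = e * frechet_derivative r (at y) b" for y
 have p0: "p y\<^sub>0 > 0" using b(2) by (simp add: p_def e_def sgn_mult_self_eq[symmetric] mult_sgn_abs) (metis abs_sgn zero_less_abs_iff mult.commute)
 have pc: "continuous_on U p" unfolding p_def by (intro continuous_intros S(2) b)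
 have "open (U \<inter> p -` {p y\<^sub>0 / 2<..})"
  by (rule continuous_open_preimage[OF pc U(1) open_greaterThan])
 moreover have "y\<^sub>0 \<in> U \<inter> p -` {p y\<^sub>0 / 2<..}" using U p0 by auto
 ultimately obtain R' where R': "0 < R'" "cball y\<^sub>0 R' \<subseteq> U \<inter> p -` {p y\<^sub>0 / 2<..}"
  by (meson open_contains_cball)
 \<comment> \<open>Points of tangency are taken in the ball of half the radius, so a line can be
   followed for a length \<open>R\<close> on either side without leaving \<open>V\<close>.\<close>
 define R where "R = R' / 2"
 define V where "V = cball y\<^sub>0 R'"
 have V: "compact V" "convex V" "V \<subseteq> U" "!!y. y \<in> V ==> p y\<^sub>0 / 2 <= p y"
  using R' by (auto simp: V_def)
 have eb: "norm (e *\<^sub>R b) = 1" using b by (simp add: e_def sgn_real_def)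
 have "\<exists>K\<ge>0. \<forall>\<delta>\<ge>0. emeasure lborel {y \<in> V. \<bar>r y\<bar> <= \<delta>} <= ennreal (K * \<delta>)"
 proof (rule thin_level_set[OF V(1,2) eb, of "p y\<^sub>0 / 2" r "%y. frechet_derivative r (at y)"])
  show "0 < p y\<^sub>0 / 2" using p0 by simp
  show "continuous_on V r" using S(5) V(3) by (rule continuous_on_subset)
  show "(r has_derivative frechet_derivative r (at y)) (at y)" if "y \<in> V" for y using S(1) V(3) that by blast
  show "p y\<^sub>0 / 2 <= frechet_derivative r (at y) (e *\<^sub>R b)" if "y \<in> V" for y
  proof -
   interpret bounded_linear "frechet_derivative r (at y)"
    using S(1)[of y] V(3) that by (auto intro: has_derivative_bounded_linear)
   show ?thesis using V(4)[OF that] by (simp add: p_def scaleR)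
  qed
 qed blast
 then obtain K where K: "0 <= K" "!!\<delta>. 0 <= \<delta> ==> emeasure lborel {y \<in> V. \<bar>r y\<bar> <= \<delta>} <= ennreal (K * \<delta>)" by blast
 let ?H = "%b c y. frechet_derivative (%y. frechet_derivative r (at y) b) (at y) c"
 have "\<forall>b c. \<exists>B. b \<in> Basis & c \<in> Basis \<longrightarrow> (\<forall>y\<in>V. \<bar>?H b c y\<bar> <= B)"
 proof (intro allI)
  fix b c
  show "\<exists>B. b \<in> Basis & c \<in> Basis \<longrightarrow> (\<forall>y\<in>V. \<bar>?H b c y\<bar> <= B)"
  proof (cases "b \<in> Basis & c \<in> Basis")
   case True
   then have "continuous_on V (?H b c)" using S(4) V(3) continuous_on_subset by blast
   then have "bounded (?H b c ` V)" using V(1) by (intro compact_imp_bounded compact_continuous_image)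
   then show ?thesis by (auto simp: bounded_iff)
  qed auto
 qed
 then obtain B where B: "!!b c y. b \<in> Basis ==> c \<in> Basis ==> y \<in> V ==> \<bar>?H b c y\<bar> <= B b c" by metis
 define C where "C = (\<Sum>b\<in>Basis. \<Sum>c\<in>Basis. \<bar>B b c\<bar>)"
 have C0: "0 <= C" unfolding C_def by (intro sum_nonneg) auto
 \<comment> \<open>Taylor's formula: at a point of tangency both \<open>r\<close> and its derivative
   along the line vanish, and \<open>C\<close> bounds the second derivative of \<open>r\<close> in
   unit directions on \<open>V\<close>.\<close>
 have second: "\<bar>r (y + s *\<^sub>R th)\<bar> <= C * \<epsilon>\<^sup>2"
  if y: "y \<in> cball y\<^sub>0 R" "r y = 0" "gradient r y \<bullet> th = 0" and th: "norm th = 1" and \<epsilon>: "0 < \<epsilon>" "\<epsilon> <= R" and s: "s \<in> {-\<epsilon>..\<epsilon>}"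
  for y th \<epsilon> s
 proof -
  have inV: "y + s *\<^sub>R th \<in> V" if "s \<in> {-\<epsilon>..\<epsilon>}" for s
  proof -
   have "dist y\<^sub>0 (y + s *\<^sub>R th) <= dist y\<^sub>0 y + norm (s *\<^sub>R th)"
    using dist_triangle[of y\<^sub>0 "y + s *\<^sub>R th" y] by (simp add: dist_norm)
   also have "\<dots> <= R + R" using y(1) that \<epsilon> th by auto
   finally show ?thesis by (simp add: V_def R_def)
  qed
  have g: "gradient r y \<bullet> th = (\<Sum>b\<in>Basis. (th \<bullet> b) * frechet_derivative r (at y) b)" for y
   by (simp add: gradient_def inner_sum_left inner_commute[of th] mult.commute)
  have thb: "\<bar>th \<bullet> b\<bar> <= 1" if "b \<in> Basis" for b using Basis_le_norm[OF that, of th] th by simp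
  let ?d2 = "%s. \<Sum>b\<in>Basis. (th \<bullet> b) * frechet_derivative (%y. frechet_derivative r (at y) b) (at (y + s *\<^sub>R th)) th"
  have d1: "((%s. r (y + s *\<^sub>R th)) has_real_derivative gradient r (y + s *\<^sub>R th) \<bullet> th) (at s within {-\<epsilon>..\<epsilon>})" if "s \<in> {-\<epsilon>..\<epsilon>}" for s
  proof -
   have D: "(r has_derivative frechet_derivative r (at (y + s *\<^sub>R th))) (at (y + s *\<^sub>R th))" using S(1) inV[OF that] V(3) by blast
   show ?thesis using DERIV_along_line[OF D] unfolding gradient_inner[OF D] .
  qed
  have d2: "((%s. gradient r (y + s *\<^sub>R th) \<bullet> th) has_real_derivative ?d2 s) (at s within {-\<epsilon>..\<epsilon>})" if "s \<in> {-\<epsilon>..\<epsilon>}" for s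
   unfolding g using inV[OF that] V(3) by (intro DERIV_sum DERIV_cmult DERIV_along_line S(3)) auto
  have d2b: "\<bar>?d2 s\<bar> <= C" if "s \<in> {-\<epsilon>..\<epsilon>}" for s
  proof -
   have "\<bar>?d2 s\<bar> <= (\<Sum>b\<in>Basis. \<bar>(th \<bullet> b) * frechet_derivative (%y. frechet_derivative r (at y) b) (at (y + s *\<^sub>R th)) th\<bar>)"
    by (rule sum_abs)
   also have "\<dots> <= C"
    unfolding C_def
   proof (rule sum_mono)
    fix b :: 'a assume b: "b \<in> Basis"
    have D: "((%y. frechet_derivative r (at y) b) has_derivative frechet_derivative (%y. frechet_derivative r (at y) b) (at (y + s *\<^sub>R th))) (at (y + s *\<^sub>R th))"
     using S(3)[OF b] inV[OF that] V(3) by blast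
    have "\<bar>(th \<bullet> b) * frechet_derivative (%y. frechet_derivative r (at y) b) (at (y + s *\<^sub>R th)) th\<bar>
     <= 1 * \<bar>frechet_derivative (%y. frechet_derivative r (at y) b) (at (y + s *\<^sub>R th)) th\<bar>"
     unfolding abs_mult by (intro mult_right_mono thb b) auto
    also have "\<dots> = \<bar>\<Sum>c\<in>Basis. (th \<bullet> c) * ?H b c (y + s *\<^sub>R th)\<bar>"
     using bounded_linear_Basis_expansion[OF has_derivative_bounded_linear[OF D], of th] by simp
    also have "\<dots> <= (\<Sum>c\<in>Basis. \<bar>(th \<bullet> c) * ?H b c (y + s *\<^sub>R th)\<bar>)" by (rule sum_abs)
    also have "\<dots> <= (\<Sum>c\<in>Basis. \<bar>B b c\<bar>)"
    proof (rule sum_mono)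
     fix c :: 'a assume c: "c \<in> Basis"
     have Hb: "\<bar>?H b c (y + s *\<^sub>R th)\<bar> <= \<bar>B b c\<bar>" using B[OF b c inV[OF that]] by linarith
     then show "\<bar>(th \<bullet> c) * ?H b c (y + s *\<^sub>R th)\<bar> <= \<bar>B b c\<bar>"
      using mult_mono[OF thb[OF c] Hb] by (simp add: abs_mult)
    qed
    finally show "\<bar>(th \<bullet> b) * frechet_derivative (%y. frechet_derivative r (at y) b) (at (y + s *\<^sub>R th)) th\<bar> <= (\<Sum>c\<in>Basis. \<bar>B b c\<bar>)" .
   qed
   finally show ?thesis .
  qed
  have i0: "0 \<in> {-\<epsilon>..\<epsilon>}" using \<epsilon> by simp
  have d1b: "norm (gradient r (y + s *\<^sub>R th) \<bullet> th) <= C * \<epsilon>" if sI: "s \<in> {-\<epsilon>..\<epsilon>}" for s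
  proof -
   have "norm (gradient r (y + s *\<^sub>R th) \<bullet> th - gradient r (y + 0 *\<^sub>R th) \<bullet> th) <= C * norm (s - 0)"
    by (rule field_differentiable_bound[OF _ d2 _ sI i0]) (use d2b in auto)
   also have "\<dots> <= C * \<epsilon>" using sI C0 by (intro mult_left_mono) auto
   finally show ?thesis using y(3) by simp
  qed
  have "norm (r (y + s *\<^sub>R th) - r (y + 0 *\<^sub>R th)) <= C * \<epsilon> * norm (s - 0)"
   by (rule field_differentiable_bound[OF _ d1 d1b s i0]) auto
  also have "\<dots> <= C * \<epsilon> * \<epsilon>" using s C0 \<epsilon> by (intro mult_left_mono) auto
  finally show ?thesis using y(2) by (simp add: power2_eq_square mult.assoc)
 qed
 show ?thesis
 proof
  show "0 < R" using R' by (simp add: R_def)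
  show "cball y\<^sub>0 R \<subseteq> U" using R' V(3) by (auto simp: R_def V_def)
  fix th N assume th: "norm th = 1" and N [measurable]: "N \<in> sets borel"
   and tan: "!!x. x \<in> N ==> \<exists>y t. x = y + t *\<^sub>R th & y \<in> cball y\<^sub>0 R & r y = 0 & gradient r y \<bullet> th = 0 & 0 <= t & t <= d"
  have bound: "emeasure lborel N <= ennreal ((d + 2) * K * C / 2 * \<epsilon>)" if \<epsilon>: "0 < \<epsilon>" "\<epsilon> <= R" "\<epsilon> <= 1" for \<epsilon>
  proof -
   let ?A = "{y \<in> V. \<bar>r y\<bar> <= C * \<epsilon>\<^sup>2}"
   have "?A = V \<inter> (%y. \<bar>r y\<bar>) -` {..C * \<epsilon>\<^sup>2}" by auto
   then have "closed ?A"
    using continuous_closed_preimage[of V "%y. \<bar>r y\<bar>" "{..C * \<epsilon>\<^sup>2}"] continuous_on_subset[OF S(5) V(3)] compact_imp_closed[OF V(1)]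
    by (auto intro: continuous_on_rabs)
   then have A [measurable]: "?A \<in> sets borel" by simp
   have "ennreal (2 * \<epsilon>) * emeasure lborel N = (\<integral>\<^sup>+x. ennreal (2 * \<epsilon>) * indicator N x \<partial>lborel)"
    by (simp add: nn_integral_cmult)
   \<comment> \<open>Each point of \<open>N\<close> sees its point of tangency at parameter
     \<open>- t\<close> with \<open>0 <= t <= d\<close>; the window of half-width
     \<open>\<epsilon> <= 1\<close> around it lies in \<open>{- d - 1..1}\<close> and is spent in
     the thin set.\<close>
   also have "\<dots> <= (\<integral>\<^sup>+x. (\<integral>\<^sup>+s. indicator ?A (x + s *\<^sub>R th) * indicator {- d - 1..1} s \<partial>lborel) \<partial>lborel)"
   proof (rule nn_integral_mono)
    fix x
    show "ennreal (2 * \<epsilon>) * indicator N x <= (\<integral>\<^sup>+s. indicator ?A (x + s *\<^sub>R th) * indicator {- d - 1..1} s \<partial>lborel)"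
    proof (cases "x \<in> N")
     case True
     then obtain y t where y: "x = y + t *\<^sub>R th" "y \<in> cball y\<^sub>0 R" "r y = 0" "gradient r y \<bullet> th = 0" "0 <= t" "t <= d"
      using tan by blast
     have "ennreal (2 * \<epsilon>) = (\<integral>\<^sup>+s. indicator {- t - \<epsilon>..- t + \<epsilon>} s \<partial>lborel)"
      using \<epsilon> by (subst nn_integral_indicator) auto
     also have "\<dots> <= (\<integral>\<^sup>+s. indicator ?A (x + s *\<^sub>R th) * indicator {- d - 1..1} s \<partial>lborel)"
     proof (rule nn_integral_mono)
      fix s
      show "indicator {- t - \<epsilon>..- t + \<epsilon>} s <= (indicator ?A (x + s *\<^sub>R th) * indicator {- d - 1..1} s :: ennreal)"
      proof (cases "s \<in> {- t - \<epsilon>..- t + \<epsilon>}")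
       case s: True
       then have st: "t + s \<in> {-\<epsilon>..\<epsilon>}" by auto
       have e: "x + s *\<^sub>R th = y + (t + s) *\<^sub>R th" by (simp add: y(1) algebra_simps)
       have "\<bar>r (y + (t + s) *\<^sub>R th)\<bar> <= C * \<epsilon>\<^sup>2" by (rule second[OF y(2-4) th \<epsilon>(1,2) st])
       moreover have "y + (t + s) *\<^sub>R th \<in> V"
       proof -
        have "dist y\<^sub>0 (y + (t + s) *\<^sub>R th) <= dist y\<^sub>0 y + norm ((t + s) *\<^sub>R th)"
         using dist_triangle[of y\<^sub>0 "y + (t + s) *\<^sub>R th" y] by (simp add: dist_norm)
        also have "\<dots> <= R + R" using y(2) st \<epsilon> th by auto
        finally show ?thesis by (simp add: V_def R_def)
       qed
       ultimately show ?thesis using s y(5,6) \<epsilon> by (auto simp: e)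
      qed auto
     qed
     finally show ?thesis using True by simp
    qed simp
   qed
   also have "\<dots> = ennreal (1 - (- d - 1)) * emeasure lborel ?A"
    by (rule emeasure_lborel_lines) (use \<open>0 <= d\<close> in auto)
   also have "\<dots> <= ennreal (d + 2) * ennreal (K * (C * \<epsilon>\<^sup>2))"
    using K(2)[of "C * \<epsilon>\<^sup>2"] C0 by (intro mult_mono) (auto simp: add.commute)
   also have "\<dots> = ennreal (2 * \<epsilon>) * ennreal ((d + 2) * K * C / 2 * \<epsilon>)"
   proof -
    have e: "(d + 2) * (K * (C * \<epsilon>\<^sup>2)) = 2 * \<epsilon> * ((d + 2) * K * C / 2 * \<epsilon>)" by (simp add: power2_eq_square)
    have "ennreal (d + 2) * ennreal (K * (C * \<epsilon>\<^sup>2)) = ennreal ((d + 2) * (K * (C * \<epsilon>\<^sup>2)))"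
     using \<open>0 <= d\<close> K(1) C0 by (intro ennreal_mult[symmetric]) auto
    also have "\<dots> = ennreal (2 * \<epsilon>) * ennreal ((d + 2) * K * C / 2 * \<epsilon>)"
     unfolding e using \<epsilon> \<open>0 <= d\<close> K(1) C0 by (intro ennreal_mult) auto
    finally show ?thesis .
   qed
   finally show ?thesis using \<epsilon>(1) by (subst (asm) ennreal_mult_le_mult_iff) auto
  qed
  define k where "k = (d + 2) * K * C / 2"
  have k: "0 <= k" using \<open>0 <= d\<close> K(1) C0 by (simp add: k_def)
  show "emeasure lborel N = 0"
  proof (rule antisym)
   show "emeasure lborel N <= 0"
   proof (rule ennreal_le_epsilon)
    fix e :: real assume e: "0 < e"
    define \<epsilon> where "\<epsilon> = min (min R 1) (e / (k + 1))"
    have \<epsilon>: "0 < \<epsilon>" "\<epsilon> <= R" "\<epsilon> <= 1" "\<epsilon> <= e / (k + 1)" using e k \<open>0 < R\<close> by (auto simp: \<epsilon>_def)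
    have "k * \<epsilon> <= (k + 1) * \<epsilon>" using \<epsilon> by (intro mult_right_mono) auto
    also have "\<dots> <= e" using \<epsilon>(4) k by (simp add: pos_le_divide_eq mult.commute)
    finally have ke: "k * \<epsilon> <= e" .
    show "emeasure lborel N <= 0 + ennreal e"
     using order_trans[OF bound[OF \<epsilon>(1-3), folded k_def] ennreal_leI[OF ke]] by simp
   qed
  qed simp
 qed
qed

section \<open>Defining functions, outer normal and entering directions\<close>

lemma local_defining_functionD:
 assumes "local_defining_function X x U r"
 shows "open U" "x \<in> U" "smooth_on U r" "!!y. y \<in> U ==> gradient r y \<noteq> 0"
  "!!y. y \<in> U ==> y \<in> X \<longleftrightarrow> r y < 0" "!!y. y \<in> U ==> local_defining_function X y U r"
  "!!y. y \<in> U ==> (r has_derivative (%h. gradient r y \<bullet> h)) (at y)"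
proof -
 show 1: "open U" "x \<in> U" "smooth_on U r" "!!y. y \<in> U ==> local_defining_function X y U r"
  using assms by (auto simp: local_defining_function_def)
 show "!!y. y \<in> U ==> y \<in> X \<longleftrightarrow> r y < 0"
  using assms unfolding local_defining_function_def by blast
 fix y assume y: "y \<in> U"
 note D = smooth_onD(1)[OF 1(3,1) y]
 have e: "frechet_derivative r (at y) = (%h. gradient r y \<bullet> h)" using gradient_inner[OF D] by blast
 show "(r has_derivative (%h. gradient r y \<bullet> h)) (at y)" using D unfolding e .
 have "frechet_derivative r (at y) \<noteq> (%_. 0)" using assms y by (auto simp: local_defining_function_def)
 then show "gradient r y \<noteq> 0" unfolding e by auto
qed

lemma defining_function_boundary:
 assumes r: "local_defining_function X x U r" and "open X" "y \<in> frontier X" "y \<in> U"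
 shows "r y = 0"
proof (rule antisym)
 note L = local_defining_functionD[OF r]
 have "y \<notin> X" using assms(2,3) by (auto simp: frontier_def interior_open)
 then show "0 <= r y" using L(5)[OF assms(4)] by simp
 show "r y <= 0"
 proof (rule ccontr)
  assume "\<not> r y <= 0"
  then have "y \<in> U \<inter> r -` {0<..}" using assms(4) by auto
  moreover have "open (U \<inter> r -` {0<..})"
   by (rule continuous_open_preimage[OF smooth_onD(5)[OF L(3,1)] L(1) open_greaterThan])
  moreover have "(U \<inter> r -` {0<..}) \<inter> X = {}" using L(5) by fastforce
  moreover have "y \<in> closure X" using assms(3) by (simp add: frontier_def)
  ultimately show False using open_Int_closure_eq_empty by blast
 qed
qed

lemma defining_function_line:
 assumes r: "local_defining_function X x U r" and X: "open X" "x \<in> frontier X"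
 shows "gradient r x \<bullet> v < 0 ==> \<exists>e>0. \<forall>t. 0 < t & t < e \<longrightarrow> x + t *\<^sub>R v \<in> X"
  and "gradient r x \<bullet> v > 0 ==> \<exists>e>0. \<forall>t. 0 < t & t < e \<longrightarrow> x + t *\<^sub>R v \<notin> X"
proof -
 note L = local_defining_functionD[OF r]
 have r0: "r x = 0" by (rule defining_function_boundary[OF r X L(2)])
 have d: "((%t. r (x + t *\<^sub>R v)) has_real_derivative gradient r x \<bullet> v) (at 0)"
  by (rule DERIV_along_line) (simp add: L(7)[OF L(2)])
 have "open ((%t. x + t *\<^sub>R v) -` U)" by (intro open_vimage L(1) continuous_intros)
 moreover have "0 \<in> (%t. x + t *\<^sub>R v) -` U" using L(2) by simp
 ultimately obtain e1 where e1: "0 < e1" "ball 0 e1 \<subseteq> (%t. x + t *\<^sub>R v) -` U" by (meson openE)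
 have inU: "x + t *\<^sub>R v \<in> U" if "0 < t" "t < e1" for t using e1(2) that by (auto simp: subset_eq dist_norm)
 show "\<exists>e>0. \<forall>t. 0 < t & t < e \<longrightarrow> x + t *\<^sub>R v \<in> X" if neg: "gradient r x \<bullet> v < 0"
 proof -
  obtain e2 where e2: "0 < e2" "!!t. 0 < t ==> t < e2 ==> r (x + t *\<^sub>R v) < 0"
   using DERIV_neg_dec_right[OF d neg] r0 by auto
  show ?thesis using e1(1) e2 inU L(5) by (intro exI[of _ "min e1 e2"]) auto
 qed
 show "\<exists>e>0. \<forall>t. 0 < t & t < e \<longrightarrow> x + t *\<^sub>R v \<notin> X" if pos: "gradient r x \<bullet> v > 0"
 proof -
  obtain e2 where e2: "0 < e2" "!!t. 0 < t ==> t < e2 ==> 0 < r (x + t *\<^sub>R v)"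
   using DERIV_pos_inc_right[OF d pos] r0 by auto
  have "x + t *\<^sub>R v \<notin> X" if "0 < t" "t < min e1 e2" for t
   using L(5)[OF inU[of t]] e2(2)[of t] that by auto
  then show ?thesis using e1(1) e2(1) by (intro exI[of _ "min e1 e2"]) auto
 qed
qed

text \<open>The description in \<open>outer_normal\<close> has to determine a unique vector,
  although different defining functions are allowed. If two unit normals differed, their difference
  would point strictly into \<open>X\<close> by one defining function and strictly out of it by the
  other.\<close>

lemma outer_normal_eq:
 assumes r: "local_defining_function X x U r" and X: "open X" "x \<in> frontier X"
 shows "outer_normal X x = sgn (gradient r x)"
 unfolding outer_normal_def
proof (rule the_equality)
 note L = local_defining_functionD[OF r]
 have nz: "gradient r x \<noteq> 0" by (rule L(4)[OF L(2)])
 have "(%h. norm (gradient r x) * (sgn (gradient r x) \<bullet> h)) = (%h. gradient r x \<bullet> h)"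
  using nz by (simp add: sgn_div_norm fun_eq_iff mult.assoc[symmetric])
 then show "norm (sgn (gradient r x)) = 1 & (\<exists>U r' c. local_defining_function X x U r' & 0 < c & (r' has_derivative (%h. c * (sgn (gradient r x) \<bullet> h))) (at x))"
  using nz L(7)[OF L(2)] r by (intro conjI exI[of _ U] exI[of _ r] exI[of _ "norm (gradient r x)"]) (auto simp: norm_sgn)
 fix \<nu> assume "norm \<nu> = 1 & (\<exists>U r c. local_defining_function X x U r & 0 < c & (r has_derivative (%h. c * (\<nu> \<bullet> h))) (at x))"
 then obtain U' r' c where \<nu>: "norm \<nu> = 1" "local_defining_function X x U' r'" "0 < c" "(r' has_derivative (%h. c * (\<nu> \<bullet> h))) (at x)" by blast
 have g: "gradient r' x \<bullet> h = c * (\<nu> \<bullet> h)" for h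
  using has_derivative_unique[OF local_defining_functionD(7)[OF \<nu>(2) local_defining_functionD(2)[OF \<nu>(2)]] \<nu>(4)] by meson
 define \<mu> where "\<mu> = sgn (gradient r x)"
 have n\<mu>: "norm \<mu> = 1" using nz by (simp add: \<mu>_def norm_sgn)
 show "\<nu> = sgn (gradient r x)"
 proof (rule ccontr)
  assume ne: "\<nu> \<noteq> sgn (gradient r x)"
  define p where "p = \<nu> \<bullet> \<mu>"
  have "0 < (norm (\<nu> - \<mu>))\<^sup>2" using ne by (simp add: \<mu>_def)
  also have "(norm (\<nu> - \<mu>))\<^sup>2 = 2 - 2 * p"
   using \<nu>(1) n\<mu> by (simp add: power2_norm_eq_inner inner_diff_left inner_diff_right inner_commute p_def norm_eq_1)
  finally have p: "p < 1" by simp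
  have 1: "\<nu> \<bullet> (\<mu> - \<nu>) = p - 1" "\<mu> \<bullet> (\<mu> - \<nu>) = 1 - p"
   using \<nu>(1) n\<mu> by (simp_all add: inner_diff_right norm_eq_1 p_def inner_commute)
  have "gradient r' x \<bullet> (\<mu> - \<nu>) < 0" unfolding g 1 using p \<nu>(3) by (simp add: mult_pos_neg)
  then obtain e1 where e1: "0 < e1" "!!t. 0 < t & t < e1 \<longrightarrow> x + t *\<^sub>R (\<mu> - \<nu>) \<in> X"
   using defining_function_line(1)[OF \<nu>(2) X] by blast
  have "gradient r x \<bullet> (\<mu> - \<nu>) = norm (gradient r x) * (\<mu> \<bullet> (\<mu> - \<nu>))"
   using nz by (simp add: \<mu>_def sgn_div_norm)
  then have "gradient r x \<bullet> (\<mu> - \<nu>) > 0" unfolding 1 using p nz by simp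
  then obtain e2 where e2: "0 < e2" "!!t. 0 < t & t < e2 \<longrightarrow> x + t *\<^sub>R (\<mu> - \<nu>) \<notin> X"
   using defining_function_line(2)[OF r X] by blast
  show False using e1(2)[of "min e1 e2 / 2"] e2(2)[of "min e1 e2 / 2"] e1(1) e2(1) by auto
 qed
qed

lemma Gamma_minus_iff:
 assumes r: "local_defining_function X x U r" and X: "open X" "x \<in> frontier X"
 shows "(x, th) \<in> Gamma_minus X \<longleftrightarrow> norm th = 1 & gradient r x \<bullet> th < 0"
proof -
 have "th \<bullet> outer_normal X x = (gradient r x \<bullet> th) / norm (gradient r x)"
  unfolding outer_normal_eq[OF assms] by (simp add: sgn_div_norm inner_commute divide_inverse mult.commute)
 moreover have "0 < norm (gradient r x)" using local_defining_functionD(4)[OF r local_defining_functionD(2)[OF r]] by simp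
 ultimately show ?thesis using X(2) by (auto simp: Gamma_minus_def divide_less_0_iff)
qed

lemma Gamma_minus_entering:
 assumes X: "open X" "smooth_boundary X" and y: "(y, th) \<in> Gamma_minus X"
 shows "y \<notin> X" "\<exists>e>0. \<forall>t. 0 < t & t < e \<longrightarrow> y + t *\<^sub>R th \<in> X"
proof -
 have f: "y \<in> frontier X" using y by (simp add: Gamma_minus_def)
 then show "y \<notin> X" using X(1) by (auto simp: frontier_def interior_open)
 obtain U r where r: "local_defining_function X y U r" using X(2) f by (auto simp: smooth_boundary_def)
 show "\<exists>e>0. \<forall>t. 0 < t & t < e \<longrightarrow> y + t *\<^sub>R th \<in> X"
  using defining_function_line(1)[OF r X(1) f] y unfolding Gamma_minus_iff[OF r X(1) f] by blast
qed

section \<open>Almost every characteristic leaves transversally\<close>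

context bounded_domain
begin

text \<open>A ray that exits tangentially starts in some \<open>Bad y\<^sub>0\<close>, the points at
  most \<open>D\<close> ahead of a tangency. Finitely many charts cover the compact boundary; each
  bad set is compact, hence Borel, and its slices in fixed directions are null, so Fubini makes it
  null.\<close>

lemma transversal_exit_smooth:
 assumes smooth: "smooth_boundary X"
 shows transversal_exit
proof -
 let ?M = "phase_measure X"
 have "\<forall>y\<^sub>0\<in>frontier X. \<exists>U r \<rho>. local_defining_function X y\<^sub>0 U r & 0 < \<rho> & cball y\<^sub>0 \<rho> \<subseteq> U &
   (\<forall>th N. norm th = 1 \<longrightarrow> N \<in> sets borel \<longrightarrow>
    (\<forall>x\<in>N. \<exists>y t. x = y + t *\<^sub>R th & y \<in> cball y\<^sub>0 \<rho> & r y = 0 & gradient r y \<bullet> th = 0 & 0 <= t & t <= D) \<longrightarrow>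
    emeasure lborel N = 0)"
 proof
  fix y\<^sub>0 assume "y\<^sub>0 \<in> frontier X"
  then obtain U r where r: "local_defining_function X y\<^sub>0 U r" using smooth by (auto simp: smooth_boundary_def)
  note L = local_defining_functionD[OF r]
  obtain \<rho> where "0 < \<rho>" "cball y\<^sub>0 \<rho> \<subseteq> U" "!!th N. norm th = 1 ==> N \<in> sets borel ==>
   (!!x. x \<in> N ==> \<exists>y t. x = y + t *\<^sub>R th & y \<in> cball y\<^sub>0 \<rho> & r y = 0 & gradient r y \<bullet> th = 0 & 0 <= t & t <= D) ==>
   emeasure lborel N = 0"
   using tangential_lines_null[OF L(1,2,3) L(4)[OF L(2)] less_imp_le[OF D_pos]] by blast
  then show "\<exists>U r \<rho>. local_defining_function X y\<^sub>0 U r & 0 < \<rho> & cball y\<^sub>0 \<rho> \<subseteq> U &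
   (\<forall>th N. norm th = 1 \<longrightarrow> N \<in> sets borel \<longrightarrow>
    (\<forall>x\<in>N. \<exists>y t. x = y + t *\<^sub>R th & y \<in> cball y\<^sub>0 \<rho> & r y = 0 & gradient r y \<bullet> th = 0 & 0 <= t & t <= D) \<longrightarrow>
    emeasure lborel N = 0)"
   using r by (intro exI[of _ U] exI[of _ r] exI[of _ \<rho>]) blast
 qed
 from bchoice[OF this] obtain U where "\<forall>y\<^sub>0\<in>frontier X. \<exists>r \<rho>. local_defining_function X y\<^sub>0 (U y\<^sub>0) r & 0 < \<rho> & cball y\<^sub>0 \<rho> \<subseteq> U y\<^sub>0 &
   (\<forall>th N. norm th = 1 \<longrightarrow> N \<in> sets borel \<longrightarrow>
    (\<forall>x\<in>N. \<exists>y t. x = y + t *\<^sub>R th & y \<in> cball y\<^sub>0 \<rho> & r y = 0 & gradient r y \<bullet> th = 0 & 0 <= t & t <= D) \<longrightarrow>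
    emeasure lborel N = 0)" ..
 from bchoice[OF this] obtain r where "\<forall>y\<^sub>0\<in>frontier X. \<exists>\<rho>. local_defining_function X y\<^sub>0 (U y\<^sub>0) (r y\<^sub>0) & 0 < \<rho> & cball y\<^sub>0 \<rho> \<subseteq> U y\<^sub>0 &
   (\<forall>th N. norm th = 1 \<longrightarrow> N \<in> sets borel \<longrightarrow>
    (\<forall>x\<in>N. \<exists>y t. x = y + t *\<^sub>R th & y \<in> cball y\<^sub>0 \<rho> & r y\<^sub>0 y = 0 & gradient (r y\<^sub>0) y \<bullet> th = 0 & 0 <= t & t <= D) \<longrightarrow>
    emeasure lborel N = 0)" ..
 from bchoice[OF this] obtain \<rho> where all: "\<forall>y\<^sub>0\<in>frontier X. local_defining_function X y\<^sub>0 (U y\<^sub>0) (r y\<^sub>0) & 0 < \<rho> y\<^sub>0 & cball y\<^sub>0 (\<rho> y\<^sub>0) \<subseteq> U y\<^sub>0 &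
   (\<forall>th N. norm th = 1 \<longrightarrow> N \<in> sets borel \<longrightarrow>
    (\<forall>x\<in>N. \<exists>y t. x = y + t *\<^sub>R th & y \<in> cball y\<^sub>0 (\<rho> y\<^sub>0) & r y\<^sub>0 y = 0 & gradient (r y\<^sub>0) y \<bullet> th = 0 & 0 <= t & t <= D) \<longrightarrow>
    emeasure lborel N = 0)" ..
 then have R: "!!y\<^sub>0. y\<^sub>0 \<in> frontier X ==> local_defining_function X y\<^sub>0 (U y\<^sub>0) (r y\<^sub>0)"
   "!!y\<^sub>0. y\<^sub>0 \<in> frontier X ==> 0 < \<rho> y\<^sub>0" "!!y\<^sub>0. y\<^sub>0 \<in> frontier X ==> cball y\<^sub>0 (\<rho> y\<^sub>0) \<subseteq> U y\<^sub>0"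
   "!!y\<^sub>0 th N. y\<^sub>0 \<in> frontier X ==> norm th = 1 ==> N \<in> sets borel ==>
    (\<forall>x\<in>N. \<exists>y t. x = y + t *\<^sub>R th & y \<in> cball y\<^sub>0 (\<rho> y\<^sub>0) & r y\<^sub>0 y = 0 & gradient (r y\<^sub>0) y \<bullet> th = 0 & 0 <= t & t <= D) ==>
    emeasure lborel N = 0"
  by blast+
 have cpt: "compact (frontier X)" using bounded_X by (rule compact_frontier_bounded)
 have cover: "frontier X \<subseteq> (\<Union>y\<^sub>0\<in>frontier X. ball y\<^sub>0 (\<rho> y\<^sub>0))" using R(2) by force
 obtain F where F: "F \<subseteq> frontier X" "finite F" "frontier X \<subseteq> (\<Union>y\<^sub>0\<in>F. ball y\<^sub>0 (\<rho> y\<^sub>0))"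
  using compactE_image[OF cpt _ cover] open_ball by metis
 define Z where "Z y\<^sub>0 = {w :: 'a \<times> 'a. fst w \<in> cball y\<^sub>0 (\<rho> y\<^sub>0) & norm (snd w) = 1 & r y\<^sub>0 (fst w) = 0 & gradient (r y\<^sub>0) (fst w) \<bullet> snd w = 0}" for y\<^sub>0
 define Bad where "Bad y\<^sub>0 = (%w. shift (fst w) (- snd w)) ` (Z y\<^sub>0 \<times> {0..D})" for y\<^sub>0
 have Bad_compact: "compact (Bad y\<^sub>0)" if y0: "y\<^sub>0 \<in> frontier X" for y\<^sub>0
 proof -
  note L = local_defining_functionD[OF R(1)[OF y0]]
  let ?S = "cball y\<^sub>0 (\<rho> y\<^sub>0) \<times> sphere (0::'a) 1"
  have c1: "continuous_on ?S (%w. r y\<^sub>0 (fst w))"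
   by (rule continuous_on_compose2[OF smooth_onD(5)[OF L(3,1)]]) (use R(3)[OF y0] in \<open>auto intro!: continuous_intros\<close>)
  have c2: "continuous_on ?S (%w. gradient (r y\<^sub>0) (fst w) \<bullet> snd w)"
   unfolding gradient_def
   by (intro continuous_intros continuous_on_compose2[OF smooth_onD(2)[OF L(3,1)]]) (use R(3)[OF y0] in \<open>auto intro!: continuous_intros\<close>)
  have S: "compact ?S" by (intro compact_Times) auto
  have "closed {w \<in> ?S. r y\<^sub>0 (fst w) = 0}" "closed {w \<in> ?S. gradient (r y\<^sub>0) (fst w) \<bullet> snd w = 0}"
   by (rule continuous_closed_preimage_constant[OF c1 compact_imp_closed[OF S]]
     continuous_closed_preimage_constant[OF c2 compact_imp_closed[OF S]])+
  from compact_Int_closed[OF S closed_Int[OF this]]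
  have "compact (?S \<inter> ({w \<in> ?S. r y\<^sub>0 (fst w) = 0} \<inter> {w \<in> ?S. gradient (r y\<^sub>0) (fst w) \<bullet> snd w = 0}))" .
  moreover have "?S \<inter> ({w \<in> ?S. r y\<^sub>0 (fst w) = 0} \<inter> {w \<in> ?S. gradient (r y\<^sub>0) (fst w) \<bullet> snd w = 0}) = Z y\<^sub>0"
   by (auto simp: Z_def)
  ultimately have "compact (Z y\<^sub>0)" by simp
  then show ?thesis unfolding Bad_def
   by (intro compact_continuous_image compact_Times compact_Icc continuous_intros)
 qed
 have Bad_null: "AE z in ?M. z \<notin> Bad y\<^sub>0" if y0: "y\<^sub>0 \<in> frontier X" for y\<^sub>0
 proof -
  have B [measurable]: "Bad y\<^sub>0 \<in> sets borel" using Bad_compact[OF y0] by (simp add: compact_imp_closed)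
  have XS: "{z. fst z \<in> X} \<in> sets (borel :: ('a \<times> 'a) measure)"
  proof -
   have "{z :: 'a \<times> 'a. fst z \<in> X} = X \<times> UNIV" by auto
   then show ?thesis using open_X by (simp add: open_Times)
  qed
  define H where "H z = indicator (Bad y\<^sub>0) z * (indicator {z. fst z \<in> X} z :: ennreal)" for z
  have H [measurable]: "H \<in> borel_measurable borel" unfolding H_def using XS by measurable
  have "(\<integral>\<^sup>+z. H z \<partial>?M) = (\<integral>\<^sup>+th. (\<integral>\<^sup>+x. H (x, th) \<partial>lborel) \<partial>sphere_measure)"
   by (rule nn_integral_phase[OF H]) (auto simp: H_def indicator_def split: if_splits)
  also have "\<dots> = (\<integral>\<^sup>+th. 0 \<partial>(sphere_measure :: 'a measure))"
  proof (rule nn_integral_cong)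
   fix th :: 'a assume "th \<in> space sphere_measure"
   then have th: "norm th = 1" by simp
   have N: "(%x. (x, th)) -` Bad y\<^sub>0 \<in> sets borel"
    using measurable_sets[of "%x. (x, th)" borel borel "Bad y\<^sub>0"] by simp
   have "emeasure lborel ((%x. (x, th)) -` Bad y\<^sub>0) = 0"
    by (rule R(4)[OF y0 th N]) (force simp: Bad_def Z_def shift_def)
   moreover have "(\<integral>\<^sup>+x. H (x, th) \<partial>lborel) <= (\<integral>\<^sup>+x. indicator ((%x. (x, th)) -` Bad y\<^sub>0) x \<partial>lborel)"
    by (intro nn_integral_mono) (auto simp: H_def indicator_def)
   ultimately show "(\<integral>\<^sup>+x. H (x, th) \<partial>lborel) = 0" using N by simp
  qed
  finally have "AE z in ?M. H z = 0"
   using borel_measurable_phase[OF H] by (subst nn_integral_0_iff_AE[symmetric]) auto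
  then show ?thesis
   by (rule AE_mp[OF _ AE_I2]) (auto simp: H_def indicator_def split: if_splits)
 qed
 have "AE z in ?M. \<forall>y\<^sub>0\<in>F. z \<notin> Bad y\<^sub>0"
  by (rule AE_finite_allI[OF F(2)]) (use F(1) Bad_null in blast)
 then show ?thesis
  unfolding transversal_exit_def
 proof (rule AE_mp[OF _ AE_I2[OF impI]])
  fix z assume z: "z \<in> space ?M" and good: "\<forall>y\<^sub>0\<in>F. z \<notin> Bad y\<^sub>0"
  \<comment> \<open>The backward exit time is the forward exit time for the reversed
    direction.\<close>
  have z': "(fst z, - snd z) \<in> space ?M" using z by auto
  obtain \<tau> where \<tau>: "0 < \<tau>" "fst z - \<tau> *\<^sub>R snd z \<notin> X" "!!s. (shift (fst z, - snd z) (- s), s) \<in> chord X \<longleftrightarrow> 0 <= s & s < \<tau>"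
   using forward_exit_time[OF z'] by (simp only: fst_conv snd_conv scaleR_minus_right add_uminus_conv_diff) metis
  have chord: "(z, s) \<in> chord X \<longleftrightarrow> 0 <= s & s < \<tau>" for s
   using \<tau>(3)[of s] unfolding chord_shift_minus by (simp add: chord_def split_beta')
  define y where "y = fst z - \<tau> *\<^sub>R snd z"
  define th where "th = snd z"
  have nth: "norm th = 1" using z by (auto simp: th_def)
  have inX: "y + t *\<^sub>R th \<in> X" if "0 < t" "t < \<tau>" for t
  proof -
   have "(z, \<tau> - t) \<in> chord X" using that by (simp add: chord)
   from shift_in_X[OF this] show ?thesis by (simp add: y_def th_def algebra_simps)
  qed
  have yX: "y \<notin> X" using \<tau>(2) by (simp add: y_def)
  have "\<tau> <= D"
  proof (rule ccontr)
   assume "\<not> \<tau> <= D"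
   then have "(z, D) \<in> chord X" using D_pos by (simp add: chord)
   then show False using chord_length(2)[of z D] z by auto
  qed
  have "y \<in> closure X"
   unfolding closure_sequential
  proof (intro exI conjI allI)
   show "y + (\<tau> / (2 + real n)) *\<^sub>R th \<in> X" for n
    using \<tau>(1) by (intro inX) (auto simp: divide_less_eq)
   have "(%n. \<tau> / (2 + real n)) \<longlonglongrightarrow> 0"
    by (rule tendsto_divide_0[OF tendsto_const]) (intro filterlim_at_top_imp_at_infinity filterlim_tendsto_add_at_top[OF tendsto_const filterlim_real_sequentially])
   then have "(%n. y + (\<tau> / (2 + real n)) *\<^sub>R th) \<longlonglongrightarrow> y + 0 *\<^sub>R th" by (intro tendsto_intros)
   then show "(%n. y + (\<tau> / (2 + real n)) *\<^sub>R th) \<longlonglongrightarrow> y" by simp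
  qed
  then have y: "y \<in> frontier X" using yX open_X by (simp add: frontier_def interior_open)
  then obtain y\<^sub>0 where y0: "y\<^sub>0 \<in> F" "y \<in> ball y\<^sub>0 (\<rho> y\<^sub>0)" using F(3) by blast
  have y0f: "y\<^sub>0 \<in> frontier X" using y0(1) F(1) by blast
  have yU: "y \<in> U y\<^sub>0" using R(3)[OF y0f] y0(2) by auto
  note ldf = local_defining_functionD(6)[OF R(1)[OF y0f] yU]
  have "gradient (r y\<^sub>0) y \<bullet> th \<noteq> 0"
  proof
   assume g: "gradient (r y\<^sub>0) y \<bullet> th = 0"
   have "(y, th) \<in> Z y\<^sub>0"
    using y0(2) nth g defining_function_boundary[OF ldf open_X y yU] by (simp add: Z_def)
   then have "shift (y, th) (- \<tau>) \<in> Bad y\<^sub>0"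
    unfolding Bad_def using \<tau>(1) \<open>\<tau> <= D\<close> by (intro image_eqI[where x = "((y, th), \<tau>)"]) auto
   moreover have "shift (y, th) (- \<tau>) = z" by (simp add: shift_def y_def th_def)
   ultimately show False using good y0(1) by simp
  qed
  \<comment> \<open>Followed forwards from its exit point, the characteristic runs in
    \<open>X\<close>, which excludes an outward direction.\<close>
  moreover have "\<not> 0 < gradient (r y\<^sub>0) y \<bullet> th"
  proof
   assume "0 < gradient (r y\<^sub>0) y \<bullet> th"
   then obtain e where e: "0 < e" "!!t. 0 < t & t < e \<longrightarrow> y + t *\<^sub>R th \<notin> X"
    using defining_function_line(2)[OF ldf open_X y] by blast
   have "0 < min e \<tau> / 2" "min e \<tau> / 2 < \<tau>" "min e \<tau> / 2 < e" using e(1) \<tau>(1) by (auto simp: min_def)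
   then show False using e(2) inX by blast
  qed
  ultimately have "(y, th) \<in> Gamma_minus X"
   unfolding Gamma_minus_iff[OF ldf open_X y] using nth by simp
  then show "\<exists>\<tau>>0. (\<forall>s. (z, s) \<in> chord X \<longleftrightarrow> 0 <= s & s < \<tau>) & shift z \<tau> \<in> Gamma_minus X"
   using \<tau>(1) chord by (intro exI[of _ \<tau>]) (simp add: shift_def y_def th_def)
 qed
qed

end

section \<open>Finite rank approximation\<close>

lemma L2_dominated_convergence:
 assumes u: "u \<in> L2 M" and U: "!!i. U i \<in> borel_measurable M"
  and bound: "!!i. AE x in M. \<bar>U i x\<bar> <= \<bar>u x\<bar>" and lim: "AE x in M. (%i. U i x) \<longlonglongrightarrow> u x"
 shows "L2_tendsto M U u"
proof -
 note [measurable] = U L2_measurable[OF u]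
 have UL: "U i \<in> L2 M" for i by (rule L2_mono(1)[OF u U bound])
 have "(%i. \<integral>x. (U i x - u x)\<^sup>2 \<partial>M) \<longlonglongrightarrow> (\<integral>x. 0 \<partial>M)"
 proof (rule integral_dominated_convergence[where w = "%x. 4 * (u x)\<^sup>2"])
  show "AE x in M. (%i. (U i x - u x)\<^sup>2) \<longlonglongrightarrow> 0"
   using lim
  proof eventually_elim
   case (elim x)
   from tendsto_power[OF tendsto_diff[OF elim tendsto_const[of "u x"]], of 2] show ?case by simp
  qed
  show "AE x in M. norm ((U i x - u x)\<^sup>2) <= 4 * (u x)\<^sup>2" for i
   using bound[of i]
  proof eventually_elim
   case (elim x)
   then have "\<bar>U i x - u x\<bar> <= 2 * \<bar>u x\<bar>" by linarith
   from power_mono[OF this abs_ge_zero, of 2] show ?case by (simp add: power_mult_distrib)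
  qed
 qed (use u in \<open>auto simp: L2_def\<close>)
 then have "(%i. sqrt (\<integral>x. (U i x - u x)\<^sup>2 \<partial>M)) \<longlonglongrightarrow> sqrt 0" by (intro tendsto_real_sqrt) simp
 then show ?thesis using u UL by (simp add: L2_tendsto_def L2_norm_def)
qed

lemma L2_tendsto_eps:
 assumes "L2_tendsto M F f" "0 < e"
 shows "\<exists>j. L2_norm M (%x. F j x - f x) < e"
proof -
 have "(%j. L2_norm M (%x. F j x - f x)) \<longlonglongrightarrow> 0" using assms(1) by (simp add: L2_tendsto_def)
 from order_tendstoD(2)[OF this assms(2)] show ?thesis by (auto simp: eventually_sequentially)
qed

context bounded_domain
begin

text \<open>Truncation reduces to bounded functions. A measurable function is almost everywhere a
  limit of continuous ones, by \<open>measurable_on\<close>; clamping these to the bound of the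
  function makes the convergence dominated.\<close>

lemma continuous_dense_L2:
 assumes f: "f \<in> L2 (space_measure X)"
 obtains F where "!!j. continuous_on (closure X) (F j)" "L2_tendsto (space_measure X) F f"
proof -
 let ?M = "space_measure X"
 have X_lborel: "X \<inter> space lborel \<in> sets lborel" by simp
 have cL: "g \<in> borel_measurable ?M" if "continuous_on UNIV g" for g :: "'a => real"
  by (intro measurable_restrict_space1) (use that in \<open>auto intro: borel_measurable_continuous_onI\<close>)
 have bounded_case: "\<exists>h. continuous_on UNIV h & h \<in> L2 ?M & L2_norm ?M (%x. h x - g x) < e"
  if g: "g \<in> L2 ?M" and gb: "!!x. \<bar>g x\<bar> <= B" and e: "0 < e" for g B e
 proof -
  have "(%x. indicator X x *\<^sub>R g x) \<in> borel_measurable lborel"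
   using L2_measurable[OF g] borel_measurable_restrict_space_iff[OF X_lborel, of g] by simp
  then have "(%x. indicator X x *\<^sub>R g x) \<in> borel_measurable lebesgue" by (rule measurable_completion)
  then have "(%x. indicator X x *\<^sub>R g x) measurable_on UNIV"
   by (intro lebesgue_measurable_imp_measurable_on) simp_all
  then obtain N G where N: "negligible N" and G: "!!n::nat. continuous_on UNIV (G n)"
   and lim: "!!x. x \<notin> N ==> (%n. G n x) \<longlonglongrightarrow> indicator X x *\<^sub>R g x"
   unfolding measurable_on_def by auto
  have B: "0 <= B" using order_trans[OF abs_ge_zero gb] .
  define H where "H n x = max (- B) (min B (G n x))" for n x
  have Hc: "continuous_on UNIV (H n)" for n unfolding H_def by (intro continuous_intros G)
  have "AE x in lebesgue. x \<notin> N" using N by (intro AE_not_in) (simp add: negligible_iff_null_sets)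
  then have "AE x in lborel. x \<notin> N" by (simp only: AE_completion_iff)
  then have "AE x in ?M. x \<notin> N" using AE_restrict_space_iff[OF X_lborel, of "%x. x \<notin> N"] by (auto elim: eventually_mono)
  then have Hlim: "AE x in ?M. (%n. H n x) \<longlonglongrightarrow> g x"
   using AE_space
  proof eventually_elim
   case (elim x)
   have "(%n. max (- B) (min B (G n x))) \<longlonglongrightarrow> max (- B) (min B (g x))"
    using lim[OF elim(1)] elim(2) by (intro tendsto_max tendsto_min tendsto_const) simp
   then show ?case using gb[of x] by (simp add: H_def abs_le_iff)
  qed
  have HL: "H n \<in> L2 ?M" for n
   by (rule space.L2_bounded[where C = B]) (use B in \<open>auto intro!: cL Hc simp: H_def\<close>)
  have gM [measurable]: "g \<in> borel_measurable ?M" by (rule L2_measurable[OF g])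
  have HM [measurable]: "H n \<in> borel_measurable ?M" for n by (rule cL[OF Hc])
  have "(%n. \<integral>x. (H n x - g x)\<^sup>2 \<partial>?M) \<longlonglongrightarrow> (\<integral>x. 0 \<partial>?M)"
  proof (rule integral_dominated_convergence[where w = "%x. (2 * B)\<^sup>2"])
   show "AE x in ?M. (%n. (H n x - g x)\<^sup>2) \<longlonglongrightarrow> 0"
    using Hlim
   proof eventually_elim
    case (elim x)
    from tendsto_power[OF tendsto_diff[OF elim tendsto_const[of "g x"]], of 2] show ?case by simp
   qed
   show "AE x in ?M. norm ((H n x - g x)\<^sup>2) <= (2 * B)\<^sup>2" for n
   proof (rule AE_I2)
    fix x
    have "\<bar>H n x\<bar> <= B" using B by (auto simp: H_def)
    then have "\<bar>H n x - g x\<bar> <= 2 * B" using gb[of x] by linarith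
    from power_mono[OF this abs_ge_zero, of 2] show "norm ((H n x - g x)\<^sup>2) <= (2 * B)\<^sup>2" by simp
   qed
  qed (use space.emeasure_finite in auto)
  then have "(%n. sqrt (\<integral>x. (H n x - g x)\<^sup>2 \<partial>?M)) \<longlonglongrightarrow> sqrt 0" by (intro tendsto_real_sqrt) simp
  then have "L2_tendsto ?M H g" using g HL by (simp add: L2_tendsto_def L2_norm_def)
  from L2_tendsto_eps[OF this e] show ?thesis using Hc HL by blast
 qed
 have approx: "\<exists>h. continuous_on UNIV h & h \<in> L2 ?M & L2_norm ?M (%x. h x - f x) < e" if e: "0 < e" for e
 proof -
  define g where "g n x = max (- real n) (min (real n) (f x))" for n x
  have [measurable]: "f \<in> borel_measurable ?M" by (rule L2_measurable[OF f])
  have gm: "g n \<in> borel_measurable ?M" for n unfolding g_def[abs_def] by measurable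
  have "L2_tendsto ?M g f"
  proof (rule L2_dominated_convergence[OF f gm])
   show "AE x in ?M. \<bar>g n x\<bar> <= \<bar>f x\<bar>" for n by (rule AE_I2) (auto simp: g_def)
   show "AE x in ?M. (%n. g n x) \<longlonglongrightarrow> f x"
   proof (rule AE_I2)
    fix x
    obtain n0 where n0: "\<bar>f x\<bar> <= real n0" using real_arch_simple by blast
    have "eventually (%n. g n x = f x) sequentially"
     unfolding eventually_sequentially
    proof (intro exI[of _ n0] allI impI)
     fix n assume "n0 <= n"
     then have "\<bar>f x\<bar> <= real n" using n0 by linarith
     then show "g n x = f x" by (auto simp: g_def abs_le_iff)
    qed
    then show "(%n. g n x) \<longlonglongrightarrow> f x" by (rule tendsto_eventually)
   qed
  qed
  then obtain n where n: "L2_norm ?M (%x. g n x - f x) < e / 2" "g n \<in> L2 ?M"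
   using L2_tendsto_eps[of ?M g f "e / 2"] e by (auto simp: L2_tendsto_def)
  have "\<bar>g n x\<bar> <= real n" for x by (auto simp: g_def)
  then obtain h where h: "continuous_on UNIV h" "h \<in> L2 ?M" "L2_norm ?M (%x. h x - g n x) < e / 2"
   using bounded_case[OF n(2), of "real n" "e / 2"] e by auto
  then show ?thesis using L2_norm_triangle3[OF h(2) n(2) f] n(1) by (intro exI[of _ h]) auto
 qed
 have "\<forall>j. \<exists>h. continuous_on UNIV h & h \<in> L2 ?M & L2_norm ?M (%x. h x - f x) < inverse (real (Suc j))"
  using approx by simp
 from choice[OF this] obtain F where F: "!!j. continuous_on UNIV (F j)" "!!j. F j \<in> L2 ?M"
  "!!j. L2_norm ?M (%x. F j x - f x) < inverse (real (Suc j))" by blast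
 have "(%j. L2_norm ?M (%x. F j x - f x)) \<longlonglongrightarrow> 0"
  by (rule LIMSEQ_squeeze_zero[OF LIMSEQ_inverse_real_of_nat]) (use less_imp_le[OF F(3)] in auto)
 then have "L2_tendsto ?M F f" using F(2) f by (simp add: L2_tendsto_def)
 then show ?thesis using that[of F] F(1) continuous_on_subset by blast
qed

text \<open>If \<open>B\<close> is already bounded on all of \<open>L2\<close>, then
  \<open>B f\<close> is an admissible value for the choice in \<open>L2_extension\<close>, and
  density of the continuous functions leaves no other one up to null sets.\<close>

lemma L2_extension_eq:
 assumes B: "bounded_linear_L2 (space_measure X) B" and f: "f \<in> L2 (space_measure X)"
 shows "L2_extension X B f \<in> L2 (space_measure X)" "AE x in space_measure X. L2_extension X B f x = B f x"
proof -
 let ?M = "space_measure X"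
 let ?P = "%g. g \<in> L2 ?M & (\<forall>F. (\<forall>j. continuous_on (closure X) (F j)) & L2_tendsto ?M F f \<longrightarrow> L2_tendsto ?M (%j. B (F j)) g)"
 have "?P (B f)" using bounded_linear_L2D(1)[OF B f] bounded_linear_L2_tendsto[OF B] by blast
 then have P: "?P (L2_extension X B f)" unfolding L2_extension_def by (rule someI[where P = ?P])
 then show "L2_extension X B f \<in> L2 ?M" by blast
 obtain F where F: "!!j. continuous_on (closure X) (F j)" "L2_tendsto ?M F f" using continuous_dense_L2[OF f] by blast
 show "AE x in ?M. L2_extension X B f x = B f x"
  by (rule L2_tendsto_unique[OF _ bounded_linear_L2_tendsto[OF B F(2)]]) (use P F in blast)
qed

end

section \<open>Kernels as limits of finite sums of products\<close>

definition tensor_approximable :: "'b measure => 'c measure => ('b \<times> 'c => real) => bool" where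
 "tensor_approximable M N h \<longleftrightarrow> (\<forall>e>0. \<exists>(n::nat) a b. (\<forall>i<n. a i \<in> L2 M & b i \<in> L2 N) &
   (%z. \<Sum>i<n. a i (fst z) * b i (snd z)) \<in> L2 (M \<Otimes>\<^sub>M N) &
   L2_norm (M \<Otimes>\<^sub>M N) (%z. h z - (\<Sum>i<n. a i (fst z) * b i (snd z))) < e)"

lemma tensor_approximable_add:
 assumes h: "h \<in> L2 (M \<Otimes>\<^sub>M N)" "tensor_approximable M N h" and g: "g \<in> L2 (M \<Otimes>\<^sub>M N)" "tensor_approximable M N g"
 shows "tensor_approximable M N (%z. h z + g z)"
 unfolding tensor_approximable_def
proof (intro allI impI)
 fix e :: real assume "0 < e"
 then have e: "0 < e / 2" by simp
 obtain n :: nat and a b where 1: "\<forall>i<n. a i \<in> L2 M & b i \<in> L2 N" "(%z. \<Sum>i<n. a i (fst z) * b i (snd z)) \<in> L2 (M \<Otimes>\<^sub>M N)"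
   "L2_norm (M \<Otimes>\<^sub>M N) (%z. h z - (\<Sum>i<n. a i (fst z) * b i (snd z))) < e / 2"
  using h(2) e unfolding tensor_approximable_def by blast
 obtain n' :: nat and a' b' where 2: "\<forall>i<n'. a' i \<in> L2 M & b' i \<in> L2 N" "(%z. \<Sum>i<n'. a' i (fst z) * b' i (snd z)) \<in> L2 (M \<Otimes>\<^sub>M N)"
   "L2_norm (M \<Otimes>\<^sub>M N) (%z. g z - (\<Sum>i<n'. a' i (fst z) * b' i (snd z))) < e / 2"
  using g(2) e unfolding tensor_approximable_def by blast
 define A where "A i = (if i < n then a i else a' (i - n))" for i
 define B where "B i = (if i < n then b i else b' (i - n))" for i
 have sum: "(\<Sum>i<n + n'. A i (fst z) * B i (snd z)) = (\<Sum>i<n. a i (fst z) * b i (snd z)) + (\<Sum>i<n'. a' i (fst z) * b' i (snd z))" for z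
 proof -
  have "(\<Sum>i<n + n'. A i (fst z) * B i (snd z)) = (\<Sum>i<n. A i (fst z) * B i (snd z)) + (\<Sum>i=n..<n + n'. A i (fst z) * B i (snd z))"
   by (simp add: sum.atLeastLessThan_concat lessThan_atLeast0)
  also have "(\<Sum>i=n..<n + n'. A i (fst z) * B i (snd z)) = (\<Sum>i<n'. A (i + n) (fst z) * B (i + n) (snd z))"
   using sum.shift_bounds_nat_ivl[of "%i. A i (fst z) * B i (snd z)" 0 n n'] by (simp add: lessThan_atLeast0 add.commute)
  finally show ?thesis by (simp add: A_def B_def)
 qed
 show "\<exists>(n::nat) a b. (\<forall>i<n. a i \<in> L2 M & b i \<in> L2 N) & (%z. \<Sum>i<n. a i (fst z) * b i (snd z)) \<in> L2 (M \<Otimes>\<^sub>M N) &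
   L2_norm (M \<Otimes>\<^sub>M N) (%z. h z + g z - (\<Sum>i<n. a i (fst z) * b i (snd z))) < e"
 proof (intro exI[of _ "n + n'"] exI[of _ A] exI[of _ B] conjI)
  show "\<forall>i<n + n'. A i \<in> L2 M & B i \<in> L2 N" using 1(1) 2(1) by (auto simp: A_def B_def)
  show "(%z. \<Sum>i<n + n'. A i (fst z) * B i (snd z)) \<in> L2 (M \<Otimes>\<^sub>M N)"
   unfolding sum by (intro L2_add 1 2)
  have "L2_norm (M \<Otimes>\<^sub>M N) (%z. (h z - (\<Sum>i<n. a i (fst z) * b i (snd z))) + (g z - (\<Sum>i<n'. a' i (fst z) * b' i (snd z)))) < e"
   using L2_norm_triangle[OF L2_diff[OF h(1) 1(2)] L2_diff[OF g(1) 2(2)]] 1(3) 2(3) by linarith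
  then show "L2_norm (M \<Otimes>\<^sub>M N) (%z. h z + g z - (\<Sum>i<n + n'. A i (fst z) * B i (snd z))) < e"
   unfolding sum by (simp add: algebra_simps)
 qed
qed

lemma tensor_approximable_scale:
 assumes h: "tensor_approximable M N h"
 shows "tensor_approximable M N (%z. c * h z)"
 unfolding tensor_approximable_def
proof (intro allI impI)
 fix e :: real assume e: "0 < e"
 then have "0 < e / (\<bar>c\<bar> + 1)" by simp
 then obtain n :: nat and a b where 1: "\<forall>i<n. a i \<in> L2 M & b i \<in> L2 N" "(%z. \<Sum>i<n. a i (fst z) * b i (snd z)) \<in> L2 (M \<Otimes>\<^sub>M N)"
   "L2_norm (M \<Otimes>\<^sub>M N) (%z. h z - (\<Sum>i<n. a i (fst z) * b i (snd z))) < e / (\<bar>c\<bar> + 1)"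
  using h unfolding tensor_approximable_def by blast
 have s: "(\<Sum>i<n. c * a i (fst z) * b i (snd z)) = c * (\<Sum>i<n. a i (fst z) * b i (snd z))" for z
  by (simp add: sum_distrib_left mult.assoc)
 show "\<exists>(n::nat) a b. (\<forall>i<n. a i \<in> L2 M & b i \<in> L2 N) & (%z. \<Sum>i<n. a i (fst z) * b i (snd z)) \<in> L2 (M \<Otimes>\<^sub>M N) &
   L2_norm (M \<Otimes>\<^sub>M N) (%z. c * h z - (\<Sum>i<n. a i (fst z) * b i (snd z))) < e"
 proof (intro exI[of _ n] exI[of _ "%i x. c * a i x"] exI[of _ b] conjI)
  show "\<forall>i<n. (%x. c * a i x) \<in> L2 M & b i \<in> L2 N" using 1(1) by (auto intro: L2_scale)
  show "(%z. \<Sum>i<n. c * a i (fst z) * b i (snd z)) \<in> L2 (M \<Otimes>\<^sub>M N)" unfolding s by (intro L2_scale 1)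
  let ?x = "L2_norm (M \<Otimes>\<^sub>M N) (%z. h z - (\<Sum>i<n. a i (fst z) * b i (snd z)))"
  have "\<bar>c\<bar> * ?x <= (\<bar>c\<bar> + 1) * ?x" by (intro mult_right_mono) auto
  also have "\<dots> < e" using 1(3) by (simp add: pos_less_divide_eq mult.commute)
  finally show "L2_norm (M \<Otimes>\<^sub>M N) (%z. c * h z - (\<Sum>i<n. c * a i (fst z) * b i (snd z))) < e"
   unfolding s by (simp add: L2_norm_scale flip: right_diff_distrib)
 qed
qed

lemma tensor_approximable_limit:
 assumes F: "L2_tendsto (M \<Otimes>\<^sub>M N) F h" and "!!j. tensor_approximable M N (F j)"
 shows "tensor_approximable M N h"
 unfolding tensor_approximable_def
proof (intro allI impI)
 fix e :: real assume "0 < e"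
 then have e: "0 < e / 2" by simp
 obtain j where j: "L2_norm (M \<Otimes>\<^sub>M N) (%z. F j z - h z) < e / 2" using L2_tendsto_eps[OF F e] by blast
 have L: "h \<in> L2 (M \<Otimes>\<^sub>M N)" "F j \<in> L2 (M \<Otimes>\<^sub>M N)" using F by (auto simp: L2_tendsto_def)
 obtain n :: nat and a b where 1: "\<forall>i<n. a i \<in> L2 M & b i \<in> L2 N" "(%z. \<Sum>i<n. a i (fst z) * b i (snd z)) \<in> L2 (M \<Otimes>\<^sub>M N)"
   "L2_norm (M \<Otimes>\<^sub>M N) (%z. F j z - (\<Sum>i<n. a i (fst z) * b i (snd z))) < e / 2"
  using assms(2)[of j] e unfolding tensor_approximable_def by blast
 have "L2_norm (M \<Otimes>\<^sub>M N) (%z. h z - (\<Sum>i<n. a i (fst z) * b i (snd z))) < e"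
  using L2_norm_triangle3[OF L 1(2)] j 1(3) L2_norm_minus_commute[of "M \<Otimes>\<^sub>M N" h "F j"] by linarith
 then show "\<exists>(n::nat) a b. (\<forall>i<n. a i \<in> L2 M & b i \<in> L2 N) & (%z. \<Sum>i<n. a i (fst z) * b i (snd z)) \<in> L2 (M \<Otimes>\<^sub>M N) &
   L2_norm (M \<Otimes>\<^sub>M N) (%z. h z - (\<Sum>i<n. a i (fst z) * b i (snd z))) < e"
  using 1 by blast
qed

text \<open>Rectangles are themselves products, a Dynkin argument reaches all measurable sets,
  monotone limits reach nonnegative functions and differences the rest. Finiteness of the measures
  puts the indicators into \<open>L2\<close>.\<close>

lemma tensor_approximable_L2:
 assumes M: "finite_measure M" and N: "finite_measure N" and h: "h \<in> L2 (M \<Otimes>\<^sub>M N)"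
 shows "tensor_approximable M N h"
proof -
 interpret M: finite_measure M by fact
 interpret N: finite_measure N by fact
 interpret P: finite_measure "M \<Otimes>\<^sub>M N" by (rule finite_measure_pair_measure[OF N M])
 let ?P = "M \<Otimes>\<^sub>M N"
 have ind_L2: "indicator A \<in> L2 ?P" if "A \<in> sets ?P" for A
  using that by (intro P.L2_bounded[where C = 1]) (auto simp: indicator_def)
 have rect: "tensor_approximable M N (indicator (A \<times> B))" if A: "A \<in> sets M" and B: "B \<in> sets N" for A B
  unfolding tensor_approximable_def
 proof (intro allI impI exI[of _ "Suc 0"] exI[of _ "%_. indicator A"] exI[of _ "%_. indicator B"] conjI)
  have e: "(\<Sum>i<Suc 0. indicator A (fst z) * indicator B (snd z)) = (indicator (A \<times> B) z :: real)" for z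
   by (cases z) (simp add: indicator_times)
  show "indicator A \<in> L2 M" using A by (intro M.L2_bounded[where C = 1]) (auto simp: indicator_def)
  show "indicator B \<in> L2 N" using B by (intro N.L2_bounded[where C = 1]) (auto simp: indicator_def)
  show "(%z. \<Sum>i<Suc 0. indicator A (fst z) * indicator B (snd z)) \<in> L2 ?P"
   unfolding e using A B by (intro ind_L2) auto
  show "L2_norm ?P (%z. indicator (A \<times> B) z - (\<Sum>i<Suc 0. indicator A (fst z) * indicator B (snd z))) < e" if "0 < e" for e
   unfolding e using that by simp
 qed
 have set: "tensor_approximable M N (indicator A)" if "A \<in> sets ?P" for A
  using Int_stable_pair_measure_generator pair_measure_closed that[unfolded sets_pair_measure]
 proof (induction rule: sigma_sets_induct_disjoint)
  case (basic A) then show ?case using rect by auto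
 next
  case empty
  show ?case using rect[of "{}" "{}"] by (simp add: indicator_def[abs_def])
 next
  case (compl A)
  have A: "A \<in> sets ?P" using compl(1) by (simp add: sets_pair_measure)
  have "tensor_approximable M N (%z. indicator (space M \<times> space N) z + (- 1) * indicator A z)"
   by (intro tensor_approximable_add tensor_approximable_scale compl(2) rect ind_L2 L2_scale A) auto
  moreover have "indicator (space M \<times> space N - A) = (%z. indicator (space M \<times> space N) z + (- 1) * indicator A z :: real)"
   using sets.sets_into_space[OF A] by (intro ext) (auto simp: indicator_def space_pair_measure)
  ultimately show ?case by simp
 next
  case (union A)
  have A: "A i \<in> sets ?P" for i using union(2) by (auto simp: sets_pair_measure)
  have part: "tensor_approximable M N (indicator (\<Union>i<n. A i))" for n :: nat
  proof (induction n)
   case 0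
   show ?case using rect[of "{}" "{}"] by (simp add: indicator_def[abs_def])
  next
   case (Suc n)
   have "tensor_approximable M N (%z. indicator (\<Union>i<n. A i) z + indicator (A n) z)"
    using A by (intro tensor_approximable_add Suc union(3) ind_L2) auto
   moreover have "indicator (\<Union>i<Suc n. A i) = (%z. indicator (\<Union>i<n. A i) z + indicator (A n) z :: real)"
   proof
    fix z
    have "z \<notin> A i" if "z \<in> A n" "i < n" for i using disjoint_family_onD[OF union(1), of i n] that by auto
    then show "indicator (\<Union>i<Suc n. A i) z = (indicator (\<Union>i<n. A i) z + indicator (A n) z :: real)"
     by (auto simp: indicator_def lessThan_Suc)
   qed
   ultimately show ?case by simp
  qed
  have "L2_tendsto ?P (%n. indicator (\<Union>i<n. A i)) (indicator (\<Union>i. A i))"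
  proof (rule L2_dominated_convergence)
   show "indicator (\<Union>i. A i) \<in> L2 ?P" using A by (intro ind_L2) auto
   show "indicator (\<Union>i<n. A i) \<in> borel_measurable ?P" for n :: nat using A by (intro borel_measurable_indicator) auto
   show "AE z in ?P. (%n. indicator (\<Union>i<n. A i) z :: real) \<longlonglongrightarrow> indicator (\<Union>i. A i) z"
    by (intro AE_I2 LIMSEQ_indicator_UN)
   show "AE z in ?P. \<bar>indicator (\<Union>i<n. A i) z :: real\<bar> <= \<bar>indicator (\<Union>i. A i) z\<bar>" for n :: nat
    by (intro AE_I2) (auto simp: indicator_def)
  qed
  then show ?case using part by (rule tensor_approximable_limit)
 qed
 \<comment> \<open>The induction runs over all nonnegative measurable functions, so membership in
   \<open>L2\<close> belongs to the claim; the parts of a sum and the members of a monotone sequence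
   inherit it by domination.\<close>
 have nonneg: "u \<in> L2 ?P \<longrightarrow> tensor_approximable M N u" if "u \<in> borel_measurable ?P" "!!z. 0 <= u z" for u
  using that
 proof (induction rule: borel_measurable_induct_real)
  case (set A) then show ?case using \<open>!!A. A \<in> sets ?P ==> tensor_approximable M N (indicator A)\<close> by blast
 next
  case (mult u c)
  show ?case
  proof (cases "c = 0")
   case True
   then have e: "(%z. c * u z) = indicator ({} \<times> {})" by auto
   show ?thesis unfolding e by (intro impI rect) auto
  next
   case False
   have "u \<in> L2 ?P" if "(%x. c * u x) \<in> L2 ?P"
    using L2_scale[OF that, of "1 / c"] False by simp
   then show ?thesis using mult by (auto intro: tensor_approximable_scale)
  qed
 next
  case (add u v)
  show ?case
  proof
   assume uv: "(%x. v x + u x) \<in> L2 ?P"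
   have bounds: "\<bar>v x\<bar> <= \<bar>v x + u x\<bar>" "\<bar>u x\<bar> <= \<bar>v x + u x\<bar>" for x
    using add.hyps(2)[of x] add.hyps(4)[of x] by auto
   have L: "v \<in> L2 ?P" "u \<in> L2 ?P"
    by (rule L2_mono(1)[OF uv add.hyps(3) AE_I2[OF bounds(1)]]) (rule L2_mono(1)[OF uv add.hyps(1) AE_I2[OF bounds(2)]])
   show "tensor_approximable M N (%x. v x + u x)"
    by (rule tensor_approximable_add[OF L(1) _ L(2)]) (use add.IH L in blast)+
  qed
 next
  case (seq U)
  show ?case
  proof
   assume u: "u \<in> L2 ?P"
   have "U i x <= u x" if "x \<in> space ?P" for i x
   proof (rule incseq_le[OF _ seq.hyps(4)[OF that]])
    show "incseq (%i. U i x)" using \<open>incseq U\<close> unfolding incseq_def le_fun_def by blast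
   qed
   then have bound: "AE x in ?P. \<bar>U i x\<bar> <= \<bar>u x\<bar>" for i using seq.hyps(2) by (intro AE_I2) (auto intro: order_trans[OF _ abs_ge_self])
   have UL: "U i \<in> L2 ?P" for i by (rule L2_mono(1)[OF u seq.hyps(1) bound])
   have "L2_tendsto ?P U u"
    by (rule L2_dominated_convergence[OF u seq.hyps(1) bound AE_I2]) (rule seq.hyps(4))
   moreover have "tensor_approximable M N (U i)" for i using seq.IH[of i] UL[of i] by blast
   ultimately show "tensor_approximable M N u" by (rule tensor_approximable_limit)
  qed
 qed
 note [measurable] = L2_measurable[OF h]
 have p: "(%z. max 0 (h z)) \<in> L2 ?P" "(%z. max 0 (- h z)) \<in> L2 ?P"
  by (rule L2_mono(1)[OF h]; auto)+
 have "tensor_approximable M N (%z. max 0 (h z) + (- 1) * max 0 (- h z))"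
 proof (rule tensor_approximable_add[OF p(1) _ L2_scale[OF p(2)]])
  show "tensor_approximable M N (%z. max 0 (h z))" using nonneg[OF L2_measurable[OF p(1)]] p(1) by simp
  show "tensor_approximable M N (%z. (- 1) * max 0 (- h z))"
   using nonneg[OF L2_measurable[OF p(2)]] p(2) by (intro tensor_approximable_scale) simp_all
 qed
 moreover have "(%z. max 0 (h z) + (- 1) * max 0 (- h z)) = h" by (auto simp: max_def)
 ultimately show ?thesis by simp
qed

text \<open>Cauchy-Schwarz on each slice of the kernel.\<close>

lemma Hilbert_Schmidt_bound:
 assumes M: "sigma_finite_measure M" and N: "sigma_finite_measure N"
  and h: "h \<in> L2 (M \<Otimes>\<^sub>M N)" and p: "p \<in> L2 N"
 shows "(%x. \<integral>y. h (x, y) * p y \<partial>N) \<in> L2 M"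
  and "L2_norm M (%x. \<integral>y. h (x, y) * p y \<partial>N) <= L2_norm (M \<Otimes>\<^sub>M N) h * L2_norm N p"
proof -
 interpret M: sigma_finite_measure M by fact
 interpret N: sigma_finite_measure N by fact
 note [measurable] = L2_measurable[OF h] L2_measurable[OF p]
 have meas: "(%x. \<integral>y. h (x, y) * p y \<partial>N) \<in> borel_measurable M" by measurable
 have "(\<integral>\<^sup>+x. ennreal ((\<integral>y. h (x, y) * p y \<partial>N)\<^sup>2) \<partial>M)
   <= (\<integral>\<^sup>+x. (\<integral>\<^sup>+y. ennreal ((h (x, y))\<^sup>2) \<partial>N) * ennreal ((L2_norm N p)\<^sup>2) \<partial>M)"
 proof (rule nn_integral_mono_AE, use L2_slice[OF N h] in eventually_elim)
  case (elim x)
  have "\<bar>\<integral>y. h (x, y) * p y \<partial>N\<bar> <= (\<integral>y. \<bar>h (x, y) * p y\<bar> \<partial>N)" by (rule integral_abs_bound)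
  also have "\<dots> <= L2_norm N (%y. h (x, y)) * L2_norm N p" by (rule L2_Cauchy_Schwarz[OF elim p])
  finally have "(\<integral>y. h (x, y) * p y \<partial>N)\<^sup>2 <= (L2_norm N (%y. h (x, y)))\<^sup>2 * (L2_norm N p)\<^sup>2"
   by (metis abs_ge_zero power2_abs power_mono power_mult_distrib)
  then show ?case by (simp add: L2_norm_nn_integral[OF elim] ennreal_mult[symmetric] ennreal_leI)
 qed
 also have "\<dots> = (\<integral>\<^sup>+x. (\<integral>\<^sup>+y. ennreal ((h (x, y))\<^sup>2) \<partial>N) \<partial>M) * ennreal ((L2_norm N p)\<^sup>2)"
  by (rule nn_integral_multc) measurable
 also have "(\<integral>\<^sup>+x. (\<integral>\<^sup>+y. ennreal ((h (x, y))\<^sup>2) \<partial>N) \<partial>M) = ennreal ((L2_norm (M \<Otimes>\<^sub>M N) h)\<^sup>2)"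
  by (subst N.nn_integral_fst) (auto simp: L2_norm_nn_integral[OF h])
 finally have b: "(\<integral>\<^sup>+x. ennreal ((\<integral>y. h (x, y) * p y \<partial>N)\<^sup>2) \<partial>M) <= ennreal ((L2_norm (M \<Otimes>\<^sub>M N) h * L2_norm N p)\<^sup>2)"
  by (simp add: ennreal_mult[symmetric] power_mult_distrib)
 show "(%x. \<integral>y. h (x, y) * p y \<partial>N) \<in> L2 M" by (rule L2_I_nn_integral[OF meas b])
 show "L2_norm M (%x. \<integral>y. h (x, y) * p y \<partial>N) <= L2_norm (M \<Otimes>\<^sub>M N) h * L2_norm N p"
  by (rule L2_norm_le[OF meas b]) simp
qed

lemma kernel_finite_rank_approximation:
 assumes M: "finite_measure M" and N: "finite_measure N" and h: "h \<in> L2 (M \<Otimes>\<^sub>M N)" and e: "0 < e"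
 obtains n :: nat and a b where "!!i. i < n ==> a i \<in> L2 M" "!!i. i < n ==> b i \<in> L2 N"
  "!!p. p \<in> L2 N ==> L2_norm M (%x. (\<integral>y. h (x, y) * p y \<partial>N) - (\<Sum>i<n. (\<integral>y. b i y * p y \<partial>N) * a i x)) <= e * L2_norm N p"
proof -
 interpret M: finite_measure M by fact
 interpret N: finite_measure N by fact
 note sM = M.sigma_finite_measure_axioms and sN = N.sigma_finite_measure_axioms
 obtain n :: nat and a b where ab: "\<forall>i<n. a i \<in> L2 M & b i \<in> L2 N" and s: "(%z. \<Sum>i<n. a i (fst z) * b i (snd z)) \<in> L2 (M \<Otimes>\<^sub>M N)"
   and d: "L2_norm (M \<Otimes>\<^sub>M N) (%z. h z - (\<Sum>i<n. a i (fst z) * b i (snd z))) < e"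
  using tensor_approximable_L2[OF M N h] e unfolding tensor_approximable_def by blast
 show ?thesis
 proof
  show "!!i. i < n ==> a i \<in> L2 M" "!!i. i < n ==> b i \<in> L2 N" using ab by auto
  fix p assume p: "p \<in> L2 N"
  let ?d = "%z. h z - (\<Sum>i<n. a i (fst z) * b i (snd z))"
  note HS = Hilbert_Schmidt_bound[OF sM sN L2_diff[OF h s] p]
  have e1: "(\<integral>y. (\<Sum>i<n. a i x * b i y) * p y \<partial>N) = (\<Sum>i<n. (\<integral>y. b i y * p y \<partial>N) * a i x)" for x
  proof -
   have "(\<integral>y. (\<Sum>i<n. a i x * b i y) * p y \<partial>N) = (\<integral>y. (\<Sum>i<n. a i x * (b i y * p y)) \<partial>N)"
    by (simp add: sum_distrib_right mult.assoc)
   also have "\<dots> = (\<Sum>i<n. \<integral>y. a i x * (b i y * p y) \<partial>N)"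
    using ab p by (intro Bochner_Integration.integral_sum integrable_mult_right L2_mult_integrable) auto
   finally show ?thesis by (simp add: mult.commute)
  qed
  have "AE x in M. (\<integral>y. h (x, y) * p y \<partial>N) - (\<Sum>i<n. (\<integral>y. b i y * p y \<partial>N) * a i x) = (\<integral>y. ?d (x, y) * p y \<partial>N)"
   using L2_slice[OF sN h] L2_slice[OF sN s]
  proof eventually_elim
   case (elim x)
   show ?case
    using L2_mult_integrable[OF elim(1) p] L2_mult_integrable[OF elim(2) p] e1[of x] by (simp add: left_diff_distrib)
  qed
  moreover have "(%x. (\<integral>y. h (x, y) * p y \<partial>N) - (\<Sum>i<n. (\<integral>y. b i y * p y \<partial>N) * a i x)) \<in> L2 M"
   using ab by (intro L2_diff Hilbert_Schmidt_bound(1)[OF sM sN h p] L2_sum L2_scale) auto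
  ultimately have "L2_norm M (%x. (\<integral>y. h (x, y) * p y \<partial>N) - (\<Sum>i<n. (\<integral>y. b i y * p y \<partial>N) * a i x))
    = L2_norm M (%x. \<integral>y. ?d (x, y) * p y \<partial>N)"
   using HS(1) by (intro L2_norm_cong_AE) (auto dest: L2_measurable)
  also have "\<dots> <= L2_norm (M \<Otimes>\<^sub>M N) ?d * L2_norm N p" by (rule HS(2))
  also have "\<dots> <= e * L2_norm N p" using d by (intro mult_right_mono) auto
  finally show "L2_norm M (%x. (\<integral>y. h (x, y) * p y \<partial>N) - (\<Sum>i<n. (\<integral>y. b i y * p y \<partial>N) * a i x)) <= e * L2_norm N p" .
 qed
qed

lemma bounded_functional_L2_integral:
 assumes b: "b \<in> L2 M"
 shows "bounded_functional_L2 M (%p. \<integral>x. b x * p x \<partial>M)"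
proof (rule bounded_functional_L2I)
 fix f assume f: "f \<in> L2 M"
 note [measurable] = L2_measurable[OF b] L2_measurable[OF f]
 show "(\<integral>x. b x * (a * f x) \<partial>M) = a * (\<integral>x. b x * f x \<partial>M)" for a
  unfolding integral_mult_right_zero[symmetric] by (simp add: mult.left_commute)
 show "\<bar>\<integral>x. b x * f x \<partial>M\<bar> <= L2_norm M b * L2_norm M f"
  by (rule order_trans[OF integral_abs_bound L2_Cauchy_Schwarz[OF b f]])
 fix g assume g: "g \<in> L2 M"
 note [measurable] = L2_measurable[OF g]
 show "(\<integral>x. b x * (f x + g x) \<partial>M) = (\<integral>x. b x * f x \<partial>M) + (\<integral>x. b x * g x \<partial>M)"
  using L2_mult_integrable[OF b f] L2_mult_integrable[OF b g] by (simp add: distrib_left)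
 show "(\<integral>x. b x * f x \<partial>M) = (\<integral>x. b x * g x \<partial>M)" if "AE x in M. f x = g x"
  by (rule integral_cong_AE, measurable) (use that in eventually_elim, simp)
qed

lemma bounded_functional_L2_operator:
 assumes l: "bounded_functional_L2 N l" and T: "bounded_operator_L2 M N K T"
 shows "bounded_functional_L2 M (%f. l (T f))"
proof -
 note lD = bounded_functional_L2D[OF l] and TD = bounded_operator_L2D[OF T]
 obtain C where C: "C \<ge> 0" "!!f. f \<in> L2 N ==> \<bar>l f\<bar> <= C * L2_norm N f"
  using bounded_functional_L2_bound[OF l] by blast
 show ?thesis
 proof (rule bounded_functional_L2I)
  fix f assume f: "f \<in> L2 M"
  show "l (T (%x. a * f x)) = a * l (T f)" for a
   using lD(1)[OF TD(2)[OF L2_scale[OF f]] L2_scale[OF TD(2)[OF f]] TD(5)[OF f]] lD(3)[OF TD(2)[OF f]] by simp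
  show "\<bar>l (T f)\<bar> <= C * K * L2_norm M f"
   using C(2)[OF TD(2)[OF f]] mult_left_mono[OF TD(6)[OF f] C(1)] by (simp add: mult.assoc)
  fix g assume g: "g \<in> L2 M"
  show "l (T (%x. f x + g x)) = l (T f) + l (T g)"
   using lD(1)[OF TD(2)[OF L2_add[OF f g]] L2_add[OF TD(2)[OF f] TD(2)[OF g]] TD(4)[OF f g]]
    lD(2)[OF TD(2)[OF f] TD(2)[OF g]] by simp
  show "l (T f) = l (T g)" if "AE x in M. f x = g x" by (rule lD(1)[OF TD(2)[OF f] TD(2)[OF g] TD(3)[OF f g that]])
 qed
qed

section \<open>Operators approximable by finite rank\<close>

text \<open>Compactness in the form used by \<open>Fredholm_finite_rank_contraction\<close>: within
  any positive distance, in operator norm, there is an operator of finite rank.\<close>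

definition finite_rank_approximable ::
  "'b measure => 'c measure => (('b => real) => 'c => real) => bool" where
 "finite_rank_approximable M N T \<longleftrightarrow> (\<forall>e>0. \<exists>(n::nat) a l.
   (\<forall>i<n. a i \<in> L2 N & bounded_functional_L2 M (l i)) &
   (\<forall>f\<in>L2 M. L2_norm N (%x. T f x - (\<Sum>i<n. l i f * a i x)) <= e * L2_norm M f))"

lemma finite_rank_approximable_compose:
 assumes A: "finite_rank_approximable N P T" and S: "bounded_operator_L2 M N K S"
 shows "finite_rank_approximable M P (%f. T (S f))"
 unfolding finite_rank_approximable_def
proof (intro allI impI)
 fix e :: real assume e: "0 < e"
 note SD = bounded_operator_L2D[OF S]
 \<comment> \<open>The summand 1 covers the case \<open>K = 0\<close>.\<close>
 have "0 < e / (K + 1)" using e SD(1) by simp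
 then obtain n :: nat and a l where al: "\<forall>i<n. a i \<in> L2 P & bounded_functional_L2 N (l i)"
   and d: "\<forall>f\<in>L2 N. L2_norm P (%x. T f x - (\<Sum>i<n. l i f * a i x)) <= e / (K + 1) * L2_norm N f"
  using A unfolding finite_rank_approximable_def by blast
 have "L2_norm P (%x. T (S f) x - (\<Sum>i<n. l i (S f) * a i x)) <= e * L2_norm M f" if f: "f \<in> L2 M" for f
 proof -
  have "L2_norm P (%x. T (S f) x - (\<Sum>i<n. l i (S f) * a i x)) <= e / (K + 1) * L2_norm N (S f)"
   using d SD(2)[OF f] by blast
  also have "\<dots> <= e / (K + 1) * (K * L2_norm M f)" using e SD(1) by (intro mult_left_mono SD(6)[OF f]) simp
  also have "\<dots> = (e * L2_norm M f) * (K / (K + 1))" by simp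
  also have "\<dots> <= (e * L2_norm M f) * 1" using e SD(1) L2_norm_nonneg[of M f] by (intro mult_left_mono) auto
  finally show ?thesis by simp
 qed
 then show "\<exists>(n::nat) a l. (\<forall>i<n. a i \<in> L2 P & bounded_functional_L2 M (l i)) &
   (\<forall>f\<in>L2 M. L2_norm P (%x. T (S f) x - (\<Sum>i<n. l i f * a i x)) <= e * L2_norm M f)"
  using al bounded_functional_L2_operator[OF _ S]
  by (intro exI[of _ n] exI[of _ a] exI[of _ "%i f. l i (S f)"]) auto
qed

lemma finite_rank_approximable_add:
 assumes T: "finite_rank_approximable M N T" "!!f. f \<in> L2 M ==> T f \<in> L2 N"
  and S: "finite_rank_approximable M N S" "!!f. f \<in> L2 M ==> S f \<in> L2 N"
 shows "finite_rank_approximable M N (%f x. T f x + S f x)"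
 unfolding finite_rank_approximable_def
proof (intro allI impI)
 fix e :: real assume "0 < e"
 then have e: "0 < e / 2" by simp
 obtain n :: nat and a l where 1: "\<forall>i<n. a i \<in> L2 N & bounded_functional_L2 M (l i)"
   "\<forall>f\<in>L2 M. L2_norm N (%x. T f x - (\<Sum>i<n. l i f * a i x)) <= e / 2 * L2_norm M f"
  using T(1) e unfolding finite_rank_approximable_def by blast
 obtain n' :: nat and a' l' where 2: "\<forall>i<n'. a' i \<in> L2 N & bounded_functional_L2 M (l' i)"
   "\<forall>f\<in>L2 M. L2_norm N (%x. S f x - (\<Sum>i<n'. l' i f * a' i x)) <= e / 2 * L2_norm M f"
  using S(1) e unfolding finite_rank_approximable_def by blast
 define A where "A i = (if i < n then a i else a' (i - n))" for i
 define l'' where "l'' i = (if i < n then l i else l' (i - n))" for i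
 have sum: "(\<Sum>i<n + m. l'' i f * A i x) = (\<Sum>i<n. l i f * a i x) + (\<Sum>i<m. l' i f * a' i x)" for f x m
  by (induction m) (simp_all add: A_def l''_def)
 have "L2_norm N (%x. T f x + S f x - (\<Sum>i<n + n'. l'' i f * A i x)) <= e * L2_norm M f" if f: "f \<in> L2 M" for f
 proof -
  let ?t = "%x. T f x - (\<Sum>i<n. l i f * a i x)" and ?s = "%x. S f x - (\<Sum>i<n'. l' i f * a' i x)"
  have "?t \<in> L2 N" "?s \<in> L2 N"
   using 1(1) 2(1) by (auto intro!: L2_diff L2_sum L2_scale T(2)[OF f] S(2)[OF f])
  from L2_norm_triangle[OF this]
  have "L2_norm N (%x. ?t x + ?s x) <= e * L2_norm M f" using 1(2)[rule_format, OF f] 2(2)[rule_format, OF f] by linarith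
  moreover have "(%x. T f x + S f x - (\<Sum>i<n + n'. l'' i f * A i x)) = (%x. ?t x + ?s x)" by (intro ext) (simp add: sum)
  ultimately show ?thesis by simp
 qed
 moreover have "\<forall>i<n + n'. A i \<in> L2 N & bounded_functional_L2 M (l'' i)" using 1(1) 2(1) by (auto simp: A_def l''_def)
 ultimately show "\<exists>(n::nat) a l. (\<forall>i<n. a i \<in> L2 N & bounded_functional_L2 M (l i)) &
   (\<forall>f\<in>L2 M. L2_norm N (%x. T f x + S f x - (\<Sum>i<n. l i f * a i x)) <= e * L2_norm M f)" by blast
qed

text \<open>What remains after subtracting the finite rank part is still linear and compatible with
  null sets, so it can serve as the contraction in the Fredholm argument.\<close>

lemma finite_rank_remainder:
 fixes n :: nat
 assumes T: "bounded_operator_L2 M N K T" and a: "!!i. i < n ==> a i \<in> L2 N"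
  and l: "!!i. i < n ==> bounded_functional_L2 M (l i)" and e: "0 <= e"
  and d: "!!f. f \<in> L2 M ==> L2_norm N (%x. T f x - (\<Sum>i<n. l i f * a i x)) <= e * L2_norm M f"
 shows "bounded_operator_L2 M N e (%f x. T f x - (\<Sum>i<n. l i f * a i x))"
proof (rule bounded_operator_L2I)
 note TD = bounded_operator_L2D[OF T]
 show "0 <= e" by fact
 fix f assume f: "f \<in> L2 M"
 show "(%x. T f x - (\<Sum>i<n. l i f * a i x)) \<in> L2 N" using a by (intro L2_diff L2_sum L2_scale TD(2)[OF f]) auto
 show "L2_norm N (%x. T f x - (\<Sum>i<n. l i f * a i x)) <= e * L2_norm M f" by (rule d[OF f])
 have "(\<Sum>i<n. l i (%x. c * f x) * a i y) = c * (\<Sum>i<n. l i f * a i y)" for c y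
  unfolding sum_distrib_left by (rule sum.cong) (auto simp: bounded_functional_L2D(3)[OF l f])
 then show "AE y in N. T (%x. c * f x) y - (\<Sum>i<n. l i (%x. c * f x) * a i y) = c * (T f y - (\<Sum>i<n. l i f * a i y))" for c
  using TD(5)[OF f, of c] by (simp add: right_diff_distrib)
 fix g assume g: "g \<in> L2 M"
 have s: "(\<Sum>i<n. l i (%x. f x + g x) * a i y) = (\<Sum>i<n. l i f * a i y) + (\<Sum>i<n. l i g * a i y)" for y
  unfolding sum.distrib[symmetric] by (rule sum.cong) (auto simp: bounded_functional_L2D(2)[OF l f g] distrib_right)
 show "AE y in N. T (%x. f x + g x) y - (\<Sum>i<n. l i (%x. f x + g x) * a i y)
   = T f y - (\<Sum>i<n. l i f * a i y) + (T g y - (\<Sum>i<n. l i g * a i y))"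
  unfolding s using TD(4)[OF f g] by eventually_elim simp
 assume e: "AE x in M. f x = g x"
 have s: "(\<Sum>i<n. l i f * a i y) = (\<Sum>i<n. l i g * a i y)" for y
  by (rule sum.cong) (auto simp: bounded_functional_L2D(1)[OF l f g e])
 show "AE y in N. T f y - (\<Sum>i<n. l i f * a i y) = T g y - (\<Sum>i<n. l i g * a i y)"
  unfolding s using TD(3)[OF f g e] by eventually_elim simp
qed

section \<open>The averaged transport operator as an integral operator\<close>

context bounded_domain
begin

text \<open>By \<open>nn_integral_polar\<close> for indicators, Lebesgue measure is the image of a
  density on the product of sphere and line; integrals of signed functions are transferred through
  this image.\<close>

lemma integral_polar:
 fixes F :: "'a => real"
 assumes F: "integrable lborel F"
 shows "(\<integral>th. (\<integral>s. (if 0 < s then s ^ (DIM('a) - 1) else 0) * F (s *\<^sub>R th) \<partial>lborel) \<partial>sphere_measure) = (\<integral>y. F y \<partial>lborel)"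
proof -
 let ?P = "(sphere_measure :: 'a measure) \<Otimes>\<^sub>M (lborel :: real measure)"
 let ?d = "%s :: real. if 0 < s then s ^ (DIM('a) - 1) else 0"
 let ?f = "%w :: 'a \<times> real. snd w *\<^sub>R fst w"
 have fst_m: "fst \<in> borel_measurable ?P"
  using measurable_compose[OF measurable_fst measurable_sphere_measure_ident] by simp
 have f_m [measurable]: "?f \<in> borel_measurable ?P"
  by (intro borel_measurable_scaleR fst_m) measurable
 have [measurable]: "F \<in> borel_measurable borel" using F by auto
 have e: "distr (density ?P (%w. ennreal (?d (snd w)))) borel ?f = lborel"
 proof (rule measure_eqI)
  fix A assume "A \<in> sets (distr (density ?P (%w. ennreal (?d (snd w)))) borel ?f)"
  then have A [measurable]: "A \<in> sets (borel :: 'a measure)" by simp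
  have "emeasure (distr (density ?P (%w. ennreal (?d (snd w)))) borel ?f) A
    = (\<integral>\<^sup>+w. indicator A w \<partial>distr (density ?P (%w. ennreal (?d (snd w)))) borel ?f)" by simp
  also have "\<dots> = (\<integral>\<^sup>+w. indicator A (?f w) \<partial>density ?P (%w. ennreal (?d (snd w))))"
   by (subst nn_integral_distr) (use f_m in simp_all)
  also have "\<dots> = (\<integral>\<^sup>+w. ennreal (?d (snd w)) * indicator A (?f w) \<partial>?P)"
   by (subst nn_integral_density) measurable
  also have "\<dots> = (\<integral>\<^sup>+th. (\<integral>\<^sup>+s. ennreal (?d (snd (th, s))) * indicator A (?f (th, s)) \<partial>lborel) \<partial>sphere_measure)"
   by (rule lborel.nn_integral_fst[symmetric]) measurable
  also have "\<dots> = (\<integral>\<^sup>+th. (\<integral>\<^sup>+s. indicator A (s *\<^sub>R th) * ennreal (s ^ (DIM('a) - 1)) * indicator {0<..} s \<partial>lborel) \<partial>sphere_measure)"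
   by (intro nn_integral_cong) (auto simp: indicator_def)
  also have "\<dots> = (\<integral>\<^sup>+y. indicator A y \<partial>lborel)" by (rule nn_integral_polar) measurable
  finally show "emeasure (distr (density ?P (%w. ennreal (?d (snd w)))) borel ?f) A = emeasure lborel A" by simp
 qed simp
 have "integrable (distr (density ?P (%w. ennreal (?d (snd w)))) borel ?f) F" using F unfolding e .
 then have "integrable (density ?P (%w. ennreal (?d (snd w)))) (%w. F (?f w))"
  by (subst (asm) integrable_distr_eq) (use f_m in simp_all)
 then have i: "integrable ?P (%w. ?d (snd w) * F (?f w))"
  by (subst (asm) integrable_density) auto
 have "(\<integral>y. F y \<partial>lborel) = (\<integral>y. F y \<partial>distr (density ?P (%w. ennreal (?d (snd w)))) borel ?f)" unfolding e ..
 also have "\<dots> = (\<integral>w. F (?f w) \<partial>density ?P (%w. ennreal (?d (snd w))))"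
  by (subst integral_distr) (use f_m in simp_all)
 also have "\<dots> = (\<integral>w. ?d (snd w) * F (?f w) \<partial>?P)"
  by (subst integral_density) auto
 also have "\<dots> = (\<integral>th. (\<integral>s. ?d (snd (th, s)) * F (?f (th, s)) \<partial>lborel) \<partial>sphere_measure)"
  by (rule sphere_line.integral_fst'[OF i, symmetric])
 finally show ?thesis by (simp cong: if_cong)
qed

end

lemma lborel_distr_reflect: "distr lborel borel (%v :: 'a::euclidean_space. x - v) = lborel"
 using lborel_affine[of "-1" x] by (simp add: density_1)

context transport_problem
begin

text \<open>In the coordinates \<open>y = x - s *\<^sub>R th\<close> of the backward rays through \<open>x\<close>, the part of the transport
 operator with \<open>a <= s\<close>, averaged over \<open>th\<close>, is an integral operator with this bounded kernel.\<close>

definition remote_kernel ::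
  "('a \<times> 'a => real) => ('a => 'a => 'a => real) => real => 'a => 'a \<times> 'a => real" where
 "remote_kernel w m a x z =
   zext X w (x, sgn (x - fst z)) * (indicator (chord X) ((x, sgn (x - fst z)), norm (x - fst z))
    * (indicator {a..} (norm (x - fst z)) * att ((x, sgn (x - fst z)), norm (x - fst z)))
    / norm (x - fst z) ^ (DIM('a) - 1)) * m (fst z) (sgn (x - fst z)) (snd z)"

context
 fixes w :: "'a \<times> 'a => real" and m :: "'a => 'a => 'a => real" and W B :: real
 assumes w [measurable]: "w \<in> borel_measurable (phase_measure X)"
  and W: "!!z. z \<in> space (phase_measure X) ==> \<bar>w z\<bar> <= W" "0 <= W"
  and m: "(%v. m (fst v) (fst (snd v)) (snd (snd v))) \<in> borel_measurable borel"
  and B: "!!x th th'. \<bar>m x th th'\<bar> <= B" "0 <= B"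
begin

lemma m_measurable [measurable (raw)]:
 assumes "f \<in> borel_measurable M" "g \<in> borel_measurable M" "h \<in> borel_measurable M"
 shows "(%x. m (f x) (g x) (h x)) \<in> borel_measurable M"
 using measurable_compose[OF borel_measurable_Pair[OF assms(1) borel_measurable_Pair[OF assms(2,3)]] m] by simp

lemma remote_kernel_bound:
 assumes a: "0 < a"
 shows "\<bar>remote_kernel w m a x z\<bar> <= W * (1 / a ^ (DIM('a) - 1)) * B"
proof -
 let ?r = "norm (x - fst z)" and ?n = "DIM('a) - 1"
 have "\<bar>indicator (chord X) ((x, sgn (x - fst z)), ?r) * (indicator {a..} ?r * att ((x, sgn (x - fst z)), ?r)) / ?r ^ ?n\<bar> <= 1 / a ^ ?n"
 proof (cases "a <= ?r")
  case True
  have "\<bar>indicator (chord X) ((x, sgn (x - fst z)), ?r) * (indicator {a..} ?r * att ((x, sgn (x - fst z)), ?r))\<bar> <= 1"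
   using att_bounds[of "((x, sgn (x - fst z)), ?r)"] by (auto simp: indicator_def)
  then show ?thesis unfolding abs_divide using True a
   by (intro frac_le) (auto intro: power_mono)
 qed (use a in auto)
 moreover have "\<bar>zext X w (x, sgn (x - fst z))\<bar> <= W" using W by (auto simp: zext_def)
 ultimately show ?thesis unfolding remote_kernel_def abs_mult[of "_ * _"] abs_mult[of "zext X w _"]
  using B W(2) a by (intro mult_mono) auto
qed

lemma measurable_remote_arguments [measurable (raw)]:
 "fst \<in> borel_measurable (borel :: ('a \<times> 'a \<times> 'a) measure)"
 "(%v. fst (snd v)) \<in> borel_measurable (borel :: ('a \<times> 'a \<times> 'a) measure)"
 "(%v. snd (snd v)) \<in> borel_measurable (borel :: ('a \<times> 'a \<times> 'a) measure)"
 by (intro borel_measurable_continuous_onI continuous_intros)+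

lemma remote_kernel_borel: "(%v. remote_kernel w m a (fst v) (snd v)) \<in> borel_measurable borel"
proof -
 define g where "g = (%v :: 'a \<times> 'a \<times> 'a. sgn (fst v - fst (snd v)))"
 have g [measurable]: "g \<in> borel_measurable borel" unfolding g_def sgn_div_norm by measurable
 have [measurable]: "(%v. ((fst v, g v), norm (fst v - fst (snd v)))) \<in> borel_measurable (borel :: ('a \<times> 'a \<times> 'a) measure)"
  by (intro borel_measurable_Pair g) measurable
 have 1: "(%v. zext X w (fst v, g v)) \<in> borel_measurable borel"
  by (rule measurable_compose[OF borel_measurable_Pair borel_measurable_zext[OF w]]) measurable
 have 2: "(%v. indicator (chord X) ((fst v, g v), norm (fst v - fst (snd v))) :: real) \<in> borel_measurable borel"
  by (rule measurable_compose[of _ borel borel]) measurable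
 have 3: "(%v. att ((fst v, g v), norm (fst v - fst (snd v)))) \<in> borel_measurable borel"
  by (rule measurable_compose[OF _ att_measurable]) measurable
 have 4: "(%v. indicator {a..} (norm (fst v - fst (snd v))) :: real) \<in> borel_measurable (borel :: ('a \<times> 'a \<times> 'a) measure)"
  by measurable
 have 5: "(%v. m (fst (snd v)) (g v) (snd (snd v))) \<in> borel_measurable borel" by measurable
 show ?thesis unfolding remote_kernel_def[abs_def]
  using 1 2 3 4 5 unfolding g_def by measurable
qed

lemma remote_kernel_measurable: "(%(x, z). remote_kernel w m a x z) \<in> borel_measurable (space_measure X \<Otimes>\<^sub>M phase_measure X)"
proof -
 have "(%v. (fst v, snd v)) \<in> borel_measurable (space_measure X \<Otimes>\<^sub>M phase_measure X)"
  by (intro borel_measurable_Pair measurable_compose[OF measurable_fst measurable_space_ident]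
    measurable_compose[OF measurable_snd measurable_phase_ident])
 from measurable_compose[OF this remote_kernel_borel] show ?thesis by (simp add: split_beta')
qed

text \<open>Polar coordinates around \<open>x\<close>: the Jacobian cancels the power of
  \<open>norm (x - y)\<close> in the denominator of the kernel, and the scattering integral at
  \<open>y\<close> together with the integral over \<open>y\<close> becomes an integral over the
  phase space.\<close>

lemma averaged_remote_transport:
 assumes a: "0 < a" and p: "p \<in> L2 (phase_measure X)" and x: "x \<in> X"
 shows "(\<integral>th. w (x, th) * transport X (%v. indicator {a..} (snd v) * att v) (scattering m p) (x, th) \<partial>sphere_measure)
  = (\<integral>z. remote_kernel w m a x z * p z \<partial>phase_measure X)"
proof -
 let ?n = "DIM('a) - 1"
 note [measurable] = L2_measurable[OF p]
 have Nm [measurable]: "remote_kernel w m a x \<in> borel_measurable (phase_measure X)"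
  using measurable_Pair2[OF remote_kernel_measurable, of x] x by simp
 have pe: "zext X p \<in> borel_measurable borel" by measurable
 define P where "P y th = (\<integral>th'. m y th th' * zext X p (y, th') \<partial>sphere_measure)" for y th
 have P: "scattering m p (y, th) = P y th" if "y \<in> X" for y th
  unfolding scattering_def P_def using that by (auto intro!: Bochner_Integration.integral_cong simp: zext_eq)
 define c where "c y = zext X w (x, sgn (x - y)) * (indicator (chord X) ((x, sgn (x - y)), norm (x - y))
    * (indicator {a..} (norm (x - y)) * att ((x, sgn (x - y)), norm (x - y))) / norm (x - y) ^ ?n)" for y
 define G where "G y = c y * P y (sgn (x - y))" for y
 have N: "remote_kernel w m a x (y, th') = c y * m y (sgn (x - y)) th'" for y th' by (simp add: remote_kernel_def c_def)
 have G: "G y = indicator X y *\<^sub>R (\<integral>th'. remote_kernel w m a x (y, th') * p (y, th') \<partial>sphere_measure)" for y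
 proof (cases "y \<in> X")
  case True
  have "G y = (\<integral>th'. c y * (m y (sgn (x - y)) th' * zext X p (y, th')) \<partial>sphere_measure)" by (simp add: G_def P_def)
  also have "\<dots> = (\<integral>th'. remote_kernel w m a x (y, th') * p (y, th') \<partial>sphere_measure)"
   using True by (intro Bochner_Integration.integral_cong) (auto simp: zext_eq N)
  finally show ?thesis using True by simp
 next
  case False
  then have "P y th = 0" for th by (simp add: P_def zext_def)
  then show ?thesis using False by (simp add: G_def)
 qed
 have i: "integrable (phase_measure X) (%z. remote_kernel w m a x z * p z)"
  using L2_mult_bounded(1)[OF p Nm AE_I2[OF remote_kernel_bound[OF a]]] by (rule phase.L2_imp_integrable)
 have Gi: "integrable lborel G" and GI: "(\<integral>y. G y \<partial>lborel) = (\<integral>z. remote_kernel w m a x z * p z \<partial>phase_measure X)"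
  using phase_pair.integrable_fst'[OF i] phase_pair.integral_fst'[OF i] unfolding G[abs_def]
  by (simp_all add: integrable_restrict_space integral_restrict_space)
 have Fi: "integrable lborel (%v. G (x - v))" and FI: "(\<integral>v. G (x - v) \<partial>lborel) = (\<integral>y. G y \<partial>lborel)"
 proof -
  have Gm: "G \<in> borel_measurable borel" using borel_measurable_integrable[OF Gi] by simp
  show "integrable lborel (%v. G (x - v))"
   using Gi by (subst (asm) lborel_distr_reflect[of x, symmetric], subst (asm) integrable_distr_eq) (use Gm in auto)
  show "(\<integral>v. G (x - v) \<partial>lborel) = (\<integral>y. G y \<partial>lborel)"
   by (subst (2) lborel_distr_reflect[of x, symmetric], subst integral_distr) (use Gm in auto)
 qed
 have "w (x, th) * transport X (%v. indicator {a..} (snd v) * att v) (scattering m p) (x, th)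
   = (\<integral>s. (if 0 < s then s ^ ?n else 0) * G (x - s *\<^sub>R th) \<partial>lborel)" if th: "th \<in> sphere 0 1" for th
 proof -
  have n: "norm th = 1" using th by simp
  have "w (x, th) * (indicator (chord X) ((x, th), s) * (indicator {a..} (snd ((x, th), s)) * att ((x, th), s)) * scattering m p (shift (x, th) s))
   = (if 0 < s then s ^ ?n else 0) * G (x - s *\<^sub>R th)" for s
  proof (cases "0 < s & ((x, th), s) \<in> chord X")
   case True
   have s: "sgn (s *\<^sub>R th) = th" "norm (s *\<^sub>R th) = s" using True th by (simp_all add: sgn_div_norm)
   have "scattering m p (shift (x, th) s) = P (x - s *\<^sub>R th) th"
    using P[of "x - s *\<^sub>R th" th] shift_in_X[of "(x, th)" s] True by (simp add: shift_def)
   moreover have "zext X w (x, th) = w (x, th)" using x th by (simp add: zext_eq)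
   ultimately show ?thesis using True by (simp add: G_def c_def s n)
  next
   case False
   \<comment> \<open>For \<open>s <= 0\<close> the cut-off at \<open>a > 0\<close> annihilates the
     left-hand side, including the end \<open>s = 0\<close> that belongs to the chord.\<close>
   then consider "s <= 0" | "0 < s" "((x, th), s) \<notin> chord X" by linarith
   then show ?thesis
   proof cases
    case 1 then show ?thesis using a by simp
   next
    case 2
    have s: "sgn (s *\<^sub>R th) = th" "norm (s *\<^sub>R th) = s" using 2 th by (simp_all add: sgn_div_norm)
    show ?thesis using 2 by (simp add: G_def c_def s n)
   qed
  qed
  then show ?thesis unfolding transport_def integral_mult_right_zero[symmetric] by simp
 qed
 then have "(\<integral>th. w (x, th) * transport X (%v. indicator {a..} (snd v) * att v) (scattering m p) (x, th) \<partial>sphere_measure)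
   = (\<integral>th. (\<integral>s. (if 0 < s then s ^ ?n else 0) * G (x - s *\<^sub>R th) \<partial>lborel) \<partial>sphere_measure)"
  by (intro Bochner_Integration.integral_cong) auto
 also have "\<dots> = (\<integral>v. G (x - v) \<partial>lborel)" by (rule integral_polar[OF Fi])
 finally show ?thesis using FI GI by simp
qed

text \<open>The part with \<open>s < a\<close> has norm at most \<open>a * c\<close>; the part with
  \<open>a <= s\<close> has a bounded kernel on a product of finite measures, hence a
  square-integrable one. The weight \<open>w\<close> and the kernel \<open>m\<close> are kept
  general because the result is applied to two different scattering kernels.\<close>

lemma averaged_transport_approximable:
 "finite_rank_approximable (phase_measure X) (space_measure X)
   (%p x. \<integral>th. w (x, th) * L (scattering m p) (x, th) \<partial>sphere_measure)"
 unfolding finite_rank_approximable_def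
proof (intro allI impI)
 fix e :: real assume e: "0 < e"
 let ?M = "phase_measure X" and ?X = "space_measure X"
 let ?W = "%u x. \<integral>th. w (x, th) * u (x, th) \<partial>sphere_measure"
 define c where "c = W * sqrt sphere_area * (B * sphere_area)"
 have c: "0 <= c" unfolding c_def using W B sphere_area_nonneg by simp
 \<comment> \<open>Chosen so that \<open>a * c <= e / 2\<close>; the summand 1 covers
   \<open>c = 0\<close>.\<close>
 define a where "a = e / 2 / (c + 1)"
 have a: "0 < a" using e c by (simp add: a_def)
 let ?near = "transport X (%v. indicator {..<a} (snd v) * att v)" and ?far = "transport X (%v. indicator {a..} (snd v) * att v)"
 have WO: "bounded_operator_L2 ?M ?X (W * sqrt sphere_area) ?W" by (rule bounded_operator_L2_angular[OF w W])
 have "(%(z, th'). m (fst z) (snd z) th') \<in> borel_measurable (?M \<Otimes>\<^sub>M (sphere_measure :: 'a measure))"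
  unfolding split_beta' by measurable
 then have SO: "bounded_operator_L2 ?M ?M (B * sphere_area) (scattering m)"
  by (rule bounded_operator_L2_scattering) (use B in auto)
 note near = bounded_operator_L2_compose[OF bounded_operator_L2_compose[OF SO transport_truncated[OF less_imp_le[OF a]]] WO]
 have hL: "(%(x, z). remote_kernel w m a x z) \<in> L2 (?X \<Otimes>\<^sub>M ?M)"
  by (rule finite_measure.L2_bounded[OF finite_measure_pair_measure[OF phase.finite_measure_axioms space.finite_measure_axioms]
    remote_kernel_measurable AE_I2, where C = "W * (1 / a ^ (DIM('a) - 1)) * B"])
   (use remote_kernel_bound[OF a] in \<open>simp only: split_beta'\<close>)
 have e2: "0 < e / 2" using e by simp
 obtain n :: nat and \<alpha> \<beta> where \<alpha>: "!!i. i < n ==> \<alpha> i \<in> L2 ?X" and \<beta>: "!!i. i < n ==> \<beta> i \<in> L2 ?M"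
  and d: "!!p. p \<in> L2 ?M ==> L2_norm ?X (%x. (\<integral>y. (case (x, y) of (x, z) => remote_kernel w m a x z) * p y \<partial>?M)
    - (\<Sum>i<n. (\<integral>y. \<beta> i y * p y \<partial>?M) * \<alpha> i x)) <= e / 2 * L2_norm ?M p"
  using kernel_finite_rank_approximation[OF space.finite_measure_axioms phase.finite_measure_axioms hL e2] by blast
 have "L2_norm ?X (%x. ?W (L (scattering m p)) x - (\<Sum>i<n. (\<integral>y. \<beta> i y * p y \<partial>?M) * \<alpha> i x)) <= e * L2_norm ?M p"
  if p: "p \<in> L2 ?M" for p
 proof -
  let ?q = "scattering m p" and ?s = "%x. \<Sum>i<n. (\<integral>y. \<beta> i y * p y \<partial>?M) * \<alpha> i x"
  have q: "?q \<in> L2 ?M" by (rule bounded_operator_L2D(2)[OF SO p])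
  note [measurable] = L2_measurable[OF q]
  have nq: "?near ?q \<in> L2 ?M" by (rule bounded_operator_L2D(2)[OF transport_truncated[OF less_imp_le[OF a]] q])
  have Lq: "L ?q \<in> L2 ?M" by (rule bounded_operator_L2D(2)[OF L_operator q])
  have split: "AE z in ?M. L ?q z = ?near ?q z + ?far ?q z"
   using L_integrable[OF q]
  proof eventually_elim
   case (elim z)
   have [measurable]: "{..<a} \<in> sets lborel" "{a..} \<in> sets lborel" by auto
   have "integrable lborel (%s. indicator {..<a} s *\<^sub>R (indicator (chord X) (z, s) * att (z, s) * ?q (shift z s)))"
    "integrable lborel (%s. indicator {a..} s *\<^sub>R (indicator (chord X) (z, s) * att (z, s) * ?q (shift z s)))"
    by (rule integrable_mult_indicator[OF _ elim]; simp)+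
   then have "(\<integral>s. indicator {..<a} s *\<^sub>R (indicator (chord X) (z, s) * att (z, s) * ?q (shift z s)) + indicator {a..} s *\<^sub>R (indicator (chord X) (z, s) * att (z, s) * ?q (shift z s)) \<partial>lborel)
    = (\<integral>s. indicator {..<a} s *\<^sub>R (indicator (chord X) (z, s) * att (z, s) * ?q (shift z s)) \<partial>lborel)
     + (\<integral>s. indicator {a..} s *\<^sub>R (indicator (chord X) (z, s) * att (z, s) * ?q (shift z s)) \<partial>lborel)"
    by (rule Bochner_Integration.integral_add)
   moreover have "indicator {..<a} s *\<^sub>R x + indicator {a..} s *\<^sub>R x = x" for s x :: real by (auto simp: indicator_def)
   ultimately show ?case unfolding L_def transport_def by (simp add: mult.assoc mult.left_commute)
  qed
  have fq: "?far ?q \<in> L2 ?M"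
   by (rule L2_cong_AE[OF L2_diff[OF Lq nq]], measurable) (use split in eventually_elim, simp)
  have hp: "(%x. \<integral>z. remote_kernel w m a x z * p z \<partial>?M) \<in> L2 ?X"
   using Hilbert_Schmidt_bound(1)[OF space.sigma_finite_measure_axioms phase.sigma_finite_measure_axioms hL p] by simp
  have sL: "?s \<in> L2 ?X" using \<alpha> by (intro L2_sum L2_scale) auto
  have "AE x in ?X. ?W (L ?q) x = ?W (?near ?q) x + ?W (?far ?q) x"
   using bounded_operator_L2D(3)[OF WO Lq L2_add[OF nq fq] split] bounded_operator_L2D(4)[OF WO nq fq]
   by eventually_elim simp
  moreover have "AE x in ?X. ?W (?far ?q) x = (\<integral>z. remote_kernel w m a x z * p z \<partial>?M)"
   by (rule AE_I2) (use averaged_remote_transport[OF a p] in simp)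
  ultimately have "AE x in ?X. ?W (L ?q) x - ?s x = ?W (?near ?q) x + ((\<integral>z. remote_kernel w m a x z * p z \<partial>?M) - ?s x)"
   by eventually_elim simp
  then have "L2_norm ?X (%x. ?W (L ?q) x - ?s x) = L2_norm ?X (%x. ?W (?near ?q) x + ((\<integral>z. remote_kernel w m a x z * p z \<partial>?M) - ?s x))"
   by (intro L2_norm_cong_AE L2_measurable L2_add L2_diff sL hp bounded_operator_L2D(2)[OF WO] Lq nq)
  also have "\<dots> <= L2_norm ?X (?W (?near ?q)) + L2_norm ?X (%x. (\<integral>z. remote_kernel w m a x z * p z \<partial>?M) - ?s x)"
   by (intro L2_norm_triangle L2_diff sL hp bounded_operator_L2D(2)[OF WO] nq)
  also have "L2_norm ?X (?W (?near ?q)) <= e / 2 * L2_norm ?M p"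
  proof -
   have "L2_norm ?X (?W (?near ?q)) <= (W * sqrt sphere_area) * (a * (B * sphere_area)) * L2_norm ?M p"
    by (rule bounded_operator_L2D(6)[OF near p])
   also have "\<dots> = (a * c) * L2_norm ?M p" by (simp add: c_def)
   also have "\<dots> <= e / 2 * L2_norm ?M p"
   proof (rule mult_right_mono[OF _ L2_norm_nonneg])
    have "a * c = e / 2 * (c / (c + 1))" by (simp add: a_def)
    also have "\<dots> <= e / 2 * 1" using c e by (intro mult_left_mono) auto
    finally show "a * c <= e / 2" by simp
   qed
   finally show ?thesis .
  qed
  also have "L2_norm ?X (%x. (\<integral>z. remote_kernel w m a x z * p z \<partial>?M) - ?s x) <= e / 2 * L2_norm ?M p"
   using d[OF p] by simp
  finally show ?thesis by simp
 qed
 then show "\<exists>(n::nat) a l. (\<forall>i<n. a i \<in> L2 ?X & bounded_functional_L2 ?M (l i)) &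
   (\<forall>p\<in>L2 ?M. L2_norm ?X (%x. ?W (L (scattering m p)) x - (\<Sum>i<n. l i p * a i x)) <= e * L2_norm ?M p)"
  using \<alpha> bounded_functional_L2_integral[OF \<beta>]
  by (intro exI[of _ n] exI[of _ \<alpha>] exI[of _ "%i p. \<integral>y. \<beta> i y * p y \<partial>?M"]) auto
qed

end

end

section \<open>Reconstruction of the source\<close>

lemma bounded_linear_L2_cong:
 assumes T: "bounded_linear_L2 M T" and m: "!!f. f \<in> L2 M ==> B f \<in> borel_measurable M"
  and e: "!!f. f \<in> L2 M ==> AE x in M. B f x = T f x"
 shows "bounded_linear_L2 M B"
proof -
 note TD = bounded_linear_L2D[OF T]
 obtain C where C: "!!f. f \<in> L2 M ==> L2_norm M (T f) <= C * L2_norm M f" using bounded_linear_L2_bound[OF T] by blast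
 show ?thesis unfolding bounded_linear_L2_def
 proof (intro conjI ballI allI impI exI[of _ C])
  fix f assume f: "f \<in> L2 M"
  show "B f \<in> L2 M" by (rule L2_cong_AE[OF TD(1)[OF f] m[OF f]]) (use e[OF f] in eventually_elim, simp)
  show "L2_norm M (B f) <= C * L2_norm M f"
   using C[OF f] L2_norm_cong_AE[OF m[OF f] L2_measurable[OF TD(1)[OF f]] e[OF f]] by simp
  show "AE x in M. B (%y. a * f y) x = a * B f x" for a
   using e[OF f] e[OF L2_scale[OF f, of a]] TD(4)[OF f, of a] by eventually_elim simp
  fix g assume g: "g \<in> L2 M"
  show "AE x in M. B (%y. f y + g y) x = B f x + B g x"
   using e[OF f] e[OF g] e[OF L2_add[OF f g]] TD(3)[OF f g] by eventually_elim simp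
  show "AE x in M. B f x = B g x" if "AE x in M. f x = g x"
   using e[OF f] e[OF g] TD(2)[OF f g that] by eventually_elim simp
 qed
qed

context bounded_domain
begin

lemma abs_sphere_integral_le:
 fixes h :: "'a => real"
 assumes h: "!!th. th \<in> sphere 0 1 ==> \<bar>h th\<bar> <= B" and B: "0 <= B"
 shows "\<bar>\<integral>th. h th \<partial>sphere_measure\<bar> <= B * sphere_area"
proof (cases "integrable sphere_measure h")
 case True
 have "\<bar>\<integral>th. h th \<partial>sphere_measure\<bar> <= (\<integral>th. \<bar>h th\<bar> \<partial>sphere_measure)" by (rule integral_abs_bound)
 also have "\<dots> <= (\<integral>th. B \<partial>(sphere_measure :: 'a measure))"
  by (rule integral_mono[OF integrable_abs[OF True] sphere_measure.integrable_const]) (use h in simp)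
 finally show ?thesis by (simp add: sphere_area_def mult.commute)
qed (use B sphere_area_nonneg in \<open>simp add: not_integrable_integral_eq\<close>)

lemma sphere_area_pos: "0 < sphere_area"
 unfolding sphere_area_def measure_def emeasure_sphere_measure enn2real_mult
 using content_ball_pos[of 1 "0::'a"] by (simp add: measure_def)

lemma C1_test_L2:
 fixes \<phi> :: "'a \<times> 'a => real"
 assumes "C1_compact_support (X \<times> UNIV) \<phi>"
 shows "\<phi> \<in> L2 (phase_measure X)" "streaming \<phi> \<in> L2 (phase_measure X)"
proof -
 obtain B where "0 <= B" and B: "!!z. \<bar>\<phi> z\<bar> <= B" "!!z. \<bar>streaming \<phi> z\<bar> <= B"
  by (rule C1_compact_support_bounded[OF assms]) (rule that)
 note C = C1_compact_supportD[OF assms]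
 show "\<phi> \<in> L2 (phase_measure X)"
  by (rule phase.L2_bounded[OF borel_measurable_phase[OF borel_measurable_continuous_onI[OF C(2)]] AE_I2[OF B(1)]])
 show "streaming \<phi> \<in> L2 (phase_measure X)"
  by (rule phase.L2_bounded[OF borel_measurable_phase[OF borel_measurable_continuous_onI[OF C(3)]] AE_I2[OF B(2)]])
qed

lemma H12_derivative_diff:
 assumes u: "H12_derivative X u g" and v: "H12_derivative X v h"
 shows "H12_derivative X (%z. u z - v z) (%z. g z - h z)"
 unfolding H12_derivative_def streaming_def[symmetric]
proof (intro conjI allI impI)
 note U = u[unfolded H12_derivative_def streaming_def[symmetric]] and V = v[unfolded H12_derivative_def streaming_def[symmetric]]
 show "(%z. u z - v z) \<in> L2 (phase_measure X)" "(%z. g z - h z) \<in> L2 (phase_measure X)"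
  using U V by (auto intro: L2_diff)
 fix \<phi> :: "'a \<times> 'a => real" assume \<phi>: "C1_compact_support (X \<times> UNIV) \<phi>"
 have "integrable (phase_measure X) (%z. f z * \<phi> z)" "integrable (phase_measure X) (%z. f z * streaming \<phi> z)"
  if "f \<in> L2 (phase_measure X)" for f
  by (intro L2_mult_integrable that C1_test_L2[OF \<phi>])+
 then show "(\<integral>z. (u z - v z) * streaming \<phi> z \<partial>phase_measure X) = - (\<integral>z. (g z - h z) * \<phi> z \<partial>phase_measure X)"
  using U V \<phi> by (simp add: left_diff_distrib)
qed

lemma H12_derivative_cong_AE:
 assumes H: "H12_derivative X u g" and [measurable]: "u' \<in> borel_measurable (phase_measure X)"
  and e: "AE z in phase_measure X. u z = u' z"
 shows "H12_derivative X u' g"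
 unfolding H12_derivative_def streaming_def[symmetric]
proof (intro conjI allI impI)
 note U = H[unfolded H12_derivative_def streaming_def[symmetric]]
 have uL: "u \<in> L2 (phase_measure X)" using U by blast
 note [measurable] = L2_measurable[OF uL]
 show "u' \<in> L2 (phase_measure X)" by (rule L2_cong_AE[OF uL _ e]) measurable
 show "g \<in> L2 (phase_measure X)" using U by blast
 fix \<phi> :: "'a \<times> 'a => real" assume \<phi>: "C1_compact_support (X \<times> UNIV) \<phi>"
 note [measurable] = L2_measurable[OF C1_test_L2(2)[OF \<phi>]]
 have "(\<integral>z. u' z * streaming \<phi> z \<partial>phase_measure X) = (\<integral>z. u z * streaming \<phi> z \<partial>phase_measure X)"
  by (rule integral_cong_AE, measurable) (use e in eventually_elim, simp)
 then show "(\<integral>z. u' z * streaming \<phi> z \<partial>phase_measure X) = - (\<integral>z. g z * \<phi> z \<partial>phase_measure X)" using U \<phi> by simp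
qed

lemma inflow_trace_diff:
 assumes "inflow_trace X u (%_. 0)" "inflow_trace X v (%_. 0)"
 shows "inflow_trace X (%z. u z - v z) (%_. 0)"
proof -
 obtain w where w: "AE z in phase_measure X. w z = u z"
  "!!y th. (y, th) \<in> Gamma_minus X ==> ((%t. w (y + t *\<^sub>R th, th)) \<longlongrightarrow> 0) (at_right 0)"
  using assms(1) unfolding inflow_trace_def by fast
 obtain w' where w': "AE z in phase_measure X. w' z = v z"
  "!!y th. (y, th) \<in> Gamma_minus X ==> ((%t. w' (y + t *\<^sub>R th, th)) \<longlongrightarrow> 0) (at_right 0)"
  using assms(2) unfolding inflow_trace_def by fast
 have "AE z in phase_measure X. w z - w' z = u z - v z" using w(1) w'(1) by eventually_elim simp
 moreover have "((%t. w (y + t *\<^sub>R th, th) - w' (y + t *\<^sub>R th, th)) \<longlongrightarrow> 0) (at_right 0)" if "(y, th) \<in> Gamma_minus X" for y th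
  using tendsto_diff[OF w(2)[OF that] w'(2)[OF that]] by simp
 ultimately show ?thesis unfolding inflow_trace_def by (intro exI[of _ "%z. w z - w' z"]) auto
qed

end

context transport_problem
begin

lemma mild_source_L2:
 assumes "f \<in> L2 (space_measure X)" "u \<in> L2 (phase_measure X)"
 shows "(%z. f (fst z) + scattering k u z) \<in> L2 (phase_measure X)"
 using assms by (intro L2_add bounded_operator_L2D(2)[OF bounded_operator_L2_lift] bounded_operator_L2D(2)[OF scattering_operator])

text \<open>Freeze the right-hand side \<open>q = f + K u\<close>. Then \<open>L q\<close> solves
  the equation with absorption only and has zero trace, so its difference \<open>d\<close> from a
  forward solution \<open>u\<close> has streaming derivative \<open>- \<sigma> * d\<close> and zero
  trace, and \<open>damped_equation_zero\<close> applies. Conversely \<open>L q\<close> is the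
  representative of a mild solution that exhibits the trace.\<close>

lemma forward_solution_iff_mild:
 assumes smooth: "smooth_boundary X" and f: "f \<in> L2 (space_measure X)"
 shows "forward_solution X \<sigma> k f u \<longleftrightarrow> mild f u"
proof
 let ?M = "phase_measure X" and ?q = "%z. f (fst z) + scattering k u z"
 have trace: "\<forall>(y, th)\<in>Gamma_minus X. ((%t. L ?q (y + t *\<^sub>R th, th)) \<longlongrightarrow> 0) (at_right 0)"
 proof (intro ballI, clarify)
  fix y th assume y: "(y, th) \<in> Gamma_minus X"
  obtain e where e: "0 < e" "!!t. 0 < t ==> t < e ==> y + t *\<^sub>R th \<in> X"
   using Gamma_minus_entering(2)[OF open_X smooth y] by blast
  show "((%t. L ?q (y + t *\<^sub>R th, th)) \<longlongrightarrow> 0) (at_right 0)"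
   by (rule L_entering_trace[OF Gamma_minus_entering(1)[OF open_X smooth y] e])
 qed
 show "mild f u" if "forward_solution X \<sigma> k f u"
 proof -
  have ex: "\<exists>g. H12_derivative X u g & (AE (x, th) in ?M. g (x, th) + \<sigma> x * u (x, th) - scattering k u (x, th) = f x)"
   and tr: "inflow_trace X u (%_. 0)"
   using that by (simp_all only: forward_solution_def)
  obtain g where H: "H12_derivative X u g"
   and eq: "AE (x, th) in ?M. g (x, th) + \<sigma> x * u (x, th) - scattering k u (x, th) = f x"
   using ex by (elim exE conjE)
  have uL: "u \<in> L2 ?M" using H by (simp add: H12_derivative_def)
  note q = mild_source_L2[OF f uL]
  have "inflow_trace X (L ?q) (%_. 0)" unfolding inflow_trace_def using trace by (intro exI[of _ "L ?q"]) auto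
  note trD = inflow_trace_diff[OF tr this] and D = H12_derivative_diff[OF H L_weak_derivative[OF q]]
  have "AE z in ?M. \<bar>g z - (?q z - \<sigma> (fst z) * L ?q z)\<bar> <= \<sigma>\<^sub>1 * \<bar>u z - L ?q z\<bar>"
   using eq
  proof eventually_elim
   case (elim z)
   have "g z - (?q z - \<sigma> (fst z) * L ?q z) = - (\<sigma> (fst z) * (u z - L ?q z))"
    using elim by (simp add: split_beta' algebra_simps)
   then show ?case
    using mult_right_mono[OF \<sigma>_bounds(2)[of "fst z"] abs_ge_zero[of "u z - L ?q z"]] \<sigma>_pos[of "fst z"] by (simp add: abs_mult)
  qed
  moreover have "0 < \<sigma>\<^sub>1" using \<sigma>_pos[of 0] \<sigma>_bounds(2)[of 0] by linarith
  ultimately have "AE z in ?M. u z - L ?q z = 0"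
   using damped_equation_zero[OF D trD transversal_exit_smooth[OF smooth]] by blast
  then show "mild f u" using uL unfolding mild_def by simp
 qed
 show "forward_solution X \<sigma> k f u" if m: "mild f u"
 proof -
  have uL: "u \<in> L2 ?M" and e: "AE z in ?M. u z = L ?q z" using m by (auto simp: mild_def)
  have e': "AE z in ?M. L ?q z = u z" using e by eventually_elim simp
  note H = H12_derivative_cong_AE[OF L_weak_derivative[OF mild_source_L2[OF f uL]] L2_measurable[OF uL] e']
  have "AE (x, th) in ?M. (?q (x, th) - \<sigma> (fst (x, th)) * L ?q (x, th)) + \<sigma> x * u (x, th) - scattering k u (x, th) = f x"
   using e by eventually_elim (simp add: split_beta')
  moreover have "inflow_trace X u (%_. 0)" unfolding inflow_trace_def using trace e' by (intro exI[of _ "L ?q"]) auto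
  ultimately show ?thesis unfolding forward_solution_def using H by blast
 qed
qed

text \<open>A mild solution is \<open>L\<close> applied to the isotropic source plus
  \<open>L\<close> applied to a scattered function. The source is also a scattered function, for the
  constant kernel \<open>1 / sphere_area\<close>, because it does not depend on the direction; so
  both terms are covered by \<open>averaged_transport_approximable\<close>.\<close>

lemma averaged_solution_approximable:
 assumes w: "w \<in> borel_measurable (phase_measure X)" "!!z. z \<in> space (phase_measure X) ==> \<bar>w z\<bar> <= W" "0 <= W"
  and G: "bounded_operator_L2 (space_measure X) (phase_measure X) K G"
  and mild: "!!f. f \<in> L2 (space_measure X) ==> mild f (G f)"
 shows "finite_rank_approximable (space_measure X) (space_measure X) (%f x. \<integral>th. w (x, th) * G f (x, th) \<partial>sphere_measure)"
proof -
 let ?M = "phase_measure X" and ?X = "space_measure X"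
 let ?W = "%u x. \<integral>th. w (x, th) * u (x, th) \<partial>sphere_measure"
 let ?c = "%_ _ _. 1 / sphere_area" and ?J = "%f z. f (fst z)"
 have WO: "bounded_operator_L2 ?M ?X (W * sqrt sphere_area) ?W" by (rule bounded_operator_L2_angular[OF w])
 note J = bounded_operator_L2_lift
 note WLG = bounded_operator_L2_compose[OF G bounded_operator_L2_compose[OF bounded_operator_L2_compose[OF scattering_operator L_operator] WO]]
 note WLJ = bounded_operator_L2_compose[OF J bounded_operator_L2_compose[OF L_operator WO]]
 have c: "scattering ?c (?J f) = ?J f" for f :: "'a => real"
  using less_imp_neq[OF sphere_area_pos] by (intro ext) (simp add: scattering_def split_beta' sphere_area_def)
 have "finite_rank_approximable ?X ?X (%f. ?W (L (scattering ?c (?J f))))"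
  by (rule finite_rank_approximable_compose[OF averaged_transport_approximable[OF w, of ?c "1 / sphere_area"] J])
   (use sphere_area_pos in auto)
 then have 1: "finite_rank_approximable ?X ?X (%f. ?W (L (?J f)))" unfolding c .
 have 2: "finite_rank_approximable ?X ?X (%f. ?W (L (scattering k (G f))))"
  by (rule finite_rank_approximable_compose[OF averaged_transport_approximable[OF w k_borel, of C] G])
   (use k_bounds C_nonneg in auto)
 have sum: "finite_rank_approximable ?X ?X (%f x. ?W (L (?J f)) x + ?W (L (scattering k (G f))) x)"
  by (rule finite_rank_approximable_add[OF 1 bounded_operator_L2D(2)[OF WLJ] 2 bounded_operator_L2D(2)[OF WLG]])
 have e: "AE x in ?X. ?W (G f) x = ?W (L (?J f)) x + ?W (L (scattering k (G f))) x" if f: "f \<in> L2 ?X" for f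
 proof -
  have GL: "G f \<in> L2 ?M" by (rule bounded_operator_L2D(2)[OF G f])
  have JL: "?J f \<in> L2 ?M" by (rule bounded_operator_L2D(2)[OF J f])
  have KL: "scattering k (G f) \<in> L2 ?M" by (rule bounded_operator_L2D(2)[OF scattering_operator GL])
  note L2s = bounded_operator_L2D(2)[OF L_operator JL] bounded_operator_L2D(2)[OF L_operator KL]
  have "AE z in ?M. G f z = L (?J f) z + L (scattering k (G f)) z"
   using mild[OF f, unfolded mild_def, THEN conjunct2] bounded_operator_L2D(4)[OF L_operator JL KL] by eventually_elim simp
  from bounded_operator_L2D(3)[OF WO GL L2_add[OF L2s] this] bounded_operator_L2D(4)[OF WO L2s]
  show ?thesis by eventually_elim simp
 qed
 show ?thesis unfolding finite_rank_approximable_def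
 proof (intro allI impI)
  fix e :: real assume "0 < e"
  then obtain n :: nat and a l where al: "\<forall>i<n. a i \<in> L2 ?X & bounded_functional_L2 ?X (l i)"
   and d: "\<forall>f\<in>L2 ?X. L2_norm ?X (%x. ?W (L (?J f)) x + ?W (L (scattering k (G f))) x - (\<Sum>i<n. l i f * a i x)) <= e * L2_norm ?X f"
   using sum unfolding finite_rank_approximable_def by blast
  have "L2_norm ?X (%x. ?W (G f) x - (\<Sum>i<n. l i f * a i x)) <= e * L2_norm ?X f" if f: "f \<in> L2 ?X" for f
  proof -
   have "L2_norm ?X (%x. ?W (G f) x - (\<Sum>i<n. l i f * a i x))
    = L2_norm ?X (%x. ?W (L (?J f)) x + ?W (L (scattering k (G f))) x - (\<Sum>i<n. l i f * a i x))"
   proof (rule L2_norm_cong_AE)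
    have s: "(%x. \<Sum>i<n. l i f * a i x) \<in> L2 ?X" using al by (intro L2_sum L2_scale) auto
    show "(%x. ?W (G f) x - (\<Sum>i<n. l i f * a i x)) \<in> borel_measurable ?X"
     by (rule L2_measurable[OF L2_diff[OF bounded_operator_L2D(2)[OF WO bounded_operator_L2D(2)[OF G f]] s]])
    show "(%x. ?W (L (?J f)) x + ?W (L (scattering k (G f))) x - (\<Sum>i<n. l i f * a i x)) \<in> borel_measurable ?X"
     by (rule L2_measurable[OF L2_diff[OF L2_add[OF bounded_operator_L2D(2)[OF WLJ f] bounded_operator_L2D(2)[OF WLG f]] s]])
    show "AE x in ?X. ?W (G f) x - (\<Sum>i<n. l i f * a i x)
      = ?W (L (?J f)) x + ?W (L (scattering k (G f))) x - (\<Sum>i<n. l i f * a i x)"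
     using e[OF f] by eventually_elim simp
   qed
   then show ?thesis using d f by simp
  qed
  then show "\<exists>(n::nat) a l. (\<forall>i<n. a i \<in> L2 ?X & bounded_functional_L2 ?X (l i)) &
    (\<forall>f\<in>L2 ?X. L2_norm ?X (%x. ?W (G f) x - (\<Sum>i<n. l i f * a i x)) <= e * L2_norm ?X f)"
   using al by blast
 qed
qed

text \<open>Symmetry of \<open>k\<close> and Fubini on the sphere move the scattering from
  \<open>u\<close> onto \<open>v\<close>. The result is an average of \<open>u\<close> against a
  fixed weight, bounded when \<open>v\<close> is, to which the approximation results apply.\<close>

lemma op_K_angular:
 assumes v [measurable]: "v \<in> borel_measurable (phase_measure X)"
  and V: "!!z. z \<in> space (phase_measure X) ==> \<bar>v z\<bar> <= V" "0 <= V"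
  and u: "u \<in> L2 (phase_measure X)"
 shows "AE x in space_measure X. op_K \<sigma> k v u x
  = (\<integral>th. (scattering k v (x, th) - \<sigma> x * v (x, th)) * u (x, th) \<partial>sphere_measure)"
proof -
 let ?S = "sphere_measure :: 'a measure"
 have "AE x in space_measure X. x \<in> X" by (rule AE_I2) simp
 with L2_slice[OF sphere_measure.sigma_finite_measure_axioms u] show ?thesis
 proof eventually_elim
  case (elim x)
  define p where "p th = u (x, th)" for th
  define r where "r th = v (x, th)" for th
  have p: "p \<in> L2 ?S" unfolding p_def[abs_def] by (rule elim)
  have r [measurable]: "r \<in> borel_measurable ?S"
   unfolding r_def[abs_def] by (rule measurable_Pair2[OF v]) (simp add: elim(2))
  have V': "\<bar>r th\<bar> <= V" if "th \<in> sphere 0 1" for th using V(1)[of "(x, th)"] that elim by (simp add: r_def)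
  note [measurable] = L2_measurable[OF p]
  have kr: "\<bar>k x b a * r b\<bar> <= C * V" if "b \<in> sphere 0 1" for a b
   unfolding abs_mult using k_bounds[of x b a] V'[OF that] C_nonneg by (intro mult_mono) simp_all
  have sp: "fst \<in> borel_measurable (?S \<Otimes>\<^sub>M ?S)" "snd \<in> borel_measurable (?S \<Otimes>\<^sub>M ?S)"
   using measurable_compose[OF measurable_fst measurable_sphere_measure_ident] measurable_compose[OF measurable_snd measurable_sphere_measure_ident] by simp_all
  have km [measurable]: "(%w. k x (snd w) (fst w)) \<in> borel_measurable (?S \<Otimes>\<^sub>M ?S)"
   by (rule k_measurable[OF borel_measurable_const sp(2,1)])
  have rm [measurable]: "(%w. r (snd w)) \<in> borel_measurable (?S \<Otimes>\<^sub>M ?S)" "(%w. p (fst w)) \<in> borel_measurable (?S \<Otimes>\<^sub>M ?S)"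
   by (rule measurable_compose[OF measurable_snd r], rule measurable_compose[OF measurable_fst L2_measurable[OF p]])
  have kx: "k x b \<in> borel_measurable ?S" "(%a. k x a b) \<in> borel_measurable ?S" for b
   by (rule k_measurable[OF borel_measurable_const borel_measurable_const measurable_sphere_measure_ident],
    rule k_measurable[OF borel_measurable_const measurable_sphere_measure_ident borel_measurable_const])
  define h where "h a = (\<integral>b. \<bar>k x b a * r b\<bar> \<partial>?S)" for a
  have hm: "h \<in> borel_measurable ?S"
   unfolding h_def[abs_def]
   by (rule sphere_measure.borel_measurable_lebesgue_integral, unfold split_beta')
    (intro borel_measurable_abs borel_measurable_times km rm)
  have h: "\<bar>h a\<bar> <= C * V * sphere_area" for a
   unfolding h_def by (rule abs_sphere_integral_le) (use kr mult_nonneg_nonneg[OF C_nonneg V(2)] in simp_all)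
  let ?f = "%(a, b). k x b a * p a * r b"
  have fm: "?f \<in> borel_measurable (?S \<Otimes>\<^sub>M ?S)"
   unfolding split_beta' by (intro borel_measurable_times km rm)
  \<comment> \<open>The slice of \<open>u\<close> is only square integrable in the angle, which is
    enough: the inner integral is bounded by a constant times \<open>\<bar>p a\<bar>\<close>, and
    the sphere has finite measure.\<close>
  have i: "integrable (?S \<Otimes>\<^sub>M ?S) ?f"
  proof (rule sphere_sphere.Fubini_integrable[OF fm])
   have "integrable ?S (%a. h a * \<bar>p a\<bar>)"
    by (rule sphere_measure.L2_imp_integrable, rule L2_mult_bounded(1)[OF _ hm AE_I2[OF h]], rule L2_mono(1)[OF p])
     (intro borel_measurable_abs L2_measurable[OF p], simp)
   moreover have "(\<integral>b. norm (k x b a * p a * r b) \<partial>?S) = h a * \<bar>p a\<bar>" for a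
   proof -
    have "(\<integral>b. norm (k x b a * p a * r b) \<partial>?S) = (\<integral>b. \<bar>k x b a * r b\<bar> * \<bar>p a\<bar> \<partial>?S)"
     by (intro Bochner_Integration.integral_cong) (auto simp: abs_mult)
    then show ?thesis by (simp add: h_def)
   qed
   ultimately show "integrable ?S (%a. \<integral>b. norm (?f (a, b)) \<partial>?S)" by simp
   have "integrable ?S (%b. p a * (k x b a * r b))" for a
    by (intro integrable_mult_right sphere_measure.integrable_const_bound[where B = "C * V"] AE_I2
      borel_measurable_times kx r) (use kr in simp)
   then show "AE a in ?S. integrable ?S (%b. ?f (a, b))" by (simp add: mult.left_commute mult.assoc)
  qed
  have pr: "integrable ?S (%th. r th * p th)"
   by (rule sphere_measure.L2_imp_integrable, rule L2_mult_bounded(1)[OF p r AE_I2, where C = V]) (use V' in simp)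
  have "(\<integral>th. (- \<sigma> x * p th + (\<integral>a. k x th a * p a \<partial>?S)) * r th \<partial>?S)
   = (\<integral>th. - \<sigma> x * (r th * p th) + (\<integral>a. k x th a * p a * r th \<partial>?S) \<partial>?S)"
  proof (rule Bochner_Integration.integral_cong[OF refl])
   fix th
   have e: "(\<integral>a. k x th a * p a * r th \<partial>?S) = (\<integral>a. k x th a * p a \<partial>?S) * r th" by simp
   show "(- \<sigma> x * p th + (\<integral>a. k x th a * p a \<partial>?S)) * r th = - \<sigma> x * (r th * p th) + (\<integral>a. k x th a * p a * r th \<partial>?S)"
    unfolding e by (subst distrib_right) (simp only: mult_ac)
  qed
  also have "\<dots> = - \<sigma> x * (\<integral>th. r th * p th \<partial>?S) + (\<integral>b. (\<integral>a. k x b a * p a * r b \<partial>?S) \<partial>?S)"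
   using pr sphere_sphere.integrable_snd[OF i] by (subst Bochner_Integration.integral_add) auto
  also have "(\<integral>b. (\<integral>a. k x b a * p a * r b \<partial>?S) \<partial>?S) = (\<integral>a. (\<integral>b. k x b a * p a * r b \<partial>?S) \<partial>?S)"
   by (rule sphere_sphere.Fubini_integral[OF i])
  also have "- \<sigma> x * (\<integral>th. r th * p th \<partial>?S) + (\<integral>a. (\<integral>b. k x b a * p a * r b \<partial>?S) \<partial>?S)
   = (\<integral>a. - \<sigma> x * (r a * p a) + (\<integral>b. k x b a * p a * r b \<partial>?S) \<partial>?S)"
   using pr sphere_sphere.integrable_fst[OF i] by (subst Bochner_Integration.integral_add) auto
  also have "\<dots> = (\<integral>a. ((\<integral>b. k x a b * r b \<partial>?S) - \<sigma> x * r a) * p a \<partial>?S)"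
  proof (rule Bochner_Integration.integral_cong[OF refl])
   fix a assume "a \<in> space ?S"
   then have "(\<integral>b. k x b a * p a * r b \<partial>?S) = (\<integral>b. k x a b * r b * p a \<partial>?S)"
    using k_sym[of x] elim by (intro Bochner_Integration.integral_cong) auto
   moreover have "(\<integral>b. k x a b * r b * p a \<partial>?S) = (\<integral>b. k x a b * r b \<partial>?S) * p a" by simp
   ultimately show "- \<sigma> x * (r a * p a) + (\<integral>b. k x b a * p a * r b \<partial>?S) = ((\<integral>b. k x a b * r b \<partial>?S) - \<sigma> x * r a) * p a"
    by (simp add: left_diff_distrib)
  qed
  finally show ?case unfolding op_K_def op_A_def scattering_def p_def r_def by simp
 qed
qed

end

lemma L2_cong_space: "(!!x. x \<in> space M ==> f x = g x) ==> f \<in> L2 M \<longleftrightarrow> g \<in> L2 M"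
 unfolding L2_def mem_Collect_eq
 by (intro arg_cong2[where f = "(&)"] measurable_cong Bochner_Integration.integrable_cong refl) simp_all

context transport_problem
begin

text \<open>Up to null sets the operator is \<open>f + \<mu> * ?W (G f)\<close>, where
  \<open>\<mu>\<close> is the reciprocal of the angular integral of \<open>v\<close> and
  \<open>?W\<close> is the average against the weight of \<open>op_K_angular\<close>. It is
  therefore a contraction perturbation of the identity plus a finite rank operator. Dividing the
  internal functional by the angular integral of \<open>v\<close> gives this operator applied to
  \<open>S\<close>.\<close>

lemma source_reconstruction:
 assumes smooth: "smooth_boundary X" and v [measurable]: "v \<in> borel_measurable (phase_measure X)"
  and V: "!!z. z \<in> space (phase_measure X) ==> \<bar>v z\<bar> <= V" "0 <= V"
  and c: "0 < c" "!!x. x \<in> X ==> c <= (\<integral>th. v (x, th) \<partial>sphere_measure)"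
  and ne: "\<not> eigenvalue_L2 (space_measure X) (op_Id_MKS X \<sigma> k v) 0"
  and S: "S \<in> L2 (space_measure X)"
  and H: "!!x. x \<in> X ==> H x = internal_functional \<sigma> k v S (op_S X \<sigma> k S) x"
 shows "bounded_linear_L2 (space_measure X) (op_Id_MKS X \<sigma> k v) &
  (\<exists>R. inverse_L2 (space_measure X) (op_Id_MKS X \<sigma> k v) R & bounded_linear_L2 (space_measure X) R &
   (AE x in space_measure X. S x = R (op_M_L2 X v H) x))"
proof -
 let ?M = "phase_measure X" and ?X = "space_measure X" and ?S = "sphere_measure :: 'a measure"
 let ?T = "op_Id_MKS X \<sigma> k v"
 let ?w = "%z. scattering k v z - \<sigma> (fst z) * v z"
 let ?W = "%u x. \<integral>th. ?w (x, th) * u (x, th) \<partial>?S" and ?V = "%u x. \<integral>th. v (x, th) * u (x, th) \<partial>?S"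
 define \<mu> where "\<mu> x = 1 / (\<integral>th. v (x, th) \<partial>?S)" for x
 have onX: "AE x in ?X. x \<in> X" by (rule AE_I2) simp
 have vL: "v \<in> L2 ?M" by (rule phase.L2_bounded[OF v AE_I2]) (rule V(1))
 note [measurable] = L2_measurable[OF bounded_operator_L2D(2)[OF scattering_operator vL]]
 have w: "?w \<in> borel_measurable ?M" by measurable
 have wb: "\<bar>?w z\<bar> <= C * V * sphere_area + \<sigma>\<^sub>1 * V" if z: "z \<in> space ?M" for z
 proof -
  have "\<bar>scattering k v z\<bar> <= C * V * sphere_area"
   unfolding scattering_def split_beta'
  proof (rule abs_sphere_integral_le)
   fix th assume "th \<in> sphere (0::'a) 1"
   then have "\<bar>v (fst z, th)\<bar> <= V" using z by (intro V(1)) auto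
   then show "\<bar>k (fst z) (snd z) th * v (fst z, th)\<bar> <= C * V"
    unfolding abs_mult using k_bounds[of "fst z" "snd z" th] C_nonneg by (intro mult_mono) simp_all
  qed (intro mult_nonneg_nonneg C_nonneg V(2))
  moreover have "\<bar>\<sigma> (fst z) * v z\<bar> <= \<sigma>\<^sub>1 * V"
   unfolding abs_mult using \<sigma>_bounds(2)[of "fst z"] \<sigma>_pos[of "fst z"] V(1)[OF z] by (intro mult_mono) auto
  ultimately show ?thesis by linarith
 qed
 have wb0: "0 <= C * V * sphere_area + \<sigma>\<^sub>1 * V"
  using \<sigma>_pos[of 0] \<sigma>_bounds(2)[of 0]
  by (intro add_nonneg_nonneg mult_nonneg_nonneg C_nonneg V(2) sphere_area_nonneg) linarith
 have WO: "bounded_operator_L2 ?M ?X ((C * V * sphere_area + \<sigma>\<^sub>1 * V) * sqrt sphere_area) ?W"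
  by (rule bounded_operator_L2_angular[OF w wb wb0])
 have VO: "bounded_operator_L2 ?M ?X (V * sqrt sphere_area) ?V" by (rule bounded_operator_L2_angular[OF v V])
 have int_m [measurable]: "(%x. \<integral>th. v (x, th) \<partial>?S) \<in> borel_measurable ?X"
  by (rule sphere_measure.borel_measurable_lebesgue_integral, unfold split_beta' prod.collapse) (rule v)
 have MO: "bounded_operator_L2 ?X ?X \<bar>1 / c\<bar> (%f x. \<mu> x * f x)"
 proof (rule bounded_operator_L2_mult)
  show "\<mu> \<in> borel_measurable ?X" unfolding \<mu>_def[abs_def] by (intro borel_measurable_divide borel_measurable_const int_m)
  have "\<bar>\<mu> x\<bar> <= 1 / c" if "x \<in> X" for x using c(1) c(2)[OF that] by (simp add: \<mu>_def frac_le)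
  then show "AE x in ?X. \<bar>\<mu> x\<bar> <= 1 / c" by (intro AE_I2) simp
 qed
 obtain G K where G: "bounded_operator_L2 ?X ?M K G" and G_mild: "!!f. f \<in> L2 ?X ==> mild f (G f)" using mild_operator by blast
 \<comment> \<open>\<open>op_S\<close> chooses an arbitrary forward solution, with no linearity in
   \<open>f\<close>. By uniqueness it agrees almost everywhere with the linear operator
   \<open>G\<close>, which replaces it from here on.\<close>
 have U: "mild f (op_S X \<sigma> k f)" if f: "f \<in> L2 ?X" for f
 proof -
  have "forward_solution X \<sigma> k f (G f)" using G_mild[OF f] forward_solution_iff_mild[OF smooth f] by simp
  then have "forward_solution X \<sigma> k f (op_S X \<sigma> k f)" unfolding op_S_def by (rule someI[where P = "forward_solution X \<sigma> k f"])
  then show ?thesis using forward_solution_iff_mild[OF smooth f] by simp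
 qed
 have UL: "op_S X \<sigma> k f \<in> L2 ?M" if "f \<in> L2 ?X" for f using U[OF that] by (simp add: mild_def)
 have opA: "op_A \<sigma> k u = (%z. scattering k u z - \<sigma> (fst z) * u z)" for u by (auto simp: op_A_def)
 have opK: "op_K \<sigma> k v u = ?V (%z. scattering k u z - \<sigma> (fst z) * u z)" for u
  unfolding op_K_def[abs_def] opA by (simp add: mult.commute)
 have KL: "op_K \<sigma> k v u \<in> L2 ?X" if "u \<in> L2 ?M" for u
  unfolding opK by (intro bounded_operator_L2D(2)[OF VO] L2_diff \<sigma>_mult_L2 bounded_operator_L2D(2)[OF scattering_operator] that)
 note T0 = bounded_operator_L2_compose[OF G WO]
 have B: "AE x in ?X. (op_K \<sigma> k v \<circ> op_S X \<sigma> k) f x = ?W (G f) x" if f: "f \<in> L2 ?X" for f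
 proof -
  have "AE x in ?X. op_K \<sigma> k v (op_S X \<sigma> k f) x = (\<integral>th. (scattering k v (x, th) - \<sigma> x * v (x, th)) * op_S X \<sigma> k f (x, th) \<partial>?S)"
   by (rule op_K_angular[OF v V UL[OF f]])
  then show ?thesis
   using bounded_operator_L2D(3)[OF WO UL[OF f] bounded_operator_L2D(2)[OF G f] mild_unique[OF f U[OF f] G_mild[OF f]]]
   by eventually_elim simp
 qed
 have bB: "bounded_linear_L2 ?X (op_K \<sigma> k v \<circ> op_S X \<sigma> k)"
 proof (rule bounded_linear_L2_cong[OF bounded_operator_imp_bounded_linear_L2[OF T0] _ B])
  show "(op_K \<sigma> k v \<circ> op_S X \<sigma> k) f \<in> borel_measurable ?X" if "f \<in> L2 ?X" for f
   unfolding comp_def by (rule L2_measurable[OF KL[OF UL[OF that]]])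
 qed
 have KS: "op_KS_L2 X \<sigma> k v f \<in> L2 ?X" "AE x in ?X. op_KS_L2 X \<sigma> k v f x = ?W (G f) x" if f: "f \<in> L2 ?X" for f
 proof -
  show "op_KS_L2 X \<sigma> k v f \<in> L2 ?X" unfolding op_KS_L2_def by (rule L2_extension_eq(1)[OF bB f])
  show "AE x in ?X. op_KS_L2 X \<sigma> k v f x = ?W (G f) x"
   unfolding op_KS_L2_def using L2_extension_eq(2)[OF bB f] B[OF f] by eventually_elim simp
 qed
 have opM: "op_M v = (%f x. \<mu> x * f x)" by (intro ext) (simp add: op_M_def \<mu>_def)
 have bM: "bounded_linear_L2 ?X (op_M v)" unfolding opM by (rule bounded_operator_imp_bounded_linear_L2[OF MO])
 have MvL: "op_M_L2 X v h \<in> L2 ?X" "AE x in ?X. op_M_L2 X v h x = \<mu> x * h x" if "h \<in> L2 ?X" for h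
  using L2_extension_eq[OF bM that] unfolding op_M_L2_def opM by auto
 have TL: "?T f \<in> L2 ?X" if f: "f \<in> L2 ?X" for f
  unfolding op_Id_MKS_def by (intro L2_add f MvL(1) KS(1))
 have T: "AE x in ?X. ?T f x = f x + \<mu> x * ?W (G f) x" if f: "f \<in> L2 ?X" for f
  unfolding op_Id_MKS_def using MvL(2)[OF KS(1)[OF f]] KS(2)[OF f] by eventually_elim simp
 have "bounded_operator_L2 ?X ?X 1 (%f. f)" by (rule bounded_operator_L2I) auto
 note IO = bounded_operator_L2_add[OF this bounded_operator_L2_compose[OF T0 MO]]
 have bT: "bounded_linear_L2 ?X ?T"
  by (rule bounded_linear_L2_cong[OF bounded_operator_imp_bounded_linear_L2[OF IO]]) (rule L2_measurable[OF TL], assumption, rule T)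
 \<comment> \<open>Multiplication by \<open>\<mu>\<close> has norm at most \<open>1 / c\<close>, so
   an approximation error of \<open>c / 2\<close> leaves a remainder of norm at most 1/2.\<close>
 have c2: "0 < c / 2" using c by simp
 obtain n :: nat and a l where a: "!!i. i < n ==> a i \<in> L2 ?X" and l: "!!i. i < n ==> bounded_functional_L2 ?X (l i)"
  and d: "!!f. f \<in> L2 ?X ==> L2_norm ?X (%x. ?W (G f) x - (\<Sum>i<n. l i f * a i x)) <= c / 2 * L2_norm ?X f"
 proof -
  have "finite_rank_approximable ?X ?X (%f. ?W (G f))" by (rule averaged_solution_approximable[OF w wb wb0 G G_mild])
  from this[unfolded finite_rank_approximable_def, rule_format, OF c2] obtain n :: nat and a l
   where *: "\<forall>i<n. a i \<in> L2 ?X & bounded_functional_L2 ?X (l i)"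
    "\<forall>f\<in>L2 ?X. L2_norm ?X (%x. ?W (G f) x - (\<Sum>i<n. l i f * a i x)) <= c / 2 * L2_norm ?X f"
   by (elim exE conjE)
  then show ?thesis using that[of n a l] by simp
 qed
 let ?R = "%f x. \<mu> x * (?W (G f) x - (\<Sum>i<n. l i f * a i x))"
 have "bounded_operator_L2 ?X ?X (\<bar>1 / c\<bar> * (c / 2)) ?R"
  by (rule bounded_operator_L2_compose[OF finite_rank_remainder[OF T0 a l less_imp_le[OF c2] d] MO])
 moreover have "\<bar>1 / c\<bar> * (c / 2) = 1 / 2" using c(1) by simp
 ultimately have R: "bounded_operator_L2 ?X ?X (1 / 2) ?R" by (simp only:)
 have T_eq: "AE x in ?X. ?T f x = f x + ?R f x + (\<Sum>i<n. l i f * (\<mu> x * a i x))" if "f \<in> L2 ?X" for f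
  using T[OF that] by eventually_elim (simp add: right_diff_distrib sum_distrib_left mult.left_commute)
 \<comment> \<open>Zero not being an eigenvalue is injectivity modulo null sets.\<close>
 have inj: "AE x in ?X. f x = 0" if "f \<in> L2 ?X" "AE x in ?X. ?T f x = 0" for f
  using ne that unfolding eigenvalue_L2_def mult_zero_left by blast
 obtain Q where Q: "bounded_linear_L2 ?X Q" "inverse_L2 ?X ?T Q"
  by (rule space.Fredholm_finite_rank_contraction[OF bounded_operator_imp_bounded_linear_L2[OF R] _ _
    bounded_operator_L2D(6)[OF R] bounded_operator_L2D(2)[OF MO a] l bT T_eq inj]) auto
 let ?u = "op_S X \<sigma> k S" and ?I = "%x. \<integral>th. v (x, th) \<partial>?S"
 note uL = UL[OF S]
 have su: "(%z. \<sigma> (fst z) * ?u z) \<in> L2 ?M" and Ku: "scattering k ?u \<in> L2 ?M"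
  by (rule \<sigma>_mult_L2[OF uL], rule bounded_operator_L2D(2)[OF scattering_operator uL])
 have SI: "(%x. ?I x * S x) \<in> L2 ?X"
  by (rule L2_mult_bounded(1)[OF S int_m AE_I2[where P = "%x. \<bar>?I x\<bar> <= V * sphere_area"]], rule abs_sphere_integral_le)
   (use V in auto)
 let ?H = "%x. ?V (scattering k ?u) x - ?V (%z. \<sigma> (fst z) * ?u z) x + ?I x * S x"
 have H': "H x = ?H x" if x: "x \<in> X" for x
 proof -
  have 1: "(\<integral>th. \<sigma> x * ?u (x, th) * v (x, th) \<partial>?S) = ?V (%z. \<sigma> (fst z) * ?u z) x" by (simp add: ac_simps)
  have 2: "(\<integral>th. v (x, th) * S x \<partial>?S) = ?I x * S x" by simp
  have "(\<integral>th'. k x th th' * v (x, th) * ?u (x, th') \<partial>?S) = v (x, th) * scattering k ?u (x, th)" for th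
  proof -
   have "(\<integral>th'. k x th th' * v (x, th) * ?u (x, th') \<partial>?S) = (\<integral>th'. v (x, th) * (k x th th' * ?u (x, th')) \<partial>?S)"
    by (simp only: mult_ac)
   also have "\<dots> = v (x, th) * (\<integral>th'. k x th th' * ?u (x, th') \<partial>?S)" by (rule integral_mult_right_zero)
   finally show ?thesis by (simp only: scattering_def split_conv)
  qed
  then show ?thesis unfolding H[OF x] internal_functional_def 1 2 by simp
 qed
 have HL0: "?H \<in> L2 ?X" by (intro L2_add L2_diff SI bounded_operator_L2D(2)[OF VO] su Ku)
 have HL: "H \<in> L2 ?X"
  by (rule L2_cong_space[THEN iffD1, OF _ HL0]) (use H' in simp)
 have "AE x in ?X. op_M_L2 X v H x = ?T S x"
  using MvL(2)[OF HL] T[OF S] B[OF S] bounded_operator_L2_diff[OF VO Ku su] onX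
 proof eventually_elim
  case (elim x)
  have "\<mu> x * ?I x = 1" using c(1) c(2)[OF elim(5)] by (simp add: \<mu>_def)
  moreover have "op_K \<sigma> k v ?u x = ?V (scattering k ?u) x - ?V (%z. \<sigma> (fst z) * ?u z) x" using elim(4) by (simp add: opK)
  then have "H x = ?W (G S) x + ?I x * S x" using H'[OF elim(5)] elim(3) by simp
  ultimately have "\<mu> x * H x = \<mu> x * ?W (G S) x + S x" by (simp add: distrib_left mult.assoc[symmetric])
  then show ?case using elim(1,2) by simp
 qed
 from bounded_linear_L2D(2)[OF Q(1) MvL(1)[OF HL] TL[OF S] this]
 have "AE x in ?X. Q (op_M_L2 X v H) x = Q (?T S) x" .
 moreover have "AE x in ?X. Q (?T S) x = S x" using Q(2) S unfolding inverse_L2_def by blast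
 ultimately have "AE x in ?X. S x = Q (op_M_L2 X v H) x" by eventually_elim simp
 then show ?thesis using bT Q by blast
qed

end

section \<open>From the extended coefficients back to the given ones\<close>

lemma L2_norm_cong_space: "(!!x. x \<in> space M ==> f x = g x) ==> L2_norm M f = L2_norm M g"
 unfolding L2_norm_def by (intro arg_cong[where f = sqrt] Bochner_Integration.integral_cong refl) simp

lemma L2_tendsto_cong_space:
 assumes "!!j x. x \<in> space M ==> F j x = G j x" "!!x. x \<in> space M ==> f x = g x"
 shows "L2_tendsto M F f \<longleftrightarrow> L2_tendsto M G g"
proof -
 have "F j \<in> L2 M \<longleftrightarrow> G j \<in> L2 M" for j by (rule L2_cong_space) (rule assms)
 moreover have "f \<in> L2 M \<longleftrightarrow> g \<in> L2 M" by (rule L2_cong_space) (rule assms)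
 moreover have "L2_norm M (%x. F j x - f x) = L2_norm M (%x. G j x - g x)" for j
  by (rule L2_norm_cong_space) (simp add: assms)
 ultimately show ?thesis by (simp add: L2_tendsto_def)
qed

lemma L2_extension_cong:
 assumes "!!h x. x \<in> X ==> B h x = B' h x"
 shows "L2_extension X B f = L2_extension X B' f"
proof -
 have "L2_tendsto (space_measure X) (%j. B (F j)) g \<longleftrightarrow> L2_tendsto (space_measure X) (%j. B' (F j)) g" for F g
  by (rule L2_tendsto_cong_space) (simp_all add: assms space_restrict_space)
 then show ?thesis unfolding L2_extension_def by simp
qed

text \<open>The coefficients enter only through their values on the phase space. \<open>op_S\<close>
  is a choice from the predicate \<open>forward_solution\<close>, so an equivalent predicate yields
  literally the same function, and the equalities of operators are exact rather than almost
  everywhere.\<close>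

lemma operators_cong:
 fixes \<sigma> \<sigma>' :: "'a::euclidean_space => real"
 assumes \<sigma>: "!!x. x \<in> X ==> \<sigma> x = \<sigma>' x"
  and k: "!!x th th'. x \<in> X ==> th \<in> sphere 0 1 ==> th' \<in> sphere 0 1 ==> k x th th' = k' x th th'"
 shows "op_S X \<sigma> k = op_S X \<sigma>' k'" "op_Id_MKS X \<sigma> k v = op_Id_MKS X \<sigma>' k' v"
  and "x \<in> X ==> internal_functional \<sigma> k v S u x = internal_functional \<sigma>' k' v S u x"
proof -
 have sc: "scattering k u (x, th) = scattering k' u (x, th)" if "x \<in> X" "th \<in> sphere 0 1" for u x th
  unfolding scattering_def using k that by (auto intro!: Bochner_Integration.integral_cong)
 have "(AE (x, th) in phase_measure X. g (x, th) + \<sigma> x * u (x, th) - scattering k u (x, th) = S x)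
  \<longleftrightarrow> (AE (x, th) in phase_measure X. g (x, th) + \<sigma>' x * u (x, th) - scattering k' u (x, th) = S x)" for g u S
 proof (rule AE_cong)
  fix z :: "'a \<times> 'a" assume "z \<in> space (phase_measure X)"
  then have "fst z \<in> X" "snd z \<in> sphere 0 1" by (auto simp: space_pair_measure space_restrict_space)
  then show "(case z of (x, th) => g (x, th) + \<sigma> x * u (x, th) - scattering k u (x, th) = S x)
   \<longleftrightarrow> (case z of (x, th) => g (x, th) + \<sigma>' x * u (x, th) - scattering k' u (x, th) = S x)"
   using \<sigma> sc[of "fst z" "snd z" u] by (simp add: split_beta')
 qed
 then have "forward_solution X \<sigma> k S u \<longleftrightarrow> forward_solution X \<sigma>' k' S u" for S u
  unfolding forward_solution_def by simp
 then show op_S: "op_S X \<sigma> k = op_S X \<sigma>' k'" by (intro ext) (simp add: op_S_def)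
 have "op_K \<sigma> k v u x = op_K \<sigma>' k' v u x" if "x \<in> X" for u x
  unfolding op_K_def op_A_def using sc[OF that] \<sigma>[OF that] by (auto intro!: Bochner_Integration.integral_cong)
 then have "op_KS_L2 X \<sigma> k v f = op_KS_L2 X \<sigma>' k' v f" for f
  unfolding op_KS_L2_def op_S by (intro L2_extension_cong) simp
 then show "op_Id_MKS X \<sigma> k v = op_Id_MKS X \<sigma>' k' v" by (intro ext) (simp add: op_Id_MKS_def)
 show "internal_functional \<sigma> k v S u x = internal_functional \<sigma>' k' v S u x" if x: "x \<in> X"
 proof -
  have "(\<integral>th. (\<integral>th'. k x th th' * v (x, th) * u (x, th') \<partial>sphere_measure) \<partial>sphere_measure)
   = (\<integral>th. (\<integral>th'. k' x th th' * v (x, th) * u (x, th') \<partial>sphere_measure) \<partial>sphere_measure)"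
   using k[OF x] by (intro Bochner_Integration.integral_cong refl) simp
  then show ?thesis unfolding internal_functional_def using \<sigma>[OF x] by simp
 qed
qed

lemma continuous_compact_bounded:
 fixes f :: "'a::metric_space => real"
 assumes "compact K" "continuous_on K f"
 obtains B where "0 < B" "!!x. x \<in> K ==> \<bar>f x\<bar> <= B"
 using compact_imp_bounded[OF compact_continuous_image[OF assms(2,1)]] unfolding bounded_pos by auto

lemma borel_measurable_extend_zero:
 fixes f :: "'a::euclidean_space => real"
 assumes "A \<in> sets borel" "continuous_on A f"
 shows "(%x. if x \<in> A then f x else 0) \<in> borel_measurable borel"
proof -
 have "(%x. if x \<in> A then f x else 0) = (%x. indicator A x *\<^sub>R f x)" by auto
 then show ?thesis using borel_measurable_continuous_on_indicator[OF assms] by (simp only:)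
qed

theorem theorem5:
  fixes X :: "(real ^ 'n) set"
    and \<sigma> S :: "real ^ 'n \<Rightarrow> real"
    and k :: "real ^ 'n \<Rightarrow> real ^ 'n \<Rightarrow> real ^ 'n \<Rightarrow> real"
    and f\<^sub>0 v\<^sub>0 :: "(real ^ 'n) \<times> (real ^ 'n) \<Rightarrow> real"
    and \<rho> :: real
  assumes dim: "CARD('n) \<ge> 2"
    and domain: "open X" "bounded X" "smooth_boundary X"
    and k_pos: "\<exists>c>0. \<forall>x\<in>X. \<forall>\<theta>\<in>sphere 0 1. \<forall>\<theta>'\<in>sphere 0 1. c \<le> k x \<theta> \<theta>'"
    and k_rot: "\<exists>\<kappa>. \<forall>x\<in>closure X. \<forall>\<theta>\<in>sphere 0 1. \<forall>\<theta>'\<in>sphere 0 1. k x \<theta> \<theta>' = \<kappa> x (\<theta> \<bullet> \<theta>')"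
    and A1: "continuous_on (closure X) \<sigma>"
            "continuous_on (closure X \<times> sphere 0 1 \<times> sphere 0 1) (\<lambda>(x, \<theta>, \<theta>'). k x \<theta> \<theta>')"
            "continuous_on (closure X) S"
    and \<rho>_def: "\<rho> = Linf_norm (phase_measure X) (\<lambda>(x, \<theta>). \<integral>\<theta>'. k x \<theta> \<theta>' \<partial>sphere_measure)"
    and A2: "(\<exists>\<alpha>>0. (INF x\<in>closure X. \<sigma> x) - \<rho> \<ge> \<alpha>) \<or> diameter X * \<rho> < 1"
    and A3: "\<exists>\<sigma>\<^sub>0>0. \<forall>x\<in>X. \<sigma> x \<ge> \<sigma>\<^sub>0"
    and A4: "\<exists>k\<^sub>0<1. Linf_norm (phase_measure X)
                (\<lambda>(x, \<theta>). 1 / \<sigma> x * (\<integral>\<theta>'. k x \<theta> \<theta>' \<partial>sphere_measure)) \<le> k\<^sub>0"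
    and A5: "\<sigma> \<in> W12 X"
            "\<forall>\<theta>\<in>sphere 0 1. \<forall>\<theta>'\<in>sphere 0 1. (\<lambda>x. k x \<theta> \<theta>') \<in> W12 X"
    and f0: "continuous_on (Gamma_plus X) f\<^sub>0" "\<exists>c>0. \<forall>z\<in>Gamma_plus X. c \<le> f\<^sub>0 z"
    and v0: "adjoint_solution X \<sigma> k f\<^sub>0 v\<^sub>0"
            "\<exists>c>0. \<forall>x\<in>X. \<forall>\<theta>\<in>sphere 0 1.
                c \<le> v\<^sub>0 (x, \<theta>) \<and> c \<le> (\<integral>\<theta>'. v\<^sub>0 (x, \<theta>') \<partial>sphere_measure)"
    and not_eigenvalue: "\<not> eigenvalue_L2 (space_measure X) (op_Id_MKS X \<sigma> k v\<^sub>0) 0"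
  shows "bounded_linear_L2 (space_measure X) (op_Id_MKS X \<sigma> k v\<^sub>0) \<and>
         (\<exists>R. inverse_L2 (space_measure X) (op_Id_MKS X \<sigma> k v\<^sub>0) R \<and>
             bounded_linear_L2 (space_measure X) R \<and>
             (AE x in space_measure X.
                S x = R (op_M_L2 X v\<^sub>0 (internal_functional \<sigma> k v\<^sub>0 S (op_S X \<sigma> k S))) x))"
proof -
 let ?B = "sphere (0 :: real ^ 'n) 1"
 interpret D: bounded_domain X using domain(1,2) by unfold_locales
 have cX: "compact (closure X)" using domain(2) by (simp add: compact_closure)
 have XX: "x \<in> closure X" if "x \<in> X" for x using that closure_subset by blast
 obtain \<sigma>\<^sub>0 where \<sigma>\<^sub>0: "0 < \<sigma>\<^sub>0" "!!x. x \<in> X ==> \<sigma>\<^sub>0 <= \<sigma> x" using A3 by blast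
 obtain b\<^sub>1 where b\<^sub>1: "0 < b\<^sub>1" "!!x. x \<in> closure X ==> \<bar>\<sigma> x\<bar> <= b\<^sub>1" using continuous_compact_bounded[OF cX A1(1)] by blast
 \<comment> \<open>The maximum with \<open>\<sigma>\<^sub>0\<close> keeps the two bounds in order
   even when \<open>X\<close> is empty.\<close>
 define \<sigma>\<^sub>1 where "\<sigma>\<^sub>1 = max \<sigma>\<^sub>0 b\<^sub>1"
 obtain \<sigma>\<^sub>e where \<sigma>\<^sub>e: "continuous_on UNIV \<sigma>\<^sub>e" "!!x. x \<in> closure X ==> \<sigma>\<^sub>e x = \<sigma> x"
  using Tietze_unbounded[OF A1(1), of UNIV] by auto
 \<comment> \<open>The Tietze extension is continuous but may leave the range of
   \<open>\<sigma>\<close>; clamping restores both bounds everywhere and changes nothing on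
   \<open>X\<close>.\<close>
 define \<sigma>' where "\<sigma>' x = max \<sigma>\<^sub>0 (min \<sigma>\<^sub>1 (\<sigma>\<^sub>e x))" for x
 have \<sigma>': "\<sigma> x = \<sigma>' x" if "x \<in> X" for x
  using \<sigma>\<^sub>0(2)[OF that] b\<^sub>1(2)[OF XX[OF that]] \<sigma>\<^sub>e(2)[OF XX[OF that]] by (simp add: \<sigma>'_def \<sigma>\<^sub>1_def)
 obtain C where C: "0 < C" "!!w. w \<in> closure X \<times> ?B \<times> ?B ==> \<bar>(%(x, th, th'). k x th th') w\<bar> <= C"
  using continuous_compact_bounded[OF compact_Times[OF cX compact_Times[OF compact_sphere compact_sphere]] A1(2)] by blast
 have kC: "\<bar>k x th th'\<bar> <= C" if "x \<in> X" "th \<in> ?B" "th' \<in> ?B" for x th th'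
  using C(2)[of "(x, th, th')"] that XX by auto
 \<comment> \<open>Extension by zero keeps nonnegativity, the upper bound and the symmetry;
   continuity is lost across the boundary, but the locale asks only for a Borel kernel.\<close>
 define k' where "k' x th th' = (if x \<in> X & th \<in> ?B & th' \<in> ?B then k x th th' else 0)" for x th th'
 have k': "k x th th' = k' x th th'" if "x \<in> X" "th \<in> ?B" "th' \<in> ?B" for x th th' using that by (simp add: k'_def)
 have k'_nonneg: "0 <= k' x th th'" for x th th'
 proof -
  obtain c where c: "0 < c" "\<forall>x\<in>X. \<forall>th\<in>?B. \<forall>th'\<in>?B. c <= k x th th'" using k_pos by blast
  have nn: "0 <= k x th th'" if "x \<in> X" "th \<in> ?B" "th' \<in> ?B" using c(2)[rule_format, OF that] c(1) by linarith
  show ?thesis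
  proof (cases "x \<in> X & th \<in> ?B & th' \<in> ?B")
   case True
   show ?thesis unfolding k'_def if_P[OF True] using True by (intro nn) blast+
  next
   case False
   show ?thesis unfolding k'_def if_not_P[OF False] by (rule order_refl)
  qed
 qed
 have k'_le: "k' x th th' <= C" for x th th'
 proof (cases "x \<in> X & th \<in> ?B & th' \<in> ?B")
  case True
  show ?thesis unfolding k'_def if_P[OF True] using True by (intro order_trans[OF abs_ge_self kC]) blast+
 next
  case False
  show ?thesis unfolding k'_def if_not_P[OF False] by (rule less_imp_le[OF C(1)])
 qed
 have k'_borel: "(%w. k' (fst w) (fst (snd w)) (snd (snd w))) \<in> borel_measurable borel"
 proof -
  have e: "X \<times> ?B \<times> ?B = (X \<times> UNIV) \<inter> (UNIV \<times> ?B \<times> ?B)" by auto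
  have "X \<times> ?B \<times> ?B \<in> sets borel"
   unfolding e by (intro sets.Int borel_open borel_closed open_Times closed_Times domain(1)) auto
  from borel_measurable_extend_zero[OF this continuous_on_subset[OF A1(2)]] closure_subset[of X]
  have "(%w. if w \<in> X \<times> ?B \<times> ?B then (%(x, th, th'). k x th th') w else 0) \<in> borel_measurable borel" by auto
  moreover have "(%w. if w \<in> X \<times> ?B \<times> ?B then (%(x, th, th'). k x th th') w else 0)
   = (%w. k' (fst w) (fst (snd w)) (snd (snd w)))" by (auto simp: k'_def fun_eq_iff)
  ultimately show ?thesis by simp
 qed
 define K where "K x th = (\<integral>th'. k x th th' \<partial>sphere_measure)" for x th
 have KC: "\<bar>K x th\<bar> <= C * D.sphere_area" if "x \<in> X" "th \<in> ?B" for x th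
  unfolding K_def using kC[OF that] C(1) by (intro D.abs_sphere_integral_le) auto
 obtain k\<^sub>0 where k\<^sub>0: "k\<^sub>0 < 1" "Linf_norm (phase_measure X) (%(x, th). 1 / \<sigma> x * K x th) <= k\<^sub>0"
  using A4 unfolding K_def by blast
 \<comment> \<open>The essential supremum is defined as the infimum of the admissible bounds. This
   set is nonempty because \<open>\<sigma>\<close> is bounded below and \<open>k\<close> above; its
   infimum is below 1, so some admissible, and by definition nonnegative, bound is below 1 as
   well.\<close>
 obtain \<kappa> where \<kappa>: "0 <= \<kappa>" "\<kappa> < 1" "AE z in phase_measure X. \<bar>1 / \<sigma> (fst z) * K (fst z) (snd z)\<bar> <= \<kappa>"
 proof -
  let ?C = "{c. 0 <= c & (AE z in phase_measure X. \<bar>1 / \<sigma> (fst z) * K (fst z) (snd z)\<bar> <= c)}"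
  have "\<bar>1 / \<sigma> (fst z) * K (fst z) (snd z)\<bar> <= 1 / \<sigma>\<^sub>0 * (C * D.sphere_area)" if z: "z \<in> space (phase_measure X)" for z
   unfolding abs_mult
  proof (rule mult_mono)
   show "\<bar>1 / \<sigma> (fst z)\<bar> <= 1 / \<sigma>\<^sub>0" using \<sigma>\<^sub>0(1) \<sigma>\<^sub>0(2)[of "fst z"] z unfolding abs_divide by (intro frac_le) auto
   show "\<bar>K (fst z) (snd z)\<bar> <= C * D.sphere_area" using z by (intro KC) auto
  qed (use \<sigma>\<^sub>0(1) in auto)
  then have "1 / \<sigma>\<^sub>0 * (C * D.sphere_area) \<in> ?C" using \<sigma>\<^sub>0(1) C(1) D.sphere_area_nonneg by (auto intro!: AE_I2)
  then have ne: "?C \<noteq> {}" by blast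
  have "Inf ?C <= k\<^sub>0" using k\<^sub>0(2) unfolding Linf_norm_def by (simp add: split_beta')
  then have "Inf ?C < 1" using k\<^sub>0(1) by simp
  from cInf_lessD[OF ne this] show ?thesis using that by blast
 qed
 interpret T: transport_problem X \<sigma>' k' \<sigma>\<^sub>0 \<sigma>\<^sub>1 \<kappa> C
 proof
  show "continuous_on UNIV \<sigma>'" unfolding \<sigma>'_def by (intro continuous_intros \<sigma>\<^sub>e(1))
  show "0 < \<sigma>\<^sub>0" "0 <= \<kappa>" "\<kappa> < 1" by fact+
  show "\<sigma>\<^sub>0 <= \<sigma>' x" "\<sigma>' x <= \<sigma>\<^sub>1" for x by (auto simp: \<sigma>'_def \<sigma>\<^sub>1_def)
  show "(%w. k' (fst w) (fst (snd w)) (snd (snd w))) \<in> borel_measurable borel" by fact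
  show "0 <= k' x th th'" "k' x th th' <= C" for x th th' by fact+
  show "k' x th th' = k' x th' th" if "x \<in> X" "th \<in> ?B" "th' \<in> ?B" for x th th'
  proof -
   obtain q where q: "\<forall>x\<in>closure X. \<forall>th\<in>?B. \<forall>th'\<in>?B. k x th th' = q x (th \<bullet> th')" using k_rot by blast
   have "k x th th' = k x th' th"
    using q[rule_format, OF XX[OF that(1)] that(2,3)] q[rule_format, OF XX[OF that(1)] that(3,2)] by (simp add: inner_commute)
   then show ?thesis using that by (simp add: k'_def)
  qed
  show "AE z in phase_measure X. (\<integral>\<^sup>+th'. ennreal (k' (fst z) (snd z) th') \<partial>sphere_measure) <= ennreal (\<kappa> * \<sigma>' (fst z))"
   using \<kappa>(3) AE_space
  proof eventually_elim
   case (elim z)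
   then have z: "fst z \<in> X" "snd z \<in> ?B" by auto
   have "(%th'. (fst z, snd z, th')) \<in> borel_measurable (sphere_measure :: (real ^ 'n) measure)"
    by (intro borel_measurable_Pair borel_measurable_const measurable_sphere_measure_ident)
   from measurable_compose[OF this k'_borel]
   have "integrable sphere_measure (k' (fst z) (snd z))"
    using k'_nonneg k'_le by (intro sphere_measure.integrable_const_bound[where B = C] AE_I2) auto
   then have "(\<integral>\<^sup>+th'. ennreal (k' (fst z) (snd z) th') \<partial>sphere_measure) = ennreal (\<integral>th'. k' (fst z) (snd z) th' \<partial>sphere_measure)"
    by (intro nn_integral_eq_integral) (auto simp: k'_nonneg)
   also have "(\<integral>th'. k' (fst z) (snd z) th' \<partial>sphere_measure) = K (fst z) (snd z)"
    unfolding K_def using z by (intro Bochner_Integration.integral_cong) (auto simp: k'_def)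
   also have "K (fst z) (snd z) <= \<kappa> * \<sigma>' (fst z)"
   proof -
    have s: "0 < \<sigma> (fst z)" using \<sigma>\<^sub>0(1) \<sigma>\<^sub>0(2)[OF z(1)] by linarith
    have "K (fst z) (snd z) / \<sigma> (fst z) <= \<kappa>" using abs_le_D1[OF elim(1)] by simp
    then have "K (fst z) (snd z) <= \<kappa> * \<sigma> (fst z)" using s by (simp add: pos_divide_le_eq)
    then show ?thesis using \<sigma>'[OF z(1)] by simp
   qed
   finally show ?case by (simp add: ennreal_leI)
  qed
 qed
 have v_cont: "continuous_on (closure X \<times> ?B) v\<^sub>0" using v0(1) by (simp add: adjoint_solution_def)
 have cXB: "compact (closure X \<times> ?B)" by (intro compact_Times cX compact_sphere)
 obtain V where V: "0 < V" "!!z. z \<in> closure X \<times> ?B ==> \<bar>v\<^sub>0 z\<bar> <= V" using continuous_compact_bounded[OF cXB v_cont] by blast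
 have XB: "z \<in> closure X \<times> ?B" if "z \<in> space (phase_measure X)" for z using that XX by auto
 have v: "v\<^sub>0 \<in> borel_measurable (phase_measure X)"
  by (rule measurable_cong[THEN iffD1, OF if_P[OF XB] D.borel_measurable_phase[OF
     borel_measurable_extend_zero[OF borel_closed[OF compact_imp_closed[OF cXB]] v_cont]]])
 obtain s where s: "0 < s" "!!x. x \<in> closure X ==> \<bar>S x\<bar> <= s" using continuous_compact_bounded[OF cX A1(3)] by blast
 have XS: "x \<in> closure X" if "x \<in> space (space_measure X)" for x using that XX by simp
 have S_m: "S \<in> borel_measurable (space_measure X)"
  by (rule measurable_cong[THEN iffD1, OF if_P[OF XS] measurable_compose[OF D.measurable_space_ident
     borel_measurable_extend_zero[OF borel_closed[OF closed_closure] A1(3)]]])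
 have S: "S \<in> L2 (space_measure X)" by (rule D.space.L2_bounded[OF S_m AE_I2[OF s(2)[OF XS]]])
 obtain c where c: "0 < c" "!!x th. x \<in> X ==> th \<in> ?B ==> c <= (\<integral>th'. v\<^sub>0 (x, th') \<partial>sphere_measure)" using v0(2) by blast
 \<comment> \<open>The lower bound on the angular integral is stated under a quantifier over
   directions, so one direction has to be supplied.\<close>
 obtain e :: "real ^ 'n" where e: "e \<in> ?B" using vector_choose_size[of 1] by auto
 have IdM: "op_Id_MKS X \<sigma> k v\<^sub>0 = op_Id_MKS X \<sigma>' k' v\<^sub>0" by (rule operators_cong(2)[OF \<sigma>' k'])
 have opS: "op_S X \<sigma> k = op_S X \<sigma>' k'" by (rule operators_cong(1)[OF \<sigma>' k'])
 have H: "internal_functional \<sigma> k v\<^sub>0 S (op_S X \<sigma> k S) x = internal_functional \<sigma>' k' v\<^sub>0 S (op_S X \<sigma>' k' S) x" if "x \<in> X" for x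
  unfolding opS by (rule operators_cong(3)[OF \<sigma>' k' that])
 show ?thesis
  unfolding IdM
  by (rule T.source_reconstruction[OF domain(3) v V(2)[OF XB] less_imp_le[OF V(1)] c(1) c(2)[OF _ e]
     not_eigenvalue[unfolded IdM] S H])
qed

end
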